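(* Let $\nu\in\{3,4,5\}$ and consider AM$\nu$. Assume the inverse inequality $\|GV_h\|_\Omega\le C_Gh^{-1}\|V_h\|_\Omega$ for all $V_h\in\mathcal V_h$, and, with $c_0>0$ sufficiently small, either (i) $0<\delta\le C_\delta h$ and $\tau\le c_0C_G^{-1}h$, together with $\tau\le C_{4/3}h^{4/3}$ if $\nu=3$ and $\tau\le C_{6/5}h^{6/5}$ if $\nu=4$; or (ii) $\nu\in\{3,4\}$, $\mathcal V_h$ consists of continuous piecewise affine functions on a shape-regular quasi-uniform mesh $\mathcal T_h$, $G$ has constant coefficients (so that $GV_h|_K\in[\mathbb P_0(K)]^{n_{\rm sys}}$ for all $V_h\in\mathcal V_h$, $K\in\mathcal T_h$), and $\tau\le C_{\tau\delta}\delta$, $0<\delta\le C_\delta h$, $\tau\le c_0C_G^{-1}h$. Assume also $0<\delta\le1$, the approximation estimate $$\|Y-\Pi_hY\|_\Omega+h\|G(Y-\Pi_hY)\|_\Omega\lesssim h^r\|Y\|_{H^r(\Omega)}$$ for $Y=U(t),\partial_tU(t),\partial_t^2U(t)$, and that $U,F$ are regular enough that the norms below are finite. Let $U_h^n\in\mathcal V_h$ satisfy $U_h^j=\Pi_hU(t^j)$ for $0\le j<n_0(\nu)$ and $(A_\tau U_h^n,T_\delta W)_\Omega=(\mathcal M_\tau F(t^n),T_\delta W)_\Omega$ for all $W\in\mathcal V_h$, $n_0(\nu)\le n\le N$. Then $$\begin{aligned}\max_{n_0(\nu)\le n\le N}\|T_\delta(U_h^n-U(t^n))\|_\Omega\lesssim{}&(h^r+\delta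 h^{r-1})\|U\|_{L^\infty(0,T;H^r(\Omega))}\\&+\bigl((1+T^{1/2})\delta^{1/2}h^{r-1}+\delta^{-1/2}h^r\bigr)\mathcal N_{r,2}(U)\\&+(1+T^{1/2})\tau^\nu\mathcal C^\sharp_{T,\nu+2}(U,F)\\&+\tau^{1/2}(h^r+\tau h^{r-1})\|\partial_tU\|_{L^2(0,T;H^r(\Omega))}\\&+\tau^{1/2}h^{r-1}\|U\|_{L^2(0,T;H^r(\Omega))}+\tau^{\nu+1/2}\mathcal C^\sharp_{T,\nu+2}(U,F).\end{aligned}$$
   Context: Setting. $\Omega\subset\mathbb R^d$ is a Lipschitz domain, $\mathcal H=[L^2(\Omega)]^{n_{\rm sys}}$ with inner product $(\cdot,\cdot)_\Omega$ and norm $\|\cdot\|_\Omega$; $\mathcal V\subset[H^1(\Omega)]^{n_{\rm sys}}$ is dense in $\mathcal H$; $G:\mathcal V\to\mathcal H$ is a time-independent linear first-order differential operator with $(GU,V)_\Omega=-(U,GV)_\Omega$ for all $U,V\in\mathcal V$. $U$ is the exact solution of $\partial_tU+GU=F$ on $(0,T)$, $U(0)=U_0$. $\mathcal V_h\subset\mathcal V$ is a conforming finite element space of componentwise polynomial degree at most $k$ on a shape-regular mesh of mesh size $h$; $\Pi_h:\mathcal H\to\mathcal V_h$ is the $L^2$-orthogonal projection; $s\ge1$ is the spatial Sobolev regularity index, $r=\min(s,k+1)$. $\tau>0$, $t^n=n\tau$ ($0\le n\le N$), $t^N\le T$, $\delta>0$. AM$\nu$: $D_\tau^-V^n=\tau^{-1}(V^n-V^{n-1})$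 and $\mathcal M_\tau V^n=\sum_{j=0}^{\nu-1}b_jV^{n-j}$ (also for sampled functions) with AM3: $(b_0,b_1,b_2)=(\frac5{12},\frac23,-\frac1{12})$; AM4: $(b_0,\dots,b_3)=(\frac38,\frac{19}{24},-\frac5{24},\frac1{24})$; AM5: $(b_0,\dots,b_4)=(\frac{251}{720},\frac{646}{720},-\frac{264}{720},\frac{106}{720},-\frac{19}{720})$. First computed indices $n_0(3)=2$, $n_0(4)=3$, $n_0(5)=4$. $T_\delta=\mathrm{Id}+\delta G$, $A_\tau=D_\tau^-+G\mathcal M_\tau$. $$\mathcal N_{r,2}(U)=\sum_{j=0}^2\|\partial_t^jU\|_{L^2(0,T;H^r(\Omega))}+\sum_{j=0}^1\|\partial_t^jU\|_{L^\infty(0,T;H^r(\Omega))},$$ $$\mathcal C^\sharp_{T,\nu+2}(U,F)=\|\partial_t^\nu(F-GU)\|_{L^2(0,T;\mathcal H)}+\|\partial_t^\nu(F-GU)\|_{L^\infty(0,T;\mathcal H)}+\|\partial_t^{\nu+1}(F-GU)\|_{L^2(0,T;\mathcal H)}.$$ Conventions: $a\lesssim b$ means $a\le Cb$ with $C>0$ independent of $h$, $\tau$ and $N$ (in case (i) with $\nu=3,4$ it depends exponentially on $TC_{4/3}^3$, resp. $TC_{6/5}^5$); "$c_0$ sufficiently small" means below a positive threshold independent of $h$, $\tau$, $N$. *)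

theory Defs
  imports "HOL-Analysis.Analysis"
begin

text \<open>
  Elements of $[L^2(\Omega)]^{n_{\rm sys}}$ are represented by functions
  \<open>real^'d \<Rightarrow> real^'m\<close> with \<open>d = CARD('d)\<close> and \<open>n_sys = CARD('m)\<close>; equality in the space is
  equality almost everywhere in \<open>\<Omega>\<close>, and values outside \<open>\<Omega>\<close> are irrelevant.
\<close>

type_synonym ('d, 'm) field = "real^'d \<Rightarrow> real^'m"


section \<open>The space H and its inner product\<close>

definition L2 :: "(real^'d) set \<Rightarrow> ('d::finite, 'm::finite) field set" where
  "L2 \<Omega> = {u. u \<in> borel_measurable (lebesgue_on \<Omega>) \<and>
              integrable (lebesgue_on \<Omega>) (\<lambda>x. (norm (u x))\<^sup>2)}"

definition L2_inner :: "(real^'d) set \<Rightarrow> ('d::finite, 'm::finite) field \<Rightarrow> ('d, 'm) field \<Rightarrow> real" where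
  "L2_inner \<Omega> u v = integral\<^sup>L (lebesgue_on \<Omega>) (\<lambda>x. u x \<bullet> v x)"

definition L2_norm :: "(real^'d) set \<Rightarrow> ('d::finite, 'm::finite) field \<Rightarrow> real" where
  "L2_norm \<Omega> u = sqrt (L2_inner \<Omega> u u)"

definition fsub :: "('d, 'm::finite) field \<Rightarrow> ('d, 'm) field \<Rightarrow> ('d, 'm) field" where
  "fsub u v = (\<lambda>x. u x - v x)"

definition linear_subspace :: "('d, 'm::finite) field set \<Rightarrow> bool" where
  "linear_subspace S \<longleftrightarrow> (\<lambda>x. 0) \<in> S \<and>
     (\<forall>u\<in>S. \<forall>v\<in>S. (\<lambda>x. u x + v x) \<in> S) \<and> (\<forall>c. \<forall>u\<in>S. (\<lambda>x. c *\<^sub>R u x) \<in> S)"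

text \<open>A set of functions that stands for a set of almost-everywhere classes.\<close>

definition ae_saturated :: "(real^'d) set \<Rightarrow> ('d::finite, 'm::finite) field set \<Rightarrow> bool" where
  "ae_saturated \<Omega> S \<longleftrightarrow>
     (\<forall>u\<in>S. \<forall>v\<in>L2 \<Omega>. (AE x in lebesgue_on \<Omega>. u x = v x) \<longrightarrow> v \<in> S)"

definition L2_dense :: "(real^'d) set \<Rightarrow> ('d::finite, 'm::finite) field set \<Rightarrow> bool" where
  "L2_dense \<Omega> S \<longleftrightarrow> S \<subseteq> L2 \<Omega> \<and> (\<forall>u\<in>L2 \<Omega>. \<forall>\<epsilon>>0. \<exists>v\<in>S. L2_norm \<Omega> (fsub u v) < \<epsilon>)"


section \<open>Weak derivatives and Sobolev spaces\<close>

text \<open>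
  A multi-index is a function \<open>\<alpha> :: 'd \<Rightarrow> nat\<close>. A smooth function is given together with the
  family \<open>D\<close> of all its partial derivatives: \<open>D \<alpha>\<close> is the derivative of order \<open>\<alpha>\<close> of \<open>D (\<lambda>_. 0)\<close>,
  which determines the whole family.
\<close>

definition mi_order :: "('d::finite \<Rightarrow> nat) \<Rightarrow> nat" where
  "mi_order \<alpha> = sum \<alpha> UNIV"

definition smooth_jet :: "(('d::finite \<Rightarrow> nat) \<Rightarrow> real^'d \<Rightarrow> real) \<Rightarrow> bool" where
  "smooth_jet D \<longleftrightarrow> (\<forall>\<alpha>. continuous_on UNIV (D \<alpha>)) \<and>
     (\<forall>\<alpha> i x. ((\<lambda>t. D \<alpha> (x + t *\<^sub>R axis i 1)) has_real_derivative D (\<alpha>(i := Suc (\<alpha> i))) x) (at 0))"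

definition test_jet :: "(real^'d) set \<Rightarrow> (('d::finite \<Rightarrow> nat) \<Rightarrow> real^'d \<Rightarrow> real) \<Rightarrow> bool" where
  "test_jet \<Omega> D \<longleftrightarrow> smooth_jet D \<and>
     (\<exists>K. compact K \<and> K \<subseteq> \<Omega> \<and> (\<forall>x. x \<notin> K \<longrightarrow> D (\<lambda>_. 0) x = 0))"

definition is_weak_deriv ::
  "(real^'d) set \<Rightarrow> ('d::finite \<Rightarrow> nat) \<Rightarrow> ('d, 'm::finite) field \<Rightarrow> ('d, 'm) field \<Rightarrow> bool" where
  "is_weak_deriv \<Omega> \<alpha> u v \<longleftrightarrow> v \<in> L2 \<Omega> \<and>
     (\<forall>D. test_jet \<Omega> D \<longrightarrow>
        integral\<^sup>L (lebesgue_on \<Omega>) (\<lambda>x. D \<alpha> x *\<^sub>R u x) =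
        (- 1) ^ mi_order \<alpha> *\<^sub>R integral\<^sup>L (lebesgue_on \<Omega>) (\<lambda>x. D (\<lambda>_. 0) x *\<^sub>R v x))"

definition weak_deriv ::
  "(real^'d) set \<Rightarrow> ('d::finite \<Rightarrow> nat) \<Rightarrow> ('d, 'm::finite) field \<Rightarrow> ('d, 'm) field" where
  "weak_deriv \<Omega> \<alpha> u = (SOME v. is_weak_deriv \<Omega> \<alpha> u v)"

text \<open>The square of the Sobolev--Slobodeckij seminorm of order \<open>\<theta>\<close>, \<open>0 < \<theta> < 1\<close>.\<close>

definition slobodeckij ::
  "(real^'d) set \<Rightarrow> real \<Rightarrow> ('d::finite, 'm::finite) field \<Rightarrow> ennreal" where
  "slobodeckij \<Omega> \<theta> v =
     (\<integral>\<^sup>+x. \<integral>\<^sup>+y. ennreal ((norm (v x - v y))\<^sup>2 / norm (x - y) powr (real CARD('d) + 2 * \<theta>))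
        \<partial>lebesgue_on \<Omega> \<partial>lebesgue_on \<Omega>)"

text \<open>$[H^r(\Omega)]^{n_{\rm sys}}$ for real \<open>r \<ge> 0\<close>; the seminorm term is present only for fractional \<open>r\<close>.\<close>

definition sobolev :: "(real^'d) set \<Rightarrow> real \<Rightarrow> ('d::finite, 'm::finite) field set" where
  "sobolev \<Omega> r = {u \<in> L2 \<Omega>.
     (\<forall>\<alpha>. mi_order \<alpha> \<le> nat \<lfloor>r\<rfloor> \<longrightarrow> (\<exists>v. is_weak_deriv \<Omega> \<alpha> u v)) \<and>
     (frac r > 0 \<longrightarrow> (\<forall>\<alpha>. mi_order \<alpha> = nat \<lfloor>r\<rfloor> \<longrightarrow> slobodeckij \<Omega> (frac r) (weak_deriv \<Omega> \<alpha> u) < \<infinity>))}"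

definition sobolev_norm :: "(real^'d) set \<Rightarrow> real \<Rightarrow> ('d::finite, 'm::finite) field \<Rightarrow> real" where
  "sobolev_norm \<Omega> r u = sqrt (
     (\<Sum>\<alpha> | mi_order \<alpha> \<le> nat \<lfloor>r\<rfloor>. (L2_norm \<Omega> (weak_deriv \<Omega> \<alpha> u))\<^sup>2) +
     (if frac r > 0
      then \<Sum>\<alpha> | mi_order \<alpha> = nat \<lfloor>r\<rfloor>. enn2real (slobodeckij \<Omega> (frac r) (weak_deriv \<Omega> \<alpha> u))
      else 0))"


section \<open>Domain and differential operator\<close>

text \<open>
  Near each boundary point, in suitable orthogonal coordinates with vertical direction \<open>e\<close>,
  \<open>\<Omega>\<close> is the region above the graph of a Lipschitz function \<open>\<gamma>\<close> on the hyperplane orthogonal to \<open>e\<close>.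
\<close>

definition lipschitz_domain :: "(real^'d::finite) set \<Rightarrow> bool" where
  "lipschitz_domain \<Omega> \<longleftrightarrow> open \<Omega> \<and> connected \<Omega> \<and> \<Omega> \<noteq> {} \<and>
     (\<forall>p\<in>frontier \<Omega>. \<exists>e \<gamma> L \<epsilon>. norm e = 1 \<and> L-lipschitz_on {y. y \<bullet> e = 0} \<gamma> \<and> \<epsilon> > 0 \<and>
        (\<forall>x\<in>ball p \<epsilon>. x \<in> \<Omega> \<longleftrightarrow> x \<bullet> e > \<gamma> (x - (x \<bullet> e) *\<^sub>R e)))"

text \<open>
  The operator $GU = \sum_j A_j(x)\,\partial_jU + B(x)\,U$ with weak derivatives. It depends on \<open>U\<close>
  only through its almost-everywhere class.
\<close>

definition first_order_op ::
  "(real^'d) set \<Rightarrow> ('d \<Rightarrow> real^'d \<Rightarrow> real^'m^'m) \<Rightarrow> (real^'d \<Rightarrow> real^'m^'m) \<Rightarrow>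
   ('d::finite, 'm::finite) field \<Rightarrow> ('d, 'm) field" where
  "first_order_op \<Omega> A B U =
     (\<lambda>x. (\<Sum>j\<in>UNIV. A j x *v weak_deriv \<Omega> ((\<lambda>_. 0)(j := 1)) U x) + B x *v U x)"

definition T_op :: "(('d, 'm::finite) field \<Rightarrow> ('d, 'm) field) \<Rightarrow> real \<Rightarrow> ('d, 'm) field \<Rightarrow> ('d, 'm) field" where
  "T_op G \<delta> W = (\<lambda>x. W x + \<delta> *\<^sub>R G W x)"


section \<open>Meshes and finite element spaces\<close>

text \<open>
  Ciarlet's notion of a mesh: finitely many closed elements with nonempty, pairwise disjoint interiors
  that cover the closure of \<open>\<Omega>\<close>; of the element boundaries only measure zero is required, so that
  simplicial meshes as well as others are included.
\<close>

definition is_mesh :: "(real^'d::finite) set \<Rightarrow> (real^'d) set set \<Rightarrow> bool" where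
  "is_mesh \<Omega> \<T> \<longleftrightarrow> finite \<T> \<and> \<T> \<noteq> {} \<and> \<Union>\<T> = closure \<Omega> \<and>
     (\<forall>K\<in>\<T>. compact K \<and> interior K \<noteq> {} \<and> negligible (frontier K)) \<and>
     (\<forall>K\<in>\<T>. \<forall>K'\<in>\<T>. K \<noteq> K' \<longrightarrow> interior K \<inter> interior K' = {})"

definition mesh_size :: "(real^'d::finite) set set \<Rightarrow> real" where
  "mesh_size \<T> = Max (diameter ` \<T>)"

definition shape_regular :: "real \<Rightarrow> (real^'d::finite) set set \<Rightarrow> bool" where
  "shape_regular \<sigma> \<T> \<longleftrightarrow> (\<forall>K\<in>\<T>. \<exists>x. cball x (diameter K / \<sigma>) \<subseteq> K)"

definition quasi_uniform :: "real \<Rightarrow> (real^'d::finite) set set \<Rightarrow> bool" where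
  "quasi_uniform \<sigma> \<T> \<longleftrightarrow> (\<forall>K\<in>\<T>. mesh_size \<T> \<le> \<sigma> * diameter K)"

text \<open>\<open>V\<close> coincides on \<open>K\<close> with an element of $[\mathbb P_k]^{n_{\rm sys}}$ (total degree at most \<open>k\<close>).\<close>

definition poly_on :: "nat \<Rightarrow> (real^'d) set \<Rightarrow> ('d::finite, 'm::finite) field \<Rightarrow> bool" where
  "poly_on k K V \<longleftrightarrow> (\<exists>c :: ('d \<Rightarrow> nat) \<Rightarrow> real^'m.
     \<forall>x\<in>K. V x = (\<Sum>\<alpha> | mi_order \<alpha> \<le> k. (\<Prod>i\<in>UNIV. (x $ i) ^ \<alpha> i) *\<^sub>R c \<alpha>))"

definition conforming_fe_space ::
  "('d::finite, 'm::finite) field set \<Rightarrow> (real^'d) set set \<Rightarrow> nat \<Rightarrow> ('d, 'm) field set \<Rightarrow> bool" where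
  "conforming_fe_space V \<T> k Vh \<longleftrightarrow> linear_subspace Vh \<and> Vh \<subseteq> V \<and>
     (\<forall>W\<in>Vh. \<forall>K\<in>\<T>. poly_on k (interior K) W)"

definition L2_proj ::
  "(real^'d) set \<Rightarrow> ('d::finite, 'm::finite) field set \<Rightarrow> ('d, 'm) field \<Rightarrow> ('d, 'm) field" where
  "L2_proj \<Omega> Vh Y = (SOME P. P \<in> Vh \<and> (\<forall>W\<in>Vh. L2_inner \<Omega> (fsub Y P) W = 0))"


section \<open>Functions of time with values in a function space\<close>

text \<open>
  Here a normed function space is given by its carrier \<open>S\<close> and its norm \<open>\<eta>\<close>. Bochner (strong)
  measurability on \<open>(0,T)\<close> is approximability almost everywhere by measurable simple functions.
\<close>

definition bochner_measurable ::
  "real \<Rightarrow> ('d, 'm::finite) field set \<Rightarrow> (('d, 'm) field \<Rightarrow> real) \<Rightarrow> (real \<Rightarrow> ('d, 'm) field) \<Rightarrow> bool" where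
  "bochner_measurable T S \<eta> X \<longleftrightarrow> (\<exists>Z :: nat \<Rightarrow> real \<Rightarrow> ('d, 'm) field.
     (\<forall>i. finite (Z i ` {0<..<T}) \<and> Z i ` {0<..<T} \<subseteq> S \<and>
          (\<forall>v. {t \<in> {0<..<T}. Z i t = v} \<in> sets lebesgue)) \<and>
     (AE t in lebesgue_on {0<..<T}. X t \<in> S \<and> (\<lambda>i. \<eta> (fsub (Z i t) (X t))) \<longlonglongrightarrow> 0))"

definition L2T ::
  "real \<Rightarrow> ('d, 'm::finite) field set \<Rightarrow> (('d, 'm) field \<Rightarrow> real) \<Rightarrow> (real \<Rightarrow> ('d, 'm) field) set" where
  "L2T T S \<eta> = {X. bochner_measurable T S \<eta> X \<and>
     integrable (lebesgue_on {0<..<T}) (\<lambda>t. (\<eta> (X t))\<^sup>2)}"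

definition L2T_norm :: "real \<Rightarrow> (('d, 'm::finite) field \<Rightarrow> real) \<Rightarrow> (real \<Rightarrow> ('d, 'm) field) \<Rightarrow> real" where
  "L2T_norm T \<eta> X = sqrt (integral\<^sup>L (lebesgue_on {0<..<T}) (\<lambda>t. (\<eta> (X t))\<^sup>2))"

definition LinfT ::
  "real \<Rightarrow> ('d, 'm::finite) field set \<Rightarrow> (('d, 'm) field \<Rightarrow> real) \<Rightarrow> (real \<Rightarrow> ('d, 'm) field) set" where
  "LinfT T S \<eta> = {X. bochner_measurable T S \<eta> X \<and>
     (\<exists>C. AE t in lebesgue_on {0<..<T}. \<eta> (X t) \<le> C)}"

definition LinfT_norm :: "real \<Rightarrow> (('d, 'm::finite) field \<Rightarrow> real) \<Rightarrow> (real \<Rightarrow> ('d, 'm) field) \<Rightarrow> real" where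
  "LinfT_norm T \<eta> X = Inf {C. AE t in lebesgue_on {0<..<T}. \<eta> (X t) \<le> C}"

definition time_test_fun :: "real \<Rightarrow> (real \<Rightarrow> real) \<Rightarrow> bool" where
  "time_test_fun T \<phi> \<longleftrightarrow> (\<forall>n t. (deriv ^^ n) \<phi> field_differentiable at t) \<and>
     (\<exists>K. compact K \<and> K \<subseteq> {0<..<T} \<and> (\<forall>t. t \<notin> K \<longrightarrow> \<phi> t = 0))"

text \<open>
  Weak time derivative in \<open>L\<^sup>2(0,T;H)\<close>: the identity
  $\int_0^T\phi'(t)X(t)\,dt = -\int_0^T\phi(t)Y(t)\,dt$ of Bochner integrals in \<open>H\<close>, expressed by taking
  the inner product with every \<open>W \<in> H\<close>.
\<close>

definition is_time_deriv ::
  "(real^'d) set \<Rightarrow> real \<Rightarrow> (real \<Rightarrow> ('d::finite, 'm::finite) field) \<Rightarrow> (real \<Rightarrow> ('d, 'm) field) \<Rightarrow> bool" where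
  "is_time_deriv \<Omega> T X Y \<longleftrightarrow>
     X \<in> L2T T (L2 \<Omega>) (L2_norm \<Omega>) \<and> Y \<in> L2T T (L2 \<Omega>) (L2_norm \<Omega>) \<and>
     (\<forall>\<phi> W. time_test_fun T \<phi> \<longrightarrow> W \<in> L2 \<Omega> \<longrightarrow>
        integral\<^sup>L (lebesgue_on {0<..<T}) (\<lambda>t. deriv \<phi> t * L2_inner \<Omega> (X t) W) =
        - integral\<^sup>L (lebesgue_on {0<..<T}) (\<lambda>t. \<phi> t * L2_inner \<Omega> (Y t) W))"

definition time_deriv ::
  "(real^'d) set \<Rightarrow> real \<Rightarrow> nat \<Rightarrow> (real \<Rightarrow> ('d::finite, 'm::finite) field) \<Rightarrow> real \<Rightarrow> ('d, 'm) field" where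
  "time_deriv \<Omega> T j X = ((\<lambda>X. SOME Y. is_time_deriv \<Omega> T X Y) ^^ j) X"

definition time_differentiable ::
  "(real^'d) set \<Rightarrow> real \<Rightarrow> nat \<Rightarrow> (real \<Rightarrow> ('d::finite, 'm::finite) field) \<Rightarrow> bool" where
  "time_differentiable \<Omega> T m X \<longleftrightarrow>
     (\<forall>j<m. is_time_deriv \<Omega> T (time_deriv \<Omega> T j X) (time_deriv \<Omega> T (Suc j) X))"

definition L2_continuous_on ::
  "(real^'d) set \<Rightarrow> real set \<Rightarrow> (real \<Rightarrow> ('d::finite, 'm::finite) field) \<Rightarrow> bool" where
  "L2_continuous_on \<Omega> I X \<longleftrightarrow> (\<forall>t\<in>I. X t \<in> L2 \<Omega> \<and>
     ((\<lambda>t'. L2_norm \<Omega> (fsub (X t') (X t))) \<longlongrightarrow> 0) (at t within I))"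


section \<open>The exact solution and its norms\<close>

definition residual ::
  "(('d, 'm::finite) field \<Rightarrow> ('d, 'm) field) \<Rightarrow> (real \<Rightarrow> ('d, 'm) field) \<Rightarrow> (real \<Rightarrow> ('d, 'm) field) \<Rightarrow>
   real \<Rightarrow> ('d, 'm) field" where
  "residual G U F = (\<lambda>t. fsub (F t) (G (U t)))"

text \<open>
  The last two continuity requirements single out the representatives in time whose values at the
  nodes \<open>t^n \<in> [0,T]\<close> enter the scheme and the error; the equation itself extends to \<open>t = 0\<close> and
  \<open>t = T\<close> by continuity.
\<close>

definition exact_solution ::
  "(real^'d) set \<Rightarrow> ('d::finite, 'm::finite) field set \<Rightarrow> (('d, 'm) field \<Rightarrow> ('d, 'm) field) \<Rightarrow> real \<Rightarrow>
   (real \<Rightarrow> ('d, 'm) field) \<Rightarrow> ('d, 'm) field \<Rightarrow> (real \<Rightarrow> ('d, 'm) field) \<Rightarrow> bool" where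
  "exact_solution \<Omega> V G T F U0 U \<longleftrightarrow>
     (\<forall>t\<in>{0..T}. U t \<in> V \<and> F t \<in> L2 \<Omega>) \<and>
     time_differentiable \<Omega> T 1 U \<and>
     (AE t in lebesgue_on {0<..<T}. AE x in lebesgue_on \<Omega>. time_deriv \<Omega> T 1 U t x + G (U t) x = F t x) \<and>
     (AE x in lebesgue_on \<Omega>. U 0 x = U0 x) \<and>
     L2_continuous_on \<Omega> {0..T} U \<and>
     L2_continuous_on \<Omega> {0..T} (residual G U F)"

definition N_norm ::
  "(real^'d) set \<Rightarrow> real \<Rightarrow> real \<Rightarrow> (real \<Rightarrow> ('d::finite, 'm::finite) field) \<Rightarrow> real" where
  "N_norm \<Omega> T r U =
     (\<Sum>j\<le>2. L2T_norm T (sobolev_norm \<Omega> r) (time_deriv \<Omega> T j U)) +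
     (\<Sum>j\<le>1. LinfT_norm T (sobolev_norm \<Omega> r) (time_deriv \<Omega> T j U))"

definition C_sharp ::
  "(real^'d) set \<Rightarrow> (('d::finite, 'm::finite) field \<Rightarrow> ('d, 'm) field) \<Rightarrow> real \<Rightarrow> nat \<Rightarrow>
   (real \<Rightarrow> ('d, 'm) field) \<Rightarrow> (real \<Rightarrow> ('d, 'm) field) \<Rightarrow> real" where
  "C_sharp \<Omega> G T \<nu> U F =
     L2T_norm T (L2_norm \<Omega>) (time_deriv \<Omega> T \<nu> (residual G U F)) +
     LinfT_norm T (L2_norm \<Omega>) (time_deriv \<Omega> T \<nu> (residual G U F)) +
     L2T_norm T (L2_norm \<Omega>) (time_deriv \<Omega> T (\<nu> + 1) (residual G U F))"

text \<open>
  All quantities in \<open>N_norm\<close> and \<open>C_sharp\<close> exist and are finite. (Membership of the derivatives of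
  the residual in \<open>L\<^sup>2(0,T;H)\<close> is part of \<open>time_differentiable\<close>.)
\<close>

definition regular_solution ::
  "(real^'d) set \<Rightarrow> (('d::finite, 'm::finite) field \<Rightarrow> ('d, 'm) field) \<Rightarrow> real \<Rightarrow> real \<Rightarrow> nat \<Rightarrow>
   (real \<Rightarrow> ('d, 'm) field) \<Rightarrow> (real \<Rightarrow> ('d, 'm) field) \<Rightarrow> bool" where
  "regular_solution \<Omega> G T r \<nu> U F \<longleftrightarrow>
     time_differentiable \<Omega> T 2 U \<and>
     (\<forall>j\<le>2. time_deriv \<Omega> T j U \<in> L2T T (sobolev \<Omega> r) (sobolev_norm \<Omega> r)) \<and>
     (\<forall>j\<le>1. time_deriv \<Omega> T j U \<in> LinfT T (sobolev \<Omega> r) (sobolev_norm \<Omega> r)) \<and>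
     time_differentiable \<Omega> T (\<nu> + 1) (residual G U F) \<and>
     time_deriv \<Omega> T \<nu> (residual G U F) \<in> LinfT T (L2 \<Omega>) (L2_norm \<Omega>)"

text \<open>
  $\|Y-\Pi_hY\|_\Omega+h\|G(Y-\Pi_hY)\|_\Omega\le C h^r\|Y\|_{H^r(\Omega)}$. Membership in \<open>V\<close>, the domain
  of \<open>G\<close>, is what gives the left-hand side its meaning.
\<close>

definition approx_estimate ::
  "(real^'d) set \<Rightarrow> ('d::finite, 'm::finite) field set \<Rightarrow> (('d, 'm) field \<Rightarrow> ('d, 'm) field) \<Rightarrow>
   ('d, 'm) field set \<Rightarrow> real \<Rightarrow> real \<Rightarrow> real \<Rightarrow> ('d, 'm) field \<Rightarrow> bool" where
  "approx_estimate \<Omega> V G Vh C h r Y \<longleftrightarrow> Y \<in> V \<and>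
     L2_norm \<Omega> (fsub Y (L2_proj \<Omega> Vh Y)) + h * L2_norm \<Omega> (G (fsub Y (L2_proj \<Omega> Vh Y)))
       \<le> C * h powr r * sobolev_norm \<Omega> r Y"


section \<open>Adams--Moulton time stepping\<close>

definition am_coeffs :: "nat \<Rightarrow> real list" where
  "am_coeffs \<nu> =
     (if \<nu> = 3 then [5/12, 2/3, -1/12]
      else if \<nu> = 4 then [3/8, 19/24, -5/24, 1/24]
      else if \<nu> = 5 then [251/720, 646/720, -264/720, 106/720, -19/720]
      else [])"

definition first_index :: "nat \<Rightarrow> nat" where
  "first_index \<nu> = \<nu> - 1"

definition am_mean :: "nat \<Rightarrow> (nat \<Rightarrow> ('d, 'm::finite) field) \<Rightarrow> nat \<Rightarrow> ('d, 'm) field" where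
  "am_mean \<nu> X n = (\<lambda>x. \<Sum>j<\<nu>. (am_coeffs \<nu> ! j) *\<^sub>R X (n - j) x)"

definition backward_diff :: "real \<Rightarrow> (nat \<Rightarrow> ('d, 'm::finite) field) \<Rightarrow> nat \<Rightarrow> ('d, 'm) field" where
  "backward_diff \<tau> X n = (\<lambda>x. (1 / \<tau>) *\<^sub>R (X n x - X (n - 1) x))"

definition A_op ::
  "(('d, 'm::finite) field \<Rightarrow> ('d, 'm) field) \<Rightarrow> nat \<Rightarrow> real \<Rightarrow> (nat \<Rightarrow> ('d, 'm) field) \<Rightarrow> nat \<Rightarrow> ('d, 'm) field" where
  "A_op G \<nu> \<tau> X n = (\<lambda>x. backward_diff \<tau> X n x + G (am_mean \<nu> X n) x)"

definition am_solution ::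
  "(real^'d) set \<Rightarrow> (('d::finite, 'm::finite) field \<Rightarrow> ('d, 'm) field) \<Rightarrow> ('d, 'm) field set \<Rightarrow> nat \<Rightarrow> real \<Rightarrow>
   real \<Rightarrow> nat \<Rightarrow> (real \<Rightarrow> ('d, 'm) field) \<Rightarrow> (real \<Rightarrow> ('d, 'm) field) \<Rightarrow> (nat \<Rightarrow> ('d, 'm) field) \<Rightarrow> bool" where
  "am_solution \<Omega> G Vh \<nu> \<tau> \<delta> N U F Uh \<longleftrightarrow>
     (\<forall>n\<le>N. Uh n \<in> Vh) \<and>
     (\<forall>j<first_index \<nu>. AE x in lebesgue_on \<Omega>. Uh j x = L2_proj \<Omega> Vh (U (real j * \<tau>)) x) \<and>
     (\<forall>n\<in>{first_index \<nu>..N}. \<forall>W\<in>Vh.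
        L2_inner \<Omega> (A_op G \<nu> \<tau> Uh n) (T_op G \<delta> W) =
        L2_inner \<Omega> (am_mean \<nu> (\<lambda>i. F (real i * \<tau>)) n) (T_op G \<delta> W))"

text \<open>
  The six terms of the error bound, in the order in which the estimate lists them.
\<close>

definition error_bound ::
  "(real^'d) set \<Rightarrow> (('d::finite, 'm::finite) field \<Rightarrow> ('d, 'm) field) \<Rightarrow> real \<Rightarrow> nat \<Rightarrow> real \<Rightarrow> real \<Rightarrow> real \<Rightarrow>
   real \<Rightarrow> (real \<Rightarrow> ('d, 'm) field) \<Rightarrow> (real \<Rightarrow> ('d, 'm) field) \<Rightarrow> real" where
  "error_bound \<Omega> G T \<nu> r h \<tau> \<delta> U F =
     (h powr r + \<delta> * h powr (r - 1)) * LinfT_norm T (sobolev_norm \<Omega> r) U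
     + ((1 + T powr (1/2)) * \<delta> powr (1/2) * h powr (r - 1) + \<delta> powr (-1/2) * h powr r) * N_norm \<Omega> T r U
     + (1 + T powr (1/2)) * \<tau> ^ \<nu> * C_sharp \<Omega> G T \<nu> U F
     + \<tau> powr (1/2) * (h powr r + \<tau> * h powr (r - 1)) * L2T_norm T (sobolev_norm \<Omega> r) (time_deriv \<Omega> T 1 U)
     + \<tau> powr (1/2) * h powr (r - 1) * L2T_norm T (sobolev_norm \<Omega> r) U
     + \<tau> powr (real \<nu> + 1/2) * C_sharp \<Omega> G T \<nu> U F"

end

theory Submission
  imports Defs "HOL-Computational_Algebra.Polynomial"
begin

text \<open>
  Let \<open>D\<close> be the backward difference quotient, \<open>M\<close> the Adams--Moulton mean, \<open>\<eta> = U - \<Pi>\<^sub>h U\<close> and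
  \<open>e = U\<^sub>h - \<Pi>\<^sub>h U\<close>. The error \<open>e\<close> vanishes at the starting indices and satisfies
  \<open>(D e + G M e, W + \<delta> G W) = (f, W + \<delta> G W)\<close> for all discrete \<open>W\<close>, with \<open>f = \<epsilon> + D \<eta> + G M \<eta>\<close> and \<open>\<epsilon>\<close> the
  truncation error of the formula applied to the residual \<open>F - G U\<close>. The proof tests with
  \<open>W = M e + \<delta> D e\<close>. As \<open>G\<close> is skew-symmetric, the left-hand side becomes
  \<open>(D e, M e) + \<delta>\<^sup>2 (G D e, G M e) + \<delta> |D e + G M e|\<^sup>2\<close> (\<open>dissipation_identity\<close>), and three things remain.

  Stability. The pairing \<open>\<tau> (D e, M e)\<close> is half the increment of \<open>|e|\<^sup>2\<close>, plus a telescoping form in the last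
  increments, minus squares of higher differences of \<open>e\<close> (\<open>am_energy_step\<close>): second ones for \<nu> = 3,
  third ones for \<nu> = 4, while for \<nu> = 5 a square of third differences helps against one of fourth
  differences. By the scheme every further difference is smaller by a factor \<open>\<lambda> = \<tau> C\<^sub>G / h\<close>. Hence the growth per step
  is \<open>\<lambda> ^ 4\<close> or \<open>\<lambda> ^ 6\<close>, and the restrictions \<open>\<tau> \<le> C h ^ (4/3)\<close>, \<open>\<tau> \<le> C h ^ (6/5)\<close> keep its sum up to
  time \<open>T\<close> bounded; for \<nu> = 5 the fourth differences are absorbed. For piecewise affine functions and
  constant coefficients \<open>G V\<close> is constant on each element, so that \<open>W + G V\<close> has the slopes of \<open>W\<close>
  and \<open>|G W| \<le> C h\<^sup>-\<^sup>1 |W + G V|\<close> (\<open>piecewise_affine_inverse_estimate\<close>); with \<open>W = D e\<close>, \<open>V = M e\<close> the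
  growth is then absorbed by the dissipation (\<open>growth_le\<close>, \<open>stability\<close>).

  Right-hand side. Orthogonality of \<open>\<eta>\<close> and skew-symmetry give \<open>(f, M e) = (\<epsilon>, M e) - (M \<eta>, D e + G M e)\<close>,
  the term \<open>\<delta> (f, D e + G M e)\<close> meets the dissipation, and \<open>\<delta>\<^sup>2 (f, G D e)\<close> is summed by parts in time
  (\<open>rhs_bound\<close>).

  Consistency. The solution has only weak time derivatives. Paired with a fixed element they are
  derivatives of absolutely continuous functions (\<open>weak_deriv_imp_primitive\<close>), whose Taylor expansion
  and the order \<nu> of the formula bound \<open>\<epsilon>\<close> and its differences; values of \<open>\<eta>\<close> at the nodes are bounded by time
  averages.

  All of this takes place in the space of classes of fields modulo null sets, a real inner product
  space. There \<open>G\<close> is linear: this follows from skew-symmetry on a dense subspace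
  (\<open>skew_operator_on_classes\<close>).
\<close>

section \<open>The Hilbert space of classes of square-integrable fields\<close>

lemma L2_measurable: "u \<in> L2 \<Omega> \<Longrightarrow> u \<in> borel_measurable (lebesgue_on \<Omega>)"
  by (simp add: L2_def)

lemma L2_norm_integrable: "u \<in> L2 \<Omega> \<Longrightarrow> integrable (lebesgue_on \<Omega>) (\<lambda>x. (norm (u x))\<^sup>2)"
  by (simp add: L2_def)

lemma L2_inner_integrable:
  assumes "u \<in> L2 \<Omega>" "v \<in> L2 \<Omega>"
  shows "integrable (lebesgue_on \<Omega>) (\<lambda>x. u x \<bullet> v x)"
proof (rule Bochner_Integration.integrable_bound)
  show "integrable (lebesgue_on \<Omega>) (\<lambda>x. (norm (u x))\<^sup>2 + (norm (v x))\<^sup>2)"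
    using assms by (intro Bochner_Integration.integrable_add L2_norm_integrable)
  show "(\<lambda>x. u x \<bullet> v x) \<in> borel_measurable (lebesgue_on \<Omega>)"
    using assms by (intro borel_measurable_inner L2_measurable)
  have "\<bar>a \<bullet> b\<bar> \<le> (norm a)\<^sup>2 + (norm b)\<^sup>2" for a b :: "real^'b"
  proof -
    have "\<bar>a \<bullet> b\<bar> \<le> norm a * norm b" by (rule Cauchy_Schwarz_ineq2)
    also have "\<dots> \<le> (norm a)\<^sup>2 + (norm b)\<^sup>2"
      using sum_squares_bound[of "norm a" "norm b"] mult_nonneg_nonneg[OF norm_ge_zero norm_ge_zero, of a b]
      by linarith
    finally show ?thesis .
  qed
  then show "AE x in lebesgue_on \<Omega>. norm (u x \<bullet> v x) \<le> norm ((norm (u x))\<^sup>2 + (norm (v x))\<^sup>2)"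
    by (intro always_eventually) (simp add: order.trans[OF _ abs_ge_self])
qed

lemma L2_zero [simp]: "(\<lambda>x. 0) \<in> L2 \<Omega>"
  by (simp add: L2_def)

lemma L2_add:
  assumes "u \<in> L2 \<Omega>" "v \<in> L2 \<Omega>"
  shows "(\<lambda>x. u x + v x) \<in> L2 \<Omega>"
proof -
  have "integrable (lebesgue_on \<Omega>) (\<lambda>x. (norm (u x))\<^sup>2 + (norm (v x))\<^sup>2 + 2 * (u x \<bullet> v x))"
    using assms by (intro Bochner_Integration.integrable_add integrable_mult_right L2_norm_integrable L2_inner_integrable)
  then show ?thesis
    using assms unfolding L2_def
    by (auto simp: power2_norm_eq_inner inner_add_left inner_add_right inner_commute algebra_simps
        intro: borel_measurable_add)
qed

lemma L2_scaleR:
  assumes "u \<in> L2 \<Omega>"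
  shows "(\<lambda>x. c *\<^sub>R u x) \<in> L2 \<Omega>"
  using assms unfolding L2_def by (auto simp: power_mult_distrib)

lemma L2_diff:
  assumes "u \<in> L2 \<Omega>" "v \<in> L2 \<Omega>"
  shows "(\<lambda>x. u x - v x) \<in> L2 \<Omega>"
  using L2_add[OF assms(1) L2_scaleR[OF assms(2), of "-1"]] by simp

lemma L2_inner_cong_AE:
  assumes "u \<in> L2 \<Omega>" "v \<in> L2 \<Omega>" "u' \<in> L2 \<Omega>" "v' \<in> L2 \<Omega>"
    and "AE x in lebesgue_on \<Omega>. u x = u' x" "AE x in lebesgue_on \<Omega>. v x = v' x"
  shows "L2_inner \<Omega> u v = L2_inner \<Omega> u' v'"
  unfolding L2_inner_def
  using assms
  by (intro integral_cong_AE borel_measurable_inner L2_measurable) auto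

lemma L2_inner_self_eq_0:
  assumes "u \<in> L2 \<Omega>"
  shows "L2_inner \<Omega> u u = 0 \<longleftrightarrow> (AE x in lebesgue_on \<Omega>. u x = 0)"
proof -
  have "L2_inner \<Omega> u u = 0 \<longleftrightarrow> (AE x in lebesgue_on \<Omega>. u x \<bullet> u x = 0)"
    unfolding L2_inner_def
    by (intro integral_nonneg_eq_0_iff_AE L2_inner_integrable assms) auto
  then show ?thesis by simp
qed

text \<open>
  The classes of fields on \<Omega> form a subspace of the classes of fields on the whole space (extend by
  zero), so that one quotient type serves every \<Omega>; on it the energy arguments can use the class of
  real inner product spaces.
\<close>

definition l2_rel :: "('d::finite, 'm::finite) field \<Rightarrow> ('d, 'm) field \<Rightarrow> bool" where
  "l2_rel u v \<longleftrightarrow> u \<in> L2 UNIV \<and> v \<in> L2 UNIV \<and> (AE x in lebesgue_on UNIV. u x = v x)"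

quotient_type (overloaded) ('d, 'm) l2 = "('d::finite, 'm::finite) field" / partial: l2_rel
proof (rule part_equivpI)
  show "\<exists>x. l2_rel x x" by (rule exI[of _ "\<lambda>x. 0"]) (simp add: l2_rel_def)
  show "symp l2_rel" unfolding l2_rel_def by (rule sympI) (auto elim: eventually_mono)
  show "transp l2_rel" unfolding l2_rel_def by (rule transpI) (auto elim: eventually_elim2)
qed

instantiation l2 :: (finite, finite) real_vector
begin

lift_definition zero_l2 :: "('a, 'b) l2" is "\<lambda>x. 0" by (simp add: l2_rel_def)

lift_definition plus_l2 :: "('a, 'b) l2 \<Rightarrow> ('a, 'b) l2 \<Rightarrow> ('a, 'b) l2" is "\<lambda>u v x. u x + v x"
  unfolding l2_rel_def by (auto intro: L2_add elim: eventually_elim2)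

lift_definition minus_l2 :: "('a, 'b) l2 \<Rightarrow> ('a, 'b) l2 \<Rightarrow> ('a, 'b) l2" is "\<lambda>u v x. u x - v x"
  unfolding l2_rel_def by (auto intro: L2_diff elim: eventually_elim2)

lift_definition uminus_l2 :: "('a, 'b) l2 \<Rightarrow> ('a, 'b) l2" is "\<lambda>u x. - u x"
  unfolding l2_rel_def using L2_scaleR[of _ UNIV "-1"] by (auto elim: eventually_mono)

lift_definition scaleR_l2 :: "real \<Rightarrow> ('a, 'b) l2 \<Rightarrow> ('a, 'b) l2" is "\<lambda>c u x. c *\<^sub>R u x"
  unfolding l2_rel_def by (auto intro: L2_scaleR elim: eventually_mono)

instance
proof
  fix a b c :: "('a, 'b) l2" and r s :: real
  show "a + b + c = a + (b + c)"
    by transfer (auto simp: l2_rel_def add.assoc intro!: L2_add)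
  show "a + b = b + a"
    by transfer (auto simp: l2_rel_def add.commute intro!: L2_add)
  show "0 + a = a" by transfer (auto simp: l2_rel_def)
  show "- a + a = 0" by transfer (auto simp: l2_rel_def)
  show "a - b = a + - b"
    by transfer (auto simp: l2_rel_def intro: L2_diff)
  show "r *\<^sub>R (a + b) = r *\<^sub>R a + r *\<^sub>R b"
    by transfer (auto simp: l2_rel_def scaleR_add_right intro!: L2_add L2_scaleR)
  show "(r + s) *\<^sub>R a = r *\<^sub>R a + s *\<^sub>R a"
    by transfer (auto simp: l2_rel_def scaleR_add_left intro!: L2_add L2_scaleR)
  show "r *\<^sub>R s *\<^sub>R a = (r * s) *\<^sub>R a"
    by transfer (auto simp: l2_rel_def intro!: L2_scaleR)
  show "1 *\<^sub>R a = a" by transfer (auto simp: l2_rel_def)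
qed

end

instantiation l2 :: (finite, finite) real_inner
begin

lift_definition inner_l2 :: "('a, 'b) l2 \<Rightarrow> ('a, 'b) l2 \<Rightarrow> real" is "L2_inner UNIV"
  unfolding l2_rel_def by (intro L2_inner_cong_AE) auto

definition norm_l2 :: "('a, 'b) l2 \<Rightarrow> real" where "norm_l2 a = sqrt (inner a a)"

definition sgn_l2 :: "('a, 'b) l2 \<Rightarrow> ('a, 'b) l2" where "sgn_l2 a = a /\<^sub>R norm a"

definition dist_l2 :: "('a, 'b) l2 \<Rightarrow> ('a, 'b) l2 \<Rightarrow> real" where "dist_l2 a b = norm (a - b)"

definition uniformity_l2 :: "(('a, 'b) l2 \<times> ('a, 'b) l2) filter" where
  "uniformity_l2 = (INF e\<in>{0 <..}. principal {(x, y). dist x y < e})"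

definition open_l2 :: "('a, 'b) l2 set \<Rightarrow> bool" where
  "open_l2 S \<longleftrightarrow> (\<forall>x\<in>S. \<forall>\<^sub>F (x', y) in uniformity. x' = x \<longrightarrow> y \<in> S)"

instance
proof
  fix a b c :: "('a, 'b) l2" and r :: real
  show "dist a b = norm (a - b)" by (rule dist_l2_def)
  show "sgn a = a /\<^sub>R norm a" by (rule sgn_l2_def)
  show "norm a = sqrt (inner a a)" by (rule norm_l2_def)
  show "(uniformity :: (('a, 'b) l2 \<times> ('a, 'b) l2) filter) = (INF e\<in>{0 <..}. principal {(x, y). dist x y < e})"
    by (rule uniformity_l2_def)
  show "open S \<longleftrightarrow> (\<forall>x\<in>S. \<forall>\<^sub>F (x', y) in uniformity. x' = x \<longrightarrow> y \<in> S)" for S :: "('a, 'b) l2 set"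
    by (rule open_l2_def)
  show "inner a b = inner b a"
    by transfer (simp add: L2_inner_def inner_commute)
  show "inner (a + b) c = inner a c + inner b c"
    by transfer (auto simp: l2_rel_def L2_inner_def inner_add_left
        intro!: Bochner_Integration.integral_add L2_inner_integrable[of _ UNIV, simplified])
  show "inner (r *\<^sub>R a) b = r * inner a b"
    by transfer (simp add: L2_inner_def)
  show "0 \<le> inner a a"
    by transfer (simp add: L2_inner_def)
  show "inner a a = 0 \<longleftrightarrow> a = 0"
    by transfer (subst L2_inner_self_eq_0, auto simp: l2_rel_def)
qed

end

text \<open>
  The factor \<open>indicator \<Omega> x\<close> makes the class independent of the irrelevant values outside \<Omega>.
\<close>

definition cls :: "(real^'d) set \<Rightarrow> ('d::finite, 'm::finite) field \<Rightarrow> ('d, 'm) l2" where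
  "cls \<Omega> u = abs_l2 (\<lambda>x. indicator \<Omega> x *\<^sub>R u x)"

lemma L2_extend:
  assumes "\<Omega> \<in> sets lebesgue" "u \<in> L2 \<Omega>"
  shows "(\<lambda>x. indicator \<Omega> x *\<^sub>R u x) \<in> L2 UNIV"
proof -
  have "(\<lambda>x. indicator \<Omega> x *\<^sub>R u x) \<in> borel_measurable lebesgue"
    using assms L2_measurable[OF assms(2)] by (subst (asm) borel_measurable_restrict_space_iff) auto
  moreover have "integrable lebesgue (\<lambda>x. indicator \<Omega> x *\<^sub>R (norm (u x))\<^sup>2)"
    using assms L2_norm_integrable[OF assms(2)] by (subst (asm) integrable_restrict_space) auto
  moreover have "indicator \<Omega> x *\<^sub>R (norm (u x))\<^sup>2 = (norm (indicator \<Omega> x *\<^sub>R u x))\<^sup>2" for x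
    by (simp add: indicator_def)
  ultimately show ?thesis by (simp add: L2_def lebesgue_on_UNIV_eq)
qed

lemma L2_rel_extend:
  assumes "\<Omega> \<in> sets lebesgue" "u \<in> L2 \<Omega>"
  shows "l2_rel (\<lambda>x. indicator \<Omega> x *\<^sub>R u x) (\<lambda>x. indicator \<Omega> x *\<^sub>R u x)"
  using L2_extend[OF assms] by (simp add: l2_rel_def)

lemma inner_cls:
  assumes \<Omega>: "\<Omega> \<in> sets lebesgue" and u: "u \<in> L2 \<Omega>" and v: "v \<in> L2 \<Omega>"
  shows "inner (cls \<Omega> u) (cls \<Omega> v) = L2_inner \<Omega> u v"
proof -
  have "inner (cls \<Omega> u) (cls \<Omega> v) = L2_inner UNIV (\<lambda>x. indicator \<Omega> x *\<^sub>R u x) (\<lambda>x. indicator \<Omega> x *\<^sub>R v x)"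
    unfolding cls_def inner_l2.abs_eq[OF L2_rel_extend[OF \<Omega> u] L2_rel_extend[OF \<Omega> v]] ..
  also have "\<dots> = L2_inner \<Omega> u v"
  proof -
    have "(\<lambda>x. (indicator \<Omega> x *\<^sub>R u x) \<bullet> (indicator \<Omega> x *\<^sub>R v x)) = (\<lambda>x. indicator \<Omega> x *\<^sub>R (u x \<bullet> v x))"
      by (auto simp: indicator_def)
    then show ?thesis using \<Omega> by (simp add: L2_inner_def integral_restrict_space)
  qed
  finally show ?thesis .
qed

lemma norm_cls:
  assumes "\<Omega> \<in> sets lebesgue" "u \<in> L2 \<Omega>"
  shows "norm (cls \<Omega> u) = L2_norm \<Omega> u"
  by (simp add: norm_eq_sqrt_inner inner_cls assms L2_norm_def)

lemma cls_add:
  assumes "\<Omega> \<in> sets lebesgue" "u \<in> L2 \<Omega>" "v \<in> L2 \<Omega>"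
  shows "cls \<Omega> (\<lambda>x. u x + v x) = cls \<Omega> u + cls \<Omega> v"
  unfolding cls_def plus_l2.abs_eq[OF L2_rel_extend[OF assms(1,2)] L2_rel_extend[OF assms(1,3)]]
  by (simp add: scaleR_add_right)

lemma cls_diff:
  assumes "\<Omega> \<in> sets lebesgue" "u \<in> L2 \<Omega>" "v \<in> L2 \<Omega>"
  shows "cls \<Omega> (\<lambda>x. u x - v x) = cls \<Omega> u - cls \<Omega> v"
  unfolding cls_def minus_l2.abs_eq[OF L2_rel_extend[OF assms(1,2)] L2_rel_extend[OF assms(1,3)]]
  by (simp add: scaleR_diff_right)

lemma cls_scaleR:
  assumes "\<Omega> \<in> sets lebesgue" "u \<in> L2 \<Omega>"
  shows "cls \<Omega> (\<lambda>x. c *\<^sub>R u x) = c *\<^sub>R cls \<Omega> u"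
  unfolding cls_def scaleR_l2.abs_eq[OF L2_rel_extend[OF assms(1,2)]]
  by (simp add: mult.commute)

lemma cls_zero: "cls \<Omega> (\<lambda>x. 0) = 0"
  unfolding cls_def zero_l2.abs_eq by simp

lemma L2_sum:
  assumes "finite I" "\<And>i. i \<in> I \<Longrightarrow> u i \<in> L2 \<Omega>"
  shows "(\<lambda>x. \<Sum>i\<in>I. u i x) \<in> L2 \<Omega>"
  using assms by (induction I rule: finite_induct) (simp_all add: L2_add)

lemma cls_sum:
  assumes "\<Omega> \<in> sets lebesgue" "finite I" "\<And>i. i \<in> I \<Longrightarrow> u i \<in> L2 \<Omega>"
  shows "cls \<Omega> (\<lambda>x. \<Sum>i\<in>I. u i x) = (\<Sum>i\<in>I. cls \<Omega> (u i))"
  using assms(2,3) 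
  by (induction I rule: finite_induct) (simp_all add: cls_zero cls_add assms(1) L2_sum)

lemma cls_eq_iff:
  assumes "\<Omega> \<in> sets lebesgue" "u \<in> L2 \<Omega>" "v \<in> L2 \<Omega>"
  shows "cls \<Omega> u = cls \<Omega> v \<longleftrightarrow> (AE x in lebesgue_on \<Omega>. u x = v x)"
proof -
  have "cls \<Omega> u = cls \<Omega> v \<longleftrightarrow> inner (cls \<Omega> (\<lambda>x. u x - v x)) (cls \<Omega> (\<lambda>x. u x - v x)) = 0"
    using assms by (simp add: cls_diff)
  also have "\<dots> \<longleftrightarrow> (AE x in lebesgue_on \<Omega>. u x - v x = 0)"
    using assms by (simp only: inner_cls L2_diff L2_inner_self_eq_0)
  finally show ?thesis by simp
qed

section \<open>Energy identities of the Adams--Moulton formulas\<close>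

definition dif :: "(nat \<Rightarrow> 'a::real_vector) \<Rightarrow> nat \<Rightarrow> 'a" where
  "dif X = (\<lambda>n. X n - X (n - 1))"

definition am :: "nat \<Rightarrow> (nat \<Rightarrow> 'a::real_vector) \<Rightarrow> nat \<Rightarrow> 'a" where
  "am \<nu> X n = (\<Sum>j<\<nu>. (am_coeffs \<nu> ! j) *\<^sub>R X (n - j))"

lemma funpow_dif_0 [simp]: "X 0 = 0 \<Longrightarrow> (dif ^^ p) X 0 = 0"
  by (cases p) (simp_all add: dif_def)

lemma am_0 [simp]: "X 0 = 0 \<Longrightarrow> am \<nu> X 0 = 0"
  by (simp add: am_def)

lemma am_dif: "am \<nu> (dif X) n = am \<nu> X n - am \<nu> X (n - 1)"
  by (simp add: am_def dif_def scaleR_diff_right sum_subtractf add.commute)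

lemma abs_am_coeffs_le_1:
  assumes "\<nu> \<in> {3, 4, 5}" "j < \<nu>"
  shows "\<bar>am_coeffs \<nu> ! j\<bar> \<le> 1"
proof -
  have "j \<in> {0, 1, 2, 3, 4}" using assms by auto
  then show ?thesis using assms by (auto simp: am_coeffs_def numeral_eq_Suc)
qed

lemma norm_am_le:
  fixes X :: "nat \<Rightarrow> 'a::real_normed_vector"
  assumes "\<nu> \<in> {3, 4, 5}"
  shows "norm (am \<nu> X n) \<le> (\<Sum>j<\<nu>. norm (X (n - j)))"
  unfolding am_def
proof (rule order.trans[OF norm_sum sum_mono])
  fix j assume "j \<in> {..<\<nu>}"
  then show "norm ((am_coeffs \<nu> ! j) *\<^sub>R X (n - j)) \<le> norm (X (n - j))"
    using abs_am_coeffs_le_1[OF assms, of j] by (simp add: mult_left_le_one_le)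
qed

lemma am_in_subspace: "subspace S \<Longrightarrow> (\<And>n. X n \<in> S) \<Longrightarrow> am \<nu> X n \<in> S"
  unfolding am_def by (intro subspace_sum subspace_scale)

lemma funpow_dif_in_subspace: "subspace S \<Longrightarrow> (\<And>n. X n \<in> S) \<Longrightarrow> (dif ^^ p) X n \<in> S"
  by (induction p arbitrary: n) (simp_all add: dif_def subspace_diff)

text \<open>
  What \<open>\<Sum> dif X n \<bullet> am \<nu> X n\<close> contains besides \<open>(norm (X m))\<^sup>2 / 2\<close>: a quadratic form \<open>bdry\<close> in the last
  increments, and a sum of squares of higher differences, the \<open>growth\<close>. For \<nu> = 3 and 4 the latter has
  the unfavourable sign; for \<nu> = 5 the third differences have the favourable one.
\<close>

definition bdry :: "nat \<Rightarrow> 'a::real_inner \<Rightarrow> 'a \<Rightarrow> 'a \<Rightarrow> real" where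
  "bdry \<nu> a b c =
     - (a \<bullet> a) / 24
     - (if \<nu> \<ge> 4 then (3/2 * (a \<bullet> a) + 1/2 * (b \<bullet> b) - 2 * (a \<bullet> b)) / 24 else 0)
     - (if \<nu> \<ge> 5 then 19/720 * (2 * (a \<bullet> a) + 7/2 * (b \<bullet> b) + 1/2 * (c \<bullet> c)
          - 6 * (a \<bullet> b) - 3 * (b \<bullet> c) + 3 * (a \<bullet> c)) else 0)"

definition growth :: "nat \<Rightarrow> (nat \<Rightarrow> 'a::real_inner) \<Rightarrow> nat \<Rightarrow> real" where
  "growth \<nu> X n =
     (if \<nu> = 3 then (norm ((dif ^^ 2) X n))\<^sup>2 / 24
      else if \<nu> = 4 then (norm ((dif ^^ 3) X n))\<^sup>2 / 48
      else 19/1440 * (norm ((dif ^^ 4) X n))\<^sup>2 - 27/1440 * (norm ((dif ^^ 3) X n))\<^sup>2)"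

text \<open>
  A polynomial identity in at most five consecutive values of \<open>X\<close>. The form \<open>bdry\<close> is chosen so that
  the rest consists of squares of differences of the highest possible order, because
  each further order of difference gains a factor \<open>\<tau> C\<^sub>G / h\<close>.
\<close>

lemma am_energy_step:
  fixes X :: "nat \<Rightarrow> 'a::real_inner"
  assumes "\<nu> \<in> {3, 4, 5}"
  shows "dif X n \<bullet> am \<nu> X n = ((norm (X n))\<^sup>2 - (norm (X (n - 1)))\<^sup>2) / 2
     + (bdry \<nu> (dif X n) (dif X (n - 1)) (dif X (n - 2))
        - bdry \<nu> (dif X (n - 1)) (dif X (n - 2)) (dif X (n - 3)))
     - growth \<nu> X n"
proof -
  consider "\<nu> = 3" | "\<nu> = 4" | "\<nu> = 5" using assms by auto
  then show ?thesis
  proof cases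
    case 1
    then show ?thesis
      by (simp add: am_def am_coeffs_def bdry_def growth_def dif_def numeral_eq_Suc
          power2_norm_eq_inner[unfolded numeral_eq_Suc, simplified] inner_diff_left inner_diff_right inner_add_left inner_add_right
          inner_commute field_simps)
  next
    case 2
    then show ?thesis
      by (simp add: am_def am_coeffs_def bdry_def growth_def dif_def numeral_eq_Suc
          power2_norm_eq_inner[unfolded numeral_eq_Suc, simplified] inner_diff_left inner_diff_right inner_add_left inner_add_right
          inner_commute field_simps)
  next
    case 3
    then show ?thesis
      by (simp add: am_def am_coeffs_def bdry_def growth_def dif_def numeral_eq_Suc
          power2_norm_eq_inner[unfolded numeral_eq_Suc, simplified] inner_diff_left inner_diff_right inner_add_left inner_add_right
          inner_commute field_simps)
  qed
qed

lemma sum_shift_le: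
  fixes \<phi> :: "nat \<Rightarrow> real"
  assumes "\<phi> 0 = 0" "\<And>n. 0 \<le> \<phi> n"
  shows "(\<Sum>n\<le>m. \<phi> (n - j)) \<le> (\<Sum>n\<le>m. \<phi> n)"
proof (induction j)
  case (Suc j)
  have "(\<Sum>n\<le>m. \<phi> (n - Suc j)) = (\<Sum>n<m. \<phi> (n - j))"
    using assms(1) by (simp add: sum.atMost_shift)
  also have "\<dots> \<le> (\<Sum>n\<le>m. \<phi> (n - j))"
    using assms(2) by (intro sum_mono2) auto
  finally show ?case using Suc by simp
qed simp

text \<open>
  Cauchy--Schwarz over the \<nu> \<le> 5 entries of a window, each of which runs through the whole sum.
\<close>

lemma sum_window_le:
  fixes c :: "nat \<Rightarrow> real"
  assumes "c 0 = 0" "\<And>n. 0 \<le> c n" "\<nu> \<le> 5"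
  shows "(\<Sum>n\<le>m. (\<Sum>j<\<nu>. c (n - j))\<^sup>2) \<le> 25 * (\<Sum>n\<le>m. (c n)\<^sup>2)"
proof -
  have "(\<Sum>n\<le>m. (\<Sum>j<\<nu>. c (n - j))\<^sup>2) \<le> (\<Sum>n\<le>m. real \<nu> * (\<Sum>j<\<nu>. (c (n - j))\<^sup>2))"
    using sum_squared_le_sum_of_squares[of _ "{..<\<nu>}"] by (intro sum_mono) (simp add: mult.commute)
  also have "\<dots> = real \<nu> * (\<Sum>j<\<nu>. \<Sum>n\<le>m. (c (n - j))\<^sup>2)"
    unfolding sum_distrib_left by (rule sum.swap)
  also have "\<dots> \<le> real \<nu> * (\<Sum>j<\<nu>. \<Sum>n\<le>m. (c n)\<^sup>2)"
    using assms by (intro mult_left_mono sum_mono sum_shift_le[of "\<lambda>n. (c n)\<^sup>2"]) auto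
  also have "\<dots> = (real \<nu>)\<^sup>2 * (\<Sum>n\<le>m. (c n)\<^sup>2)"
    by (simp add: power2_eq_square)
  also have "\<dots> \<le> 25 * (\<Sum>n\<le>m. (c n)\<^sup>2)"
  proof (rule mult_right_mono)
    have "(real \<nu>)\<^sup>2 \<le> 5\<^sup>2" using assms(3) by (intro power_mono) auto
    then show "(real \<nu>)\<^sup>2 \<le> 25" by simp
  qed (simp add: sum_nonneg)
  finally show ?thesis .
qed

lemma sum_dif_le:
  fixes X :: "nat \<Rightarrow> 'a::real_normed_vector"
  assumes "X 0 = 0"
  shows "(\<Sum>n\<le>m. (norm (dif X n))\<^sup>2) \<le> 4 * (\<Sum>n\<le>m. (norm (X n))\<^sup>2)"
proof -
  have "(norm (dif X n))\<^sup>2 \<le> 2 * (norm (X n))\<^sup>2 + 2 * (norm (X (n - 1)))\<^sup>2" for n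
  proof -
    have "(norm (dif X n))\<^sup>2 \<le> (norm (X n) + norm (X (n - 1)))\<^sup>2"
      unfolding dif_def by (intro power_mono norm_triangle_ineq4) simp
    also have "\<dots> \<le> 2 * (norm (X n))\<^sup>2 + 2 * (norm (X (n - 1)))\<^sup>2"
      using sum_squares_bound[of "norm (X n)" "norm (X (n - 1))"] by (simp add: power2_sum)
    finally show ?thesis .
  qed
  then have "(\<Sum>n\<le>m. (norm (dif X n))\<^sup>2) \<le> (\<Sum>n\<le>m. 2 * (norm (X n))\<^sup>2 + 2 * (norm (X (n - 1)))\<^sup>2)"
    by (rule sum_mono)
  also have "\<dots> = 2 * (\<Sum>n\<le>m. (norm (X n))\<^sup>2) + 2 * (\<Sum>n\<le>m. (norm (X (n - 1)))\<^sup>2)"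
    by (simp add: sum.distrib sum_distrib_left)
  also have "\<dots> \<le> 4 * (\<Sum>n\<le>m. (norm (X n))\<^sup>2)"
    using sum_shift_le[of "\<lambda>n. (norm (X n))\<^sup>2" 1 m] assms by simp
  finally show ?thesis .
qed

lemma sum_funpow_dif_le:
  fixes X :: "nat \<Rightarrow> 'a::real_normed_vector"
  assumes "X 0 = 0"
  shows "(\<Sum>n\<le>m. (norm ((dif ^^ p) X n))\<^sup>2) \<le> 4 ^ p * (\<Sum>n\<le>m. (norm (X n))\<^sup>2)"
proof (induction p)
  case (Suc p)
  have "(\<Sum>n\<le>m. (norm ((dif ^^ Suc p) X n))\<^sup>2) \<le> 4 * (\<Sum>n\<le>m. (norm ((dif ^^ p) X n))\<^sup>2)"
    using sum_dif_le[of "(dif ^^ p) X" m] assms by simp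
  with Suc show ?case by simp
qed simp

lemma bdry_bound:
  fixes a b c :: "'a::real_inner"
  assumes "norm a \<le> \<beta>" "norm b \<le> \<beta>" "norm c \<le> \<beta>"
  shows "\<bar>bdry \<nu> a b c\<bar> \<le> \<beta>\<^sup>2"
proof -
  have *: "\<bar>x \<bullet> y\<bar> \<le> \<beta>\<^sup>2" if "norm x \<le> \<beta>" "norm y \<le> \<beta>" for x y :: 'a
  proof -
    have "\<bar>x \<bullet> y\<bar> \<le> norm x * norm y" by (rule Cauchy_Schwarz_ineq2)
    also have "\<dots> \<le> \<beta> * \<beta>" using that by (intro mult_mono) (auto intro: order.trans[OF norm_ge_zero])
    finally show ?thesis by (simp add: power2_eq_square)
  qed
  show ?thesis
    using *[OF assms(1,1)] *[OF assms(2,2)] *[OF assms(3,3)] *[OF assms(1,2)] *[OF assms(2,3)] *[OF assms(1,3)]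
    unfolding bdry_def abs_le_iff by (auto simp: field_simps)
qed

lemma am_energy:
  fixes X :: "nat \<Rightarrow> 'a::real_inner"
  assumes \<nu>: "\<nu> \<in> {3, 4, 5}" and X0: "X 0 = 0" and \<beta>: "\<And>n. n \<le> m \<Longrightarrow> norm (dif X n) \<le> \<beta>"
  shows "(norm (X m))\<^sup>2 / 2 \<le> (\<Sum>n\<le>m. dif X n \<bullet> am \<nu> X n) + \<beta>\<^sup>2 + (\<Sum>n\<le>m. growth \<nu> X n)"
proof -
  let ?b = "\<lambda>n. bdry \<nu> (dif X n) (dif X (n - 1)) (dif X (n - 2))"
  have "(\<Sum>n\<le>k. dif X n \<bullet> am \<nu> X n) = (norm (X k))\<^sup>2 / 2 + ?b k - (\<Sum>n\<le>k. growth \<nu> X n)" for k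
  proof (induction k)
    case 0
    have d0: "dif X 0 = 0" by (simp add: dif_def)
    have "growth \<nu> X 0 = 0" using \<nu> funpow_dif_0[of X, OF X0] by (simp add: growth_def)
    then show ?case by (simp add: X0 d0 bdry_def)
  next
    case (Suc k)
    have "k - 2 = Suc k - 3" by simp
    then have "dif X (Suc k) \<bullet> am \<nu> X (Suc k) = ((norm (X (Suc k)))\<^sup>2 - (norm (X k))\<^sup>2) / 2
      + (?b (Suc k) - ?b k) - growth \<nu> X (Suc k)"
      using am_energy_step[OF \<nu>, of X "Suc k"] by simp
    with Suc show ?case by (simp add: field_simps)
  qed
  note this[of m]
  moreover have "\<bar>?b m\<bar> \<le> \<beta>\<^sup>2" by (intro bdry_bound \<beta>) auto
  ultimately show ?thesis by linarith
qed

section \<open>Stability of the discrete scheme\<close>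

lemma discrete_gronwall:
  fixes E :: "nat \<Rightarrow> real"
  assumes "\<And>k. k \<le> m \<Longrightarrow> E k \<le> a + b * (\<Sum>n<k. E n)" and "0 \<le> a" "0 \<le> b"
  shows "E m \<le> a * exp (b * real m)"
proof -
  have "a + b * (\<Sum>n<k. E n) \<le> a * (1 + b) ^ k" if "k \<le> m" for k
    using that
  proof (induction k)
    case (Suc k)
    have "a + b * (\<Sum>n<Suc k. E n) = (a + b * (\<Sum>n<k. E n)) + b * E k" by (simp add: algebra_simps)
    also have "\<dots> \<le> (1 + b) * (a + b * (\<Sum>n<k. E n))"
      using assms(1)[of k] Suc.prems mult_left_mono[OF _ assms(3), of "E k" "a + b * (\<Sum>n<k. E n)"]
      by (simp add: algebra_simps)
    also have "\<dots> \<le> (1 + b) * (a * (1 + b) ^ k)" using Suc assms by (intro mult_left_mono) auto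
    finally show ?case by (simp add: algebra_simps)
  qed simp
  then have "E m \<le> a * (1 + b) ^ m" using assms(1)[of m] by force
  also have "\<dots> \<le> a * exp b ^ m"
    using assms by (intro mult_left_mono power_mono exp_ge_add_one_self) auto
  finally show ?thesis by (simp add: exp_of_nat2_mult)
qed

text \<open>
  The scheme satisfied by the discrete error \<open>e\<close> with right-hand side \<open>f\<close>. Both vanish at the starting
  indices, so that the equation holds for all \<open>n \<le> N\<close> with the convention \<open>0 - 1 = 0\<close> of natural numbers.
\<close>

locale am_scheme =
  fixes G :: "'a::real_inner \<Rightarrow> 'a" and Vh :: "'a set" and \<nu> N :: nat
    and \<tau> \<delta> h CG Cd :: real and e f :: "nat \<Rightarrow> 'a"
  assumes linG: "linear G" and Vh: "subspace Vh"
    and skew: "\<And>w z. w \<in> Vh \<Longrightarrow> z \<in> Vh \<Longrightarrow> G w \<bullet> z = - (w \<bullet> G z)"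
    and inv: "\<And>w. w \<in> Vh \<Longrightarrow> norm (G w) \<le> CG / h * norm w"
    and pos: "0 < \<tau>" "0 < \<delta>" "0 < h" "0 < CG" "0 < Cd" and \<delta>: "\<delta> \<le> Cd * h"
    and \<nu>: "\<nu> \<in> {3, 4, 5}"
    and e: "\<And>n. e n \<in> Vh" and e0: "e 0 = 0" and f0: "f 0 = 0"
    and scheme: "\<And>n w. n \<le> N \<Longrightarrow> w \<in> Vh \<Longrightarrow>
      (dif e n /\<^sub>R \<tau> + G (am \<nu> e n)) \<bullet> (w + \<delta> *\<^sub>R G w) = f n \<bullet> (w + \<delta> *\<^sub>R G w)"
begin

abbreviation "Ae n \<equiv> dif e n /\<^sub>R \<tau> + G (am \<nu> e n)"

definition "q = 1 + Cd * CG"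

text \<open>
  The energy norm of the scheme is that of the graph of \<open>\<delta> G\<close>: the energy identity is applied to the
  sequence of pairs in the product space.
\<close>

definition "pair w = (w, \<delta> *\<^sub>R G w)"

lemma q_ge_1: "1 \<le> q"
  using pos by (simp add: q_def)

lemma norm_delta_G_le: "w \<in> Vh \<Longrightarrow> \<delta> * norm (G w) \<le> Cd * CG * norm w"
proof -
  assume w: "w \<in> Vh"
  have "\<delta> * norm (G w) \<le> \<delta> * (CG / h * norm w)"
    using inv[OF w] pos by (intro mult_left_mono) auto
  also have "\<dots> = (\<delta> / h) * (CG * norm w)" by simp
  also have "\<dots> \<le> Cd * (CG * norm w)"
    using pos \<delta> by (intro mult_right_mono) (auto simp: field_simps)
  finally show ?thesis by simp
qed

lemma norm_T_le: "w \<in> Vh \<Longrightarrow> norm (w + \<delta> *\<^sub>R G w) \<le> q * norm w"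
  using norm_triangle_ineq[of w "\<delta> *\<^sub>R G w"] norm_delta_G_le[of w] pos
  by (simp add: q_def algebra_simps)

lemma norm_pair_le: "w \<in> Vh \<Longrightarrow> norm (pair w) \<le> q * norm w"
  using norm_Pair_le[of w "\<delta> *\<^sub>R G w"] norm_delta_G_le[of w] pos
  by (simp add: pair_def q_def algebra_simps)

lemma norm_le_pair: "norm w \<le> norm (pair w)" "\<delta> * norm (G w) \<le> norm (pair w)"
  using norm_fst_le[of w "\<delta> *\<^sub>R G w"] norm_snd_le[of "\<delta> *\<^sub>R G w" w] pos
  by (simp_all add: pair_def)

lemma linear_pair: "linear pair"
  unfolding pair_def
  by (rule linearI) (simp_all add: linear_add[OF linG] linear_scale[OF linG] algebra_simps)

lemma dif_pair: "dif (\<lambda>n. pair (X n)) = (\<lambda>n. pair (dif X n))"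
  by (simp add: dif_def linear_diff[OF linear_pair])

lemma funpow_dif_pair: "(dif ^^ p) (\<lambda>n. pair (X n)) = (\<lambda>n. pair ((dif ^^ p) X n))"
  by (induction p) (simp_all add: dif_pair)

lemma am_pair: "am \<nu> (\<lambda>n. pair (X n)) n = pair (am \<nu> X n)"
  unfolding am_def by (simp add: linear_sum[OF linear_pair] linear_scale[OF linear_pair])

lemma skew_self: "w \<in> Vh \<Longrightarrow> G w \<bullet> w = 0" "w \<in> Vh \<Longrightarrow> w \<bullet> G w = 0"
  using skew[of w w] by (simp_all add: inner_commute)

lemma de_in_Vh: "(dif ^^ p) e n \<in> Vh"
  by (rule funpow_dif_in_subspace[OF Vh e])

lemma am_de_in_Vh: "am \<nu> ((dif ^^ p) e) n \<in> Vh"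
  by (rule am_in_subspace[OF Vh de_in_Vh])

text \<open>
  The scheme has constant coefficients in time, so that differences of the error satisfy it too.
\<close>

lemma scheme_dif:
  "n \<le> N \<Longrightarrow> w \<in> Vh \<Longrightarrow>
    ((dif ^^ Suc p) e n /\<^sub>R \<tau> + G (am \<nu> ((dif ^^ p) e) n)) \<bullet> (w + \<delta> *\<^sub>R G w)
      = (dif ^^ p) f n \<bullet> (w + \<delta> *\<^sub>R G w)"
proof (induction p arbitrary: n)
  case 0
  then show ?case using scheme by simp
next
  case (Suc p)
  have eq: "(dif ^^ Suc (Suc p)) e n /\<^sub>R \<tau> + G (am \<nu> ((dif ^^ Suc p) e) n)
    = ((dif ^^ Suc p) e n /\<^sub>R \<tau> + G (am \<nu> ((dif ^^ p) e) n))
      - ((dif ^^ Suc p) e (n - 1) /\<^sub>R \<tau> + G (am \<nu> ((dif ^^ p) e) (n - 1)))"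
    unfolding funpow.simps(2)[of "Suc p"] funpow.simps(2)[of p] o_def am_dif linear_diff[OF linG]
    by (simp add: dif_def[of "dif _"] algebra_simps)
  show ?case
    unfolding eq using Suc.IH[of n] Suc.IH[of "n - 1"] Suc.prems
    by (simp add: inner_diff_left dif_def[of "(dif ^^ p) f"])
qed

text \<open>
  Test with the increment \<open>z\<close> itself: \<open>G z\<close> is orthogonal to \<open>z\<close>, and \<open>norm (z + \<delta> G z)\<close> is at most
  \<open>q * norm z\<close> by the inverse inequality and \<delta> \<le> C h.
\<close>

lemma step_bound:
  assumes "n \<le> N"
  shows "norm ((dif ^^ Suc p) e n) \<le> q * (\<tau> * norm ((dif ^^ p) f n) + \<tau> * norm (G (am \<nu> ((dif ^^ p) e) n)))"
proof -
  define z where "z = (dif ^^ Suc p) e n"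
  have z: "z \<in> Vh" unfolding z_def by (rule de_in_Vh)
  have "(z /\<^sub>R \<tau>) \<bullet> (z + \<delta> *\<^sub>R G z) = ((dif ^^ p) f n - G (am \<nu> ((dif ^^ p) e) n)) \<bullet> (z + \<delta> *\<^sub>R G z)"
    using scheme_dif[OF assms z, of p] by (simp add: z_def inner_add_left inner_diff_left)
  moreover have "(z /\<^sub>R \<tau>) \<bullet> (z + \<delta> *\<^sub>R G z) = (norm z)\<^sup>2 / \<tau>"
    using skew_self[OF z] by (simp add: inner_add_right power2_norm_eq_inner divide_inverse)
  ultimately have "(norm z)\<^sup>2 / \<tau> \<le> norm ((dif ^^ p) f n - G (am \<nu> ((dif ^^ p) e) n)) * norm (z + \<delta> *\<^sub>R G z)"
    using norm_cauchy_schwarz[of "(dif ^^ p) f n - G (am \<nu> ((dif ^^ p) e) n)" "z + \<delta> *\<^sub>R G z"] by linarith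
  also have "\<dots> \<le> (norm ((dif ^^ p) f n) + norm (G (am \<nu> ((dif ^^ p) e) n))) * (q * norm z)"
    using norm_triangle_ineq4 norm_T_le[OF z] by (intro mult_mono) auto
  finally have *: "norm z * norm z \<le> (q * (\<tau> * norm ((dif ^^ p) f n) + \<tau> * norm (G (am \<nu> ((dif ^^ p) e) n)))) * norm z"
    using pos by (simp add: field_simps power2_eq_square)
  show ?thesis
  proof (cases "norm z = 0")
    case True
    then show ?thesis using pos q_ge_1 unfolding z_def by (simp add: add_nonneg_nonneg)
  next
    case False
    then have "0 < norm z" by simp
    from mult_right_le_imp_le[OF * this] show ?thesis unfolding z_def .
  qed
qed

lemma step_bound_sq:
  assumes "n \<le> N" "norm (G (am \<nu> ((dif ^^ p) e) n)) \<le> g"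
  shows "(norm ((dif ^^ Suc p) e n))\<^sup>2 \<le> 2 * q\<^sup>2 * (\<tau>\<^sup>2 * (norm ((dif ^^ p) f n))\<^sup>2 + \<tau>\<^sup>2 * g\<^sup>2)"
proof -
  have "0 \<le> g" using assms(2) norm_ge_zero order.trans by blast
  have "(norm ((dif ^^ Suc p) e n))\<^sup>2 \<le> (q * (\<tau> * norm ((dif ^^ p) f n) + \<tau> * g))\<^sup>2"
    using assms(2) pos q_ge_1
    by (intro power_mono order.trans[OF step_bound[OF assms(1)]] mult_left_mono add_left_mono) auto
  also have "\<dots> = q\<^sup>2 * (\<tau> * norm ((dif ^^ p) f n) + \<tau> * g)\<^sup>2" by (simp add: power_mult_distrib)
  also have "\<dots> \<le> q\<^sup>2 * (2 * ((\<tau> * norm ((dif ^^ p) f n))\<^sup>2 + (\<tau> * g)\<^sup>2))"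
    using sum_squares_bound[of "\<tau> * norm ((dif ^^ p) f n)" "\<tau> * g"]
    by (intro mult_left_mono) (simp_all add: power2_sum)
  finally show ?thesis by (simp add: power_mult_distrib distrib_left mult_ac)
qed

definition "lam = \<tau> * CG / h"

definition "Phi = \<tau>\<^sup>2 * (\<Sum>n\<le>N. (norm (f n))\<^sup>2)"

lemma lam_pos: "0 < lam"
  using pos by (simp add: lam_def)

lemma Phi_nonneg: "0 \<le> Phi"
  by (simp add: Phi_def sum_nonneg)

lemma sum_f_le: "m \<le> N \<Longrightarrow> \<tau>\<^sup>2 * (\<Sum>n\<le>m. (norm ((dif ^^ p) f n))\<^sup>2) \<le> 4 ^ p * Phi"
proof -
  assume "m \<le> N"
  have "(\<Sum>n\<le>m. (norm ((dif ^^ p) f n))\<^sup>2) \<le> 4 ^ p * (\<Sum>n\<le>m. (norm (f n))\<^sup>2)"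
    by (rule sum_funpow_dif_le[of f, OF f0])
  also have "\<dots> \<le> 4 ^ p * (\<Sum>n\<le>N. (norm (f n))\<^sup>2)"
    using \<open>m \<le> N\<close> by (intro mult_left_mono sum_mono2) auto
  finally show ?thesis
    using mult_left_mono[of _ _ "\<tau>\<^sup>2"] by (fastforce simp: Phi_def mult.left_commute)
qed

definition "Q p m = (\<Sum>n\<le>m. (norm ((dif ^^ p) e n))\<^sup>2)"

lemma Q_nonneg: "0 \<le> Q p m"
  by (simp add: Q_def sum_nonneg)

lemma G_am_le: "\<tau> * norm (G (am \<nu> ((dif ^^ p) e) n)) \<le> lam * norm (am \<nu> ((dif ^^ p) e) n)"
  using mult_left_mono[OF inv[OF am_de_in_Vh[of p n]], of \<tau>] pos by (simp add: lam_def)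

text \<open>
  Solved for the increment, the scheme bounds the differences of order \<open>p + 1\<close> by those of order \<open>p\<close>
  times the small factor \<open>lam = \<tau> C\<^sub>G / h\<close>, up to the right-hand side.
\<close>

lemma Q_step:
  assumes "m \<le> N"
  shows "Q (Suc p) m \<le> 2 * q\<^sup>2 * (4 ^ p * Phi + 25 * lam\<^sup>2 * Q p m)"
proof -
  have "Q (Suc p) m \<le> (\<Sum>n\<le>m. 2 * q\<^sup>2 * (\<tau>\<^sup>2 * (norm ((dif ^^ p) f n))\<^sup>2
      + lam\<^sup>2 * (\<Sum>j<\<nu>. norm ((dif ^^ p) e (n - j)))\<^sup>2))"
    unfolding Q_def
  proof (rule sum_mono)
    fix n assume "n \<in> {..m}"
    then have n: "n \<le> N" using assms by simp
    have "(\<tau> * norm (G (am \<nu> ((dif ^^ p) e) n)))\<^sup>2 \<le> (lam * (\<Sum>j<\<nu>. norm ((dif ^^ p) e (n - j))))\<^sup>2"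
      using pos lam_pos norm_am_le[OF \<nu>]
      by (intro power_mono order.trans[OF G_am_le] mult_left_mono) auto
    then show "(norm ((dif ^^ Suc p) e n))\<^sup>2 \<le> 2 * q\<^sup>2 * (\<tau>\<^sup>2 * (norm ((dif ^^ p) f n))\<^sup>2
      + lam\<^sup>2 * (\<Sum>j<\<nu>. norm ((dif ^^ p) e (n - j)))\<^sup>2)"
      using step_bound_sq[OF n order.refl, of p]
      by (elim order.trans) (intro mult_left_mono, simp_all add: power_mult_distrib)
  qed
  also have "\<dots> = 2 * q\<^sup>2 * (\<tau>\<^sup>2 * (\<Sum>n\<le>m. (norm ((dif ^^ p) f n))\<^sup>2)
      + lam\<^sup>2 * (\<Sum>n\<le>m. (\<Sum>j<\<nu>. norm ((dif ^^ p) e (n - j)))\<^sup>2))"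
    by (simp add: sum_distrib_left sum.distrib distrib_left mult.assoc)
  also have "\<dots> \<le> 2 * q\<^sup>2 * (4 ^ p * Phi + lam\<^sup>2 * (25 * Q p m))"
    unfolding Q_def using assms \<nu>
    by (intro mult_left_mono add_mono sum_f_le sum_window_le) (auto simp: e0)
  finally show ?thesis by (simp add: mult_ac)
qed

text \<open>
  The choice of the test function \<open>W = M e + \<delta> D e\<close>, where \<open>D\<close> is the difference quotient and \<open>M\<close> the
  Adams--Moulton mean, is decisive. Since \<open>G\<close> is skew-symmetric,
  \<open>(D e + G M e, W + \<delta> G W) = (D e, M e) + \<delta>\<^sup>2 (G D e, G M e) + \<delta> |D e + G M e|\<^sup>2\<close>:
  the first two terms are the energy pairing of \<open>(e, \<delta> G e)\<close>, the last one is dissipation.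
\<close>

lemma dissipation_identity:
  assumes "n \<le> N"
  shows "\<tau> * (f n \<bullet> (am \<nu> e n + \<delta> *\<^sub>R (dif e n /\<^sub>R \<tau>) + \<delta> *\<^sub>R G (am \<nu> e n + \<delta> *\<^sub>R (dif e n /\<^sub>R \<tau>))))
    = dif (\<lambda>n. pair (e n)) n \<bullet> am \<nu> (\<lambda>n. pair (e n)) n + \<tau> * \<delta> * (norm (Ae n))\<^sup>2"
proof -
  define d M where "d = dif e n /\<^sub>R \<tau>" and "M = am \<nu> e n"
  have d: "d \<in> Vh" and M: "M \<in> Vh"
    unfolding d_def M_def using de_in_Vh[of 1 n] am_de_in_Vh[of 0 n] by (auto intro: subspace_scale[OF Vh])
  then have w: "M + \<delta> *\<^sub>R d \<in> Vh" by (intro subspace_add subspace_scale Vh)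
  have "f n \<bullet> (M + \<delta> *\<^sub>R d + \<delta> *\<^sub>R G (M + \<delta> *\<^sub>R d)) = (d + G M) \<bullet> (M + \<delta> *\<^sub>R d + \<delta> *\<^sub>R G (M + \<delta> *\<^sub>R d))"
    using scheme[OF assms w] by (simp add: d_def M_def)
  also have "\<dots> = d \<bullet> M + \<delta> * (norm (d + G M))\<^sup>2 + \<delta>\<^sup>2 * (G d \<bullet> G M)"
    using skew_self[OF d] skew_self[OF M] skew[OF d M]
    by (simp add: linear_add[OF linG] linear_scale[OF linG] power2_norm_eq_inner power2_eq_square
        inner_add_left inner_add_right algebra_simps inner_commute power2_norm_eq_inner[unfolded power2_eq_square])
  finally have "\<tau> * (f n \<bullet> (M + \<delta> *\<^sub>R d + \<delta> *\<^sub>R G (M + \<delta> *\<^sub>R d)))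
     = (\<tau> *\<^sub>R d) \<bullet> M + \<delta>\<^sup>2 * (G (\<tau> *\<^sub>R d) \<bullet> G M) + \<tau> * \<delta> * (norm (d + G M))\<^sup>2"
    by (simp add: linear_scale[OF linG] algebra_simps)
  moreover have "dif e n = \<tau> *\<^sub>R d" using pos by (simp add: d_def)
  ultimately show ?thesis
    using pos unfolding dif_pair am_pair by (simp add: pair_def M_def[symmetric] power2_eq_square)
qed

text \<open>
  One constant for the whole recursion: \<open>200 * q\<^sup>2\<close> covers \<open>2 * q\<^sup>2 * 4 ^ p\<close> for \<open>p \<le> 3\<close> and \<open>2 * q\<^sup>2 * 25\<close>.
\<close>

definition "K = 200 * q\<^sup>2"

definition "D m = (\<Sum>n\<le>m. \<tau> * \<delta> * (norm (Ae n))\<^sup>2)"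

lemma K_bounds: "1 \<le> K" "200 * q\<^sup>2 \<le> K" "200 \<le> K"
proof -
  have "1 \<le> q\<^sup>2" using q_ge_1 by (simp add: one_le_power)
  then show "1 \<le> K" "200 * q\<^sup>2 \<le> K" "200 \<le> K" by (simp_all add: K_def)
qed

lemma D_nonneg: "0 \<le> D m"
  using pos by (simp add: D_def sum_nonneg)

lemma Q_step_K:
  assumes "m \<le> N" "p \<le> 3"
  shows "Q (Suc p) m \<le> K * (Phi + lam\<^sup>2 * Q p m)"
proof -
  have "(4::real) ^ p \<le> 4 ^ 3" using assms(2) by (intro power_increasing) auto
  then have "2 * q\<^sup>2 * (4 ^ p * Phi + 25 * lam\<^sup>2 * Q p m) \<le> 2 * q\<^sup>2 * (100 * Phi + 100 * lam\<^sup>2 * Q p m)"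
    using Phi_nonneg Q_nonneg by (intro mult_left_mono add_mono mult_right_mono) auto
  also have "\<dots> = K * (Phi + lam\<^sup>2 * Q p m)" by (simp add: K_def algebra_simps)
  finally show ?thesis using Q_step[OF assms(1), of p] by linarith
qed

lemma Q2_le:
  assumes "m \<le> N" "lam \<le> 1"
  shows "Q 2 m \<le> K\<^sup>2 * (2 * Phi + lam ^ 4 * Q 0 m)"
proof -
  have l2: "lam\<^sup>2 \<le> 1" using assms(2) lam_pos by (simp add: power_le_one)
  have "Q 2 m \<le> K * (Phi + lam\<^sup>2 * Q 1 m)" using Q_step_K[OF assms(1), of 1] by (simp add: numeral_2_eq_2)
  also have "\<dots> \<le> K * (Phi + lam\<^sup>2 * (K * (Phi + lam\<^sup>2 * Q 0 m)))"
    using Q_step_K[OF assms(1), of 0] K_bounds(1) by (intro mult_left_mono add_left_mono) auto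
  also have "\<dots> = K * Phi + K\<^sup>2 * (lam\<^sup>2 * Phi) + K\<^sup>2 * (lam ^ 4 * Q 0 m)"
    by (simp add: algebra_simps power2_eq_square power4_eq_xxxx)
  also have "\<dots> \<le> K\<^sup>2 * Phi + K\<^sup>2 * Phi + K\<^sup>2 * (lam ^ 4 * Q 0 m)"
    using K_bounds(1) Phi_nonneg l2 mult_right_mono[of K "K\<^sup>2" Phi]
    by (intro add_mono mult_left_mono) (auto simp: power2_eq_square mult_left_le_one_le)
  finally show ?thesis by (simp add: algebra_simps)
qed

lemma Q3_le:
  assumes "m \<le> N" "lam \<le> 1"
  shows "Q 3 m \<le> K ^ 3 * (3 * Phi + lam ^ 6 * Q 0 m)"
proof -
  have l2: "lam\<^sup>2 \<le> 1" using assms(2) lam_pos by (simp add: power_le_one)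
  have K3: "K \<le> K ^ 3" using K_bounds(1) power_increasing[of 1 3 K] by simp
  have "Q 3 m \<le> K * (Phi + lam\<^sup>2 * Q 2 m)"
    using Q_step_K[OF assms(1), of 2] by (simp only: numeral_3_eq_3 numeral_2_eq_2)
  also have "\<dots> \<le> K * (Phi + lam\<^sup>2 * (K\<^sup>2 * (2 * Phi + lam ^ 4 * Q 0 m)))"
    using Q2_le[OF assms] K_bounds(1) by (intro mult_left_mono add_left_mono) auto
  also have "\<dots> = K * Phi + K ^ 3 * (2 * (lam\<^sup>2 * Phi)) + K ^ 3 * (lam ^ 6 * Q 0 m)"
    by (simp add: algebra_simps power2_eq_square power4_eq_xxxx power3_eq_cube numeral_eq_Suc)
  also have "\<dots> \<le> K ^ 3 * Phi + K ^ 3 * (2 * Phi) + K ^ 3 * (lam ^ 6 * Q 0 m)"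
    using K_bounds(1) Phi_nonneg l2 K3
    by (intro add_mono mult_left_mono mult_right_mono) (auto simp: mult_left_le_one_le)
  finally show ?thesis by (simp add: algebra_simps)
qed

lemma sum_pair_le:
  "(\<Sum>n\<le>m. (norm ((dif ^^ p) (\<lambda>n. pair (e n)) n))\<^sup>2) \<le> q\<^sup>2 * Q p m"
  unfolding Q_def sum_distrib_left funpow_dif_pair power_mult_distrib[symmetric]
  by (intro sum_mono power_mono norm_pair_le de_in_Vh) simp

lemma Q_le_sum_pair:
  "Q p m \<le> (\<Sum>n\<le>m. (norm ((dif ^^ p) (\<lambda>n. pair (e n)) n))\<^sup>2)"
  unfolding Q_def funpow_dif_pair by (intro sum_mono power_mono norm_le_pair) simp

text \<open>
  The local inverse estimate applied to \<open>w = D e\<close>, \<open>v = M e\<close> bounds \<open>G D e\<close>, and through the differenced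
  scheme the second differences, by \<open>D e + G M e\<close>, which the dissipation controls because \<tau> \<le> Ct \<delta>.
\<close>

lemma Q2_le_dissipation:
  assumes "m \<le> N" and loc: "\<And>w v. w \<in> Vh \<Longrightarrow> v \<in> Vh \<Longrightarrow> norm (G w) \<le> Ca / h * norm (w + G v)"
    and Ct: "\<tau> \<le> Ct * \<delta>"
  shows "Q 2 m \<le> 2 * q\<^sup>2 * (4 * Phi + 25 * (\<tau> * Ca / h)\<^sup>2 * (Ct * D m))"
proof -
  define g where "g n = \<tau> * Ca / h * (\<Sum>j<\<nu>. norm (Ae (n - j)))" for n
  have Gd: "norm (G (dif e k)) \<le> \<tau> * Ca / h * norm (Ae k)" for k
  proof -
    have "norm (G (dif e k /\<^sub>R \<tau>)) \<le> Ca / h * norm (Ae k)"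
      using de_in_Vh[of 1 k] am_de_in_Vh[of 0 k] by (intro loc subspace_scale[OF Vh]) auto
    then show ?thesis using pos by (simp add: linear_scale[OF linG] field_simps)
  qed
  have g: "norm (G (am \<nu> ((dif ^^ 1) e) n)) \<le> g n" for n
  proof -
    have "G (am \<nu> (dif e) n) = am \<nu> (\<lambda>n. G (dif e n)) n"
      by (simp add: am_def linear_sum[OF linG] linear_scale[OF linG])
    also have "norm \<dots> \<le> (\<Sum>j<\<nu>. norm (G (dif e (n - j))))" by (rule norm_am_le[OF \<nu>])
    also have "\<dots> \<le> g n" unfolding g_def sum_distrib_left by (intro sum_mono Gd)
    finally show ?thesis by simp
  qed
  have A0: "norm (Ae 0) = 0" using linear_0[OF linG] e0 by (simp add: dif_def)
  have "Q 2 m \<le> (\<Sum>n\<le>m. 2 * q\<^sup>2 * (\<tau>\<^sup>2 * (norm ((dif ^^ 1) f n))\<^sup>2 + \<tau>\<^sup>2 * (g n)\<^sup>2))"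
    unfolding Q_def numeral_2_eq_2 using assms(1) step_bound_sq[OF _ g] by (intro sum_mono) (simp add: numeral_2_eq_2)
  also have "\<dots> = 2 * q\<^sup>2 * (\<tau>\<^sup>2 * (\<Sum>n\<le>m. (norm ((dif ^^ 1) f n))\<^sup>2)
      + (\<tau> * Ca / h)\<^sup>2 * (\<tau>\<^sup>2 * (\<Sum>n\<le>m. (\<Sum>j<\<nu>. norm (Ae (n - j)))\<^sup>2)))"
  proof -
    have "(g n)\<^sup>2 = (\<tau> * Ca / h)\<^sup>2 * (\<Sum>j<\<nu>. norm (Ae (n - j)))\<^sup>2" for n
      unfolding g_def power_mult_distrib ..
    then show ?thesis by (simp add: sum_distrib_left sum.distrib distrib_left mult_ac)
  qed
  also have "\<dots> \<le> 2 * q\<^sup>2 * (4 ^ 1 * Phi + (\<tau> * Ca / h)\<^sup>2 * (25 * (Ct * D m)))"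
  proof (intro mult_left_mono add_mono sum_f_le assms)
    have "0 \<le> \<tau> * (Ct * \<delta>)" using Ct pos by (intro mult_nonneg_nonneg[of \<tau>]) linarith+
    then have "\<tau>\<^sup>2 * (\<Sum>n\<le>m. (\<Sum>j<\<nu>. norm (Ae (n - j)))\<^sup>2) \<le> (Ct * (\<tau> * \<delta>)) * (25 * (\<Sum>n\<le>m. (norm (Ae n))\<^sup>2))"
      using A0 \<nu> Ct pos
      by (intro mult_mono sum_window_le[of "\<lambda>n. norm (Ae n)"]) (auto simp: power2_eq_square sum_nonneg mult_ac)
    also have "\<dots> = 25 * (Ct * D m)" by (simp add: D_def sum_distrib_left mult_ac)
    finally show "\<tau>\<^sup>2 * (\<Sum>n\<le>m. (\<Sum>j<\<nu>. norm (Ae (n - j)))\<^sup>2) \<le> 25 * (Ct * D m)" .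
  qed auto
  finally show ?thesis by (simp add: mult_ac)
qed

text \<open>
  The three mechanisms that tame the growth. For \<nu> = 3, 4 without further structure it is \<open>lam ^ 4\<close>,
  \<open>lam ^ 6\<close> times the sum of squares of the error, left to Gronwall's inequality. For \<nu> = 5 the fourth
  differences are absorbed by the third ones, since \<open>lam\<close> is small. With the local inverse estimate the
  dissipation absorbs everything.
\<close>

lemma growth_le:
  assumes "m \<le> N" "lam \<le> 1" "K ^ 4 * lam\<^sup>2 \<le> 1 / 32" "0 \<le> mu"
    and cases: "\<nu> = 3 \<and> mu = lam ^ 4 \<or> \<nu> = 4 \<and> mu = lam ^ 6 \<or> \<nu> = 5 \<or>
      \<nu> \<noteq> 5 \<and> (\<forall>w\<in>Vh. \<forall>v\<in>Vh. norm (G w) \<le> Ca / h * norm (w + G v)) \<and> \<tau> \<le> Ct * \<delta>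
        \<and> K ^ 4 * ((\<tau> * Ca / h)\<^sup>2 * Ct) \<le> 1 / 2"
  shows "(\<Sum>n\<le>m. growth \<nu> (\<lambda>n. pair (e n)) n) \<le> K ^ 4 * (3 * Phi + mu * Q 0 m) + D m / 2"
    (is "?L \<le> ?R")
proof -
  let ?X = "\<lambda>n. pair (e n)"
  have KK: "1 \<le> K" "q\<^sup>2 \<le> K" "1 \<le> q\<^sup>2" using K_bounds q_ge_1 by (auto simp: one_le_power)
  have R: "0 \<le> D m" "0 \<le> Phi" "0 \<le> Q 0 m" by (rule D_nonneg Phi_nonneg Q_nonneg)+
  have g3: "?L \<le> K * Q 2 m" if "\<nu> = 3"
  proof -
    have "?L = (\<Sum>n\<le>m. (norm ((dif ^^ 2) ?X n))\<^sup>2) / 24" using that by (simp add: growth_def sum_divide_distrib)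
    also have "\<dots> \<le> q\<^sup>2 * Q 2 m" using sum_pair_le[of 2 m] mult_nonneg_nonneg[OF zero_le_power2[of q] Q_nonneg[of 2 m]] by linarith
    also have "\<dots> \<le> K * Q 2 m" by (intro mult_right_mono KK Q_nonneg)
    finally show ?thesis .
  qed
  have g4: "?L \<le> K * Q 3 m" if "\<nu> = 4"
  proof -
    have "?L = (\<Sum>n\<le>m. (norm ((dif ^^ 3) ?X n))\<^sup>2) / 48" using that by (simp add: growth_def sum_divide_distrib)
    also have "\<dots> \<le> q\<^sup>2 * Q 3 m" using sum_pair_le[of 3 m] mult_nonneg_nonneg[OF zero_le_power2[of q] Q_nonneg[of 3 m]] by linarith
    also have "\<dots> \<le> K * Q 3 m" by (intro mult_right_mono KK Q_nonneg)
    finally show ?thesis .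
  qed
  consider (a) "\<nu> = 3" "mu = lam ^ 4" | (b) "\<nu> = 4" "mu = lam ^ 6" | (c) "\<nu> = 5"
    | (d) "\<nu> \<noteq> 5" "\<And>w v. w \<in> Vh \<Longrightarrow> v \<in> Vh \<Longrightarrow> norm (G w) \<le> Ca / h * norm (w + G v)" "\<tau> \<le> Ct * \<delta>"
        "K ^ 4 * ((\<tau> * Ca / h)\<^sup>2 * Ct) \<le> 1 / 2"
    using cases by blast
  then show ?thesis
  proof cases
    case a
    have "?L \<le> K * (K\<^sup>2 * (2 * Phi + lam ^ 4 * Q 0 m))"
      using g3[OF a(1)] mult_left_mono[OF Q2_le[OF assms(1,2)], of K] KK by linarith
    also have "\<dots> = K ^ 3 * (2 * Phi + lam ^ 4 * Q 0 m)" by (simp add: power3_eq_cube power2_eq_square)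
    also have "\<dots> \<le> K ^ 4 * (3 * Phi + lam ^ 4 * Q 0 m)"
      using KK R by (intro mult_mono power_increasing) (auto simp: add_nonneg_nonneg)
    finally show ?thesis using R a(2) by simp
  next
    case b
    have "?L \<le> K * (K ^ 3 * (3 * Phi + lam ^ 6 * Q 0 m))"
      using g4[OF b(1)] mult_left_mono[OF Q3_le[OF assms(1,2)], of K] KK by linarith
    also have "\<dots> = K ^ 4 * (3 * Phi + lam ^ 6 * Q 0 m)" by (simp add: numeral_eq_Suc)
    finally show ?thesis using R b(2) by simp
  next
    case c
    have "?L = 19/1440 * (\<Sum>n\<le>m. (norm ((dif ^^ 4) ?X n))\<^sup>2) - 27/1440 * (\<Sum>n\<le>m. (norm ((dif ^^ 3) ?X n))\<^sup>2)"
      using c by (simp add: growth_def sum_subtractf sum_distrib_left)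
    also have "\<dots> \<le> 19/1440 * (q\<^sup>2 * Q 4 m) - 27/1440 * Q 3 m"
      using sum_pair_le[of 4 m] Q_le_sum_pair[of 3 m] by linarith
    also have "\<dots> \<le> 19/1440 * (K * (K * (Phi + lam\<^sup>2 * Q 3 m))) - 27/1440 * Q 3 m"
    proof -
      have "Q 4 m \<le> K * (Phi + lam\<^sup>2 * Q 3 m)" using Q_step_K[OF assms(1), of 3] by (simp add: numeral_eq_Suc)
      then have "q\<^sup>2 * Q 4 m \<le> K * (K * (Phi + lam\<^sup>2 * Q 3 m))"
        using KK Q_nonneg by (intro mult_mono) auto
      then show ?thesis by linarith
    qed
    also have "\<dots> = 19/1440 * (K\<^sup>2 * Phi) + 19/1440 * ((K\<^sup>2 * lam\<^sup>2) * Q 3 m) - 27/1440 * Q 3 m"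
      by (simp add: algebra_simps power2_eq_square)
    also have "\<dots> \<le> K ^ 4 * (3 * Phi)"
    proof -
      have K24: "K\<^sup>2 \<le> K ^ 4" using KK by (intro power_increasing) auto
      have "K\<^sup>2 * lam\<^sup>2 \<le> K ^ 4 * lam\<^sup>2" using K24 by (intro mult_right_mono) auto
      then have "(K\<^sup>2 * lam\<^sup>2) * Q 3 m \<le> 1 * Q 3 m" using assms(3) Q_nonneg by (intro mult_right_mono) auto
      moreover have "K\<^sup>2 * Phi \<le> K ^ 4 * Phi" using K24 R by (intro mult_right_mono) auto
      moreover have "0 \<le> K\<^sup>2 * Phi" using R by simp
      ultimately show ?thesis using Q_nonneg[of 3 m] by linarith
    qed
    also have "\<dots> \<le> ?R"
      using R assms(4) KK by (simp add: distrib_left add_nonneg_nonneg)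
    finally show ?thesis .
  next
    case d
    have "Q 3 m \<le> 4 * Q 2 m"
      using sum_dif_le[of "(dif ^^ 2) e" m, OF funpow_dif_0[of e 2, OF e0]] unfolding Q_def numeral_3_eq_3 numeral_2_eq_2 by simp
    then have "K * Q 3 m \<le> 4 * K * Q 2 m" using mult_left_mono[of "Q 3 m" "4 * Q 2 m" K] KK by simp
    moreover have "\<nu> = 3 \<or> \<nu> = 4" using \<nu> d(1) by auto
    moreover have "0 \<le> K * Q 2 m" using KK Q_nonneg by simp
    ultimately have "?L \<le> 4 * K * Q 2 m" using g3 g4 by fastforce
    also have "\<dots> \<le> 4 * K * (2 * q\<^sup>2 * (4 * Phi + 25 * (\<tau> * Ca / h)\<^sup>2 * (Ct * D m)))"
      using KK by (intro mult_left_mono Q2_le_dissipation assms d) auto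
    also have "\<dots> = K\<^sup>2 * ((4 * Phi + 25 * (\<tau> * Ca / h)\<^sup>2 * (Ct * D m)) / 25)"
      by (simp add: K_def power2_eq_square)
    also have "\<dots> = 4 / 25 * (K\<^sup>2 * Phi) + K\<^sup>2 * ((\<tau> * Ca / h)\<^sup>2 * Ct) * D m"
      by (simp add: algebra_simps)
    also have "\<dots> \<le> K ^ 4 * (3 * Phi) + D m / 2"
    proof -
      have K24: "K\<^sup>2 \<le> K ^ 4" using KK by (intro power_increasing) auto
      have Ct0: "0 \<le> Ct" using d(3) pos by (metis mult_less_0_iff not_le order.strict_trans2 order.asym)
      have "K\<^sup>2 * ((\<tau> * Ca / h)\<^sup>2 * Ct) \<le> K ^ 4 * ((\<tau> * Ca / h)\<^sup>2 * Ct)"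
        using K24 Ct0 by (intro mult_right_mono) auto
      then have "K\<^sup>2 * ((\<tau> * Ca / h)\<^sup>2 * Ct) * D m \<le> 1 / 2 * D m" using d(4) R by (intro mult_right_mono) auto
      moreover have "K\<^sup>2 * Phi \<le> K ^ 4 * Phi" using K24 R by (intro mult_right_mono) auto
      moreover have "0 \<le> K\<^sup>2 * Phi" using R by simp
      ultimately show ?thesis by linarith
    qed
    also have "\<dots> \<le> ?R"
      using R assms(4) KK by (simp add: distrib_left add_nonneg_nonneg)
    finally show ?thesis .
  qed
qed

text \<open>
  Energy identity, dissipation identity and growth bound together give a discrete Gronwall inequality
  for the running maximum \<open>E\<close> of the energy. The maximum is needed because \<open>rhs\<close> is stated for a
  bound on all earlier errors: summation by parts in time makes it depend on them.
\<close>

lemma stability: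
  assumes m: "m \<le> N" and lam: "lam \<le> 1" "K ^ 4 * lam\<^sup>2 \<le> 1 / 32" and mu: "0 \<le> mu" "mu \<le> lam\<^sup>2"
    and S: "0 \<le> S" "Phi \<le> S\<^sup>2"
    and rhs: "\<And>m \<beta>. m \<le> N \<Longrightarrow> (\<And>n. n \<le> m \<Longrightarrow> norm (e n) \<le> \<beta> \<and> \<delta> * norm (G (e n)) \<le> \<beta>) \<Longrightarrow>
      (\<Sum>n\<le>m. \<tau> * (f n \<bullet> (am \<nu> e n + \<delta> *\<^sub>R (dif e n /\<^sub>R \<tau>) + \<delta> *\<^sub>R G (am \<nu> e n + \<delta> *\<^sub>R (dif e n /\<^sub>R \<tau>)))))
        \<le> S * (\<beta> + sqrt (D m))"
    and cases: "\<nu> = 3 \<and> mu = lam ^ 4 \<or> \<nu> = 4 \<and> mu = lam ^ 6 \<or> \<nu> = 5 \<or>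
      \<nu> \<noteq> 5 \<and> (\<forall>w\<in>Vh. \<forall>v\<in>Vh. norm (G w) \<le> Ca / h * norm (w + G v)) \<and> \<tau> \<le> Ct * \<delta>
        \<and> K ^ 4 * ((\<tau> * Ca / h)\<^sup>2 * Ct) \<le> 1 / 2"
  shows "norm (e m + \<delta> *\<^sub>R G (e m)) \<le> 10 * K\<^sup>2 * S * exp (2 * K ^ 4 * mu * real m)"
proof -
  define X where "X n = pair (e n)" for n
  \<comment> \<open>The maximum is taken over earlier times, so the bound at step \<open>k\<close> may be read off at the maximizing index.\<close>
  define E where "E k = Max ((\<lambda>n. (norm (X n))\<^sup>2) ` {..k})" for k
  have E_ge: "(norm (X n))\<^sup>2 \<le> E k" if "n \<le> k" for n k
    unfolding E_def using that by (intro Max_ge) auto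
  have E_nonneg: "0 \<le> E k" for k using E_ge[of 0 k] by (meson order.trans le0 zero_le_power2)
  have KK: "1 \<le> K" "q\<^sup>2 \<le> K" "1 \<le> q\<^sup>2" using K_bounds q_ge_1 by (auto simp: one_le_power)
  have X0: "X 0 = 0" using linear_0[OF linear_pair] by (simp add: X_def e0)
  have dX: "norm (dif X n) \<le> sqrt (K\<^sup>2 * (Phi + lam\<^sup>2 * E k))" if "n \<le> k" "k \<le> N" for n k
  proof (rule real_le_rsqrt)
    have en: "norm (e i) \<le> sqrt (E k)" if "i \<le> k" for i
      using order.trans[OF norm_le_pair(1) real_le_rsqrt[OF E_ge[OF that, unfolded X_def]]] .
    have "\<tau> * norm (G (am \<nu> e n)) \<le> lam * norm (am \<nu> e n)" using G_am_le[of 0 n] by simp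
    also have "\<dots> \<le> lam * (\<Sum>j<\<nu>. sqrt (E k))"
      using lam_pos that by (intro mult_left_mono order.trans[OF norm_am_le[OF \<nu>]] sum_mono en) auto
    also have "\<dots> \<le> lam * (5 * sqrt (E k))"
      using lam_pos E_nonneg \<nu> by (intro mult_left_mono) (auto intro: mult_right_mono)
    finally have g: "\<tau> * norm (G (am \<nu> e n)) \<le> lam * (5 * sqrt (E k))" .
    have "(\<tau> * norm (G (am \<nu> e n)))\<^sup>2 \<le> (lam * (5 * sqrt (E k)))\<^sup>2"
      using g pos by (intro power_mono) auto
    then have g2: "\<tau>\<^sup>2 * (norm (G (am \<nu> e n)))\<^sup>2 \<le> 25 * lam\<^sup>2 * E k"
      using E_nonneg by (simp add: power_mult_distrib)
    have f2: "\<tau>\<^sup>2 * (norm (f n))\<^sup>2 \<le> Phi"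
      unfolding Phi_def using that by (intro mult_left_mono member_le_sum) auto
    have "(norm (dif X n))\<^sup>2 \<le> (q * norm (dif e n))\<^sup>2"
      unfolding X_def dif_pair using de_in_Vh[of 1 n] by (intro power_mono norm_pair_le) auto
    also have "\<dots> = q\<^sup>2 * (norm (dif e n))\<^sup>2" by (simp add: power_mult_distrib)
    also have "\<dots> \<le> q\<^sup>2 * (2 * q\<^sup>2 * (\<tau>\<^sup>2 * (norm (f n))\<^sup>2 + \<tau>\<^sup>2 * (norm (G (am \<nu> e n)))\<^sup>2))"
      using step_bound_sq[of n 0] that by (intro mult_left_mono) auto
    also have "\<dots> \<le> q\<^sup>2 * (2 * q\<^sup>2 * (25 * Phi + 25 * lam\<^sup>2 * E k))"
      using f2 g2 Phi_nonneg by (intro mult_left_mono) auto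
    also have "\<dots> = (50 * q ^ 4) * (Phi + lam\<^sup>2 * E k)" by (simp add: algebra_simps numeral_eq_Suc)
    also have "\<dots> \<le> K\<^sup>2 * (Phi + lam\<^sup>2 * E k)"
      using Phi_nonneg E_nonneg
      by (intro mult_right_mono add_nonneg_nonneg) (auto simp: K_def power_mult_distrib)
    finally show "(norm (dif X n))\<^sup>2 \<le> K\<^sup>2 * (Phi + lam\<^sup>2 * E k)" .
  qed
  have main: "E k \<le> 24 * K ^ 4 * S\<^sup>2 + 4 * K ^ 4 * mu * (\<Sum>i<k. E i)" if k: "k \<le> N" for k
  proof -
    have "E k \<in> (\<lambda>n. (norm (X n))\<^sup>2) ` {..k}" unfolding E_def by (intro Max_in) auto
    then obtain n where n: "n \<le> k" and En: "E k = (norm (X n))\<^sup>2" by auto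
    have nN: "n \<le> N" using n k by simp
    have "(norm (X n))\<^sup>2 / 2 \<le> (\<Sum>i\<le>n. dif X i \<bullet> am \<nu> X i)
        + (sqrt (K\<^sup>2 * (Phi + lam\<^sup>2 * E k)))\<^sup>2 + (\<Sum>i\<le>n. growth \<nu> X i)"
      using n k by (intro am_energy \<nu> X0 dX) auto
    also have "(\<Sum>i\<le>n. dif X i \<bullet> am \<nu> X i) \<le> S * (sqrt (E k) + sqrt (D n)) - D n"
    proof -
      have "(\<Sum>i\<le>n. dif X i \<bullet> am \<nu> X i) + D n
        = (\<Sum>i\<le>n. \<tau> * (f i \<bullet> (am \<nu> e i + \<delta> *\<^sub>R (dif e i /\<^sub>R \<tau>) + \<delta> *\<^sub>R G (am \<nu> e i + \<delta> *\<^sub>R (dif e i /\<^sub>R \<tau>)))))"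
        unfolding D_def sum.distrib[symmetric] X_def using nN
        by (intro sum.cong refl dissipation_identity[symmetric]) auto
      also have "\<dots> \<le> S * (sqrt (E k) + sqrt (D n))"
      proof (rule rhs[OF nN])
        fix i assume "i \<le> n"
        then have "norm (X i) \<le> sqrt (E k)" using E_ge[of i k] n by (intro real_le_rsqrt) auto
        then show "norm (e i) \<le> sqrt (E k) \<and> \<delta> * norm (G (e i)) \<le> sqrt (E k)"
          using norm_le_pair[of "e i"] unfolding X_def by linarith
      qed
      finally show ?thesis by linarith
    qed
    also have "(\<Sum>i\<le>n. growth \<nu> X i) \<le> K ^ 4 * (3 * Phi + mu * Q 0 n) + D n / 2"
      unfolding X_def by (rule growth_le[OF nN lam mu(1) cases])
    finally have *: "E k / 2 \<le> S * sqrt (E k) + S * sqrt (D n) - D n / 2 + K\<^sup>2 * (Phi + lam\<^sup>2 * E k)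
        + K ^ 4 * (3 * Phi + mu * Q 0 n)"
      using En Phi_nonneg E_nonneg by (simp add: algebra_simps)
    have D2: "S * sqrt (D n) \<le> D n / 2 + S\<^sup>2 / 2"
      using sum_squares_bound[of S "sqrt (D n)"] D_nonneg[of n] by simp
    have E2: "S * sqrt (E k) \<le> E k / 8 + 2 * S\<^sup>2"
      using sum_squares_bound[of "2 * S" "sqrt (E k) / 2"] E_nonneg[of k] by (simp add: power_divide power_mult_distrib)
    have K24: "K\<^sup>2 \<le> K ^ 4" "1 \<le> K ^ 4" using KK by (auto intro: power_increasing one_le_power)
    have l1: "K\<^sup>2 * (lam\<^sup>2 * E k) \<le> E k / 32"
    proof -
      have "K\<^sup>2 * lam\<^sup>2 \<le> 1 / 32" using mult_right_mono[OF K24(1), of "lam\<^sup>2"] lam(2) by simp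
      from mult_right_mono[OF this E_nonneg[of k]] show ?thesis by simp
    qed
    have q0: "Q 0 n \<le> E k + (\<Sum>i<k. E i)"
    proof -
      have "Q 0 n \<le> Q 0 k" unfolding Q_def using n by (intro sum_mono2) auto
      also have "\<dots> \<le> (\<Sum>i\<le>k. E i)" unfolding Q_def
      proof (intro sum_mono)
        fix i
        have "(norm (e i))\<^sup>2 \<le> (norm (X i))\<^sup>2" unfolding X_def by (intro power_mono norm_le_pair) simp
        with E_ge[of i i] have "(norm (e i))\<^sup>2 \<le> E i" by linarith
        then show "(norm ((dif ^^ 0) e i))\<^sup>2 \<le> E i" by simp
      qed
      also have "\<dots> = E k + (\<Sum>i<k. E i)" by (simp add: lessThan_Suc_atMost[symmetric])
      finally show ?thesis .
    qed
    have l2: "K ^ 4 * (mu * Q 0 n) \<le> E k / 32 + K ^ 4 * mu * (\<Sum>i<k. E i)"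
    proof -
      have "K ^ 4 * (mu * Q 0 n) \<le> K ^ 4 * (mu * (E k + (\<Sum>i<k. E i)))"
        using q0 mu KK by (intro mult_left_mono) auto
      also have "\<dots> = (K ^ 4 * mu) * E k + K ^ 4 * mu * (\<Sum>i<k. E i)" by (simp add: algebra_simps)
      also have "(K ^ 4 * mu) * E k \<le> (1 / 32) * E k"
      proof (rule mult_right_mono[OF _ E_nonneg])
        have "K ^ 4 * mu \<le> K ^ 4 * lam\<^sup>2" using mu(2) KK by (intro mult_left_mono) auto
        then show "K ^ 4 * mu \<le> 1 / 32" using lam(2) by linarith
      qed
      finally show ?thesis by simp
    qed
    have P: "K\<^sup>2 * Phi \<le> K ^ 4 * S\<^sup>2" "K ^ 4 * Phi \<le> K ^ 4 * S\<^sup>2" "S\<^sup>2 \<le> K ^ 4 * S\<^sup>2"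
      using S K24 KK Phi_nonneg mult_right_mono[OF K24(2), of "S\<^sup>2"]
      by (auto intro!: mult_mono)
    have "E k / 2 \<le> E k * (3 / 16) + 13 / 2 * (K ^ 4 * S\<^sup>2) + K ^ 4 * mu * (\<Sum>i<k. E i)"
    proof -
      have eq: "K\<^sup>2 * (Phi + lam\<^sup>2 * E k) = K\<^sup>2 * Phi + K\<^sup>2 * (lam\<^sup>2 * E k)"
        "K ^ 4 * (3 * Phi + mu * Q 0 n) = 3 * (K ^ 4 * Phi) + K ^ 4 * (mu * Q 0 n)"
        by (simp_all only: distrib_left mult.left_commute)
      show ?thesis using * D2 E2 l1 l2 P unfolding eq by linarith
    qed
    moreover have "0 \<le> K ^ 4 * S\<^sup>2" "0 \<le> K ^ 4 * mu * (\<Sum>i<k. E i)"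
      using KK mu E_nonneg by (auto simp: sum_nonneg)
    ultimately show ?thesis using E_nonneg[of k] by linarith
  qed
  have "(norm (X m))\<^sup>2 \<le> E m" by (rule E_ge) simp
  also have "\<dots> \<le> 24 * K ^ 4 * S\<^sup>2 * exp (4 * K ^ 4 * mu * real m)"
    using main m KK mu by (intro discrete_gronwall) auto
  also have "\<dots> \<le> (5 * K\<^sup>2 * S * exp (2 * K ^ 4 * mu * real m))\<^sup>2"
  proof -
    have "(exp (2 * K ^ 4 * mu * real m))\<^sup>2 = exp (4 * K ^ 4 * mu * real m)"
      using exp_double[of "2 * K ^ 4 * mu * real m"] by (simp add: mult.assoc)
    moreover have "(K\<^sup>2)\<^sup>2 = K ^ 4" by (simp add: power_mult[symmetric])
    ultimately have "(5 * K\<^sup>2 * S * exp (2 * K ^ 4 * mu * real m))\<^sup>2 = 25 * K ^ 4 * S\<^sup>2 * exp (4 * K ^ 4 * mu * real m)"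
      by (simp only: power_mult_distrib) simp
    moreover have "0 \<le> K ^ 4 * S\<^sup>2 * exp (4 * K ^ 4 * mu * real m)"
      by (intro mult_nonneg_nonneg zero_le_even_power zero_le_power2) auto
    ultimately show ?thesis by linarith
  qed
  finally have "norm (X m) \<le> 5 * K\<^sup>2 * S * exp (2 * K ^ 4 * mu * real m)"
    by (rule power2_le_imp_le) (use S KK in \<open>simp add: mult_nonneg_nonneg\<close>)
  moreover have "norm (e m + \<delta> *\<^sub>R G (e m)) \<le> 2 * norm (X m)"
    using norm_triangle_ineq[of "e m" "\<delta> *\<^sub>R G (e m)"] norm_le_pair[of "e m"] pos by (simp add: X_def)
  ultimately show ?thesis by linarith
qed

end

section \<open>Smooth bump functions\<close>

definition smooth :: "(real \<Rightarrow> real) \<Rightarrow> bool" where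
  "smooth g \<longleftrightarrow> (\<forall>n t. (deriv ^^ n) g field_differentiable at t)"

text \<open>
  Membership in a family of functions that is closed under taking a derivative gives smoothness at
  once; this replaces formulas for the derivatives of every order.
\<close>

lemma smooth_coinduct:
  assumes "g \<in> S" and S: "\<And>g. g \<in> S \<Longrightarrow> \<exists>g'\<in>S. \<forall>x. (g has_real_derivative g' x) (at x)"
  shows "smooth g"
proof -
  have "(deriv ^^ n) g \<in> S" for n
  proof (induction n)
    case (Suc n)
    then obtain g' where "g' \<in> S" "\<And>x. ((deriv ^^ n) g has_real_derivative g' x) (at x)"
      using S by blast
    moreover from this have "deriv ((deriv ^^ n) g) = g'" by (intro ext DERIV_imp_deriv)
    ultimately show ?case by simp
  qed (use assms in simp)
  then show ?thesis unfolding smooth_def field_differentiable_def using S by blast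
qed

lemma smooth_has_deriv: "smooth g \<Longrightarrow> ((deriv ^^ n) g has_real_derivative (deriv ^^ Suc n) g x) (at x)"
  by (simp add: smooth_def DERIV_deriv_iff_field_differentiable)

lemma smooth_continuous: "smooth g \<Longrightarrow> continuous_on S ((deriv ^^ n) g)"
  by (meson DERIV_continuous_on has_field_derivative_at_within smooth_has_deriv)

lemma smooth_linear_comb:
  assumes "smooth f" "smooth g"
  shows "smooth (\<lambda>x. a * f x + b * g x)"
proof (rule smooth_coinduct)
  let ?S = "range (\<lambda>n x. a * (deriv ^^ n) f x + b * (deriv ^^ n) g x)"
  show "(\<lambda>x. a * f x + b * g x) \<in> ?S" by (rule range_eqI[of _ _ 0]) simp
  fix k assume "k \<in> ?S"
  then obtain n where k: "k = (\<lambda>x. a * (deriv ^^ n) f x + b * (deriv ^^ n) g x)" by auto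
  show "\<exists>k'\<in>?S. \<forall>x. (k has_real_derivative k' x) (at x)"
    unfolding k using assms
    by (intro bexI[of _ "\<lambda>x. a * (deriv ^^ Suc n) f x + b * (deriv ^^ Suc n) g x"] allI
        DERIV_add DERIV_cmult smooth_has_deriv rangeI)
qed

lemma smooth_affine:
  assumes "smooth f"
  shows "smooth (\<lambda>x. f (a * x + b))"
proof (rule smooth_coinduct)
  let ?S = "{(\<lambda>x. c * (deriv ^^ n) f (a * x + b)) |c n. True}"
  show "(\<lambda>x. f (a * x + b)) \<in> ?S" by (rule CollectI, rule exI[of _ 1], rule exI[of _ 0]) simp
  fix k assume "k \<in> ?S"
  then obtain n c where k: "k = (\<lambda>x. c * (deriv ^^ n) f (a * x + b))" by auto
  have "((\<lambda>x. c * (deriv ^^ n) f (a * x + b)) has_real_derivative (c * a) * (deriv ^^ Suc n) f (a * x + b)) (at x)" for x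
  proof -
    have "((\<lambda>x. (deriv ^^ n) f (a * x + b)) has_real_derivative (deriv ^^ Suc n) f (a * x + b) * a) (at x)"
      by (rule DERIV_chain2[OF smooth_has_deriv[OF assms]]) (auto intro!: derivative_eq_intros)
    from DERIV_cmult[OF this, of c] show ?thesis by (simp add: mult_ac)
  qed
  then show "\<exists>k'\<in>?S. \<forall>x. (k has_real_derivative k' x) (at x)"
    unfolding k by (intro bexI[of _ "\<lambda>x. (c * a) * (deriv ^^ Suc n) f (a * x + b)"] allI) blast+
qed

inductive_set prods :: "(real \<Rightarrow> real) \<Rightarrow> (real \<Rightarrow> real) \<Rightarrow> (real \<Rightarrow> real) set" for f g where
  prod: "(\<lambda>x. (deriv ^^ m) f x * (deriv ^^ n) g x) \<in> prods f g"
| add: "k \<in> prods f g \<Longrightarrow> l \<in> prods f g \<Longrightarrow> (\<lambda>x. k x + l x) \<in> prods f g"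

lemma smooth_mult:
  assumes "smooth f" "smooth g"
  shows "smooth (\<lambda>x. f x * g x)"
proof (rule smooth_coinduct)
  show "(\<lambda>x. f x * g x) \<in> prods f g" using prods.prod[of 0 f 0 g] by simp
  show "\<exists>k'\<in>prods f g. \<forall>x. (k has_real_derivative k' x) (at x)" if "k \<in> prods f g" for k
    using that
  proof induction
    case (prod m n)
    have "((\<lambda>x. (deriv ^^ m) f x * (deriv ^^ n) g x) has_real_derivative
       (deriv ^^ Suc m) f x * (deriv ^^ n) g x + (deriv ^^ m) f x * (deriv ^^ Suc n) g x) (at x)" for x
      using DERIV_mult[OF smooth_has_deriv[OF assms(1), of m x] smooth_has_deriv[OF assms(2), of n x]]
      by (simp add: mult_ac add.commute)
    moreover have "(\<lambda>x. (deriv ^^ Suc m) f x * (deriv ^^ n) g x + (deriv ^^ m) f x * (deriv ^^ Suc n) g x) \<in> prods f g"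
      by (intro prods.add prods.prod)
    ultimately show ?case by (intro bexI allI)
  next
    case (add k l)
    then obtain k' l' where "k' \<in> prods f g" "\<forall>x. (k has_real_derivative k' x) (at x)"
      "l' \<in> prods f g" "\<forall>x. (l has_real_derivative l' x) (at x)" by blast
    then show ?case by (intro bexI[of _ "\<lambda>x. k' x + l' x"]) (auto intro: prods.add DERIV_add)
  qed
qed

lemma smooth_antideriv:
  assumes "smooth \<psi>" "\<And>x. (\<phi> has_real_derivative \<psi> x) (at x)"
  shows "smooth \<phi>"
proof (rule smooth_coinduct)
  let ?S = "insert \<phi> (range (\<lambda>n. (deriv ^^ n) \<psi>))"
  show "\<phi> \<in> ?S" by simp
  fix g assume "g \<in> ?S"
  then show "\<exists>g'\<in>?S. \<forall>x. (g has_real_derivative g' x) (at x)"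
  proof
    assume "g = \<phi>"
    moreover have "\<psi> = (deriv ^^ 0) \<psi>" by simp
    ultimately show ?thesis using assms(2) by blast
  next
    assume "g \<in> range (\<lambda>n. (deriv ^^ n) \<psi>)"
    then show ?thesis using smooth_has_deriv[OF assms(1)] by blast
  qed
qed

text \<open>
  For \<open>p = 1\<close> the classical smooth function that is flat at 0; the family over all \<open>p\<close> is closed under
  derivation.
\<close>

definition flat :: "real poly \<Rightarrow> real \<Rightarrow> real" where
  "flat p x = (if x > 0 then poly p (1 / x) * exp (- 1 / x) else 0)"

lemma poly_exp_tendsto_0:
  "((\<lambda>x. poly p x * exp (- x)) \<longlongrightarrow> 0) (at_top :: real filter)"
proof -
  have "((\<lambda>x. \<Sum>i\<le>degree p. coeff p i * (x ^ i / exp x)) \<longlongrightarrow> (\<Sum>i\<le>degree p. coeff p i * 0)) (at_top :: real filter)"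
    by (intro tendsto_sum tendsto_mult tendsto_const tendsto_power_div_exp_0)
  then show ?thesis
    by (simp add: poly_altdef exp_minus divide_inverse sum_distrib_right mult.assoc)
qed

lemma flat_has_deriv: "(flat p has_real_derivative flat ([:0, 0, 1:] * (p - pderiv p)) x) (at x)"
proof -
  consider "x > 0" | "x < 0" | "x = 0" by linarith
  then show ?thesis
  proof cases
    case 1
    have "((\<lambda>x. poly p (1 / x) * exp (- 1 / x)) has_real_derivative
        flat ([:0, 0, 1:] * (p - pderiv p)) x) (at x)"
      using 1 unfolding flat_def
      by (auto intro!: derivative_eq_intros simp: field_simps power2_eq_square)
    then show ?thesis
      using 1 by (elim has_field_derivative_transform_within_open[where S = "{0<..}"]) (auto simp: flat_def)
  next
    case 2
    have "((\<lambda>x. 0) has_real_derivative flat ([:0, 0, 1:] * (p - pderiv p)) x) (at x)"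
      using 2 by (simp add: flat_def)
    then show ?thesis
      using 2 by (elim has_field_derivative_transform_within_open[where S = "{..<0}"]) (auto simp: flat_def)
  next
    case 3
    have "((\<lambda>h. (flat p (0 + h) - flat p 0) / h) \<longlongrightarrow> 0) (at_right 0)"
    proof -
      have "filterlim (\<lambda>h::real. 1 / h) at_top (at_right 0)"
        using filterlim_inverse_at_top_right by (simp add: inverse_eq_divide)
      from filterlim_compose[OF poly_exp_tendsto_0[of "pCons 0 p"] this]
      show ?thesis
        by (rule Lim_transform_eventually)
          (auto simp: eventually_at_right_field flat_def intro!: exI[of _ 1])
    qed
    moreover have "((\<lambda>h. (flat p (0 + h) - flat p 0) / h) \<longlongrightarrow> 0) (at_left 0)"
      by (rule tendsto_eventually) (auto simp: eventually_at_left_field flat_def intro!: exI[of _ "-1"])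
    ultimately have "((\<lambda>h. (flat p (0 + h) - flat p 0) / h) \<longlongrightarrow> 0) (at 0)"
      by (rule filterlim_split_at[rotated])
    then show ?thesis using 3 by (simp add: DERIV_def flat_def)
  qed
qed

lemma smooth_flat: "smooth (flat p)"
proof (rule smooth_coinduct)
  show "flat p \<in> range flat" by simp
  show "\<exists>g'\<in>range flat. \<forall>x. (g has_real_derivative g' x) (at x)" if "g \<in> range flat" for g
    using that flat_has_deriv by blast
qed

text \<open>
  Supported in \<open>[a, b]\<close> and increasing to the indicator of \<open>(a, b)\<close> as \<open>n\<close> tends to infinity. Testing with these
  functions and passing to the limit replaces mollification.
\<close>

definition bump :: "real \<Rightarrow> real \<Rightarrow> nat \<Rightarrow> real \<Rightarrow> real" where
  "bump a b n x = flat 1 (real (Suc n) * (x - a)) * flat 1 (real (Suc n) * (b - x))"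

lemma smooth_bump: "smooth (bump a b n)"
proof -
  have "smooth (\<lambda>x. flat 1 (real (Suc n) * x + (- real (Suc n) * a)) * flat 1 (- real (Suc n) * x + real (Suc n) * b))"
    by (intro smooth_mult smooth_affine smooth_flat)
  moreover have "bump a b n = (\<lambda>x. flat 1 (real (Suc n) * x + (- real (Suc n) * a)) * flat 1 (- real (Suc n) * x + real (Suc n) * b))"
    by (simp add: bump_def fun_eq_iff algebra_simps)
  ultimately show ?thesis by simp
qed

lemma bump_0: "x \<notin> {a<..<b} \<Longrightarrow> bump a b n x = 0"
  by (auto simp: bump_def flat_def zero_less_mult_iff)

lemma bump_pos: "x \<in> {a<..<b} \<Longrightarrow> 0 < bump a b n x"
  by (simp add: bump_def flat_def)

lemma bump_nonneg: "0 \<le> bump a b n x"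
  using bump_0 bump_pos by (metis less_le order.refl)

lemma bump_le_1: "bump a b n x \<le> 1"
proof -
  have "flat 1 y \<le> 1" "0 \<le> flat 1 y" for y by (auto simp: flat_def)
  then show ?thesis by (simp add: bump_def mult_le_one)
qed

lemma bump_tendsto: "(\<lambda>n. bump a b n x) \<longlonglongrightarrow> indicator {a<..<b} x"
proof (cases "x \<in> {a<..<b}")
  case True
  have flat: "(\<lambda>n. flat 1 (real (Suc n) * y)) \<longlonglongrightarrow> 1" if "y > 0" for y
  proof -
    have "(\<lambda>n. exp (- (1 / y) * (1 / real (Suc n)))) \<longlonglongrightarrow> exp (- (1 / y) * 0)"
      by (intro tendsto_exp tendsto_mult tendsto_const LIMSEQ_Suc[OF lim_1_over_n])
    moreover have "flat 1 (real (Suc n) * y) = exp (- (1 / y) * (1 / real (Suc n)))" for n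
    proof -
      have "0 < real (Suc n) * y" using that by (intro mult_pos_pos) auto
      then show ?thesis by (simp add: flat_def field_simps del: of_nat_Suc)
    qed
    ultimately show ?thesis by simp
  qed
  have "(\<lambda>n. bump a b n x) \<longlonglongrightarrow> 1 * 1"
    unfolding bump_def using True by (intro tendsto_mult flat) auto
  then show ?thesis using True by simp
qed (simp add: bump_0)

section \<open>Weak derivatives of real functions\<close>

text \<open>
  Boxes generate the Borel sets and are stable under intersection, so that the integrals of \<open>f\<close> over all
  Borel sets, hence over all Lebesgue sets, vanish.
\<close>

lemma integral_box_zero_imp_AE_zero_UNIV:
  fixes f :: "'a::euclidean_space \<Rightarrow> real"
  assumes f: "integrable lebesgue f"
    and box: "\<And>a b. integral\<^sup>L lebesgue (\<lambda>x. indicator (box a b) x * f x) = 0"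
  shows "AE x in lebesgue. f x = 0"
proof -
  have int: "integrable lebesgue (\<lambda>x. indicator A x * f x)" if "A \<in> sets lebesgue" for A
    using integrable_mult_indicator[OF that f] by simp
  have borel: "integral\<^sup>L lebesgue (\<lambda>x. indicator A x * f x) = 0" if "A \<in> sets borel" for A
  proof -
    have total: "integral\<^sup>L lebesgue f = 0"
    proof -
      let ?A = "\<lambda>n::nat. box (- (real n *\<^sub>R One)) (real n *\<^sub>R One) :: 'a set"
      have "(\<lambda>n. integral\<^sup>L lebesgue (\<lambda>x. indicator (?A n) x * f x)) \<longlonglongrightarrow> integral\<^sup>L lebesgue f"
      proof (rule integral_dominated_convergence)
        show "integrable lebesgue (\<lambda>x. norm (f x))" using f by simp
        show "AE x in lebesgue. (\<lambda>n. indicator (?A n) x * f x) \<longlonglongrightarrow> f x"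
        proof (rule always_eventually, rule allI, rule tendsto_eventually)
          fix x :: 'a
          have "x \<in> (\<Union>i. ?A i)" using UN_box_eq_UNIV by blast
          then obtain i where i: "x \<in> ?A i" by auto
          have "x \<in> ?A n" if "i \<le> n" for n
            using i that by (auto simp: mem_box intro: order.strict_trans1 order.strict_trans2 dest!: bspec)
          then show "\<forall>\<^sub>F n in sequentially. indicator (?A n) x * f x = f x"
            by (auto simp: eventually_sequentially intro!: exI[of _ i])
        qed
        show "AE x in lebesgue. norm (indicator (?A n) x * f x) \<le> norm (f x)" for n
          by (auto simp: indicator_def)
      qed (use f int in \<open>auto intro: borel_measurable_integrable\<close>)
      then show ?thesis using box LIMSEQ_unique[of "\<lambda>n. 0" 0] by simp
    qed
    have G: "sigma_sets UNIV (range (\<lambda>(a, b). box a b :: 'a set)) = sets borel" by (simp add: borel_eq_box)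
    have "Int_stable (range (\<lambda>(a, b). box a b :: 'a set))"
      by (auto simp: Int_stable_def box_Int_box)
    moreover have "(range (\<lambda>(a, b). box a b :: 'a set)) \<subseteq> Pow UNIV" by auto
    moreover have "A \<in> sigma_sets UNIV (range (\<lambda>(a, b). box a b))"
      using that unfolding G .
    ultimately show ?thesis
    proof (induction rule: sigma_sets_induct_disjoint)
      case (basic A) then show ?case using box by auto
    next
      case empty then show ?case by simp
    next
      case (compl A)
      then have A: "A \<in> sets lebesgue" unfolding G by simp
      have "integral\<^sup>L lebesgue (\<lambda>x. indicator (UNIV - A) x * f x)
        = integral\<^sup>L lebesgue (\<lambda>x. f x - indicator A x * f x)"
        by (intro Bochner_Integration.integral_cong) (auto simp: indicator_def)
      also have "\<dots> = 0" using compl total f int[OF A] by simp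
      finally show ?case .
    next
      case (union A)
      then have A: "A i \<in> sets lebesgue" for i unfolding G by auto
      have "(LINT x:(\<Union>i. A i)|lebesgue. f x) = (\<Sum>i. (LINT x:(A i)|lebesgue. f x))"
      proof (rule lebesgue_integral_countable_add)
        show "A i \<inter> A j = {}" if "i \<noteq> j" for i j using union(1) that by (auto simp: disjoint_family_on_def)
        show "set_integrable lebesgue (\<Union>i. A i) f"
          unfolding set_integrable_def using A f by (intro integrable_mult_indicator) auto
      qed (rule A)
      then show ?case using union(3) by (simp add: set_lebesgue_integral_def)
    qed
  qed
  show ?thesis
  proof (rule density_unique_real[of lebesgue f "\<lambda>x. 0"])
    fix A :: "'a set" assume "A \<in> sets lebesgue"
    then obtain B N where BN: "B \<in> sets borel" "negligible N" "B \<union> N = A"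
      using sets_lebesgue_almost_borel by blast
    have "integral\<^sup>L lebesgue (\<lambda>x. indicator A x * f x) = integral\<^sup>L lebesgue (\<lambda>x. indicator B x * f x)"
    proof (rule integral_cong_AE)
      have "AE x in lebesgue. x \<notin> N" using BN(2) by (simp add: negligible_iff_null_sets AE_not_in)
      then show "AE x in lebesgue. indicator A x * f x = indicator B x * f x"
        using BN(3) by (auto simp: indicator_def elim: eventually_mono)
    qed (use BN \<open>A \<in> sets lebesgue\<close> int in \<open>auto intro: borel_measurable_integrable\<close>)
    then show "(LINT x:A|lebesgue. f x) = (LINT x:A|lebesgue. 0)"
      using borel[OF BN(1)] by (simp add: set_lebesgue_integral_def)
  qed (use f in auto)
qed

lemma integral_box_zero_imp_AE_zero:
  fixes f :: "'a::euclidean_space \<Rightarrow> real"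
  assumes S: "open S" and f: "integrable (lebesgue_on S) f"
    and box: "\<And>a b. cbox a b \<subseteq> S \<Longrightarrow> integral\<^sup>L (lebesgue_on S) (\<lambda>x. indicator (box a b) x * f x) = 0"
  shows "AE x in lebesgue_on S. f x = 0"
proof -
  have Sm: "S \<in> sets lebesgue" using S by auto
  have fS: "integrable lebesgue (\<lambda>x. indicator S x * f x)"
    using f Sm by (subst (asm) integrable_restrict_space) auto
  have loc: "AE x in lebesgue. x \<in> cbox a b \<longrightarrow> f x = 0" if ab: "cbox a b \<subseteq> S" for a b
  proof -
    have "AE x in lebesgue. indicator (box a b) x * f x = 0"
    proof (rule integral_box_zero_imp_AE_zero_UNIV)
      have "integrable lebesgue (\<lambda>x. indicator (box a b) x *\<^sub>R (indicator S x * f x))"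
        by (intro integrable_mult_indicator fS) auto
      also have "(\<lambda>x. indicator (box a b) x *\<^sub>R (indicator S x * f x)) = (\<lambda>x. indicator (box a b) x * f x)"
        using ab box_subset_cbox[of a b] by (auto simp: indicator_def fun_eq_iff)
      finally show "integrable lebesgue (\<lambda>x. indicator (box a b) x * f x)" .
      fix c d
      obtain c' d' where cd: "box c d \<inter> box a b = box c' d'" "cbox c' d' \<subseteq> S"
      proof (cases "box c d \<inter> box a b = {}")
        case True
        have "box (One :: 'a) 0 = {}" "cbox (One :: 'a) 0 = {}"
          using SOME_Basis by (auto simp: box_eq_empty)
        then show ?thesis using that[of One 0] True by simp
      next
        case False
        obtain c' d' where *: "box c d \<inter> box a b = box c' d'" by (simp add: box_Int_box)
        have "closure (box c' d') \<subseteq> closure (box a b)" using * by (intro closure_mono) auto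
        moreover have "box c' d' \<noteq> {}" "box a b \<noteq> {}" using False * by auto
        ultimately have "cbox c' d' \<subseteq> S" using ab by (auto simp: closure_box)
        with * show ?thesis by (rule that)
      qed
      have "integral\<^sup>L lebesgue (\<lambda>x. indicator (box c d) x * (indicator (box a b) x * f x))
        = integral\<^sup>L lebesgue (\<lambda>x. indicator S x *\<^sub>R (indicator (box c' d') x * f x))"
        using cd box_subset_cbox[of c' d']
        by (intro Bochner_Integration.integral_cong) (auto simp: indicator_def split: if_splits)
      also have "\<dots> = 0" using box[OF cd(2)] Sm by (simp add: integral_restrict_space)
      finally show "integral\<^sup>L lebesgue (\<lambda>x. indicator (box c d) x * (indicator (box a b) x * f x)) = 0" .
    qed
    moreover have "AE x in lebesgue. x \<notin> cbox a b - box a b"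
      by (rule AE_not_in) (use negligible_frontier_interval[of a b] in \<open>simp only: negligible_iff_null_sets\<close>)
    ultimately show ?thesis by eventually_elim (auto simp: indicator_def)
  qed
  obtain \<D> where D: "countable \<D>" "\<And>X. X \<in> \<D> \<Longrightarrow> \<exists>a b. X = cbox a b" "\<Union>\<D> = S"
    using open_countable_Union_open_cbox[OF S] by (metis (full_types))
  have "AE x in lebesgue. \<forall>X\<in>\<D>. x \<in> X \<longrightarrow> f x = 0"
  proof (intro AE_ball_countable[THEN iffD2, OF D(1)] ballI)
    fix X assume X: "X \<in> \<D>"
    then obtain a b where "X = cbox a b" using D(2) by blast
    with X D(3) loc[of a b] show "AE x in lebesgue. x \<in> X \<longrightarrow> f x = 0" by blast
  qed
  then have "AE x in lebesgue. x \<in> S \<longrightarrow> f x = 0"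
    using D(3) by (auto elim: eventually_mono)
  then show ?thesis using Sm by (subst AE_restrict_space_iff) auto
qed

lemma lborel_pair_integrable_product:
  fixes a b :: "real \<Rightarrow> real"
  assumes a: "integrable lborel a" and b: "integrable lborel b"
  shows "integrable (lborel \<Otimes>\<^sub>M lborel) (\<lambda>(t, s). a t * b s)"
proof (rule lborel_pair.Fubini_integrable)
  have [measurable]: "a \<in> borel_measurable borel" "b \<in> borel_measurable borel"
    using borel_measurable_integrable[OF a] borel_measurable_integrable[OF b] by simp_all
  show "(\<lambda>(t, s). a t * b s) \<in> borel_measurable (lborel \<Otimes>\<^sub>M lborel)" by simp
  show "integrable lborel (\<lambda>x. LINT y|lborel. norm (case (x, y) of (t, s) \<Rightarrow> a t * b s))"
    using a b by (simp add: abs_mult)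
  show "AE x in lborel. integrable lborel (\<lambda>y. case (x, y) of (t, s) \<Rightarrow> a t * b s)"
    using b by simp
qed

text \<open>
  Fubini's theorem on the triangle \<open>s < t\<close>, as \<open>y\<close> is merely integrable.
\<close>

lemma integral_by_parts_primitive:
  fixes \<phi> \<phi>' y :: "real \<Rightarrow> real"
  assumes T: "0 \<le> T" and y: "integrable (lebesgue_on {0<..<T}) y"
    and \<phi>: "\<And>x. (\<phi> has_real_derivative \<phi>' x) (at x)" and cont: "continuous_on UNIV \<phi>'" and \<phi>T: "\<phi> T = 0"
  shows "integral\<^sup>L (lebesgue_on {0<..<T}) (\<lambda>t. \<phi>' t * integral\<^sup>L (lebesgue_on {0<..<t}) y)
       = - integral\<^sup>L (lebesgue_on {0<..<T}) (\<lambda>t. \<phi> t * y t)"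
proof -
  have yI: "integrable lebesgue (\<lambda>x. indicator {0<..<T} x * y x)"
    using y by (subst (asm) integrable_restrict_space) auto
  then obtain y' where y'm: "y' \<in> borel_measurable lborel" and y'AE: "AE x in lborel. indicator {0<..<T} x * y x = y' x"
    using completion_ex_borel_measurable_real[of "\<lambda>x. indicator {0<..<T} x * y x" lborel]
    by (meson borel_measurable_integrable)
  have [measurable]: "y' \<in> borel_measurable borel" using y'm by simp
  have y'AE': "AE x in lebesgue. indicator {0<..<T} x * y x = y' x"
    using y'AE by (rule AE_completion)
  have y'int: "integrable lborel y'"
  proof -
    have "integrable lebesgue y'"
      using yI y'AE' borel_measurable_integrable[OF yI] measurable_completion[OF y'm]
      by (subst (asm) integrable_cong_AE[of _ _ y']) auto
    then show ?thesis by (simp add: integrable_completion)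
  qed
  have cb: "\<phi>' \<in> borel_measurable borel" by (rule borel_measurable_continuous_onI[OF cont])
  note [measurable] = cb
  define a where "a t = indicator {0..T} t * \<phi>' t" for t
  have aint: "integrable lborel a"
    unfolding a_def using borel_integrable_compact[of "{0..T}" \<phi>'] continuous_on_subset[OF cont]
    by (simp add: indicator_def if_distrib cong: if_cong)
  have am [measurable]: "a \<in> borel_measurable borel" using borel_measurable_integrable[OF aint] by simp
  define k where "k t s = a t * y' s * indicator {s<..} t" for t s
  have kint: "integrable (lborel \<Otimes>\<^sub>M lborel) (case_prod k)"
  proof (rule Bochner_Integration.integrable_bound[OF lborel_pair_integrable_product[OF aint y'int]])
    have "case_prod k = (\<lambda>(t, s). a t * y' s * (if s < t then 1 else 0))"
      by (auto simp: k_def indicator_def fun_eq_iff)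
    then show "case_prod k \<in> borel_measurable (lborel \<Otimes>\<^sub>M lborel)" by simp
  qed (auto simp: k_def indicator_def)
  have "(LINT s|lborel. LINT t|lborel. k t s) = (LINT t|lborel. LINT s|lborel. k t s)"
    by (rule lborel_pair.Fubini_integral[OF kint])
  moreover have "(LINT s|lborel. LINT t|lborel. k t s) = - integral\<^sup>L (lebesgue_on {0<..<T}) (\<lambda>t. \<phi> t * y t)"
  proof -
    have inner: "(LINT t|lborel. k t s) = - (\<phi> s * y' s)" if "s \<in> {0<..<T}" for s
    proof -
      have "(LINT t|lborel. k t s) = (LINT t|lborel. y' s * (\<phi>' t * indicator {s..T} t))"
      proof (rule integral_cong_AE)
        show "AE t in lborel. k t s = y' s * (\<phi>' t * indicator {s..T} t)"
          using AE_lborel_singleton[of s] by eventually_elim (use that in \<open>auto simp: k_def a_def indicator_def\<close>)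
      qed (auto simp: k_def)
      also have "\<dots> = y' s * (\<phi> T - \<phi> s)"
        using that integral_FTC_Icc_real[of s T \<phi> \<phi>'] \<phi> cont by (simp add: continuous_on_eq_continuous_at)
      finally show ?thesis using \<phi>T by (simp add: mult.commute)
    qed
    have "(LINT s|lborel. LINT t|lborel. k t s) = (LINT s|lborel. - (\<phi> s * y' s))"
    proof (rule integral_cong_AE)
      show "AE s in lborel. (LINT t|lborel. k t s) = - (\<phi> s * y' s)"
        using y'AE
      proof eventually_elim
        case (elim s)
        show ?case
        proof (cases "s \<in> {0<..<T}")
          case False
          then have "y' s = 0" using elim by simp
          then show ?thesis by (simp add: k_def)
        qed (rule inner)
      qed
      have "\<phi> \<in> borel_measurable borel"
        using \<phi> by (intro borel_measurable_continuous_onI) (meson DERIV_continuous_on has_field_derivative_at_within)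
      then show "(\<lambda>s. - (\<phi> s * y' s)) \<in> borel_measurable lborel" by simp
      have "case_prod k \<in> borel_measurable (lborel \<Otimes>\<^sub>M lborel)" by (rule borel_measurable_integrable[OF kint])
      then show "(\<lambda>s. LINT t|lborel. k t s) \<in> borel_measurable lborel" by measurable
    qed
    also have "\<dots> = (LINT s|lebesgue. - (\<phi> s * y' s))"
    proof -
      have "\<phi> \<in> borel_measurable borel"
        using \<phi> by (intro borel_measurable_continuous_onI) (meson DERIV_continuous_on has_field_derivative_at_within)
      then show ?thesis by (intro integral_completion[symmetric]) simp
    qed
    also have "\<dots> = (LINT s|lebesgue. indicator {0<..<T} s *\<^sub>R (- (\<phi> s * y s)))"
    proof (rule integral_cong_AE)
      have \<phi>m: "\<phi> \<in> borel_measurable lebesgue"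
        using \<phi> by (intro measurable_completion) (simp, intro borel_measurable_continuous_onI, meson DERIV_continuous_on has_field_derivative_at_within)
      then show "(\<lambda>s. - (\<phi> s * y' s)) \<in> borel_measurable lebesgue"
        by (intro borel_measurable_uminus borel_measurable_times measurable_completion[OF y'm])
      show "(\<lambda>s. indicator {0<..<T} s *\<^sub>R (- (\<phi> s * y s))) \<in> borel_measurable lebesgue"
        using borel_measurable_uminus[OF borel_measurable_times[OF \<phi>m borel_measurable_integrable[OF
            yI]]]
        by (simp add: mult_ac)
      show "AE s in lebesgue. - (\<phi> s * y' s) = indicator {0<..<T} s *\<^sub>R (- (\<phi> s * y s))"
        using y'AE' by eventually_elim auto
    qed
    also have "\<dots> = - integral\<^sup>L (lebesgue_on {0<..<T}) (\<lambda>t. \<phi> t * y t)"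
      by (subst integral_restrict_space[symmetric]) auto
    finally show ?thesis .
  qed
  moreover have "(LINT t|lborel. LINT s|lborel. k t s)
     = integral\<^sup>L (lebesgue_on {0<..<T}) (\<lambda>t. \<phi>' t * integral\<^sup>L (lebesgue_on {0<..<t}) y)"
  proof -
    have inner: "(LINT s|lborel. k t s) = \<phi>' t * integral\<^sup>L (lebesgue_on {0<..<t}) y" if "t \<in> {0<..<T}" for t
    proof -
      have "(LINT s|lborel. k t s) = (LINT s|lborel. \<phi>' t * (indicator {..<t} s * y' s))"
        using that by (intro Bochner_Integration.integral_cong) (auto simp: k_def a_def indicator_def)
      also have "\<dots> = \<phi>' t * (LINT s|lebesgue. indicator {..<t} s * y' s)"
        by (simp add: integral_completion)
      also have "(LINT s|lebesgue. indicator {..<t} s * y' s) = (LINT s|lebesgue. indicator {0<..<t} s *\<^sub>R y s)"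
      proof (rule integral_cong_AE)
        have eq: "(\<lambda>s. indicator {0<..<t} s *\<^sub>R y s) = (\<lambda>s. indicator {..<t} s * (indicator {0<..<T} s * y s))"
          using that by (auto simp: indicator_def fun_eq_iff)
        show "(\<lambda>s. indicator {0<..<t} s *\<^sub>R y s) \<in> borel_measurable lebesgue"
          unfolding eq
          by (intro borel_measurable_times borel_measurable_indicator borel_measurable_integrable[OF yI]) simp
        show "AE s in lebesgue. indicator {..<t} s * y' s = indicator {0<..<t} s *\<^sub>R y s"
          using y'AE' by eventually_elim (use that in \<open>auto simp: indicator_def split: if_splits\<close>)
        show "(\<lambda>s. indicator {..<t} s * y' s) \<in> borel_measurable lebesgue"
          by (intro measurable_completion) simp
      qed
      also have "\<dots> = integral\<^sup>L (lebesgue_on {0<..<t}) y" by (subst integral_restrict_space) auto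
      finally show ?thesis .
    qed
    have "case_prod k \<in> borel_measurable (lborel \<Otimes>\<^sub>M lborel)" by (rule borel_measurable_integrable[OF kint])
    then have km: "(\<lambda>t. LINT s|lborel. k t s) \<in> borel_measurable lborel" by measurable
    then have "(LINT t|lborel. LINT s|lborel. k t s) = (LINT t|lebesgue. LINT s|lborel. k t s)"
      by (rule integral_completion[symmetric])
    also have "\<dots> = (LINT t|lebesgue. indicator {0<..<T} t *\<^sub>R (LINT s|lborel. k t s))"
    proof (rule integral_cong_AE)
      have "AE t in lebesgue. t \<notin> {0, T}" by (intro AE_not_in) (simp flip: negligible_iff_null_sets)
      then show "AE t in lebesgue. (LINT s|lborel. k t s) = indicator {0<..<T} t *\<^sub>R (LINT s|lborel. k t s)"
        by eventually_elim (auto simp: indicator_def k_def a_def)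
    qed (use km in \<open>auto intro!: measurable_completion\<close>)
    also have "\<dots> = integral\<^sup>L (lebesgue_on {0<..<T}) (\<lambda>t. LINT s|lborel. k t s)"
      by (subst integral_restrict_space) auto
    also have "\<dots> = integral\<^sup>L (lebesgue_on {0<..<T}) (\<lambda>t. \<phi>' t * integral\<^sup>L (lebesgue_on {0<..<t}) y)"
      by (intro Bochner_Integration.integral_cong refl inner) (simp add: space_restrict_space)
    finally show ?thesis .
  qed
  ultimately show ?thesis by simp
qed

lemma integrable_on_subinterval_lebesgue:
  fixes y :: "real \<Rightarrow> real"
  assumes y: "integrable (lebesgue_on {0<..<T}) y" and ab: "0 \<le> a" "b \<le> T"
  shows "y absolutely_integrable_on {a..b}" "integrable (lebesgue_on {a<..<b}) y"
    "integral\<^sup>L (lebesgue_on {a<..<b}) y = integral {a..b} y"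
proof -
  have "y absolutely_integrable_on {0<..<T}"
    using y by (simp add: set_integrable_def integrable_restrict_space)
  then have yy: "y absolutely_integrable_on {a<..<b}"
    by (rule set_integrable_subset) (use ab in auto)
  then show i: "integrable (lebesgue_on {a<..<b}) y"
    by (simp add: set_integrable_def integrable_restrict_space)
  show "y absolutely_integrable_on {a..b}"
  proof (subst absolutely_integrable_spike_set_eq)
    show "y absolutely_integrable_on {a<..<b}" by (rule yy)
    show "negligible {x \<in> {a..b} - {a<..<b}. y x \<noteq> 0}" "negligible {x \<in> {a<..<b} - {a..b}. y x \<noteq> 0}"
      by (rule negligible_subset[of "{a, b}"]; auto)+
  qed
  show "integral\<^sup>L (lebesgue_on {a<..<b}) y = integral {a..b} y"
    using lebesgue_integral_eq_integral[OF i] by (simp add: integral_open_interval_real)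
qed

lemma time_test_fun_iff_smooth:
  "time_test_fun T \<phi> \<longleftrightarrow> smooth \<phi> \<and> (\<exists>K. compact K \<and> K \<subseteq> {0<..<T} \<and> (\<forall>t. t \<notin> K \<longrightarrow> \<phi> t = 0))"
  by (simp add: time_test_fun_def smooth_def)

text \<open>
  The mean value zero makes the primitive vanish to the right of the support of \<psi>.
\<close>

lemma exists_test_primitive:
  assumes \<psi>: "smooth \<psi>" and supp: "\<And>t. t \<notin> {p..q} \<Longrightarrow> \<psi> t = 0" and pq: "0 < p" "p \<le> q" "q < T"
    and mean: "integral {p..q} \<psi> = 0"
  shows "\<exists>\<phi>. time_test_fun T \<phi> \<and> (\<forall>t. (\<phi> has_real_derivative \<psi> t) (at t)) \<and> \<phi> T = 0"
proof -
  define \<phi> where "\<phi> t = integral {0..t} \<psi>" for t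
  have cont: "continuous_on S \<psi>" for S using smooth_continuous[OF \<psi>, of S 0] by simp
  have int: "\<psi> integrable_on {a..b}" for a b by (rule integrable_continuous_interval[OF cont])
  have zero: "integral {a..b} \<psi> = 0" if "\<And>t. t \<in> {a..b} \<Longrightarrow> \<psi> t = 0" for a b
    using Henstock_Kurzweil_Integration.integral_cong[of "{a..b}" \<psi> "\<lambda>_. 0"] that by simp
  have low: "\<phi> t = 0" if "t < p" for t
    unfolding \<phi>_def using that by (intro zero supp) auto
  have high: "\<phi> t = 0" if "t > q" for t
  proof -
    have "\<phi> t = integral {0..p} \<psi> + integral {p..t} \<psi>"
      unfolding \<phi>_def using that pq int by (intro Henstock_Kurzweil_Integration.integral_combine[symmetric]) auto
    also have "integral {p..t} \<psi> = integral {p..q} \<psi> + integral {q..t} \<psi>"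
      using that pq int by (intro Henstock_Kurzweil_Integration.integral_combine[symmetric]) auto
    also have "integral {0..p} \<psi> = 0"
    proof -
      have "integral {0..p} \<psi> = integral {0..p} (\<lambda>x. 0)"
        by (rule integral_spike[of "{p}"]) (use supp in auto)
      then show ?thesis by simp
    qed
    also have "integral {q..t} \<psi> = 0"
    proof -
      have "integral {q..t} \<psi> = integral {q..t} (\<lambda>x. 0)"
        by (rule integral_spike[of "{q}"]) (use supp in auto)
      then show ?thesis by simp
    qed
    finally show ?thesis using mean by simp
  qed
  have deriv: "(\<phi> has_real_derivative \<psi> t) (at t)" for t
  proof (cases "t < p")
    case True
    have "((\<lambda>x. 0) has_real_derivative \<psi> t) (at t)" using supp[of t] True by simp
    then show ?thesis
      using True low by (elim has_field_derivative_transform_within_open[where S = "{..<p}"]) auto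
  next
    case False
    have "(\<phi> has_real_derivative \<psi> t) (at t within {0..t + 1})"
      unfolding \<phi>_def using False pq by (intro integral_has_real_derivative cont) auto
    then show ?thesis using False pq by (simp add: at_within_Icc_at)
  qed
  have "smooth \<phi>" using smooth_antideriv[OF \<psi> deriv] .
  moreover have "\<phi> t = 0" if "t \<notin> {p..q}" for t using that low high by force
  ultimately have "time_test_fun T \<phi>"
    unfolding time_test_fun_iff_smooth using pq by (intro conjI exI[of _ "{p..q}"]) auto
  then show ?thesis using deriv high pq by blast
qed

text \<open>
  Du Bois-Reymond: after subtraction of the primitive of \<open>y\<close>, the function \<open>x\<close> is orthogonal to the
  derivatives of all test functions, that is, to all test functions of mean value zero, and therefore
  constant.
\<close>

lemma weak_deriv_imp_primitive:
  fixes x y :: "real \<Rightarrow> real"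
  assumes T: "0 < T" and x: "integrable (lebesgue_on {0<..<T}) x" and y: "integrable (lebesgue_on {0<..<T}) y"
    and weak: "\<And>\<phi>. time_test_fun T \<phi> \<Longrightarrow>
      integral\<^sup>L (lebesgue_on {0<..<T}) (\<lambda>t. deriv \<phi> t * x t) = - integral\<^sup>L (lebesgue_on {0<..<T}) (\<lambda>t. \<phi> t * y t)"
  shows "\<exists>c. AE t in lebesgue_on {0<..<T}. x t = c + integral {0..t} y"
proof -
  let ?M = "lebesgue_on {0<..<T}"
  define Y where "Y t = integral {0..t} y" for t
  have fin: "finite_measure ?M" by (rule finite_measure_lebesgue_on) auto
  interpret finite_measure ?M by (rule fin)
  have Yc: "continuous_on {0..T} Y"
    unfolding Y_def using integrable_on_subinterval_lebesgue(1)[OF y, of 0 T]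
    by (intro indefinite_integral_continuous_1 set_lebesgue_integral_eq_integral(1)) auto
  have bdd_cont: "integrable ?M g" if "continuous_on {0..T} g" for g :: "real \<Rightarrow> real"
  proof -
    have "g absolutely_integrable_on {0..T}" using that by (rule absolutely_integrable_continuous_real)
    then have "g absolutely_integrable_on {0<..<T}" by (rule set_integrable_subset) auto
    then show ?thesis by (simp add: set_integrable_def integrable_restrict_space)
  qed
  have prod: "integrable ?M (\<lambda>t. g t * u t)" if g: "continuous_on {0..T} g" and u: "integrable ?M u" for g u :: "real \<Rightarrow> real"
  proof -
    have "bounded (g ` {0..T})" by (intro compact_imp_bounded compact_continuous_image g) auto
    then obtain C where "\<forall>x\<in>g ` {0..T}. norm x \<le> C" by (auto simp: bounded_iff)
    then have C: "\<And>t. t \<in> {0..T} \<Longrightarrow> norm (g t) \<le> C" by blast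
    show ?thesis
    proof (rule Bochner_Integration.integrable_bound)
      show "integrable ?M (\<lambda>t. C * norm (u t))" using u by simp
      show "(\<lambda>t. g t * u t) \<in> borel_measurable ?M"
        using borel_measurable_integrable[OF bdd_cont[OF g]] borel_measurable_integrable[OF u] by simp
      have "norm (g t * u t) \<le> norm (C * norm (u t))" if "t \<in> {0<..<T}" for t
      proof -
        have "norm (g t * u t) \<le> C * norm (u t)" using C[of t] that by (simp add: abs_mult mult_right_mono)
        then show ?thesis by (metis abs_ge_self order.trans real_norm_def)
      qed
      then show "AE t in ?M. norm (g t * u t) \<le> norm (C * norm (u t))"
        by (intro AE_I2) (simp add: space_restrict_space)
    qed
  qed
  define z where "z t = x t - Y t" for t
  have z: "integrable ?M z" unfolding z_def using x bdd_cont[OF Yc] by simp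
  have orth: "integral\<^sup>L ?M (\<lambda>t. \<psi> t * z t) = 0"
    if \<psi>: "smooth \<psi>" "\<And>t. t \<notin> {p..q} \<Longrightarrow> \<psi> t = 0" "0 < p" "p \<le> q" "q < T" "integral {p..q} \<psi> = 0" for \<psi> p q
  proof -
    obtain \<phi> where \<phi>: "time_test_fun T \<phi>" "\<And>t. (\<phi> has_real_derivative \<psi> t) (at t)" "\<phi> T = 0"
      using exists_test_primitive[OF \<psi>] by blast
    have c: "continuous_on S \<psi>" for S using smooth_continuous[OF \<psi>(1), of S 0] by simp
    have "deriv \<phi> = \<psi>" by (intro ext DERIV_imp_deriv \<phi>)
    then have "integral\<^sup>L ?M (\<lambda>t. \<psi> t * x t) = - integral\<^sup>L ?M (\<lambda>t. \<phi> t * y t)"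
      using weak[OF \<phi>(1)] by simp
    moreover have "integral\<^sup>L ?M (\<lambda>t. \<psi> t * Y t) = integral\<^sup>L ?M (\<lambda>t. \<psi> t * integral\<^sup>L (lebesgue_on {0<..<t}) y)"
      using integrable_on_subinterval_lebesgue(3)[OF y]
      by (intro Bochner_Integration.integral_cong) (auto simp: Y_def space_restrict_space)
    moreover have "\<dots> = - integral\<^sup>L ?M (\<lambda>t. \<phi> t * y t)"
      using T y \<phi> c by (intro integral_by_parts_primitive) auto
    ultimately have "integral\<^sup>L ?M (\<lambda>t. \<psi> t * x t) - integral\<^sup>L ?M (\<lambda>t. \<psi> t * Y t) = 0" by simp
    then show ?thesis
      unfolding z_def right_diff_distrib using prod[OF c x] prod[OF c bdd_cont[OF Yc]] by simp
  qed
  define \<rho> where "\<rho> = bump (T/3) (2*T/3) 0"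
  have \<rho>: "smooth \<rho>" "continuous_on S \<rho>" for S
    unfolding \<rho>_def using smooth_bump smooth_continuous[OF smooth_bump, of _ 0] by simp_all
  have \<rho>0: "\<rho> t = 0" if "t \<notin> {T/3..2*T/3}" for t unfolding \<rho>_def using that by (intro bump_0) auto
  have hk: "integral {p..q} g = integral\<^sup>L ?M g"
    if "continuous_on {0..T} g" "\<And>t. t \<notin> {p..q} \<Longrightarrow> g t = 0" "0 < p" "p \<le> q" "q < T" for g :: "real \<Rightarrow> real" and p q
  proof -
    have "integral\<^sup>L ?M g = integral {0<..<T} g" by (rule lebesgue_integral_eq_integral[OF bdd_cont[OF that(1)]]) simp
    moreover have "(g has_integral integral {p..q} g) {0<..<T}"
    proof (rule has_integral_on_superset[of _ _ "{p..q}"])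
      show "(g has_integral integral {p..q} g) {p..q}"
        using that by (intro integrable_integral integrable_continuous_interval continuous_on_subset[OF that(1)]) auto
    qed (use that in auto)
    then have "integral {0<..<T} g = integral {p..q} g" by (rule integral_unique)
    ultimately show ?thesis by simp
  qed
  define R where "R = integral\<^sup>L ?M \<rho>"
  have "R \<noteq> 0"
  proof
    assume "R = 0"
    then have "AE t in ?M. \<rho> t = 0"
      unfolding R_def using integral_nonneg_eq_0_iff_AE[OF bdd_cont[OF \<rho>(2)]] by (simp add: \<rho>_def bump_nonneg)
    then have "AE t in lebesgue. t \<in> {0<..<T} \<longrightarrow> \<rho> t = 0" by (subst (asm) AE_restrict_space_iff) auto
    then have "AE t in lebesgue. t \<notin> {T/3<..<2*T/3}"
      proof eventually_elim
      case (elim t)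
      then show ?case using T bump_pos[of t "T/3" "2*T/3" 0] by (auto simp: \<rho>_def)
    qed
    then have "negligible {T/3<..<2*T/3}"
      by (simp only: negligible_iff_null_sets completion.null_sets_iff_AE) simp
    then show False using T open_not_negligible[of "{T/3<..<2*T/3}"] by auto
  qed
  define c where "c = integral\<^sup>L ?M (\<lambda>t. \<rho> t * z t) / R"
  have "AE t in ?M. z t - c = 0"
  proof (rule integral_box_zero_imp_AE_zero)
    show zc: "integrable ?M (\<lambda>t. z t - c)" using z by simp
    fix a b :: real assume ab': "cbox a b \<subseteq> {0<..<T}"
    show "integral\<^sup>L ?M (\<lambda>t. indicator (box a b) t * (z t - c)) = 0"
    proof (cases "a < b")
      case False
      then show ?thesis by simp
    next
      case True
      then have ab: "0 < a" "a < b" "b < T" using subsetD[OF ab', of a] subsetD[OF ab', of b] by auto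
      have bump: "integral\<^sup>L ?M (\<lambda>t. bump a b n t * (z t - c)) = 0" for n
      proof -
        define B where "B = bump a b n"
        define I where "I = integral\<^sup>L ?M B"
        define \<psi> where "\<psi> t = 1 * B t + (- I / R) * \<rho> t" for t
        have B: "smooth B" "continuous_on S B" for S
          unfolding B_def using smooth_bump smooth_continuous[OF smooth_bump, of _ 0] by simp_all
        have B0: "B t = 0" if "t \<notin> {a..b}" for t unfolding B_def using that by (intro bump_0) auto
        have s\<psi>: "smooth \<psi>" unfolding \<psi>_def by (intro smooth_linear_comb B \<rho>)
        have c\<psi>: "continuous_on S \<psi>" for S using smooth_continuous[OF s\<psi>, of S 0] by simp
        define p q where "p = min a (T/3)" and "q = max b (2*T/3)"
        have pq: "0 < p" "p \<le> q" "q < T" using ab T by (auto simp: p_def q_def)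
        have \<psi>0: "\<psi> t = 0" if "t \<notin> {p..q}" for t
        proof -
          have "t \<notin> {a..b}" "t \<notin> {T/3..2*T/3}" using that by (auto simp: p_def q_def)
          then show ?thesis using B0[of t] \<rho>0[of t] by (simp add: \<psi>_def)
        qed
        have "integral\<^sup>L ?M \<psi> = I + (- I / R) * R"
          unfolding \<psi>_def I_def R_def using bdd_cont[OF B(2)] bdd_cont[OF \<rho>(2)] by simp
        then have "integral\<^sup>L ?M \<psi> = 0" using \<open>R \<noteq> 0\<close> by simp
        then have "integral {p..q} \<psi> = 0" using hk[OF c\<psi> \<psi>0 pq] by simp
        from orth[OF s\<psi> \<psi>0 pq this] have "integral\<^sup>L ?M (\<lambda>t. B t * z t + (- I / R) * (\<rho> t * z t)) = 0"
          by (simp add: \<psi>_def algebra_simps)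
        then have "integral\<^sup>L ?M (\<lambda>t. B t * z t) - I * c = 0"
          using prod[OF B(2) z] prod[OF \<rho>(2) z] by (simp add: c_def)
        then show ?thesis
          unfolding right_diff_distrib B_def[symmetric]
          using prod[OF B(2) z] bdd_cont[OF B(2)] by (simp add: I_def)
      qed
      have "(\<lambda>n. integral\<^sup>L ?M (\<lambda>t. bump a b n t * (z t - c))) \<longlonglongrightarrow> integral\<^sup>L ?M (\<lambda>t. indicator {a<..<b} t * (z t - c))"
      proof (rule integral_dominated_convergence)
        show "integrable ?M (\<lambda>t. norm (z t - c))" using zc by simp
        show "AE t in ?M. (\<lambda>n. bump a b n t * (z t - c)) \<longlonglongrightarrow> indicator {a<..<b} t * (z t - c)"
          by (intro AE_I2 tendsto_mult bump_tendsto tendsto_const)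
        show "AE t in ?M. norm (bump a b n t * (z t - c)) \<le> norm (z t - c)" for n
          using bump_nonneg[of a b n] bump_le_1[of a b n]
          by (intro AE_I2) (simp add: abs_mult mult_left_le_one_le)
        show "(\<lambda>t. bump a b n t * (z t - c)) \<in> borel_measurable ?M" for n
          using prod[OF _ zc, of "bump a b n"] smooth_continuous[OF smooth_bump, of _ 0]
          by (intro borel_measurable_integrable) simp
        show "(\<lambda>t. indicator {a<..<b} t * (z t - c)) \<in> borel_measurable ?M"
          using borel_measurable_integrable[OF zc]
          by (intro borel_measurable_times borel_measurable_indicator) (use ab in \<open>auto simp: sets_restrict_space_iff\<close>)
      qed
      then show ?thesis using bump LIMSEQ_unique[of "\<lambda>n. 0" 0] True by (simp add: box_real)
    qed
  qed simp
  then have "AE t in ?M. x t = c + integral {0..t} y"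
    by eventually_elim (simp add: z_def Y_def)
  then show ?thesis by blast
qed

text \<open>
  For a weak derivative this is the statement that is used: \<open>x\<close> has an absolutely continuous
  representative with derivative \<open>y\<close>.
\<close>

definition wd :: "real \<Rightarrow> (real \<Rightarrow> real) \<Rightarrow> (real \<Rightarrow> real) \<Rightarrow> bool" where
  "wd T x y \<longleftrightarrow> integrable (lebesgue_on {0<..<T}) x \<and> integrable (lebesgue_on {0<..<T}) y \<and>
     (\<exists>c. AE t in lebesgue_on {0<..<T}. x t = c + integral {0..t} y)"

lemma AE_subinterval:
  fixes a b T :: real
  assumes "AE t in lebesgue_on {0<..<T}. P t" "0 \<le> a" "b \<le> T"
  shows "AE t in lebesgue_on {a<..<b}. P t"
  using assms by (auto simp: AE_restrict_space_iff elim!: eventually_mono)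

lemma wd_subinterval:
  assumes "wd T x y" "0 \<le> a" "b \<le> T"
  shows "\<exists>c. AE t in lebesgue_on {a<..<b}. x t = c + integral {a..t} y"
proof -
  obtain c where c: "AE t in lebesgue_on {0<..<T}. x t = c + integral {0..t} y"
    and y: "integrable (lebesgue_on {0<..<T}) y" using assms(1) by (auto simp: wd_def)
  have "AE t in lebesgue_on {a<..<b}. t \<in> {a<..<b}" by (intro AE_I2) (simp add: space_restrict_space)
  with AE_subinterval[OF c assms(2,3)]
  have "AE t in lebesgue_on {a<..<b}. x t = (c + integral {0..a} y) + integral {a..t} y"
  proof eventually_elim
    case (elim t)
    have "y integrable_on {0..t}"
      using integrable_on_subinterval_lebesgue(1)[OF y, of 0 t] elim assms by (simp add: set_lebesgue_integral_eq_integral(1))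
    then have "integral {0..a} y + integral {a..t} y = integral {0..t} y"
      using elim assms by (intro Henstock_Kurzweil_Integration.integral_combine) auto
    then show ?case using elim by simp
  qed
  then show ?thesis by blast
qed

lemma shifted_power_primitive:
  "((\<lambda>s. c / real (Suc i) * (s - z) ^ Suc i) has_real_derivative c * (s - z) ^ i) (at s within S)"
proof -
  have "((\<lambda>s. s - z) has_real_derivative 1) (at s within S)" by (auto intro!: derivative_eq_intros)
  from DERIV_cmult[OF DERIV_power_Suc[OF this, of i], of "c / real (Suc i)"] show ?thesis
    by (simp del: power_Suc of_nat_Suc flip: of_nat_Suc)
qed

text \<open>
  Integrate repeatedly. Only the existence of an approximating polynomial matters, so its coefficients
  stay implicit; the free centre \<open>z\<close> lets them be expanded at a node.
\<close>

lemma weak_taylor: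
  assumes "\<And>i. i \<le> k \<Longrightarrow> wd T (x i) (x (Suc i))" and ab: "0 \<le> a" "a < b" "b \<le> T"
  shows "\<exists>c. AE t in lebesgue_on {a<..<b}. 
    \<bar>x 0 t - (\<Sum>i\<le>k. c i * (t - z) ^ i)\<bar> \<le> (b - a) ^ k * integral {a..b} (\<lambda>s. \<bar>x (Suc k) s\<bar>)"
  using assms(1)
proof (induction k arbitrary: x)
  case 0
  then have w: "wd T (x 0) (x (Suc 0))" by simp
  obtain c where c: "AE t in lebesgue_on {a<..<b}. x 0 t = c + integral {a..t} (x (Suc 0))"
    using wd_subinterval[OF w ab(1,3)] by blast
  have y: "integrable (lebesgue_on {0<..<T}) (x (Suc 0))" using w by (simp add: wd_def)
  have abs: "x (Suc 0) absolutely_integrable_on {a..t}" if "t \<le> b" for t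
    using integrable_on_subinterval_lebesgue(1)[OF y, of a t] ab that by simp
  have "AE t in lebesgue_on {a<..<b}. t \<in> {a<..<b}" by (intro AE_I2) (simp add: space_restrict_space)
  with c have "AE t in lebesgue_on {a<..<b}. \<bar>x 0 t - (\<Sum>i\<le>0. (\<lambda>_. c) i * (t - z) ^ i)\<bar>
    \<le> (b - a) ^ 0 * integral {a..b} (\<lambda>s. \<bar>x (Suc 0) s\<bar>)"
  proof eventually_elim
    case (elim t)
    have "\<bar>integral {a..t} (x (Suc 0))\<bar> \<le> integral {a..t} (\<lambda>s. \<bar>x (Suc 0) s\<bar>)"
      using integral_norm_bound_integral[of "x (Suc 0)" "{a..t}" "\<lambda>s. \<bar>x (Suc 0) s\<bar>"] abs[of t] elim
      by (auto simp: absolutely_integrable_on_def)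
    also have "\<dots> \<le> integral {a..b} (\<lambda>s. \<bar>x (Suc 0) s\<bar>)"
      using abs[of t] abs[of b] elim by (intro integral_subset_le) (auto simp: absolutely_integrable_on_def)
    finally show ?case using elim by simp
  qed
  then show ?case by (rule exI[of _ "\<lambda>_. c"])
next
  case (Suc k)
  define B where "B = (b - a) ^ k * integral {a..b} (\<lambda>s. \<bar>x (Suc (Suc k)) s\<bar>)"
  have "\<exists>c. AE t in lebesgue_on {a<..<b}. \<bar>x (Suc 0) t - (\<Sum>i\<le>k. c i * (t - z) ^ i)\<bar> \<le> B"
    unfolding B_def by (rule Suc.IH) (rule Suc.prems, simp)
  then obtain c where c: "AE t in lebesgue_on {a<..<b}. \<bar>x (Suc 0) t - (\<Sum>i\<le>k. c i * (t - z) ^ i)\<bar> \<le> B" by blast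
  have w: "wd T (x 0) (x (Suc 0))" using Suc.prems by simp
  obtain c0 where c0: "AE t in lebesgue_on {a<..<b}. x 0 t = c0 + integral {a..t} (x (Suc 0))"
    using wd_subinterval[OF w ab(1,3)] by blast
  have y: "integrable (lebesgue_on {0<..<T}) (x (Suc 0))" using w by (simp add: wd_def)
  have int: "x (Suc 0) integrable_on {a..t}" if "t \<le> b" for t
    using integrable_on_subinterval_lebesgue(1)[OF y, of a t] ab that by (simp add: set_lebesgue_integral_eq_integral(1))
  define P where "P t = (\<Sum>i\<le>k. c i / real (Suc i) * (t - z) ^ Suc i)" for t
  have P: "((\<lambda>t. \<Sum>i\<le>k. c i * (t - z) ^ i) has_integral P t - P a) {a..t}" if "a \<le> t" for t
  proof (rule fundamental_theorem_of_calculus[OF that])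
    fix s
    have "(P has_real_derivative (\<Sum>i\<le>k. c i * (s - z) ^ i)) (at s within {a..t})"
      unfolding P_def
      by (intro DERIV_sum shifted_power_primitive)
    then show "(P has_vector_derivative (\<Sum>i\<le>k. c i * (s - z) ^ i)) (at s within {a..t})"
      by (simp add: has_real_derivative_iff_has_vector_derivative)
  qed
  have dev: "\<bar>integral {a..t} (x (Suc 0)) - (P t - P a)\<bar> \<le> (b - a) * B" if t: "t \<in> {a<..<b}" for t
  proof -
    have i: "((\<lambda>s. x (Suc 0) s - (\<Sum>i\<le>k. c i * (s - z) ^ i)) has_integral integral {a..t} (x (Suc 0)) - (P t - P a)) {a..t}"
      using t int[of t] P[of t] by (intro has_integral_diff) (auto simp: has_integral_integral)
    have "AE s in lebesgue. s \<in> {a<..<b} \<longrightarrow> \<bar>x (Suc 0) s - (\<Sum>i\<le>k. c i * (s - z) ^ i)\<bar> \<le> B"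
      using c by (subst (asm) AE_restrict_space_iff) auto
    then obtain N where N: "negligible N" "\<And>s. s \<notin> N \<Longrightarrow> s \<in> {a<..<b} \<Longrightarrow> \<bar>x (Suc 0) s - (\<Sum>i\<le>k. c i * (s - z) ^ i)\<bar> \<le> B"
      by (auto simp: completion.AE_iff_null_sets negligible_iff_null_sets)
    define g where "g s = (if s \<in> N \<union> {a, b} then 0 else x (Suc 0) s - (\<Sum>i\<le>k. c i * (s - z) ^ i))" for s
    have "integrable (lebesgue_on {0<..<T}) (x (Suc (Suc k)))" using Suc.prems[of "Suc k"] by (simp add: wd_def)
    then have "x (Suc (Suc k)) absolutely_integrable_on {a..b}"
      using integrable_on_subinterval_lebesgue(1) ab by blast
    then have "0 \<le> B" using ab unfolding B_def
      by (intro mult_nonneg_nonneg integral_nonneg) (auto simp: absolutely_integrable_on_def)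
    have "(g has_integral integral {a..t} (x (Suc 0)) - (P t - P a)) {a..t}"
      by (rule has_integral_spike[OF _ _ i, of "N \<union> {a, b}"]) (use N in \<open>auto simp: g_def\<close>)
    moreover have "norm (g s) \<le> B" if "s \<in> cbox a t" for s
      using N(2)[of s] that t \<open>0 \<le> B\<close> by (auto simp: g_def)
    ultimately have "norm (integral {a..t} (x (Suc 0)) - (P t - P a)) \<le> B * measure lborel (cbox a t)"
      using \<open>0 \<le> B\<close> by (intro has_integral_bound[where f = g]) auto
    also have "\<dots> \<le> (b - a) * B" using t \<open>0 \<le> B\<close> by (simp add: mult.commute mult_left_mono)
    finally show ?thesis by simp
  qed
  define c' where "c' i = (case i of 0 \<Rightarrow> c0 - P a | Suc i \<Rightarrow> c i / real (Suc i))" for i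
  have c': "(\<Sum>i\<le>Suc k. c' i * (t - z) ^ i) = c0 - P a + P t" for t
    by (subst sum.atMost_Suc_shift) (simp add: c'_def P_def)
  have "AE t in lebesgue_on {a<..<b}. t \<in> {a<..<b}" by (intro AE_I2) (simp add: space_restrict_space)
  with c0 have "AE t in lebesgue_on {a<..<b}. \<bar>x 0 t - (\<Sum>i\<le>Suc k. c' i * (t - z) ^ i)\<bar> \<le> (b - a) * B"
  proof eventually_elim
    case (elim t)
    have "x 0 t - (\<Sum>i\<le>Suc k. c' i * (t - z) ^ i) = integral {a..t} (x (Suc 0)) - (P t - P a)"
      unfolding c' using elim by linarith
    then show ?case using dev[of t] elim by (simp only:)
  qed
  then show ?case by (auto simp: B_def mult.assoc)
qed

text \<open>
  Weak derivatives give bounds almost everywhere, while the scheme evaluates at nodes; continuity of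
  the solution carries the bounds over.
\<close>

lemma AE_le_imp_le_continuous:
  fixes g :: "real \<Rightarrow> real"
  assumes "a < b" "continuous_on {a..b} g" "AE t in lebesgue_on {a<..<b}. g t \<le> B" "t \<in> {a..b}"
  shows "g t \<le> B"
proof -
  have "continuous_on {a<..<b} g" by (rule continuous_on_subset[OF assms(2)]) auto
  then have "open ({a<..<b} \<inter> g -` {B<..})" by (rule continuous_open_preimage) simp_all
  moreover have "negligible ({a<..<b} \<inter> g -` {B<..})"
  proof -
    have "AE t in lebesgue. t \<in> {a<..<b} \<longrightarrow> g t \<le> B" using assms(3) by (subst (asm) AE_restrict_space_iff) auto
    then have "AE t in lebesgue. t \<notin> {a<..<b} \<inter> g -` {B<..}" by eventually_elim auto
    then show ?thesis by (simp only: negligible_iff_null_sets completion.null_sets_iff_AE) simp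
  qed
  ultimately have empty: "{a<..<b} \<inter> g -` {B<..} = {}" using open_not_negligible by blast
  have le: "g s \<le> B" if "s \<in> {a<..<b}" for s
  proof -
    have "s \<notin> g -` {B<..}" using empty that by blast
    then show ?thesis by simp
  qed
  have cl: "closure {a<..<b} = {a..b}" using assms(1) by (rule closure_greaterThanLessThan)
  show ?thesis
    by (rule continuous_le_on_closure[of "{a<..<b}" g]) (use assms cl le in simp_all)
qed

section \<open>Truncation error of the Adams--Moulton formulas\<close>

text \<open>
  The Adams--Moulton mean minus the exact mean over the last step: the residual of the formula
  for \<open>u\<close> when \<open>g\<close> is the derivative of \<open>u\<close>.
\<close>

definition trunc :: "nat \<Rightarrow> real \<Rightarrow> (real \<Rightarrow> real) \<Rightarrow> real \<Rightarrow> real" where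
  "trunc \<nu> \<tau> g s = (\<Sum>j<\<nu>. am_coeffs \<nu> ! j * g (s - real j * \<tau>)) - integral {s - \<tau>..s} g / \<tau>"

lemma am_moments:
  assumes "\<nu> \<in> {3, 4, 5}" "i < \<nu>"
  shows "(\<Sum>j<\<nu>. am_coeffs \<nu> ! j * real j ^ i) = 1 / real (Suc i)"
proof -
  have "i \<in> {0, 1, 2, 3, 4}" using assms by auto
  then show ?thesis using assms by (auto simp: am_coeffs_def numeral_eq_Suc)
qed

text \<open>
  The truncation error on powers of degree up to and including \<nu> is the same at two consecutive nodes.
  In degree \<nu> this is no longer zero, but it cancels in differences; hence the additional power of \<tau>
  in the bound for differences of truncation errors.
\<close>

lemma am_moments_shift:
  assumes "\<nu> \<in> {3, 4, 5}" "i \<le> \<nu>"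
  shows "(\<Sum>j<\<nu>. am_coeffs \<nu> ! j * real (Suc j) ^ i) - (2 ^ Suc i - 1) / real (Suc i)
    = (\<Sum>j<\<nu>. am_coeffs \<nu> ! j * real j ^ i) - 1 / real (Suc i)"
proof -
  have "i \<in> {0, 1, 2, 3, 4, 5}" using assms by auto
  then show ?thesis using assms by (auto simp: am_coeffs_def numeral_eq_Suc)
qed

lemma trunc_power:
  assumes "\<tau> > 0"
  shows "trunc \<nu> \<tau> (\<lambda>t. (t - z) ^ i) (z - real m * \<tau>)
     = (- \<tau>) ^ i * ((\<Sum>j<\<nu>. am_coeffs \<nu> ! j * real (m + j) ^ i) - (real (Suc m) ^ Suc i - real m ^ Suc i) / real (Suc i))"
proof -
  have e: "(z - real m * \<tau>) - z = (- \<tau>) * real m" "(z - real m * \<tau> - \<tau>) - z = (- \<tau>) * real (Suc m)"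
    by (simp_all add: algebra_simps)
  have "((\<lambda>t. 1 * (t - z) ^ i) has_integral
      1 / real (Suc i) * ((z - real m * \<tau>) - z) ^ Suc i - 1 / real (Suc i) * ((z - real m * \<tau> - \<tau>) - z) ^ Suc i)
      {z - real m * \<tau> - \<tau>..z - real m * \<tau>}"
    using assms
    by (intro fundamental_theorem_of_calculus shifted_power_primitive[unfolded has_real_derivative_iff_has_vector_derivative]) simp
  from integral_unique[OF this] have "integral {z - real m * \<tau> - \<tau>..z - real m * \<tau>} (\<lambda>t. (t - z) ^ i)
     = ((- \<tau>) * real m) ^ Suc i / real (Suc i) - ((- \<tau>) * real (Suc m)) ^ Suc i / real (Suc i)"
    unfolding e by (simp del: of_nat_Suc power_Suc)
  also have "\<dots> / \<tau> = (- \<tau>) ^ i * ((real (Suc m) ^ Suc i - real m ^ Suc i) / real (Suc i))"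
  proof -
    have "((- \<tau>) * c * M / a - (- \<tau>) * c * M' / a) / \<tau> = c * ((M' - M) / a)" if "a \<noteq> 0" for M M' a c :: real
      using assms that by (simp add: field_simps)
    from this[of "real (Suc i)" "(- \<tau>) ^ i" "real m ^ Suc i" "real (Suc m) ^ Suc i"]
    show ?thesis unfolding power_mult_distrib power_Suc[of "- \<tau>"] by (simp only: of_nat_eq_0_iff)
  qed
  finally have I: "integral {z - real m * \<tau> - \<tau>..z - real m * \<tau>} (\<lambda>t. (t - z) ^ i) / \<tau> = \<dots>" .
  have eq: "am_coeffs \<nu> ! j * (z - real m * \<tau> - real j * \<tau> - z) ^ i = (- \<tau>) ^ i * (am_coeffs \<nu> ! j * real (m + j) ^ i)" for j
  proof -
    have "z - real m * \<tau> - real j * \<tau> - z = (- \<tau>) * real (m + j)" by (simp add: algebra_simps)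
    then show ?thesis by (simp only: power_mult_distrib mult.left_commute)
  qed
  show ?thesis
    unfolding trunc_def I right_diff_distrib sum_distrib_left eq ..
qed

lemma trunc_bound:
  assumes \<nu>: "\<nu> \<in> {3, 4, 5}" and \<tau>: "\<tau> > 0" and a: "a \<le> s - real (\<nu> - 1) * \<tau>" and B: "0 \<le> B"
    and cont: "continuous_on {a..s} g"
    and dev: "\<And>t. t \<in> {a..s} \<Longrightarrow> \<bar>g t - (\<Sum>i\<le>k. c i * (t - z) ^ i)\<bar> \<le> B"
  shows "\<bar>trunc \<nu> \<tau> g s - (\<Sum>i\<le>k. c i * trunc \<nu> \<tau> (\<lambda>t. (t - z) ^ i) s)\<bar> \<le> 6 * B"
proof -
  let ?p = "\<lambda>t. \<Sum>i\<le>k. c i * (t - z) ^ i"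
  have nodes: "s - real j * \<tau> \<in> {a..s}" if "j < \<nu>" for j
  proof -
    have "real j * \<tau> \<le> real (\<nu> - 1) * \<tau>" using that \<tau> by (intro mult_right_mono) auto
    moreover have "0 \<le> real j * \<tau>" using \<tau> by simp
    ultimately show ?thesis using a unfolding atLeastAtMost_iff by linarith
  qed
  have sub: "{s - \<tau>..s} \<subseteq> {a..s}" using nodes[of 1] \<nu> by auto
  have gi: "g integrable_on {s - \<tau>..s}"
    using continuous_on_subset[OF cont sub] by (rule integrable_continuous_interval)
  have pi: "(\<lambda>t. (t - z) ^ i) integrable_on {s - \<tau>..s}" for i
    by (intro integrable_continuous_interval continuous_intros)
  have ppi: "?p integrable_on {s - \<tau>..s}"
    by (intro integrable_continuous_interval continuous_intros)
  have tp: "(\<Sum>i\<le>k. c i * trunc \<nu> \<tau> (\<lambda>t. (t - z) ^ i) s) = trunc \<nu> \<tau> ?p s"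
  proof -
    have I: "integral {s - \<tau>..s} ?p = (\<Sum>i\<le>k. c i * integral {s - \<tau>..s} (\<lambda>t. (t - z) ^ i))"
      by (subst integral_sum) (auto intro!: integrable_continuous_interval continuous_intros)
    have S: "(\<Sum>j<\<nu>. am_coeffs \<nu> ! j * ?p (s - real j * \<tau>))
      = (\<Sum>i\<le>k. c i * (\<Sum>j<\<nu>. am_coeffs \<nu> ! j * (s - real j * \<tau> - z) ^ i))"
      unfolding sum_distrib_left by (subst sum.swap) (simp add: mult_ac)
    show ?thesis unfolding trunc_def I S
      by (simp add: right_diff_distrib sum_subtractf sum_divide_distrib)
  qed
  have "trunc \<nu> \<tau> g s - trunc \<nu> \<tau> ?p s
     = (\<Sum>j<\<nu>. am_coeffs \<nu> ! j * (g (s - real j * \<tau>) - ?p (s - real j * \<tau>))) - integral {s - \<tau>..s} (\<lambda>t. g t - ?p t) / \<tau>"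
    unfolding trunc_def Henstock_Kurzweil_Integration.integral_diff[OF gi ppi]
    by (simp add: right_diff_distrib sum_subtractf diff_divide_distrib)
  also have "\<bar>\<dots>\<bar> \<le> 5 * B + B"
  proof (rule order.trans[OF abs_triangle_ineq4 add_mono])
    have "\<bar>\<Sum>j<\<nu>. am_coeffs \<nu> ! j * (g (s - real j * \<tau>) - ?p (s - real j * \<tau>))\<bar> \<le> (\<Sum>j<\<nu>. 1 * B)"
    proof (rule order.trans[OF sum_abs sum_mono])
      fix j assume "j \<in> {..<\<nu>}"
      then show "\<bar>am_coeffs \<nu> ! j * (g (s - real j * \<tau>) - ?p (s - real j * \<tau>))\<bar> \<le> 1 * B"
        unfolding abs_mult using abs_am_coeffs_le_1[OF \<nu>, of j] dev[OF nodes, of j] by (intro mult_mono) auto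
    qed
    also have "\<dots> \<le> 5 * B" using \<nu> B by (auto intro: mult_right_mono)
    finally show "\<bar>\<Sum>j<\<nu>. am_coeffs \<nu> ! j * (g (s - real j * \<tau>) - ?p (s - real j * \<tau>))\<bar> \<le> 5 * B" .
    have "norm (integral {s - \<tau>..s} (\<lambda>t. g t - ?p t)) \<le> B * (s - (s - \<tau>))"
      using dev sub \<tau> by (intro integral_bound continuous_intros continuous_on_subset[OF cont]) auto
    then show "\<bar>integral {s - \<tau>..s} (\<lambda>t. g t - ?p t) / \<tau>\<bar> \<le> B"
      using \<tau> by (simp add: field_simps abs_mult)
  qed
  finally show ?thesis unfolding tp by simp
qed

text \<open>
  The formula is exact on polynomials of degree less than \<nu>, so that only the Taylor remainder on the
  interval of \<nu> - 1 steps covered by the nodes is left.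
\<close>

lemma trunc_le:
  assumes \<nu>: "\<nu> \<in> {3, 4, 5}" and \<tau>: "\<tau> > 0" and n: "\<nu> - 1 \<le> n" "real n * \<tau> \<le> T"
    and wd: "\<And>i. i < \<nu> \<Longrightarrow> wd T (x i) (x (Suc i))" and cont: "continuous_on {0..T} (x 0)"
  shows "\<bar>trunc \<nu> \<tau> (x 0) (real n * \<tau>)\<bar>
    \<le> 20000 * \<tau> ^ (\<nu> - 1) * integral {real (n - (\<nu> - 1)) * \<tau>..real n * \<tau>} (\<lambda>s. \<bar>x \<nu> s\<bar>)"
proof -
  define k where "k = \<nu> - 1"
  have k: "Suc k = \<nu>" "1 \<le> k" "k \<le> 4" using \<nu> by (auto simp: k_def)
  define a b where "a = real (n - k) * \<tau>" and "b = real n * \<tau>"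
  have ab: "0 \<le> a" "a < b" "b \<le> T" "b - a = real k * \<tau>"
    using n k \<tau> by (auto simp: a_def b_def k_def[symmetric] of_nat_diff algebra_simps)
  define I where "I = integral {a..b} (\<lambda>s. \<bar>x \<nu> s\<bar>)"
  have "\<And>i. i \<le> k \<Longrightarrow> wd T (x i) (x (Suc i))" using wd k by simp
  from weak_taylor[of k T x a b b, OF this ab(1-3)] obtain c where
    c: "AE t in lebesgue_on {a<..<b}. \<bar>x 0 t - (\<Sum>i\<le>k. c i * (t - b) ^ i)\<bar> \<le> (b - a) ^ k * I"
    using k by (auto simp: I_def)
  have cont': "continuous_on {a..b} (x 0)" by (rule continuous_on_subset[OF cont]) (use ab in auto)
  have dev: "\<bar>x 0 t - (\<Sum>i\<le>k. c i * (t - b) ^ i)\<bar> \<le> (b - a) ^ k * I" if "t \<in> {a..b}" for t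
    by (rule AE_le_imp_le_continuous[OF ab(2) _ c that]) (intro continuous_intros cont')
  have "0 \<le> (b - a) ^ k * I" using dev[of b] ab by (auto intro: order.trans[OF abs_ge_zero])
  then have "\<bar>trunc \<nu> \<tau> (x 0) b - (\<Sum>i\<le>k. c i * trunc \<nu> \<tau> (\<lambda>t. (t - b) ^ i) b)\<bar> \<le> 6 * ((b - a) ^ k * I)"
  proof (intro trunc_bound[OF \<nu> \<tau> _ _ cont' dev])
    show "a \<le> b - real (\<nu> - 1) * \<tau>" using ab(4) unfolding k_def by linarith
  qed auto
  moreover have "trunc \<nu> \<tau> (\<lambda>t. (t - b) ^ i) b = 0" if "i \<le> k" for i
    using trunc_power[OF \<tau>, of \<nu> b i 0] am_moments[OF \<nu>, of i] that k by simp
  ultimately have "\<bar>trunc \<nu> \<tau> (x 0) b\<bar> \<le> 6 * (real k * \<tau>) ^ k * I" using ab(4) by simp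
  also have "\<dots> = 6 * real k ^ k * (\<tau> ^ k * I)" by (simp add: power_mult_distrib)
  also have "\<dots> \<le> 20000 * (\<tau> ^ k * I)"
  proof (rule mult_right_mono)
    have "real k ^ k \<le> 4 ^ k" using k by (intro power_mono) auto
    also have "\<dots> \<le> 4 ^ 4" using k by (intro power_increasing) auto
    finally show "6 * real k ^ k \<le> 20000" by simp
    have "0 < (b - a) ^ k" using ab(2) by simp
    then have "0 \<le> I" using \<open>0 \<le> (b - a) ^ k * I\<close> by (simp only: zero_le_mult_iff) linarith
    then show "0 \<le> \<tau> ^ k * I" using \<tau> by simp
  qed
  finally show ?thesis by (simp add: I_def a_def b_def k_def mult.assoc)
qed

lemma trunc_dif_le:
  assumes \<nu>: "\<nu> \<in> {3, 4, 5}" and \<tau>: "\<tau> > 0" and n: "\<nu> \<le> n" "real n * \<tau> \<le> T"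
    and wd: "\<And>i. i \<le> \<nu> \<Longrightarrow> wd T (x i) (x (Suc i))" and cont: "continuous_on {0..T} (x 0)"
  shows "\<bar>trunc \<nu> \<tau> (x 0) (real n * \<tau>) - trunc \<nu> \<tau> (x 0) (real (n - 1) * \<tau>)\<bar>
    \<le> 40000 * \<tau> ^ \<nu> * integral {real (n - \<nu>) * \<tau>..real n * \<tau>} (\<lambda>s. \<bar>x (Suc \<nu>) s\<bar>)"
proof -
  define a b where "a = real (n - \<nu>) * \<tau>" and "b = real n * \<tau>"
  have ab: "0 \<le> a" "a < b" "b \<le> T" "b - a = real \<nu> * \<tau>"
    using n \<nu> \<tau> by (auto simp: a_def b_def of_nat_diff algebra_simps)
  define I where "I = integral {a..b} (\<lambda>s. \<bar>x (Suc \<nu>) s\<bar>)"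
  from weak_taylor[of \<nu> T x a b b, OF wd ab(1-3)] obtain c where
    c: "AE t in lebesgue_on {a<..<b}. \<bar>x 0 t - (\<Sum>i\<le>\<nu>. c i * (t - b) ^ i)\<bar> \<le> (b - a) ^ \<nu> * I"
    by (auto simp: I_def)
  define B where "B = (b - a) ^ \<nu> * I"
  have cont': "continuous_on {a..b} (x 0)" by (rule continuous_on_subset[OF cont]) (use ab in auto)
  have dev: "\<bar>x 0 t - (\<Sum>i\<le>\<nu>. c i * (t - b) ^ i)\<bar> \<le> B" if "t \<in> {a..b}" for t
    unfolding B_def by (rule AE_le_imp_le_continuous[OF ab(2) _ c that]) (intro continuous_intros cont')
  have B0: "0 \<le> B" using dev[of b] ab by (auto intro: order.trans[OF abs_ge_zero])
  have b1: "b - \<tau> \<le> b" "a \<le> b - \<tau> - real (\<nu> - 1) * \<tau>"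
    using ab \<tau> \<nu> by (auto simp: algebra_simps of_nat_diff)
  have "\<bar>trunc \<nu> \<tau> (x 0) b - (\<Sum>i\<le>\<nu>. c i * trunc \<nu> \<tau> (\<lambda>t. (t - b) ^ i) b)\<bar> \<le> 6 * B"
    using b1 \<tau> by (intro trunc_bound[OF \<nu> \<tau> _ B0 cont' dev]) auto
  moreover have "\<bar>trunc \<nu> \<tau> (x 0) (b - \<tau>) - (\<Sum>i\<le>\<nu>. c i * trunc \<nu> \<tau> (\<lambda>t. (t - b) ^ i) (b - \<tau>))\<bar> \<le> 6 * B"
    using b1 \<tau> by (intro trunc_bound[OF \<nu> \<tau> b1(2) B0 continuous_on_subset[OF cont'] dev]) auto
  moreover have "trunc \<nu> \<tau> (\<lambda>t. (t - b) ^ i) (b - \<tau>) = trunc \<nu> \<tau> (\<lambda>t. (t - b) ^ i) b" if "i \<le> \<nu>" for i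
    using trunc_power[OF \<tau>, of \<nu> b i 0] trunc_power[OF \<tau>, of \<nu> b i 1] am_moments_shift[OF \<nu> that]
    by simp
  ultimately have "\<bar>trunc \<nu> \<tau> (x 0) b - trunc \<nu> \<tau> (x 0) (b - \<tau>)\<bar> \<le> 12 * B" by simp
  also have "\<dots> = 12 * real \<nu> ^ \<nu> * (\<tau> ^ \<nu> * I)" unfolding B_def ab(4) by (simp add: power_mult_distrib)
  \<comment> \<open>\<open>12 * 5 ^ 5 = 37500\<close>\<close>
  also have "\<dots> \<le> 40000 * (\<tau> ^ \<nu> * I)"
  proof (rule mult_right_mono)
    have "real \<nu> ^ \<nu> \<le> 5 ^ \<nu>" using \<nu> by (intro power_mono) auto
    also have "\<dots> \<le> 5 ^ 5" using \<nu> by (intro power_increasing) auto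
    finally show "12 * real \<nu> ^ \<nu> \<le> 40000" by simp
    show "0 \<le> \<tau> ^ \<nu> * I" using B0 unfolding B_def using ab \<nu> \<tau> by (auto simp: zero_le_mult_iff)
  qed
  finally show ?thesis
    using n \<nu> by (auto simp: I_def a_def b_def mult.assoc of_nat_diff algebra_simps)
qed

section \<open>Square-integrable bounds in time\<close>

definition sqint :: "real \<Rightarrow> (real \<Rightarrow> real) \<Rightarrow> bool" where
  "sqint T \<phi> \<longleftrightarrow> (\<forall>t. 0 \<le> \<phi> t) \<and> integrable (lebesgue_on {0<..<T}) (\<lambda>t. (\<phi> t)\<^sup>2)"

definition sqnorm :: "real \<Rightarrow> (real \<Rightarrow> real) \<Rightarrow> real" where
  "sqnorm T \<phi> = sqrt (integral\<^sup>L (lebesgue_on {0<..<T}) (\<lambda>t. (\<phi> t)\<^sup>2))"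

lemma sqnorm_nonneg: "0 \<le> sqnorm T \<phi>"
  by (simp add: sqnorm_def integral_nonneg_AE)

lemma sqint_integrable:
  assumes "sqint T \<phi>"
  shows "integrable (lebesgue_on {0<..<T}) \<phi>"
proof (rule Bochner_Integration.integrable_bound)
  interpret finite_measure "lebesgue_on {0<..<T}" by (rule finite_measure_lebesgue_on) auto
  have i: "integrable (lebesgue_on {0<..<T}) (\<lambda>t. (\<phi> t)\<^sup>2)" and p: "0 \<le> \<phi> t" for t
    using assms by (simp_all add: sqint_def)
  show "integrable (lebesgue_on {0<..<T}) (\<lambda>t. 1 + (\<phi> t)\<^sup>2)" using i by simp
  have "\<phi> = (\<lambda>t. sqrt ((\<phi> t)\<^sup>2))" using p by auto
  moreover have "(\<lambda>t. sqrt ((\<phi> t)\<^sup>2)) \<in> borel_measurable (lebesgue_on {0<..<T})"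
    by (rule measurable_compose[OF borel_measurable_integrable[OF i] borel_measurable_sqrt])
  ultimately show "\<phi> \<in> borel_measurable (lebesgue_on {0<..<T})" by simp
  have "\<phi> t \<le> 1 + (\<phi> t)\<^sup>2" for t using sum_squares_bound[of 1 "\<phi> t"] p[of t] by (simp add: power2_eq_square) 
  then show "AE t in lebesgue_on {0<..<T}. norm (\<phi> t) \<le> norm (1 + (\<phi> t)\<^sup>2)"
    using p by (intro AE_I2) (simp add: add_nonneg_nonneg)
qed

lemma sqint_mult: "sqint T \<phi> \<Longrightarrow> 0 \<le> c \<Longrightarrow> sqint T (\<lambda>t. c * \<phi> t)"
  by (simp add: sqint_def power_mult_distrib)

lemma sqnorm_mult: "0 \<le> c \<Longrightarrow> sqnorm T (\<lambda>t. c * \<phi> t) = c * sqnorm T \<phi>"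
  by (simp add: sqnorm_def power_mult_distrib real_sqrt_mult)

lemma sqint_add:
  assumes "sqint T \<phi>" "sqint T \<psi>"
  shows "sqint T (\<lambda>t. \<phi> t + \<psi> t)" "sqnorm T (\<lambda>t. \<phi> t + \<psi> t) \<le> 2 * (sqnorm T \<phi> + sqnorm T \<psi>)"
proof -
  let ?M = "lebesgue_on {0<..<T}"
  have i: "integrable ?M (\<lambda>t. (\<phi> t)\<^sup>2)" "integrable ?M (\<lambda>t. (\<psi> t)\<^sup>2)" and p: "0 \<le> \<phi> t" "0 \<le> \<psi> t" for t
    using assms by (simp_all add: sqint_def)
  have b: "(\<phi> t + \<psi> t)\<^sup>2 \<le> 2 * (\<phi> t)\<^sup>2 + 2 * (\<psi> t)\<^sup>2" for t
    using sum_squares_bound[of "\<phi> t" "\<psi> t"] by (simp add: power2_sum)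
  have i2: "integrable ?M (\<lambda>t. (\<phi> t + \<psi> t)\<^sup>2)"
  proof (rule Bochner_Integration.integrable_bound)
    show "integrable ?M (\<lambda>t. 2 * (\<phi> t)\<^sup>2 + 2 * (\<psi> t)\<^sup>2)" using i by simp
    show "(\<lambda>t. (\<phi> t + \<psi> t)\<^sup>2) \<in> borel_measurable ?M"
      using sqint_integrable[OF assms(1)] sqint_integrable[OF assms(2)] by auto
    show "AE t in ?M. norm ((\<phi> t + \<psi> t)\<^sup>2) \<le> norm (2 * (\<phi> t)\<^sup>2 + 2 * (\<psi> t)\<^sup>2)"
      using b by (intro AE_I2) simp
  qed
  then show "sqint T (\<lambda>t. \<phi> t + \<psi> t)" using p by (simp add: sqint_def)
  have n: "0 \<le> integral\<^sup>L ?M (\<lambda>t. (\<phi> t)\<^sup>2)" "0 \<le> integral\<^sup>L ?M (\<lambda>t. (\<psi> t)\<^sup>2)" by (auto intro: integral_nonneg_AE)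
  have "integral\<^sup>L ?M (\<lambda>t. (\<phi> t + \<psi> t)\<^sup>2) \<le> integral\<^sup>L ?M (\<lambda>t. 2 * (\<phi> t)\<^sup>2 + 2 * (\<psi> t)\<^sup>2)"
    using i i2 b by (intro integral_mono) auto
  also have "\<dots> = 2 * (sqnorm T \<phi>)\<^sup>2 + 2 * (sqnorm T \<psi>)\<^sup>2"
    using i n by (simp add: sqnorm_def)
  also have "\<dots> \<le> (2 * (sqnorm T \<phi> + sqnorm T \<psi>))\<^sup>2"
    using sqnorm_nonneg[of T \<phi>] sqnorm_nonneg[of T \<psi>] by (simp add: power2_sum algebra_simps)
  finally show "sqnorm T (\<lambda>t. \<phi> t + \<psi> t) \<le> 2 * (sqnorm T \<phi> + sqnorm T \<psi>)"
    unfolding sqnorm_def[of T "\<lambda>t. \<phi> t + \<psi> t"] using sqnorm_nonneg[of T \<phi>] sqnorm_nonneg[of T \<psi>]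
    by (intro real_le_lsqrt) auto
qed

lemma integral_sq_le:
  assumes \<phi>: "sqint T \<phi>" and ab: "0 \<le> a" "a \<le> b" "b \<le> T"
  shows "(integral {a..b} \<phi>)\<^sup>2 \<le> (b - a) * integral {a..b} (\<lambda>t. (\<phi> t)\<^sup>2)"
proof (cases "a = b")
  case False
  then have ab': "a < b" using ab by simp
  have i1: "\<phi> integrable_on {a..b}"
    using integrable_on_subinterval_lebesgue(1)[OF sqint_integrable[OF \<phi>] ab(1,3)] by (simp add: set_lebesgue_integral_eq_integral(1))
  have "integrable (lebesgue_on {0<..<T}) (\<lambda>t. (\<phi> t)\<^sup>2)" using \<phi> by (simp add: sqint_def)
  from integrable_on_subinterval_lebesgue(1)[OF this ab(1,3)]
  have i2: "(\<lambda>t. (\<phi> t)\<^sup>2) integrable_on {a..b}" by (simp add: set_lebesgue_integral_eq_integral(1))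
  define \<mu> where "\<mu> = integral {a..b} \<phi> / (b - a)"
  have "((\<lambda>t. (\<phi> t)\<^sup>2 - 2 * \<mu> * \<phi> t + \<mu>\<^sup>2) has_integral
      integral {a..b} (\<lambda>t. (\<phi> t)\<^sup>2) - 2 * \<mu> * integral {a..b} \<phi> + (b - a) * \<mu>\<^sup>2) {a..b}"
    using has_integral_const_real[of "\<mu>\<^sup>2" a b] ab
    by (intro has_integral_add has_integral_diff has_integral_mult_right integrable_integral i1 i2) simp
  moreover have "(\<phi> t)\<^sup>2 - 2 * \<mu> * \<phi> t + \<mu>\<^sup>2 \<ge> 0" for t
    using zero_le_power2[of "\<phi> t - \<mu>"] by (simp add: power2_diff algebra_simps)
  ultimately have "0 \<le> integral {a..b} (\<lambda>t. (\<phi> t)\<^sup>2) - 2 * \<mu> * integral {a..b} \<phi> + (b - a) * \<mu>\<^sup>2"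
    by (rule has_integral_nonneg)
  also have "\<dots> = integral {a..b} (\<lambda>t. (\<phi> t)\<^sup>2) - (integral {a..b} \<phi>)\<^sup>2 / (b - a)"
  proof -
    have "A - 2 * (J / L) * J + L * (J / L)\<^sup>2 = A - J\<^sup>2 / L" if "0 < L" for A J L :: real
      using that by (simp add: power2_eq_square field_simps)
    from this[of "b - a" "integral {a..b} (\<lambda>t. (\<phi> t)\<^sup>2)" "integral {a..b} \<phi>"] show ?thesis
      using ab' by (simp add: \<mu>_def)
  qed
  finally show ?thesis using ab' by (simp add: field_simps)
qed simp

text \<open>
  Cauchy--Schwarz on each window of \<open>m\<close> time steps; every time step belongs to at most \<open>m\<close> windows.
\<close>

lemma window_l2:
  fixes v :: "nat \<Rightarrow> real"
  assumes \<tau>: "0 < \<tau>" and N: "real N * \<tau> \<le> T" and \<phi>: "sqint T \<phi>" and c: "0 \<le> c"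
    and v: "\<And>n. n \<in> A \<Longrightarrow> 0 \<le> v n" "\<And>n. n \<in> A \<Longrightarrow> m \<le> n \<and> n \<le> N \<and> v n \<le> c * integral {real (n - m) * \<tau>..real n * \<tau>} \<phi>"
  shows "\<tau> * (\<Sum>n\<in>A. (v n)\<^sup>2) \<le> (c * real m * \<tau> * sqnorm T \<phi>)\<^sup>2"
proof -
  define J where "J i = integral {real (i - 1) * \<tau>..real i * \<tau>} (\<lambda>t. (\<phi> t)\<^sup>2)" for i
  have isq: "integrable (lebesgue_on {0<..<T}) (\<lambda>t. (\<phi> t)\<^sup>2)" using \<phi> by (simp add: sqint_def)
  have int: "(\<lambda>t. (\<phi> t)\<^sup>2) integrable_on {real a * \<tau>..real b * \<tau>}" if "b \<le> N" for a b
  proof -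
    have "real b * \<tau> \<le> real N * \<tau>" using that \<tau> by (intro mult_right_mono) auto
    then have b: "real b * \<tau> \<le> T" using N by linarith
    have a: "0 \<le> real a * \<tau>" using \<tau> by simp
    from integrable_on_subinterval_lebesgue(1)[OF isq a b] show ?thesis
      by (rule set_lebesgue_integral_eq_integral(1))
  qed
  have split: "integral {real a * \<tau>..real (a + l) * \<tau>} (\<lambda>t. (\<phi> t)\<^sup>2) = (\<Sum>i<l. J (a + Suc i))" if "a + l \<le> N" for a l
    using that
  proof (induction l)
    case (Suc l)
    have "integral {real a * \<tau>..real (a + Suc l) * \<tau>} (\<lambda>t. (\<phi> t)\<^sup>2)
      = integral {real a * \<tau>..real (a + l) * \<tau>} (\<lambda>t. (\<phi> t)\<^sup>2) + integral {real (a + l) * \<tau>..real (a + Suc l) * \<tau>} (\<lambda>t. (\<phi> t)\<^sup>2)"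
      using \<tau> int[OF Suc.prems] by (intro Henstock_Kurzweil_Integration.integral_combine[symmetric]) (auto intro: mult_right_mono)
    also have "integral {real (a + l) * \<tau>..real (a + Suc l) * \<tau>} (\<lambda>t. (\<phi> t)\<^sup>2) = J (a + Suc l)"
      by (simp add: J_def)
    finally show ?case using Suc by simp
  qed simp
  have J0: "0 \<le> J i" if "i \<le> N" for i unfolding J_def using int[OF that] by (intro integral_nonneg) auto
  have tot: "(\<Sum>i<N. J (Suc i)) \<le> (sqnorm T \<phi>)\<^sup>2"
  proof -
    have "(\<Sum>i<N. J (Suc i)) = integral {0..real N * \<tau>} (\<lambda>t. (\<phi> t)\<^sup>2)" using split[of 0 N] by simp
    also have "\<dots> \<le> integral {0..T} (\<lambda>t. (\<phi> t)\<^sup>2)"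
      using int[of N 0] integrable_on_subinterval_lebesgue(1)[OF isq, of 0 T] N
      by (intro integral_subset_le) (auto simp: set_lebesgue_integral_eq_integral(1))
    also have "\<dots> = integral\<^sup>L (lebesgue_on {0<..<T}) (\<lambda>t. (\<phi> t)\<^sup>2)"
      using integrable_on_subinterval_lebesgue(3)[OF isq, of 0 T] by simp
    also have "\<dots> = (sqnorm T \<phi>)\<^sup>2" by (simp add: sqnorm_def integral_nonneg_AE)
    finally show ?thesis .
  qed
  have A: "A \<subseteq> {m..N}" using v(2) by auto
  then have fA: "finite A" by (rule finite_subset) simp
  have "(v n)\<^sup>2 \<le> c\<^sup>2 * (real m * \<tau>) * (\<Sum>i<m. J (n - i))" if n: "n \<in> A" for n
  proof -
    have nm: "m \<le> n" "n \<le> N" "v n \<le> c * integral {real (n - m) * \<tau>..real n * \<tau>} \<phi>" using v(2)[OF n] by auto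
    have nN: "real n * \<tau> \<le> T" using nm(2) \<tau> N by (meson mult_right_mono of_nat_le_iff order.trans less_imp_le)
    have "(v n)\<^sup>2 \<le> (c * integral {real (n - m) * \<tau>..real n * \<tau>} \<phi>)\<^sup>2" using v(1)[OF n] nm(3) by (intro power_mono)
    also have "\<dots> = c\<^sup>2 * (integral {real (n - m) * \<tau>..real n * \<tau>} \<phi>)\<^sup>2" by (simp add: power_mult_distrib)
    also have "\<dots> \<le> c\<^sup>2 * ((real n * \<tau> - real (n - m) * \<tau>) * integral {real (n - m) * \<tau>..real n * \<tau>} (\<lambda>t. (\<phi> t)\<^sup>2))"
      using \<tau> nm nN by (intro mult_left_mono integral_sq_le[OF \<phi>]) (auto intro: mult_right_mono)
    also have "real n * \<tau> - real (n - m) * \<tau> = real m * \<tau>" using nm by (simp add: of_nat_diff algebra_simps)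
    also have "integral {real (n - m) * \<tau>..real n * \<tau>} (\<lambda>t. (\<phi> t)\<^sup>2) = (\<Sum>i<m. J (n - m + Suc i))"
      using split[of "n - m" m] nm by simp
    also have "\<dots> = (\<Sum>i<m. J (n - i))"
      by (subst sum.nat_diff_reindex[symmetric]) (use nm in \<open>auto intro!: sum.cong arg_cong[of _ _ J]\<close>)
    finally show ?thesis by (simp add: mult_ac)
  qed
  then have "(\<Sum>n\<in>A. (v n)\<^sup>2) \<le> (\<Sum>n\<in>A. c\<^sup>2 * (real m * \<tau>) * (\<Sum>i<m. J (n - i)))"
    by (rule sum_mono)
  also have "\<dots> = c\<^sup>2 * (real m * \<tau>) * (\<Sum>i<m. \<Sum>n\<in>A. J (n - i))"
    unfolding sum_distrib_left[symmetric] by (subst sum.swap) simp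
  also have "\<dots> \<le> c\<^sup>2 * (real m * \<tau>) * (\<Sum>i<m. (sqnorm T \<phi>)\<^sup>2)"
  proof (intro mult_left_mono sum_mono)
    fix i assume i: "i \<in> {..<m}"
    have "(\<Sum>n\<in>A. J (n - i)) = (\<Sum>k\<in>(\<lambda>n. n - i) ` A. J k)"
    proof (rule sum.reindex[unfolded o_def, symmetric], rule inj_onI)
      fix x y assume "x \<in> A" "y \<in> A" "x - i = y - i"
      moreover from this have "m \<le> x" "m \<le> y" using A by auto
      ultimately show "x = y" using i by auto
    qed
    also have "\<dots> \<le> (\<Sum>k\<in>Suc ` {..<N}. J k)"
    proof (rule sum_mono2)
      show "(\<lambda>n. n - i) ` A \<subseteq> Suc ` {..<N}"
      proof
        fix k assume "k \<in> (\<lambda>n. n - i) ` A"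
        then obtain n where n: "n \<in> A" "k = n - i" by auto
        then have "m \<le> n" "n \<le> N" using A by auto
        then have "0 < k" "k \<le> N" using n i by auto
        then show "k \<in> Suc ` {..<N}" by (intro image_eqI[of _ _ "k - 1"]) auto
      qed
    qed (use J0 in auto)
    also have "\<dots> = (\<Sum>i<N. J (Suc i))" by (simp add: sum.reindex)
    finally show "(\<Sum>n\<in>A. J (n - i)) \<le> (sqnorm T \<phi>)\<^sup>2" using tot by simp
  qed (use \<tau> in auto)
  finally have "(\<Sum>n\<in>A. (v n)\<^sup>2) \<le> c\<^sup>2 * (real m * \<tau>) * (real m * (sqnorm T \<phi>)\<^sup>2)" by simp
  from mult_left_mono[OF this, of \<tau>] \<tau> show ?thesis
    by (simp add: power_mult_distrib power2_eq_square mult_ac)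
qed

lemma window_sup:
  assumes \<tau>: "0 < \<tau>" and n: "m \<le> n" "real n * \<tau> \<le> T" and \<phi>: "sqint T \<phi>"
    and L: "AE t in lebesgue_on {0<..<T}. \<phi> t \<le> L" and m: "0 < m"
  shows "integral {real (n - m) * \<tau>..real n * \<tau>} \<phi> \<le> real m * \<tau> * L"
proof -
  let ?a = "real (n - m) * \<tau>" and ?b = "real n * \<tau>"
  have ab: "0 \<le> ?a" "?a \<le> ?b" using \<tau> by (auto intro: mult_right_mono)
  interpret finite_measure "lebesgue_on {?a<..<?b}" by (rule finite_measure_lebesgue_on) auto
  have "integral {?a..?b} \<phi> = integral\<^sup>L (lebesgue_on {?a<..<?b}) \<phi>"
    using integrable_on_subinterval_lebesgue(3)[OF sqint_integrable[OF \<phi>] ab(1) n(2)] by simp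
  also have "\<dots> \<le> integral\<^sup>L (lebesgue_on {?a<..<?b}) (\<lambda>t. L)"
    using AE_subinterval[OF L ab(1) n(2)] integrable_on_subinterval_lebesgue(2)[OF sqint_integrable[OF \<phi>] ab(1) n(2)]
    by (intro integral_mono_AE) auto
  also have "\<dots> = (?b - ?a) * L"
    using ab by (simp add: measure_restrict_space)
  also have "?b - ?a = real m * \<tau>" using n by (simp add: of_nat_diff algebra_simps)
  finally show ?thesis .
qed

section \<open>Oscillation bounds from weak derivatives\<close>

lemma wd_integral_abs_le:
  assumes w: "integrable (lebesgue_on {0<..<T}) y" and \<phi>: "sqint T \<phi>" and B: "0 \<le> B"
    and le: "AE t in lebesgue_on {0<..<T}. \<bar>y t\<bar> \<le> B * \<phi> t" and ab: "0 \<le> a" "a \<le> b" "b \<le> T"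
  shows "integral {a..b} (\<lambda>t. \<bar>y t\<bar>) \<le> B * integral {a..b} \<phi>"
proof -
  have i: "integrable (lebesgue_on {0<..<T}) (\<lambda>t. \<bar>y t\<bar>)" using w by simp
  note p = sqint_integrable[OF \<phi>]
  have "integral {a..b} (\<lambda>t. \<bar>y t\<bar>) = integral\<^sup>L (lebesgue_on {a<..<b}) (\<lambda>t. \<bar>y t\<bar>)"
    using integrable_on_subinterval_lebesgue(3)[OF i ab(1,3)] by simp
  also have "\<dots> \<le> integral\<^sup>L (lebesgue_on {a<..<b}) (\<lambda>t. B * \<phi> t)"
    using AE_subinterval[OF le ab(1,3)] integrable_on_subinterval_lebesgue(2)[OF i ab(1,3)]
      integrable_on_subinterval_lebesgue(2)[OF p ab(1,3)]
    by (intro integral_mono_AE) auto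
  also have "\<dots> = B * integral {a..b} \<phi>"
    using integrable_on_subinterval_lebesgue(3)[OF p ab(1,3)] by simp
  finally show ?thesis .
qed

lemma continuous_sup_bound:
  fixes g :: "real \<Rightarrow> real"
  assumes T: "0 < T" and cont: "continuous_on {0..T} g" and le: "AE t in lebesgue_on {0<..<T}. \<bar>g t\<bar> \<le> B" and t: "t \<in> {0..T}"
  shows "\<bar>g t\<bar> \<le> (B::real)"
  by (rule AE_le_imp_le_continuous[OF T _ le t]) (intro continuous_intros cont)

lemma wd_osc_bound:
  assumes w: "wd T x y" and cont: "continuous_on {0..T} x" and \<phi>: "sqint T \<phi>" and B: "0 \<le> B"
    and le: "AE t in lebesgue_on {0<..<T}. \<bar>y t\<bar> \<le> B * \<phi> t" and ab: "0 \<le> a" "a < b" "b \<le> T"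
    and st: "s \<in> {a..b}" "t \<in> {a..b}"
  shows "\<bar>x t - x s\<bar> \<le> B * (2 * integral {a..b} \<phi>)"
proof -
  define X where "X i = (if i = 0 then x else y)" for i :: nat
  have "wd T (X i) (X (Suc i))" if "i \<le> 0" for i using w that by (simp add: X_def)
  from weak_taylor[of 0 T X a b 0, OF this ab] obtain c :: "nat \<Rightarrow> real" where
    "AE t in lebesgue_on {a<..<b}. \<bar>x t - c 0\<bar> \<le> integral {a..b} (\<lambda>s. \<bar>y s\<bar>)"
    by (auto simp: X_def)
  then have *: "\<bar>x t - c 0\<bar> \<le> integral {a..b} (\<lambda>s. \<bar>y s\<bar>)" if "t \<in> {a..b}" for t
    using that ab by (intro AE_le_imp_le_continuous[of a b]) (auto intro!: continuous_intros continuous_on_subset[OF cont])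
  have "integral {a..b} (\<lambda>s. \<bar>y s\<bar>) \<le> B * integral {a..b} \<phi>"
    using w ab by (intro wd_integral_abs_le[OF _ \<phi> B le]) (auto simp: wd_def)
  then show ?thesis using *[OF st(1)] *[OF st(2)] by (simp add: mult.left_commute)
qed

lemma wd_second_difference_bound:
  assumes w: "wd T x y" "wd T y z" and cont: "continuous_on {0..T} x" and \<phi>: "sqint T \<phi>" and B: "0 \<le> B"
    and le: "AE t in lebesgue_on {0<..<T}. \<bar>z t\<bar> \<le> B * \<phi> t" and ab: "0 \<le> a" "a < b" "b \<le> T"
  shows "\<bar>x b - 2 * x ((a + b) / 2) + x a\<bar> \<le> B * (4 * (b - a) * integral {a..b} \<phi>)"
proof -
  define X where "X i = (if i = 0 then x else if i = 1 then y else z)" for i :: nat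
  have "wd T (X i) (X (Suc i))" if "i \<le> 1" for i using w that by (cases i) (auto simp: X_def)
  from weak_taylor[of 1 T X a b 0, OF this ab] obtain c where
    "AE t in lebesgue_on {a<..<b}. \<bar>x t - (c 0 + c (Suc 0) * t)\<bar> \<le> (b - a) * integral {a..b} (\<lambda>s. \<bar>z s\<bar>)"
    by (auto simp: X_def)
  then have *: "\<bar>x t - (c 0 + c (Suc 0) * t)\<bar> \<le> (b - a) * integral {a..b} (\<lambda>s. \<bar>z s\<bar>)" if "t \<in> {a..b}" for t
    using that ab by (intro AE_le_imp_le_continuous[of a b]) (auto intro!: continuous_intros continuous_on_subset[OF cont])
  have "integral {a..b} (\<lambda>s. \<bar>z s\<bar>) \<le> B * integral {a..b} \<phi>"
    using w ab by (intro wd_integral_abs_le[OF _ \<phi> B le]) (auto simp: wd_def)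
  then have I: "(b - a) * integral {a..b} (\<lambda>s. \<bar>z s\<bar>) \<le> (b - a) * (B * integral {a..b} \<phi>)"
    using ab by (intro mult_left_mono) auto
  have m: "a \<in> {a..b}" "b \<in> {a..b}" "(a + b) / 2 \<in> {a..b}" using ab by auto
  define e where "e t = x t - (c 0 + c (Suc 0) * t)" for t
  have "x b - 2 * x ((a + b) / 2) + x a = e b - 2 * e ((a + b) / 2) + e a"
    by (simp add: e_def field_simps)
  then have "\<bar>x b - 2 * x ((a + b) / 2) + x a\<bar> \<le> \<bar>e b\<bar> + 2 * \<bar>e ((a + b) / 2)\<bar> + \<bar>e a\<bar>" by linarith
  also have "\<dots> \<le> 4 * ((b - a) * integral {a..b} (\<lambda>s. \<bar>z s\<bar>))"
  proof -
    define Q where "Q = (b - a) * integral {a..b} (\<lambda>s. \<bar>z s\<bar>)"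
    have eQ: "\<bar>e t\<bar> \<le> Q" if "t \<in> {a..b}" for t unfolding e_def Q_def by (rule *[OF that])
    show ?thesis unfolding Q_def[symmetric] using eQ[OF m(1)] eQ[OF m(2)] eQ[OF m(3)] by linarith
  qed
  also have "\<dots> \<le> 4 * ((b - a) * (B * integral {a..b} \<phi>))" by (intro mult_left_mono I) simp
  also have "\<dots> = B * (4 * (b - a) * integral {a..b} \<phi>)" by simp
  finally show ?thesis .
qed

text \<open>
  Average over \<open>[a, b]\<close> the triangle inequality between \<open>x t\<close> and \<open>x s\<close>. In this way pointwise values at the
  nodes are estimated by integrals of \<open>x\<close> and of its derivative.
\<close>

lemma wd_point_bound:
  assumes w: "wd T x y" and cont: "continuous_on {0..T} x" and \<phi>: "sqint T \<phi>" and \<psi>: "sqint T \<psi>" and B: "0 \<le> B"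
    and lex: "AE t in lebesgue_on {0<..<T}. \<bar>x t\<bar> \<le> B * \<psi> t"
    and le: "AE t in lebesgue_on {0<..<T}. \<bar>y t\<bar> \<le> B * \<phi> t" and ab: "0 \<le> a" "a < b" "b \<le> T"
    and t: "t \<in> {a..b}"
  shows "\<bar>x t\<bar> \<le> B * integral {a..b} (\<lambda>s. \<psi> s / (b - a) + 2 * \<phi> s)"
proof -
  have ix: "integrable (lebesgue_on {0<..<T}) x" using w by (simp add: wd_def)
  have ax: "(\<lambda>s. \<bar>x s\<bar>) integrable_on {a..b}"
    using integrable_on_subinterval_lebesgue(1)[OF ix ab(1,3)] by (simp add: absolutely_integrable_on_def)
  have p: "\<phi> integrable_on {a..b}" "\<psi> integrable_on {a..b}"
    using integrable_on_subinterval_lebesgue(1)[OF sqint_integrable[OF \<phi>] ab(1,3)]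
      integrable_on_subinterval_lebesgue(1)[OF sqint_integrable[OF \<psi>] ab(1,3)]
    by (simp_all add: set_lebesgue_integral_eq_integral(1))
  have "integral {a..b} (\<lambda>s. \<bar>x t\<bar>) \<le> integral {a..b} (\<lambda>s. \<bar>x s\<bar> + B * (2 * integral {a..b} \<phi>))"
    using wd_osc_bound[OF w cont \<phi> B le ab _ t]
    by (intro integral_le integrable_add ax integrable_const_ivl) fastforce+
  also have "\<dots> = integral {a..b} (\<lambda>s. \<bar>x s\<bar>) + (b - a) * (B * (2 * integral {a..b} \<phi>))"
    using ab by (subst Henstock_Kurzweil_Integration.integral_add[OF ax]) auto
  also have "integral {a..b} (\<lambda>s. \<bar>x s\<bar>) \<le> B * integral {a..b} \<psi>"
    using ab by (intro wd_integral_abs_le[OF ix \<psi> B lex]) auto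
  finally have "\<bar>x t\<bar> * (b - a) \<le> B * (integral {a..b} \<psi> + (b - a) * (2 * integral {a..b} \<phi>))"
    using ab by (simp add: algebra_simps)
  then have "\<bar>x t\<bar> \<le> B * (integral {a..b} \<psi> / (b - a) + 2 * integral {a..b} \<phi>)"
    using ab by (simp add: field_simps)
  also have "integral {a..b} \<psi> / (b - a) + 2 * integral {a..b} \<phi> = integral {a..b} (\<lambda>s. \<psi> s / (b - a) + 2 * \<phi> s)"
    using p by (subst Henstock_Kurzweil_Integration.integral_add) (auto intro: integrable_on_divide)
  finally show ?thesis .
qed

section \<open>The error equation\<close>

text \<open>
  The setting of the error estimate in a real inner product space. Here \<open>G\<close> is skew-symmetric on the
  dense subspace \<open>V\<close> of \<open>Hs\<close>, \<open>P\<close> is the orthogonal projection onto \<open>Vh\<close>, the functions \<open>u1\<close>, \<open>u2\<close> are time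
  derivatives of the solution \<open>u\<close>, \<open>R i\<close> is the \<open>i\<close>-th time derivative of the residual \<open>F - G u\<close>,
  \<open>N0\<close>, \<open>N1\<close>, \<open>N2\<close> stand for Sobolev norms of \<open>u\<close>, \<open>u1\<close>, \<open>u2\<close>, and \<open>A\<close> for the approximation factor \<open>C h ^ r\<close>.
  Derivatives are only required after pairing with a fixed element, so that all the calculus
  concerns real functions and no vector-valued integral occurs.
\<close>

locale am_error =
  fixes G P :: "'a::real_inner \<Rightarrow> 'a" and Hs V Vh :: "'a set" and \<nu> N :: nat
    and T \<tau> \<delta> h CG Cd A :: real and u u1 u2 :: "real \<Rightarrow> 'a" and R :: "nat \<Rightarrow> real \<Rightarrow> 'a"
    and N0 N1 N2 \<rho>0 \<rho>1 :: "real \<Rightarrow> real" and L0 L1 L\<rho> :: real and U :: "nat \<Rightarrow> 'a"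
  assumes linG: "linear G" and linP: "linear P"
    and Hs: "subspace Hs" and V: "subspace V" "V \<subseteq> Hs" and Vh: "subspace Vh" "Vh \<subseteq> V"
    and GV: "\<And>w. w \<in> V \<Longrightarrow> G w \<in> Hs"
    and skewV: "\<And>w z. w \<in> V \<Longrightarrow> z \<in> V \<Longrightarrow> G w \<bullet> z = - (w \<bullet> G z)"
    and dense: "\<And>x B. x \<in> Hs \<Longrightarrow> 0 \<le> B \<Longrightarrow> (\<And>z. z \<in> V \<Longrightarrow> \<bar>x \<bullet> z\<bar> \<le> B * norm z) \<Longrightarrow> norm x \<le> B"
    and P: "\<And>x. P x \<in> Vh" "\<And>x w. w \<in> Vh \<Longrightarrow> (x - P x) \<bullet> w = 0"
    and inv: "\<And>w. w \<in> Vh \<Longrightarrow> norm (G w) \<le> CG / h * norm w"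
    and pos: "0 < T" "0 < \<tau>" "0 < \<delta>" "0 < h" "0 < CG" "0 < Cd" "0 \<le> A" and \<delta>: "\<delta> \<le> Cd * h"
    and \<nu>: "\<nu> \<in> {3, 4, 5}" and N\<tau>: "real N * \<tau> \<le> T"
    and uV: "\<And>t. t \<in> {0..T} \<Longrightarrow> u t \<in> V" and R0: "\<And>t. t \<in> {0..T} \<Longrightarrow> R 0 t \<in> Hs"
    and wdu: "\<And>w. w \<in> Hs \<Longrightarrow> wd T (\<lambda>t. u t \<bullet> w) (\<lambda>t. u1 t \<bullet> w)"
      "\<And>w. w \<in> Hs \<Longrightarrow> wd T (\<lambda>t. u1 t \<bullet> w) (\<lambda>t. u2 t \<bullet> w)"
    and wdR: "\<And>w i. w \<in> Hs \<Longrightarrow> i \<le> \<nu> \<Longrightarrow> wd T (\<lambda>t. R i t \<bullet> w) (\<lambda>t. R (Suc i) t \<bullet> w)"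
    and cont: "\<And>w. w \<in> Hs \<Longrightarrow> continuous_on {0..T} (\<lambda>t. u t \<bullet> w)"
      "\<And>w. w \<in> Hs \<Longrightarrow> continuous_on {0..T} (\<lambda>t. R 0 t \<bullet> w)"
    and eqn: "AE t in lebesgue_on {0<..<T}. u1 t = R 0 t"
    and appV: "AE t in lebesgue_on {0<..<T}. u1 t \<in> V"
    and app0: "AE t in lebesgue_on {0<..<T}. norm (u t - P (u t)) + h * norm (G (u t - P (u t))) \<le> A * N0 t"
    and app1: "AE t in lebesgue_on {0<..<T}. norm (u1 t - P (u1 t)) + h * norm (G (u1 t - P (u1 t))) \<le> A * N1 t"
    and app2: "AE t in lebesgue_on {0<..<T}. norm (u2 t - P (u2 t)) \<le> A * N2 t"
    and sq: "sqint T N0" "sqint T N1" "sqint T N2" "sqint T \<rho>0" "sqint T \<rho>1"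
    and sup: "AE t in lebesgue_on {0<..<T}. N0 t \<le> L0" "AE t in lebesgue_on {0<..<T}. N1 t \<le> L1"
      "AE t in lebesgue_on {0<..<T}. \<rho>0 t \<le> L\<rho>" and L: "0 \<le> L0" "0 \<le> L1" "0 \<le> L\<rho>"
    and R\<nu>: "\<And>t. norm (R \<nu> t) \<le> \<rho>0 t" "\<And>t. norm (R (Suc \<nu>) t) \<le> \<rho>1 t"
    and UVh: "\<And>n. n \<le> N \<Longrightarrow> U n \<in> Vh" and init: "\<And>j. j < \<nu> - 1 \<Longrightarrow> U j = P (u (real j * \<tau>))"
    and scheme: "\<And>n w. \<nu> - 1 \<le> n \<Longrightarrow> n \<le> N \<Longrightarrow> w \<in> Vh \<Longrightarrow>
      (dif U n /\<^sub>R \<tau> + G (am \<nu> U n)) \<bullet> (w + \<delta> *\<^sub>R G w)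
        = am \<nu> (\<lambda>n. R 0 (real n * \<tau>) + G (u (real n * \<tau>))) n \<bullet> (w + \<delta> *\<^sub>R G w)"
begin

definition "eta t = u t - P (u t)"

lemma P_adjoint: "w \<in> Hs \<Longrightarrow> (x - P x) \<bullet> w = x \<bullet> (w - P w)"
  using P(2)[OF P(1), of x w] P(2)[OF P(1), of w x] by (simp add: inner_diff_left inner_diff_right inner_commute)

lemma VhHs: "w \<in> Vh \<Longrightarrow> w \<in> Hs" "w \<in> V \<Longrightarrow> w \<in> Hs" "w \<in> Vh \<Longrightarrow> w \<in> V"
  using V Vh by auto

lemma complement_in_Hs: "w \<in> Hs \<Longrightarrow> w - P w \<in> Hs"
  using VhHs(1)[OF P(1)] subspace_diff[OF Hs] by blast

lemma wd_eta: "w \<in> Hs \<Longrightarrow> wd T (\<lambda>t. eta t \<bullet> w) (\<lambda>t. (u1 t - P (u1 t)) \<bullet> w)"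
  using wdu(1)[OF complement_in_Hs] by (simp add: eta_def P_adjoint)

lemma wd_eta1: "w \<in> Hs \<Longrightarrow> wd T (\<lambda>t. (u1 t - P (u1 t)) \<bullet> w) (\<lambda>t. (u2 t - P (u2 t)) \<bullet> w)"
  using wdu(2)[OF complement_in_Hs] by (simp add: P_adjoint)

lemma cont_eta: "w \<in> Hs \<Longrightarrow> continuous_on {0..T} (\<lambda>t. eta t \<bullet> w)"
  using cont(1)[OF complement_in_Hs] by (simp add: eta_def P_adjoint)

lemma eta_in_V: "t \<in> {0..T} \<Longrightarrow> eta t \<in> V"
  unfolding eta_def using uV VhHs(3)[OF P(1)] subspace_diff[OF V(1)] by blast

lemma inner_le: "norm x \<le> B \<Longrightarrow> \<bar>x \<bullet> w\<bar> \<le> B * norm w"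
  using Cauchy_Schwarz_ineq2[of x w] mult_right_mono[of "norm x" B "norm w"] by (meson norm_ge_zero order.trans)

lemma h_part: "a + h * b \<le> c \<Longrightarrow> 0 \<le> a \<Longrightarrow> b \<le> c / h"
  using pos by (simp add: field_simps)

lemma AE_eta0: "AE t in lebesgue_on {0<..<T}. \<bar>eta t \<bullet> w\<bar> \<le> (A * norm w) * N0 t"
  using app0
proof eventually_elim
  case (elim t)
  have "0 \<le> h * norm (G (u t - P (u t)))" using pos by simp
  with elim have "norm (eta t) \<le> A * N0 t" unfolding eta_def by linarith
  from inner_le[OF this] show ?case by (simp add: mult_ac)
qed

lemma AE_eta1: "AE t in lebesgue_on {0<..<T}. \<bar>(u1 t - P (u1 t)) \<bullet> w\<bar> \<le> (A * norm w) * N1 t"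
  using app1
proof eventually_elim
  case (elim t)
  have "0 \<le> h * norm (G (u1 t - P (u1 t)))" using pos by simp
  with elim have "norm (u1 t - P (u1 t)) \<le> A * N1 t" by linarith
  from inner_le[OF this] show ?case by (simp add: mult_ac)
qed

lemma AE_eta2: "AE t in lebesgue_on {0<..<T}. \<bar>(u2 t - P (u2 t)) \<bullet> w\<bar> \<le> (A * norm w) * N2 t"
  using app2
proof eventually_elim
  case (elim t)
  from inner_le[OF elim] show ?case by (simp add: mult_ac)
qed

lemma AE_Geta0: "z \<in> V \<Longrightarrow> AE t in lebesgue_on {0<..<T}. \<bar>eta t \<bullet> G z\<bar> \<le> (A / h * norm z) * N0 t"
proof -
  assume z: "z \<in> V"
  have "AE t in lebesgue_on {0<..<T}. t \<in> {0<..<T}" by (intro AE_I2) (simp add: space_restrict_space)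
  with app0 show ?thesis
  proof eventually_elim
    case (elim t)
    then have "norm (G (eta t)) \<le> A * N0 t / h" unfolding eta_def by (intro h_part) auto
    from inner_le[OF this, of z] show ?case
      using skewV[OF eta_in_V z, of t] elim(2) by (simp add: mult_ac)
  qed
qed

lemma AE_Geta1: "z \<in> V \<Longrightarrow> AE t in lebesgue_on {0<..<T}. \<bar>(u1 t - P (u1 t)) \<bullet> G z\<bar> \<le> (A / h * norm z) * N1 t"
proof -
  assume z: "z \<in> V"
  from app1 appV show ?thesis
  proof eventually_elim
    case (elim t)
    then have "norm (G (u1 t - P (u1 t))) \<le> A * N1 t / h" by (intro h_part) auto
    moreover have "u1 t - P (u1 t) \<in> V" using elim VhHs(3)[OF P(1)] subspace_diff[OF V(1)] by blast
    ultimately show ?case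
      using inner_le[of "G (u1 t - P (u1 t))" "A * N1 t / h" z] skewV[of "u1 t - P (u1 t)" z] z by (simp add: mult_ac)
  qed
qed

text \<open>
  Scalar bounds become norm bounds by pairing a vector with itself.
\<close>

lemma norm_le_by_self: "0 \<le> B \<Longrightarrow> \<bar>x \<bullet> x\<bar> \<le> B * norm x \<Longrightarrow> norm (x::'a) \<le> B"
  by (metis abs_of_nonneg inner_ge_zero mult_right_le_imp_le norm_eq_zero norm_ge_zero power2_eq_square power2_norm_eq_inner
      order.not_eq_order_implies_strict)

lemma eta_Hs: "t \<in> {0..T} \<Longrightarrow> eta t \<in> Hs"
  using eta_in_V VhHs by blast

text \<open>
  Bounds for \<open>G x\<close> come from pairing with \<open>V\<close>, where skew-symmetry moves \<open>G\<close> away from \<open>x\<close>.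
\<close>

lemma norm_G_le:
  assumes "x \<in> V" "0 \<le> B" "\<And>z. z \<in> V \<Longrightarrow> \<bar>x \<bullet> G z\<bar> \<le> B * norm z"
  shows "norm (G x) \<le> B"
  using assms by (intro dense GV) (simp_all add: skewV)

lemma eta_sup: assumes t: "t \<in> {0..T}" shows "norm (eta t) \<le> A * L0" "norm (G (eta t)) \<le> A / h * L0"
proof -
  have sup': "AE t in lebesgue_on {0<..<T}. c * N0 t \<le> c * L0" if "0 \<le> c" for c
    using sup(1) that by (auto elim!: eventually_mono intro: mult_left_mono)
  show "norm (eta t) \<le> A * L0"
  proof (rule norm_le_by_self)
    let ?w = "eta t"
    have "AE s in lebesgue_on {0<..<T}. \<bar>eta s \<bullet> ?w\<bar> \<le> (A * norm ?w) * L0"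
    proof -
      have "0 \<le> A * norm ?w" using pos by simp
      from AE_eta0[of ?w] sup'[OF this] show ?thesis by eventually_elim linarith
    qed
    from continuous_sup_bound[OF pos(1) cont_eta[OF eta_Hs[OF t]] this t]
    show "\<bar>?w \<bullet> ?w\<bar> \<le> A * L0 * norm ?w" by (simp add: mult_ac)
  qed (use pos L in simp)
  show "norm (G (eta t)) \<le> A / h * L0"
  proof (rule norm_G_le[OF eta_in_V[OF t]])
    fix z assume z: "z \<in> V"
    have "AE s in lebesgue_on {0<..<T}. \<bar>eta s \<bullet> G z\<bar> \<le> (A / h * norm z) * L0"
    proof -
      have "0 \<le> A / h * norm z" using pos by simp
      from AE_Geta0[OF z] sup'[OF this] show ?thesis by eventually_elim linarith
    qed
    from continuous_sup_bound[OF pos(1) cont_eta[OF GV[OF z]] this t]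
    show "\<bar>eta t \<bullet> G z\<bar> \<le> A / h * L0 * norm z" by (simp add: mult_ac)
  qed (use pos L in simp)
qed

lemma eta_point:
  assumes ab: "0 \<le> a" "a < b" "b \<le> T" and t: "t \<in> {a..b}"
  defines "I \<equiv> integral {a..b} (\<lambda>s. N0 s / (b - a) + 2 * N1 s)"
  shows "norm (eta t) \<le> A * I" "norm (G (eta t)) \<le> A / h * I"
proof -
  have t': "t \<in> {0..T}" using ab t by auto
  have I0: "0 \<le> I"
    unfolding I_def
  proof (rule integral_nonneg)
    have p: "N1 integrable_on {a..b}" "N0 integrable_on {a..b}"
      using integrable_on_subinterval_lebesgue(1)[OF sqint_integrable[OF sq(2)] ab(1,3)]
        integrable_on_subinterval_lebesgue(1)[OF sqint_integrable[OF sq(1)] ab(1,3)]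
      by (simp_all add: set_lebesgue_integral_eq_integral(1))
    then show "(\<lambda>s. N0 s / (b - a) + 2 * N1 s) integrable_on {a..b}"
      by (auto intro!: integrable_add integrable_on_divide)
    show "0 \<le> N0 s / (b - a) + 2 * N1 s" for s using sq(1,2) ab by (auto simp: sqint_def)
  qed
  show "norm (eta t) \<le> A * I"
  proof (rule norm_le_by_self)
    from wd_point_bound[OF wd_eta[OF eta_Hs[OF t']] cont_eta[OF eta_Hs[OF t']] sq(2,1) _ AE_eta0 AE_eta1 ab t] pos
    show "\<bar>eta t \<bullet> eta t\<bar> \<le> A * I * norm (eta t)" by (simp add: I_def mult_ac)
  qed (use pos I0 in simp)
  show "norm (G (eta t)) \<le> A / h * I"
  proof (rule norm_G_le[OF eta_in_V[OF t']])
    fix z assume z: "z \<in> V"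
    from wd_point_bound[OF wd_eta[OF GV[OF z]] cont_eta[OF GV[OF z]] sq(2,1) _ AE_Geta0[OF z] AE_Geta1[OF z] ab t] pos
    show "\<bar>eta t \<bullet> G z\<bar> \<le> A / h * I * norm z" by (simp add: I_def mult_ac)
  qed (use pos I0 in simp)
qed

lemma integral_sqint_nonneg: "sqint T \<phi> \<Longrightarrow> 0 \<le> a \<Longrightarrow> b \<le> T \<Longrightarrow> 0 \<le> integral {a..b} \<phi>"
  using integrable_on_subinterval_lebesgue(1)[OF sqint_integrable]
  by (intro integral_nonneg) (auto simp: sqint_def set_lebesgue_integral_eq_integral(1))

lemma eta_dif:
  assumes ab: "0 \<le> a" "a < b" "b \<le> T"
  shows "norm (eta b - eta a) \<le> A * (2 * integral {a..b} N1)"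
    "norm (G (eta b - eta a)) \<le> A / h * (2 * integral {a..b} N1)"
proof -
  have m: "a \<in> {0..T}" "b \<in> {0..T}" "a \<in> {a..b}" "b \<in> {a..b}" using ab by auto
  have d: "eta b - eta a \<in> V" using eta_in_V m subspace_diff[OF V(1)] by blast
  have I0: "0 \<le> integral {a..b} N1" by (rule integral_sqint_nonneg[OF sq(2) ab(1,3)])
  show "norm (eta b - eta a) \<le> A * (2 * integral {a..b} N1)"
  proof (rule norm_le_by_self)
    have d': "eta b - eta a \<in> Hs" by (rule VhHs(2)[OF d])
    from wd_osc_bound[OF wd_eta[OF d'] cont_eta[OF d'] sq(2) _ AE_eta1 ab m(3,4)] pos
    show "\<bar>(eta b - eta a) \<bullet> (eta b - eta a)\<bar> \<le> A * (2 * integral {a..b} N1) * norm (eta b - eta a)"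
      unfolding inner_diff_left[of "eta b" "eta a"] by (simp add: mult_ac)
  qed (use pos I0 in simp)
  show "norm (G (eta b - eta a)) \<le> A / h * (2 * integral {a..b} N1)"
  proof (rule norm_G_le[OF d])
    fix z assume z: "z \<in> V"
    from wd_osc_bound[OF wd_eta[OF GV[OF z]] cont_eta[OF GV[OF z]] sq(2) _ AE_Geta1[OF z] ab m(3,4)] pos
    show "\<bar>(eta b - eta a) \<bullet> G z\<bar> \<le> A / h * (2 * integral {a..b} N1) * norm z"
      unfolding inner_diff_left[of "eta b" "eta a"] by (simp add: mult_ac)
  qed (use pos I0 in simp)
qed

text \<open>
  Second differences of the projection error gain two powers of \<tau>; they enter because the right-hand
  side is differenced in the summation by parts.
\<close>

lemma eta_dif2:
  assumes ab: "0 \<le> a" "a < b" "b \<le> T"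
  shows "norm (eta b - 2 *\<^sub>R eta ((a + b) / 2) + eta a) \<le> A * (4 * (b - a) * integral {a..b} N2)"
proof (rule norm_le_by_self)
  let ?d = "eta b - 2 *\<^sub>R eta ((a + b) / 2) + eta a"
  have m: "a \<in> {0..T}" "b \<in> {0..T}" "(a + b) / 2 \<in> {0..T}" using ab by auto
  have d: "?d \<in> Hs"
    using eta_Hs[OF m(1)] eta_Hs[OF m(2)] eta_Hs[OF m(3)] by (intro subspace_add subspace_diff subspace_scale Hs)
  from wd_second_difference_bound[OF wd_eta[OF d] wd_eta1[OF d] cont_eta[OF d] sq(3) _ AE_eta2 ab] pos
  show "\<bar>?d \<bullet> ?d\<bar> \<le> A * (4 * (b - a) * integral {a..b} N2) * norm ?d"
    unfolding inner_add_left[of _ _ ?d] inner_diff_left[of _ _ ?d] by (simp add: mult_ac)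
  show "0 \<le> A * (4 * (b - a) * integral {a..b} N2)"
    using pos ab integral_sqint_nonneg[OF sq(3) ab(1,3)] by simp
qed

text \<open>
  The consistency error of the time discretization; paired with a fixed element it is the truncation
  error of the residual, since the increments of \<open>u\<close> are integrals of \<open>R 0\<close>.
\<close>

definition "eps n = am \<nu> (\<lambda>n. R 0 (real n * \<tau>)) n - dif (\<lambda>n. u (real n * \<tau>)) n /\<^sub>R \<tau>"

lemma node_in: "n \<le> N \<Longrightarrow> real n * \<tau> \<in> {0..T}"
proof -
  assume "n \<le> N"
  then have "real n * \<tau> \<le> real N * \<tau>" using pos by (intro mult_right_mono) auto
  then have "real n * \<tau> \<le> T" using N\<tau> by linarith
  then show ?thesis using pos by simp
qed

lemma u_increment:
  assumes w: "w \<in> Hs" and ab: "0 \<le> a" "a < b" "b \<le> T"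
  shows "(u b - u a) \<bullet> w = integral {a..b} (\<lambda>t. R 0 t \<bullet> w)"
proof -
  obtain c where c: "AE t in lebesgue_on {a<..<b}. u t \<bullet> w = c + integral {a..t} (\<lambda>t. u1 t \<bullet> w)"
    using wd_subinterval[OF wdu(1)[OF w] ab(1,3)] by blast
  have i1: "integrable (lebesgue_on {0<..<T}) (\<lambda>t. u1 t \<bullet> w)" using wdu(1)[OF w] by (simp add: wd_def)
  have i1': "(\<lambda>t. u1 t \<bullet> w) integrable_on {a..b}"
    using integrable_on_subinterval_lebesgue(1)[OF i1 ab(1,3)] by (simp add: set_lebesgue_integral_eq_integral(1))
  have ci: "continuous_on {a..b} (\<lambda>t. integral {a..t} (\<lambda>t. u1 t \<bullet> w))"
    by (rule indefinite_integral_continuous_1[OF i1'])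
  have cu: "continuous_on {a..b} (\<lambda>t. u t \<bullet> w)" by (rule continuous_on_subset[OF cont(1)[OF w]]) (use ab in auto)
  have eq: "u t \<bullet> w - (c + integral {a..t} (\<lambda>t. u1 t \<bullet> w)) = 0" if "t \<in> {a..b}" for t
  proof -
    have "\<bar>u t \<bullet> w - (c + integral {a..t} (\<lambda>t. u1 t \<bullet> w))\<bar> \<le> 0"
    proof (rule AE_le_imp_le_continuous[OF ab(2) _ _ that])
      show "continuous_on {a..b} (\<lambda>t. \<bar>u t \<bullet> w - (c + integral {a..t} (\<lambda>t. u1 t \<bullet> w))\<bar>)"
        by (intro continuous_intros cu ci)
      show "AE t in lebesgue_on {a<..<b}. \<bar>u t \<bullet> w - (c + integral {a..t} (\<lambda>t. u1 t \<bullet> w))\<bar> \<le> 0"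
        using c by eventually_elim simp
    qed
    then show ?thesis by simp
  qed
  have "(u b - u a) \<bullet> w = integral {a..b} (\<lambda>t. u1 t \<bullet> w)"
    using eq[of a] eq[of b] ab by (simp add: inner_diff_left)
  also have "\<dots> = integral\<^sup>L (lebesgue_on {a<..<b}) (\<lambda>t. u1 t \<bullet> w)"
    using integrable_on_subinterval_lebesgue(3)[OF i1 ab(1,3)] by simp
  also have "\<dots> = integral\<^sup>L (lebesgue_on {a<..<b}) (\<lambda>t. R 0 t \<bullet> w)"
  proof (rule integral_cong_AE)
    have i2: "integrable (lebesgue_on {0<..<T}) (\<lambda>t. R 0 t \<bullet> w)" using wdR[OF w, of 0] by (simp add: wd_def)
    show "(\<lambda>t. R 0 t \<bullet> w) \<in> borel_measurable (lebesgue_on {a<..<b})"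
      using integrable_on_subinterval_lebesgue(2)[OF i2 ab(1,3)] by simp
    show "(\<lambda>t. u1 t \<bullet> w) \<in> borel_measurable (lebesgue_on {a<..<b})"
      using integrable_on_subinterval_lebesgue(2)[OF i1 ab(1,3)] by simp
    show "AE t in lebesgue_on {a<..<b}. u1 t \<bullet> w = R 0 t \<bullet> w"
      using AE_subinterval[OF eqn ab(1,3)] by eventually_elim simp
  qed
  also have "\<dots> = integral {a..b} (\<lambda>t. R 0 t \<bullet> w)"
  proof -
    have i2: "integrable (lebesgue_on {0<..<T}) (\<lambda>t. R 0 t \<bullet> w)" using wdR[OF w, of 0] by (simp add: wd_def)
    show ?thesis by (rule integrable_on_subinterval_lebesgue(3)[OF i2 ab(1,3)])
  qed
  finally show ?thesis .
qed

lemma inner_eps: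
  assumes n: "\<nu> - 1 \<le> n" "n \<le> N" and w: "w \<in> Hs"
  shows "eps n \<bullet> w = trunc \<nu> \<tau> (\<lambda>t. R 0 t \<bullet> w) (real n * \<tau>)"
proof -
  have n1: "1 \<le> n" using n \<nu> by auto
  have "(u (real n * \<tau>) - u (real (n - 1) * \<tau>)) \<bullet> w = integral {real (n - 1) * \<tau>..real n * \<tau>} (\<lambda>t. R 0 t \<bullet> w)"
    using n1 pos node_in[OF n(2)] by (intro u_increment[OF w]) auto
  moreover have "real (n - 1) * \<tau> = real n * \<tau> - \<tau>" using n1 by (simp add: of_nat_diff algebra_simps)
  moreover have "am \<nu> (\<lambda>n. R 0 (real n * \<tau>)) n \<bullet> w = (\<Sum>j<\<nu>. am_coeffs \<nu> ! j * (R 0 (real n * \<tau> - real j * \<tau>) \<bullet> w))"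
    unfolding am_def inner_sum_left inner_scaleR_left using n
    by (intro sum.cong refl) (auto simp: of_nat_diff left_diff_distrib)
  ultimately show ?thesis
    by (simp add: eps_def trunc_def dif_def inner_diff_left divide_inverse mult.commute)
qed

lemma eps_Hs: "n \<le> N \<Longrightarrow> eps n \<in> Hs"
  unfolding eps_def am_def dif_def
  by (intro subspace_diff[OF Hs] subspace_sum[OF Hs] subspace_scale[OF Hs] R0 VhHs(2) uV node_in) auto

lemma eps_le:
  assumes n: "\<nu> - 1 \<le> n" "n \<le> N"
  shows "norm (eps n) \<le> 20000 * \<tau> ^ (\<nu> - 1) * integral {real (n - (\<nu> - 1)) * \<tau>..real n * \<tau>} \<rho>0"
proof (rule norm_le_by_self)
  let ?w = "eps n"
  have w: "?w \<in> Hs" by (rule eps_Hs[OF n(2)])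
  have ab: "0 \<le> real (n - (\<nu> - 1)) * \<tau>" "real (n - (\<nu> - 1)) * \<tau> \<le> real n * \<tau>" "real n * \<tau> \<le> T"
    using pos node_in[OF n(2)] by (auto intro: mult_right_mono)
  have "\<bar>?w \<bullet> ?w\<bar> \<le> 20000 * \<tau> ^ (\<nu> - 1) * integral {real (n - (\<nu> - 1)) * \<tau>..real n * \<tau>} (\<lambda>s. \<bar>R \<nu> s \<bullet> ?w\<bar>)"
    unfolding inner_eps[OF n w]
    using trunc_le[OF \<nu> pos(2) n(1) ab(3), of "\<lambda>i t. R i t \<bullet> ?w"] wdR[OF w] cont(2)[OF w] by simp
  also have "\<dots> \<le> 20000 * \<tau> ^ (\<nu> - 1) * (norm ?w * integral {real (n - (\<nu> - 1)) * \<tau>..real n * \<tau>} \<rho>0)"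
  proof (intro mult_left_mono wd_integral_abs_le[OF _ sq(4) _ _ ab])
    show "integrable (lebesgue_on {0<..<T}) (\<lambda>t. R \<nu> t \<bullet> ?w)" using wdR[OF w, of \<nu>] by (simp add: wd_def)
    show "AE t in lebesgue_on {0<..<T}. \<bar>R \<nu> t \<bullet> ?w\<bar> \<le> norm ?w * \<rho>0 t"
      by (intro AE_I2, subst mult.commute, rule inner_le[OF R\<nu>(1)])
  qed (use pos in auto)
  finally show "\<bar>?w \<bullet> ?w\<bar> \<le> 20000 * \<tau> ^ (\<nu> - 1) * integral {real (n - (\<nu> - 1)) * \<tau>..real n * \<tau>} \<rho>0 * norm ?w"
    by (simp add: mult_ac)
  show "0 \<le> 20000 * \<tau> ^ (\<nu> - 1) * integral {real (n - (\<nu> - 1)) * \<tau>..real n * \<tau>} \<rho>0"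
    using integral_sqint_nonneg[OF sq(4) ab(1,3)] pos by simp
qed

lemma eps_dif_le:
  assumes n: "\<nu> \<le> n" "n \<le> N"
  shows "norm (dif eps n) \<le> 40000 * \<tau> ^ \<nu> * integral {real (n - \<nu>) * \<tau>..real n * \<tau>} \<rho>1"
proof (rule norm_le_by_self)
  let ?w = "dif eps n"
  have w: "?w \<in> Hs" unfolding dif_def using n by (intro subspace_diff[OF Hs] eps_Hs) auto
  have ab: "0 \<le> real (n - \<nu>) * \<tau>" "real (n - \<nu>) * \<tau> \<le> real n * \<tau>" "real n * \<tau> \<le> T"
    using pos node_in[OF n(2)] by (auto intro: mult_right_mono)
  have "?w \<bullet> ?w = trunc \<nu> \<tau> (\<lambda>t. R 0 t \<bullet> ?w) (real n * \<tau>) - trunc \<nu> \<tau> (\<lambda>t. R 0 t \<bullet> ?w) (real (n - 1) * \<tau>)"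
    using inner_eps[OF _ _ w, of n] inner_eps[OF _ _ w, of "n - 1"] n
    by (subst (1) dif_def) (simp add: inner_diff_left diff_le_mono)
  then have "\<bar>?w \<bullet> ?w\<bar> \<le> 40000 * \<tau> ^ \<nu> * integral {real (n - \<nu>) * \<tau>..real n * \<tau>} (\<lambda>s. \<bar>R (Suc \<nu>) s \<bullet> ?w\<bar>)"
    using trunc_dif_le[OF \<nu> pos(2) n(1) ab(3), of "\<lambda>i t. R i t \<bullet> ?w"] wdR[OF w] cont(2)[OF w] by simp
  also have "\<dots> \<le> 40000 * \<tau> ^ \<nu> * (norm ?w * integral {real (n - \<nu>) * \<tau>..real n * \<tau>} \<rho>1)"
  proof (intro mult_left_mono wd_integral_abs_le[OF _ sq(5) _ _ ab])
    show "integrable (lebesgue_on {0<..<T}) (\<lambda>t. R (Suc \<nu>) t \<bullet> ?w)" using wdR[OF w, of \<nu>] by (simp add: wd_def)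
    show "AE t in lebesgue_on {0<..<T}. \<bar>R (Suc \<nu>) t \<bullet> ?w\<bar> \<le> norm ?w * \<rho>1 t"
      by (intro AE_I2, subst mult.commute, rule inner_le[OF R\<nu>(2)])
  qed (use pos in auto)
  finally show "\<bar>?w \<bullet> ?w\<bar> \<le> 40000 * \<tau> ^ \<nu> * integral {real (n - \<nu>) * \<tau>..real n * \<tau>} \<rho>1 * norm ?w"
    by (simp add: mult_ac)
  show "0 \<le> 40000 * \<tau> ^ \<nu> * integral {real (n - \<nu>) * \<tau>..real n * \<tau>} \<rho>1"
    using integral_sqint_nonneg[OF sq(5) ab(1,3)] pos by simp
qed

end

section \<open>Discrete norms in time and the right-hand side\<close>

definition l2n :: "real \<Rightarrow> nat set \<Rightarrow> (nat \<Rightarrow> 'a::real_normed_vector) \<Rightarrow> real" where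
  "l2n \<tau> I X = sqrt \<tau> * L2_set (\<lambda>n. norm (X n)) I"

lemma l2n_nonneg: "0 \<le> \<tau> \<Longrightarrow> 0 \<le> l2n \<tau> I X"
  by (simp add: l2n_def L2_set_nonneg)

lemma l2n_sq: "0 \<le> \<tau> \<Longrightarrow> (l2n \<tau> I X)\<^sup>2 = \<tau> * (\<Sum>n\<in>I. (norm (X n))\<^sup>2)"
  by (simp add: l2n_def L2_set_def power_mult_distrib sum_nonneg)

lemma l2n_leI: "0 \<le> \<tau> \<Longrightarrow> 0 \<le> B \<Longrightarrow> \<tau> * (\<Sum>n\<in>I. (norm (X n))\<^sup>2) \<le> B\<^sup>2 \<Longrightarrow> l2n \<tau> I X \<le> B"
  by (rule power2_le_imp_le) (simp_all add: l2n_sq)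

lemma l2n_triangle:
  assumes "0 \<le> \<tau>"
  shows "l2n \<tau> I (\<lambda>n. X n + Y n) \<le> l2n \<tau> I X + l2n \<tau> I Y"
proof -
  have "L2_set (\<lambda>n. norm (X n + Y n)) I \<le> L2_set (\<lambda>n. norm (X n) + norm (Y n)) I"
    by (intro L2_set_mono norm_triangle_ineq) simp_all
  also have "\<dots> \<le> L2_set (\<lambda>n. norm (X n)) I + L2_set (\<lambda>n. norm (Y n)) I" by (rule L2_set_triangle_ineq)
  finally show ?thesis using assms by (simp add: l2n_def distrib_left[symmetric] mult_left_mono)
qed

lemma l2n_cong: "(\<And>n. n \<in> I \<Longrightarrow> X n = Y n) \<Longrightarrow> l2n \<tau> I X = l2n \<tau> I Y"
  by (simp add: l2n_def cong: L2_set_cong)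

lemma l2n_mono_set: "0 \<le> \<tau> \<Longrightarrow> finite J \<Longrightarrow> I \<subseteq> J \<Longrightarrow> l2n \<tau> I X \<le> l2n \<tau> J X"
  unfolding l2n_def L2_set_def by (intro mult_left_mono real_sqrt_le_mono sum_mono2) auto

lemma l2n_cauchy_schwarz:
  assumes "0 \<le> \<tau>"
  shows "\<tau> * (\<Sum>n\<in>I. norm (X n) * norm (Y n)) \<le> l2n \<tau> I X * l2n \<tau> I Y"
proof -
  have "(\<Sum>n\<in>I. norm (X n) * norm (Y n)) \<le> L2_set (\<lambda>n. norm (X n)) I * L2_set (\<lambda>n. norm (Y n)) I"
    using L2_set_mult_ineq[of "\<lambda>n. norm (X n)" "\<lambda>n. norm (Y n)" I] by simp
  note * = mult_left_mono[OF this assms]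
  have eq: "l2n \<tau> I X * l2n \<tau> I Y = (sqrt \<tau> * sqrt \<tau>) * (L2_set (\<lambda>n. norm (X n)) I * L2_set (\<lambda>n. norm (Y n)) I)"
    by (simp only: l2n_def mult_ac)
  show ?thesis unfolding eq using * assms by simp
qed

lemma sum_norm_le_l2n:
  assumes "0 \<le> \<tau>" "finite I" "real (card I) * \<tau> \<le> T"
  shows "\<tau> * (\<Sum>n\<in>I. norm (X n)) \<le> sqrt T * l2n \<tau> I X"
proof -
  have "\<tau> * (\<Sum>n\<in>I. norm (X n) * norm (1::real)) \<le> l2n \<tau> I X * l2n \<tau> I (\<lambda>n. 1::real)"
    by (rule l2n_cauchy_schwarz[OF assms(1)])
  also have "l2n \<tau> I (\<lambda>n. 1::real) = sqrt (real (card I) * \<tau>)"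
    by (simp add: l2n_def L2_set_def real_sqrt_mult)
  also have "l2n \<tau> I X * sqrt (real (card I) * \<tau>) \<le> l2n \<tau> I X * sqrt T"
    using assms by (intro mult_left_mono real_sqrt_le_mono l2n_nonneg)
  finally show ?thesis by (simp add: mult.commute)
qed

lemma l2n_am_le:
  assumes \<nu>: "\<nu> \<in> {3, 4, 5}" and l: "\<nu> - 1 \<le> l" and \<tau>: "0 \<le> \<tau>"
  shows "l2n \<tau> {l..N} (am \<nu> X) \<le> 5 * l2n \<tau> {l - (\<nu> - 1)..N} X"
proof (rule l2n_leI[OF \<tau>])
  let ?S = "\<Sum>i\<in>{l - (\<nu> - 1)..N}. (norm (X i))\<^sup>2"
  have "(\<Sum>n\<in>{l..N}. (norm (am \<nu> X n))\<^sup>2) \<le> (\<Sum>n\<in>{l..N}. 5 * (\<Sum>j<\<nu>. (norm (X (n - j)))\<^sup>2))"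
  proof (rule sum_mono)
    fix n
    have "(norm (am \<nu> X n))\<^sup>2 \<le> (\<Sum>j<\<nu>. norm (X (n - j)))\<^sup>2" by (intro power_mono norm_am_le \<nu>) simp
    also have "\<dots> \<le> (\<Sum>j<\<nu>. (norm (X (n - j)))\<^sup>2) * real \<nu>"
      using sum_squared_le_sum_of_squares[of _ "{..<\<nu>}"] by simp
    also have "\<dots> \<le> (\<Sum>j<\<nu>. (norm (X (n - j)))\<^sup>2) * 5" using \<nu> by (intro mult_left_mono) (auto intro: sum_nonneg)
    finally show "(norm (am \<nu> X n))\<^sup>2 \<le> 5 * (\<Sum>j<\<nu>. (norm (X (n - j)))\<^sup>2)" by simp
  qed
  also have "\<dots> = 5 * (\<Sum>j<\<nu>. \<Sum>n\<in>{l..N}. (norm (X (n - j)))\<^sup>2)"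
    unfolding sum_distrib_left[symmetric] by (subst sum.swap) simp
  also have "\<dots> \<le> 5 * (\<Sum>j<\<nu>. ?S)"
  proof (intro mult_left_mono sum_mono)
    fix j assume j: "j \<in> {..<\<nu>}"
    have "(\<Sum>n\<in>{l..N}. (norm (X (n - j)))\<^sup>2) = (\<Sum>k\<in>(\<lambda>n. n - j) ` {l..N}. (norm (X k))\<^sup>2)"
    proof (rule sum.reindex[unfolded o_def, symmetric], rule inj_onI)
      fix x y assume "x \<in> {l..N}" "y \<in> {l..N}" "x - j = y - j"
      then show "x = y" using j l by auto
    qed
    also have "\<dots> \<le> ?S" using j by (intro sum_mono2) auto
    finally show "(\<Sum>n\<in>{l..N}. (norm (X (n - j)))\<^sup>2) \<le> ?S" .
  qed simp
  also have "\<dots> \<le> 5 * (5 * ?S)" using \<nu> by (auto intro!: mult_right_mono sum_nonneg)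
  finally have "\<tau> * (\<Sum>n\<in>{l..N}. (norm (am \<nu> X n))\<^sup>2) \<le> \<tau> * (5 * (5 * ?S))" using \<tau> by (rule mult_left_mono)
  also have "\<dots> = (5 * l2n \<tau> {l - (\<nu> - 1)..N} X)\<^sup>2" using \<tau> by (simp add: power_mult_distrib l2n_sq)
  finally show "\<tau> * (\<Sum>n\<in>{l..N}. (norm (am \<nu> X n))\<^sup>2) \<le> (5 * l2n \<tau> {l - (\<nu> - 1)..N} X)\<^sup>2" .
qed (simp add: l2n_nonneg \<tau>)

lemma window_l2n:
  assumes "0 < \<tau>" "real N * \<tau> \<le> T" "sqint T \<phi>" "0 \<le> c"
    and "\<And>n. n \<in> I \<Longrightarrow> m \<le> n \<and> n \<le> N \<and> norm (X n) \<le> c * integral {real (n - m) * \<tau>..real n * \<tau>} \<phi>"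
  shows "l2n \<tau> I X \<le> c * real m * \<tau> * sqnorm T \<phi>"
proof (rule l2n_leI)
  show "\<tau> * (\<Sum>n\<in>I. (norm (X n))\<^sup>2) \<le> (c * real m * \<tau> * sqnorm T \<phi>)\<^sup>2"
    by (rule window_l2[OF assms(1-4)], rule norm_ge_zero, rule assms(5))
qed (use assms sqnorm_nonneg[of T \<phi>] in simp_all)

lemma summation_by_parts:
  fixes f x :: "nat \<Rightarrow> 'a::real_inner"
  assumes "l \<le> m" "x (l - 1) = 0" "1 \<le> l"
  shows "(\<Sum>n\<in>{l..m}. f n \<bullet> dif x n) = f m \<bullet> x m - (\<Sum>n\<in>{Suc l..m}. dif f n \<bullet> x (n - 1))"
  using assms(1)
proof (induction m rule: dec_induct)
  case base
  then show ?case using assms by (simp add: dif_def)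
next
  case (step m)
  then show ?case by (simp add: dif_def inner_diff_left inner_diff_right)
qed

context am_error
begin

definition "en n = eta (real n * \<tau>)"

text \<open>
  The discrete error, in \<open>Vh\<close>, as opposed to the projection error \<open>en\<close>; extended by zero so that it is
  defined for every index.
\<close>

definition "err n = (if n \<le> N then U n - P (u (real n * \<tau>)) else 0)"

definition "fh n = (if \<nu> - 1 \<le> n \<and> n \<le> N then eps n + dif en n /\<^sub>R \<tau> + G (am \<nu> en n) else 0)"

lemma G_am: "G (am \<nu> X n) = am \<nu> (\<lambda>n. G (X n)) n"
  by (simp add: am_def linear_sum[OF linG] linear_scale[OF linG])

lemma am_add: "am \<nu> (\<lambda>n. X n + Y n) n = am \<nu> X n + am \<nu> Y n"
  by (simp add: am_def scaleR_add_right sum.distrib)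

lemma am_minus: "am \<nu> (\<lambda>n. X n - Y n) n = am \<nu> X n - am \<nu> Y n"
  by (simp add: am_def scaleR_diff_right sum_subtractf)

lemma am_cong: "(\<And>j. j < \<nu> \<Longrightarrow> X (n - j) = Y (n - j)) \<Longrightarrow> am \<nu> X n = am \<nu> Y n"
  unfolding am_def by (intro sum.cong) auto

lemma err_0: "n < \<nu> - 1 \<Longrightarrow> err n = 0"
  using init by (simp add: err_def)

lemma err_in_Vh: "err n \<in> Vh"
  unfolding err_def using UVh P(1) Vh(1) by (auto intro: subspace_diff subspace_0)

lemma \<nu>1: "1 \<le> \<nu> - 1" "\<nu> - 1 < \<nu>" "\<nu> - 1 \<le> 4"
  using \<nu> by auto

lemma scheme_err:
  assumes n: "n \<le> N" and w: "w \<in> Vh"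
  shows "(dif err n /\<^sub>R \<tau> + G (am \<nu> err n)) \<bullet> (w + \<delta> *\<^sub>R G w) = fh n \<bullet> (w + \<delta> *\<^sub>R G w)"
proof (cases "n < \<nu> - 1")
  case True
  have "am \<nu> err n = 0" unfolding am_def using True err_0 by (intro sum.neutral) auto
  moreover have "dif err n = 0" using True err_0 by (simp add: dif_def)
  ultimately show ?thesis using True by (simp add: fh_def linear_0[OF linG])
next
  case False
  let ?t = "\<lambda>n. real n * \<tau>"
  have err: "err k = U k - u (?t k) + en k" if "k \<le> N" for k using that by (simp add: err_def en_def eta_def)
  have "am \<nu> err n = am \<nu> (\<lambda>k. U k - u (?t k) + en k) n" using n by (intro am_cong err) auto
  then have 1: "am \<nu> err n = am \<nu> U n - am \<nu> (\<lambda>k. u (?t k)) n + am \<nu> en n" by (simp add: am_add am_minus)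
  have 2: "dif err n = dif U n - dif (\<lambda>k. u (?t k)) n + dif en n" using n by (simp add: dif_def err)
  have "dif err n /\<^sub>R \<tau> + G (am \<nu> err n) = (dif U n /\<^sub>R \<tau> + G (am \<nu> U n))
      - dif (\<lambda>k. u (?t k)) n /\<^sub>R \<tau> - G (am \<nu> (\<lambda>k. u (?t k)) n) + (dif en n /\<^sub>R \<tau> + G (am \<nu> en n))"
    unfolding 1 2 by (simp add: linear_add[OF linG] linear_diff[OF linG] algebra_simps)
  moreover have "(dif U n /\<^sub>R \<tau> + G (am \<nu> U n)) \<bullet> (w + \<delta> *\<^sub>R G w)
    = (am \<nu> (\<lambda>k. R 0 (?t k)) n + G (am \<nu> (\<lambda>k. u (?t k)) n)) \<bullet> (w + \<delta> *\<^sub>R G w)"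
    using scheme[OF _ n w] False by (simp add: am_add G_am)
  ultimately show ?thesis
    using False n by (simp add: fh_def eps_def inner_add_left inner_diff_left)
qed

sublocale sch: am_scheme G Vh \<nu> N \<tau> \<delta> h CG Cd err fh
proof (rule am_scheme.intro)
  show "linear G" "subspace Vh" by (rule linG Vh)+
  show "G w \<bullet> z = - (w \<bullet> G z)" if "w \<in> Vh" "z \<in> Vh" for w z using that by (intro skewV VhHs)
  show "err 0 = 0" using err_0 \<nu>1 by simp
  show "fh 0 = 0" using \<nu> by (auto simp: fh_def)
qed (use pos \<delta> \<nu> inv err_in_Vh scheme_err in auto)

abbreviation "S0 \<equiv> sqnorm T N0"
abbreviation "S1 \<equiv> sqnorm T N1"
abbreviation "S2 \<equiv> sqnorm T N2"

text \<open>
  Bounds, in this order, for the discrete \<open>\<ell>\<^sup>2\<close> norms in time of the consistency error, of the projection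
  error, of the right-hand side \<open>fh\<close>, of its difference quotient, and for its maximum.
\<close>

definition "ae = 80000 * \<tau> ^ \<nu> * sqnorm T \<rho>0"
definition "ah = 4 * A * (S0 + 2 * \<tau> * S1)"
definition "af = ae + 2 * A * S1 + 5 * (ah / h)"
definition "aDf = 200000 * \<tau> ^ \<nu> * sqnorm T \<rho>1 + 16 * A * S2 + 10 * (A / h) * S1"
definition "asup = 80000 * \<tau> ^ \<nu> * L\<rho> + 2 * A * L1 + 5 * (A / h * L0)"

lemma S_nonneg: "0 \<le> S0" "0 \<le> S1" "0 \<le> S2"
  by (rule sqnorm_nonneg)+

lemma l2n_eps: "l2n \<tau> {\<nu> - 1..N} eps \<le> ae"
proof -
  have "l2n \<tau> {\<nu> - 1..N} eps \<le> 20000 * \<tau> ^ (\<nu> - 1) * real (\<nu> - 1) * \<tau> * sqnorm T \<rho>0"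
    using eps_le pos by (intro window_l2n[OF pos(2) N\<tau> sq(4)]) auto
  also have "\<dots> = 20000 * real (\<nu> - 1) * (\<tau> ^ \<nu> * sqnorm T \<rho>0)"
    using \<nu> by (auto simp: numeral_eq_Suc)
  also have "\<dots> \<le> 80000 * (\<tau> ^ \<nu> * sqnorm T \<rho>0)"
    using \<nu>1 pos sqnorm_nonneg by (intro mult_right_mono) auto
  finally show ?thesis by (simp add: ae_def)
qed

lemma l2n_eps_dif: "l2n \<tau> {\<nu>..N} (\<lambda>n. dif eps n /\<^sub>R \<tau>) \<le> 200000 * \<tau> ^ \<nu> * sqnorm T \<rho>1"
proof -
  have "l2n \<tau> {\<nu>..N} (\<lambda>n. dif eps n /\<^sub>R \<tau>) \<le> (40000 * \<tau> ^ \<nu> / \<tau>) * real \<nu> * \<tau> * sqnorm T \<rho>1"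
  proof (intro window_l2n[OF pos(2) N\<tau> sq(5)])
    fix n assume "n \<in> {\<nu>..N}"
    then show "\<nu> \<le> n \<and> n \<le> N \<and> norm (dif eps n /\<^sub>R \<tau>) \<le> 40000 * \<tau> ^ \<nu> / \<tau> * integral {real (n - \<nu>) * \<tau>..real n * \<tau>} \<rho>1"
      using eps_dif_le[of n] pos by (simp add: field_simps)
  qed (use pos in simp)
  also have "\<dots> = 40000 * real \<nu> * (\<tau> ^ \<nu> * sqnorm T \<rho>1)" using pos by simp
  also have "\<dots> \<le> 200000 * (\<tau> ^ \<nu> * sqnorm T \<rho>1)"
    using \<nu> pos sqnorm_nonneg by (intro mult_right_mono) auto
  finally show ?thesis by simp
qed

lemma step_interval:
  assumes "1 \<le> n" "n \<le> N"
  shows "0 \<le> real (n - 1) * \<tau>" "real (n - 1) * \<tau> < real n * \<tau>" "real n * \<tau> \<le> T" "real n * \<tau> - real (n - 1) * \<tau> = \<tau>"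
  using assms pos node_in[of n] by (auto simp: of_nat_diff algebra_simps)

lemma dif_en_le:
  assumes "1 \<le> n" "n \<le> N"
  shows "norm (dif en n) \<le> A * (2 * integral {real (n - 1) * \<tau>..real n * \<tau>} N1)"
    "norm (G (dif en n)) \<le> A / h * (2 * integral {real (n - 1) * \<tau>..real n * \<tau>} N1)"
  using eta_dif[OF step_interval(1-3)[OF assms]] by (simp_all add: dif_def en_def)

lemma l2n_dif_en: "l2n \<tau> {1..N} (\<lambda>n. dif en n /\<^sub>R \<tau>) \<le> 2 * A * S1"
  "l2n \<tau> {1..N} (\<lambda>n. G (dif en n /\<^sub>R \<tau>)) \<le> 2 * (A / h) * S1"
proof -
  have mult_2_div: "x * (2 * y) / \<tau> = 2 * x / \<tau> * y" for x y by simp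
  have "l2n \<tau> {1..N} (\<lambda>n. dif en n /\<^sub>R \<tau>) \<le> (2 * A / \<tau>) * real 1 * \<tau> * S1"
  proof (rule window_l2n[OF pos(2) N\<tau> sq(2)])
    fix n assume "n \<in> {1..N}"
    then have n: "1 \<le> n" "n \<le> N" by auto
    have "norm (dif en n /\<^sub>R \<tau>) = norm (dif en n) / \<tau>" using pos by (simp add: divide_inverse mult.commute)
    also have "\<dots> \<le> A * (2 * integral {real (n - 1) * \<tau>..real n * \<tau>} N1) / \<tau>"
      using pos by (intro divide_right_mono dif_en_le(1) n) simp
    also have "\<dots> = 2 * A / \<tau> * integral {real (n - 1) * \<tau>..real n * \<tau>} N1" by (rule mult_2_div)
    finally show "1 \<le> n \<and> n \<le> N \<and> norm (dif en n /\<^sub>R \<tau>) \<le> 2 * A / \<tau> * integral {real (n - 1) * \<tau>..real n * \<tau>} N1"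
      using n by blast
  qed (use pos in simp)
  then show "l2n \<tau> {1..N} (\<lambda>n. dif en n /\<^sub>R \<tau>) \<le> 2 * A * S1" using pos by simp
  have "l2n \<tau> {1..N} (\<lambda>n. G (dif en n /\<^sub>R \<tau>)) \<le> (2 * (A / h) / \<tau>) * real 1 * \<tau> * S1"
  proof (rule window_l2n[OF pos(2) N\<tau> sq(2)])
    fix n assume "n \<in> {1..N}"
    then have n: "1 \<le> n" "n \<le> N" by auto
    have "norm (G (dif en n /\<^sub>R \<tau>)) = norm (G (dif en n)) / \<tau>"
      using pos by (simp add: linear_scale[OF linG] divide_inverse mult.commute)
    also have "\<dots> \<le> A / h * (2 * integral {real (n - 1) * \<tau>..real n * \<tau>} N1) / \<tau>"
      using pos by (intro divide_right_mono dif_en_le(2) n) simp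
    also have "\<dots> = 2 * (A / h) / \<tau> * integral {real (n - 1) * \<tau>..real n * \<tau>} N1" by (rule mult_2_div)
    finally show "1 \<le> n \<and> n \<le> N \<and> norm (G (dif en n /\<^sub>R \<tau>)) \<le> 2 * (A / h) / \<tau> * integral {real (n - 1) * \<tau>..real n * \<tau>} N1"
      using n by blast
  qed (use pos in simp)
  then show "l2n \<tau> {1..N} (\<lambda>n. G (dif en n /\<^sub>R \<tau>)) \<le> 2 * (A / h) * S1" using pos by simp
qed

lemma l2n_dif2_en: "l2n \<tau> {\<nu>..N} (\<lambda>n. dif (\<lambda>n. dif en n /\<^sub>R \<tau>) n /\<^sub>R \<tau>) \<le> 16 * A * S2"
proof -
  have arith: "A * (4 * (2 * \<tau>) * y) / \<tau> / \<tau> = 8 * A / \<tau> * y" for y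
    using pos by (simp add: field_simps)
  have "l2n \<tau> {\<nu>..N} (\<lambda>n. dif (\<lambda>n. dif en n /\<^sub>R \<tau>) n /\<^sub>R \<tau>) \<le> (8 * A / \<tau>) * real 2 * \<tau> * S2"
  proof (intro window_l2n[OF pos(2) N\<tau> sq(3)])
    fix n assume n: "n \<in> {\<nu>..N}"
    then have n2: "2 \<le> n" "n \<le> N" using \<nu> by auto
    let ?a = "real (n - 2) * \<tau>" and ?b = "real n * \<tau>"
    have ab: "0 \<le> ?a" "?a < ?b" "?b \<le> T" using n2 pos node_in[of n] by auto
    have mid: "(?a + ?b) / 2 = real (n - 1) * \<tau>" "?b - ?a = 2 * \<tau>" using n2 by (simp_all add: of_nat_diff field_simps)
    have "dif (\<lambda>n. dif en n /\<^sub>R \<tau>) n = (eta ?b - 2 *\<^sub>R eta ((?a + ?b) / 2) + eta ?a) /\<^sub>R \<tau>"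
    proof -
      have e2: "n - 1 - 1 = n - 2" by simp
      have "x - y - (y - z) = x - 2 *\<^sub>R y + z" for x y z :: 'a
        by (simp add: scaleR_2)
      then show ?thesis unfolding mid dif_def en_def e2 scaleR_diff_right[symmetric] by simp
    qed
    note eq = this
    have nrm: "norm (x /\<^sub>R \<tau>) = norm x / \<tau>" for x :: 'a using pos by (simp add: divide_inverse mult.commute)
    have "norm (dif (\<lambda>n. dif en n /\<^sub>R \<tau>) n /\<^sub>R \<tau>) = norm (eta ?b - 2 *\<^sub>R eta ((?a + ?b) / 2) + eta ?a) / \<tau> / \<tau>"
      unfolding eq nrm ..
    also have "\<dots> \<le> (A * (4 * (2 * \<tau>) * integral {?a..?b} N2)) / \<tau> / \<tau>"
      using pos eta_dif2[OF ab] unfolding mid(2) by (intro divide_right_mono) simp_all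
    also have "\<dots> = 8 * A / \<tau> * integral {?a..?b} N2" by (rule arith)
    finally show "2 \<le> n \<and> n \<le> N \<and> norm (dif (\<lambda>n. dif en n /\<^sub>R \<tau>) n /\<^sub>R \<tau>) \<le> 8 * A / \<tau> * integral {?a..?b} N2"
      using n2 by blast
  qed (use pos in simp)
  then show ?thesis using pos by simp
qed

text \<open>
  Values at the nodes are averaged over the adjacent time step; this costs the term with the time
  derivative, with a factor \<tau>.
\<close>

lemma l2n_point:
  assumes N: "1 \<le> N" and c: "0 \<le> c"
    and w: "\<And>a b t. 0 \<le> a \<Longrightarrow> a < b \<Longrightarrow> b \<le> T \<Longrightarrow> t \<in> {a..b} \<Longrightarrow>
      norm (w t) \<le> c * integral {a..b} (\<lambda>s. N0 s / (b - a) + 2 * N1 s)"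
  shows "l2n \<tau> {..N} (\<lambda>n. w (real n * \<tau>)) \<le> 4 * c * (S0 + 2 * \<tau> * S1)"
proof -
  let ?\<phi> = "\<lambda>s. 1 / \<tau> * N0 s + 2 * N1 s"
  have sq1: "sqint T (\<lambda>s. 1 / \<tau> * N0 s)" "sqint T (\<lambda>s. 2 * N1 s)"
    by (rule sqint_mult[OF sq(1)], use pos in simp) (rule sqint_mult[OF sq(2)], simp)
  note \<phi> = sqint_add[OF sq1]
  have n\<phi>: "\<tau> * sqnorm T ?\<phi> \<le> 2 * (S0 + 2 * \<tau> * S1)"
  proof -
    have "sqnorm T ?\<phi> \<le> 2 * (1 / \<tau> * S0 + 2 * S1)"
      using \<phi>(2) sqnorm_mult[of "1 / \<tau>" T N0] sqnorm_mult[of 2 T N1] pos by simp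
    from mult_left_mono[OF this, of \<tau>] have "\<tau> * sqnorm T ?\<phi> \<le> \<tau> * (2 * (1 / \<tau> * S0 + 2 * S1))" using pos by simp
    also have "\<dots> = 2 * (S0 + 2 * \<tau> * S1)" using pos by (simp add: field_simps)
    finally show ?thesis .
  qed
  have w': "norm (w t) \<le> c * integral {real (n - 1) * \<tau>..real n * \<tau>} ?\<phi>"
    if "1 \<le> n" "n \<le> N" "t \<in> {real (n - 1) * \<tau>..real n * \<tau>}" for n t
    using w[OF step_interval(1-3)[OF that(1,2)] that(3)] unfolding step_interval(4)[OF that(1,2)] by simp
  have "l2n \<tau> {1..N} (\<lambda>n. w (real n * \<tau>)) \<le> c * real 1 * \<tau> * sqnorm T ?\<phi>"
  proof (intro window_l2n[OF pos(2) N\<tau> \<phi>(1) c])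
    fix n assume "n \<in> {1..N}"
    then show "1 \<le> n \<and> n \<le> N \<and> norm (w (real n * \<tau>)) \<le> c * integral {real (n - 1) * \<tau>..real n * \<tau>} ?\<phi>"
      using w'[of n "real n * \<tau>"] step_interval(2)[of n] by auto
  qed
  then have 1: "l2n \<tau> {1..N} (\<lambda>n. w (real n * \<tau>)) \<le> c * (\<tau> * sqnorm T ?\<phi>)" by simp
  have "l2n \<tau> {1} (\<lambda>n. w 0) \<le> c * real 1 * \<tau> * sqnorm T ?\<phi>"
  proof (intro window_l2n[OF pos(2) N\<tau> \<phi>(1) c])
    fix n :: nat assume "n \<in> {1}"
    then show "1 \<le> n \<and> n \<le> N \<and> norm (w 0) \<le> c * integral {real (n - 1) * \<tau>..real n * \<tau>} ?\<phi>"
      using w'[of 1 0] N pos by auto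
  qed
  then have 0: "l2n \<tau> {1} (\<lambda>n. w 0) \<le> c * (\<tau> * sqnorm T ?\<phi>)" by simp
  have "l2n \<tau> {..N} (\<lambda>n. w (real n * \<tau>)) \<le> 2 * (c * (\<tau> * sqnorm T ?\<phi>))"
  proof (rule l2n_leI)
    have "\<tau> * (\<Sum>n\<in>{..N}. (norm (w (real n * \<tau>)))\<^sup>2) = (l2n \<tau> {1} (\<lambda>n. w 0))\<^sup>2 + (l2n \<tau> {1..N} (\<lambda>n. w (real n * \<tau>)))\<^sup>2"
    proof -
      have "{..N} = insert 0 {1..N}" by auto
      then show ?thesis using pos by (simp add: l2n_sq distrib_left)
    qed
    also have "\<dots> \<le> (c * (\<tau> * sqnorm T ?\<phi>))\<^sup>2 + (c * (\<tau> * sqnorm T ?\<phi>))\<^sup>2"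
      using 0 1 pos by (intro add_mono power_mono l2n_nonneg) auto
    also have "\<dots> \<le> (2 * (c * (\<tau> * sqnorm T ?\<phi>)))\<^sup>2" unfolding power_mult_distrib[of 2] by simp
    finally show "\<tau> * (\<Sum>n\<in>{..N}. (norm (w (real n * \<tau>)))\<^sup>2) \<le> (2 * (c * (\<tau> * sqnorm T ?\<phi>)))\<^sup>2" .
  qed (use pos c sqnorm_nonneg in auto)
  also have "\<dots> \<le> 2 * (c * (2 * (S0 + 2 * \<tau> * S1)))"
    using n\<phi> c by (intro mult_left_mono) auto
  finally show ?thesis by (simp add: algebra_simps)
qed

lemma l2n_en:
  assumes "1 \<le> N"
  shows "l2n \<tau> {..N} en \<le> ah" "l2n \<tau> {..N} (\<lambda>n. G (en n)) \<le> ah / h"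
  using l2n_point[OF assms, of A eta] l2n_point[OF assms, of "A / h" "\<lambda>t. G (eta t)"] pos eta_point
  unfolding en_def ah_def by simp_all

lemma l2n_am_en:
  assumes "1 \<le> N"
  shows "l2n \<tau> {\<nu> - 1..N} (am \<nu> en) \<le> 5 * ah" "l2n \<tau> {\<nu> - 1..N} (\<lambda>n. G (am \<nu> en n)) \<le> 5 * (ah / h)"
  using l2n_am_le[OF \<nu> order.refl, of \<tau> N en] l2n_am_le[OF \<nu> order.refl, of \<tau> N "\<lambda>n. G (en n)"] pos l2n_en[OF assms]
  by (simp_all add: G_am atLeast0AtMost)

lemma l2n_fh:
  assumes "1 \<le> N"
  shows "l2n \<tau> {\<nu> - 1..N} fh \<le> af"
proof -
  have \<tau>: "0 \<le> \<tau>" using pos by simp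
  have "l2n \<tau> {\<nu> - 1..N} fh = l2n \<tau> {\<nu> - 1..N} (\<lambda>n. (eps n + dif en n /\<^sub>R \<tau>) + G (am \<nu> en n))"
    by (intro l2n_cong) (simp add: fh_def)
  also have "\<dots> \<le> l2n \<tau> {\<nu> - 1..N} eps + l2n \<tau> {\<nu> - 1..N} (\<lambda>n. dif en n /\<^sub>R \<tau>) + l2n \<tau> {\<nu> - 1..N} (\<lambda>n. G (am \<nu> en n))"
    by (intro order.trans[OF l2n_triangle[OF \<tau>]] add_right_mono l2n_triangle \<tau>)
  also have "l2n \<tau> {\<nu> - 1..N} (\<lambda>n. dif en n /\<^sub>R \<tau>) \<le> 2 * A * S1"
    using \<nu>1 by (intro order.trans[OF l2n_mono_set l2n_dif_en(1)] \<tau>) auto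
  finally show ?thesis using l2n_eps l2n_am_en(2)[OF assms] by (simp add: af_def)
qed

lemma l2n_dif_fh: "l2n \<tau> {\<nu>..N} (\<lambda>n. dif fh n /\<^sub>R \<tau>) \<le> aDf"
proof -
  have \<tau>: "0 \<le> \<tau>" using pos by simp
  have "l2n \<tau> {\<nu>..N} (\<lambda>n. dif fh n /\<^sub>R \<tau>) = l2n \<tau> {\<nu>..N} (\<lambda>n. (dif eps n /\<^sub>R \<tau> + dif (\<lambda>n. dif en n /\<^sub>R \<tau>) n /\<^sub>R \<tau>)
      + am \<nu> (\<lambda>n. G (dif en n /\<^sub>R \<tau>)) n)"
  proof (rule l2n_cong)
    fix n assume n: "n \<in> {\<nu>..N}"
    have "am \<nu> (\<lambda>n. G (dif en n /\<^sub>R \<tau>)) n = (G (am \<nu> en n) - G (am \<nu> en (n - 1))) /\<^sub>R \<tau>"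
      unfolding linear_diff[OF linG, symmetric] am_dif[symmetric] G_am[symmetric]
      by (simp add: linear_scale[OF linG, symmetric] am_def scaleR_sum_right mult.commute)
    moreover have "\<nu> - 1 \<le> n" "n \<le> N" "\<nu> - 1 \<le> n - 1" "n - 1 \<le> N" using n \<nu>1 by auto
    ultimately show "dif fh n /\<^sub>R \<tau> = (dif eps n /\<^sub>R \<tau> + dif (\<lambda>n. dif en n /\<^sub>R \<tau>) n /\<^sub>R \<tau>) + am \<nu> (\<lambda>n. G (dif en n /\<^sub>R \<tau>)) n"
      by (simp add: dif_def[of fh] fh_def dif_def[of eps] dif_def[of "\<lambda>n. dif en n /\<^sub>R \<tau>"] algebra_simps)
  qed
  also have "\<dots> \<le> l2n \<tau> {\<nu>..N} (\<lambda>n. dif eps n /\<^sub>R \<tau>) + l2n \<tau> {\<nu>..N} (\<lambda>n. dif (\<lambda>n. dif en n /\<^sub>R \<tau>) n /\<^sub>R \<tau>)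
      + l2n \<tau> {\<nu>..N} (am \<nu> (\<lambda>n. G (dif en n /\<^sub>R \<tau>)))"
    by (intro order.trans[OF l2n_triangle[OF \<tau>]] add_right_mono l2n_triangle \<tau>)
  also have "l2n \<tau> {\<nu>..N} (am \<nu> (\<lambda>n. G (dif en n /\<^sub>R \<tau>))) \<le> 5 * l2n \<tau> {\<nu> - (\<nu> - 1)..N} (\<lambda>n. G (dif en n /\<^sub>R \<tau>))"
    using \<nu>1 by (intro l2n_am_le \<nu> \<tau>) auto
  also have "\<nu> - (\<nu> - 1) = 1" using \<nu>1 by simp
  finally show ?thesis using l2n_eps_dif l2n_dif2_en l2n_dif_en(2) by (simp add: aDf_def)
qed

lemma fh_sup:
  shows "norm (fh n) \<le> asup"
proof (cases "\<nu> - 1 \<le> n \<and> n \<le> N")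
  case False
  then show ?thesis using pos L unfolding fh_def asup_def by (auto intro!: add_nonneg_nonneg mult_nonneg_nonneg)
next
  case True
  then have n: "\<nu> - 1 \<le> n" "n \<le> N" "1 \<le> n" using \<nu>1 by auto
  have nT: "real n * \<tau> \<le> T" using node_in[OF n(2)] by simp
  have 1: "norm (eps n) \<le> 80000 * \<tau> ^ \<nu> * L\<rho>"
  proof -
    have "norm (eps n) \<le> 20000 * \<tau> ^ (\<nu> - 1) * integral {real (n - (\<nu> - 1)) * \<tau>..real n * \<tau>} \<rho>0" by (rule eps_le[OF n(1,2)])
    also have "\<dots> \<le> 20000 * \<tau> ^ (\<nu> - 1) * (real (\<nu> - 1) * \<tau> * L\<rho>)"
      using \<nu>1 pos by (intro mult_left_mono window_sup[OF pos(2) n(1) nT sq(4) sup(3)]) auto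
    also have "\<dots> = 20000 * real (\<nu> - 1) * (\<tau> ^ \<nu> * L\<rho>)" using \<nu> by (auto simp: numeral_eq_Suc)
    also have "\<dots> \<le> 80000 * (\<tau> ^ \<nu> * L\<rho>)" using \<nu>1 pos L by (intro mult_right_mono) auto
    finally show ?thesis by simp
  qed
  have 2: "norm (dif en n /\<^sub>R \<tau>) \<le> 2 * A * L1"
  proof -
    have "integral {real (n - 1) * \<tau>..real n * \<tau>} N1 \<le> real 1 * \<tau> * L1"
      using pos by (intro window_sup[OF pos(2) n(3) nT sq(2) sup(2)]) auto
    then have "norm (dif en n) \<le> A * (2 * (real 1 * \<tau> * L1))"
      using pos by (intro order.trans[OF dif_en_le(1)[OF n(3,2)]] mult_left_mono) auto
    then show ?thesis using pos by (simp add: field_simps)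
  qed
  have 3: "norm (G (am \<nu> en n)) \<le> 5 * (A / h * L0)"
  proof -
    have "norm (G (am \<nu> en n)) \<le> (\<Sum>j<\<nu>. norm (G (en (n - j))))" unfolding G_am by (rule norm_am_le[OF \<nu>])
    also have "\<dots> \<le> (\<Sum>j<\<nu>. A / h * L0)" unfolding en_def using n by (intro sum_mono eta_sup node_in) auto
    also have "\<dots> = real \<nu> * (A / h * L0)" by simp
    also have "\<dots> \<le> 5 * (A / h * L0)" using \<nu> pos L by (intro mult_right_mono) auto
    finally show ?thesis .
  qed
  have "norm (fh n) \<le> norm (eps n) + norm (dif en n /\<^sub>R \<tau>) + norm (G (am \<nu> en n))"
  proof -
    have "fh n = eps n + dif en n /\<^sub>R \<tau> + G (am \<nu> en n)" using True by (simp add: fh_def)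
    then show ?thesis
      using norm_triangle_ineq[of "eps n + dif en n /\<^sub>R \<tau>" "G (am \<nu> en n)"]
        norm_triangle_ineq[of "eps n" "dif en n /\<^sub>R \<tau>"] by simp
  qed
  then show ?thesis using 1 2 3 by (simp add: asup_def)
qed

text \<open>
  The terms arise from the four parts of the right-hand side in \<open>rhs_term\<close>; the last one is
  there because its square bounds \<open>sch.Phi\<close>.
\<close>

definition "stab = 5 * sqrt T * ae + \<delta> * asup + \<delta> * sqrt T * aDf + 5 * ah / sqrt \<delta> + sqrt \<delta> * af + sqrt \<tau> * af"

lemma coeff_nonneg: "0 \<le> ae" "0 \<le> ah" "0 \<le> af" "0 \<le> aDf" "0 \<le> asup"
proof -
  have p: "0 \<le> A" "0 \<le> \<tau>" "0 \<le> h" "0 \<le> (2::real)" using pos by simp_all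
  show 1: "0 \<le> ae" unfolding ae_def by (intro mult_nonneg_nonneg zero_le_power p sqnorm_nonneg) simp
  show 2: "0 \<le> ah" unfolding ah_def by (intro mult_nonneg_nonneg add_nonneg_nonneg zero_le_power p S_nonneg) simp
  show "0 \<le> af" unfolding af_def
    by (intro add_nonneg_nonneg 1 mult_nonneg_nonneg divide_nonneg_nonneg 2 p S_nonneg) simp
  show "0 \<le> aDf" unfolding aDf_def
    by (intro add_nonneg_nonneg mult_nonneg_nonneg divide_nonneg_nonneg zero_le_power p sqnorm_nonneg) simp_all
  show "0 \<le> asup" unfolding asup_def
    by (intro add_nonneg_nonneg mult_nonneg_nonneg divide_nonneg_nonneg zero_le_power p L) simp_all
qed

lemma stab_parts:
  "0 \<le> 5 * sqrt T * ae" "0 \<le> \<delta> * asup" "0 \<le> \<delta> * sqrt T * aDf" "0 \<le> 5 * ah / sqrt \<delta>" "0 \<le> sqrt \<delta> * af" "0 \<le> sqrt \<tau> * af"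
proof -
  have p: "0 \<le> sqrt T" "0 \<le> sqrt \<tau>" "0 \<le> sqrt \<delta>" "0 \<le> \<delta>" using pos by simp_all
  show "0 \<le> 5 * sqrt T * ae" "0 \<le> \<delta> * asup" "0 \<le> \<delta> * sqrt T * aDf" "0 \<le> 5 * ah / sqrt \<delta>" "0 \<le> sqrt \<delta> * af" "0 \<le> sqrt \<tau> * af"
    by (intro mult_nonneg_nonneg divide_nonneg_nonneg p coeff_nonneg, simp?)+
qed

lemma en_in_V: "n \<le> N \<Longrightarrow> en n \<in> V"
  unfolding en_def by (rule eta_in_V[OF node_in])

lemma en_orth: "w \<in> Vh \<Longrightarrow> en n \<bullet> w = 0" "w \<in> Vh \<Longrightarrow> am \<nu> en n \<bullet> w = 0" "w \<in> Vh \<Longrightarrow> dif en n \<bullet> w = 0"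
proof -
  assume w: "w \<in> Vh"
  have 1: "en k \<bullet> w = 0" for k unfolding en_def eta_def by (rule P(2)[OF w])
  show "en n \<bullet> w = 0" by (rule 1)
  show "am \<nu> en n \<bullet> w = 0" unfolding am_def inner_sum_left inner_scaleR_left by (simp add: 1)
  show "dif en n \<bullet> w = 0" unfolding dif_def inner_diff_left by (simp add: 1)
qed

lemma am_en_in_V: "n \<le> N \<Longrightarrow> am \<nu> en n \<in> V"
  unfolding am_def using en_in_V by (intro subspace_sum[OF V(1)] subspace_scale[OF V(1)]) auto

text \<open>
  The singular part of the right-hand side is harmless against \<open>M e\<close>: the projection error is orthogonal
  to \<open>Vh\<close>, hence \<open>(G M \<eta>, M e) = - (M \<eta>, G M e) = - (M \<eta>, D e + G M e)\<close>, where the dissipation is available.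
\<close>

lemma rhs_term:
  assumes n: "\<nu> - 1 \<le> n" "n \<le> N"
  shows "\<tau> * (fh n \<bullet> (am \<nu> err n + \<delta> *\<^sub>R (dif err n /\<^sub>R \<tau>) + \<delta> *\<^sub>R G (am \<nu> err n + \<delta> *\<^sub>R (dif err n /\<^sub>R \<tau>))))
    = \<tau> * (eps n \<bullet> am \<nu> err n) - \<tau> * (am \<nu> en n \<bullet> sch.Ae n) + \<tau> * \<delta> * (fh n \<bullet> sch.Ae n)
      + \<delta>\<^sup>2 * (fh n \<bullet> dif (\<lambda>n. G (err n)) n)"
proof -
  define M d where "M = am \<nu> err n" and "d = dif err n /\<^sub>R \<tau>"
  have M: "M \<in> Vh" and d: "d \<in> Vh"
    unfolding M_def d_def using sch.am_de_in_Vh[of 0 n] sch.de_in_Vh[of 1 n] by (auto intro: subspace_scale[OF Vh(1)])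
  have f: "fh n = eps n + dif en n /\<^sub>R \<tau> + G (am \<nu> en n)" using n by (simp add: fh_def)
  have "dif en n \<bullet> M = 0" by (rule en_orth(3)[OF M])
  moreover have "G (am \<nu> en n) \<bullet> M = - (am \<nu> en n \<bullet> (d + G M))"
    using skewV[OF am_en_in_V[OF n(2)] VhHs(3)[OF M]] en_orth(2)[OF d] by (simp add: inner_add_right)
  ultimately have fM: "fh n \<bullet> M = eps n \<bullet> M - am \<nu> en n \<bullet> (d + G M)"
    unfolding f by (simp add: inner_add_left)
  have Gd: "\<tau> *\<^sub>R G d = dif (\<lambda>n. G (err n)) n"
    using pos by (simp add: d_def dif_def linear_scale[OF linG] linear_diff[OF linG])
  have "M + \<delta> *\<^sub>R d + \<delta> *\<^sub>R G (M + \<delta> *\<^sub>R d) = M + \<delta> *\<^sub>R (d + G M) + (\<delta>\<^sup>2) *\<^sub>R G d"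
    by (simp add: linear_add[OF linG] linear_scale[OF linG] power2_eq_square algebra_simps)
  note w = this
  have "\<tau> * (fh n \<bullet> (M + \<delta> *\<^sub>R d + \<delta> *\<^sub>R G (M + \<delta> *\<^sub>R d)))
    = \<tau> * (fh n \<bullet> M) + \<tau> * \<delta> * (fh n \<bullet> (d + G M)) + \<delta>\<^sup>2 * (fh n \<bullet> (\<tau> *\<^sub>R G d))"
    unfolding w by (simp add: inner_add_right distrib_left mult_ac)
  then show ?thesis unfolding fM Gd right_diff_distrib unfolding M_def d_def .
qed

text \<open>
  The term \<open>\<delta>\<^sup>2 (f, G D e)\<close> is summed by parts in time, which moves the difference quotient from the error
  to the data and leaves \<open>\<delta> G e\<close>, a component of the energy norm.
\<close>

lemma rhs_bound:
  assumes m: "m \<le> N" and \<beta>: "\<And>n. n \<le> m \<Longrightarrow> norm (err n) \<le> \<beta> \<and> \<delta> * norm (G (err n)) \<le> \<beta>"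
  shows "(\<Sum>n\<le>m. \<tau> * (fh n \<bullet> (am \<nu> err n + \<delta> *\<^sub>R (dif err n /\<^sub>R \<tau>) + \<delta> *\<^sub>R G (am \<nu> err n + \<delta> *\<^sub>R (dif err n /\<^sub>R \<tau>)))))
    \<le> stab * (\<beta> + sqrt (sch.D m))"
proof -
  have \<tau>: "0 \<le> \<tau>" using pos by simp
  have \<beta>0: "0 \<le> \<beta>" using \<beta>[of 0] norm_ge_zero order.trans by blast
  have stab0: "0 \<le> stab" using stab_parts unfolding stab_def by linarith
  let ?t = "\<lambda>n. \<tau> * (fh n \<bullet> (am \<nu> err n + \<delta> *\<^sub>R (dif err n /\<^sub>R \<tau>) + \<delta> *\<^sub>R G (am \<nu> err n + \<delta> *\<^sub>R (dif err n /\<^sub>R \<tau>))))"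
  show ?thesis
  proof (cases "\<nu> - 1 \<le> m")
    case False
    then have "(\<Sum>n\<le>m. ?t n) = 0" by (intro sum.neutral) (auto simp: fh_def)
    moreover have "0 \<le> stab * (\<beta> + sqrt (sch.D m))" using stab0 \<beta>0 sch.D_nonneg[of m] by simp
    ultimately show ?thesis by simp
  next
    case True
    have N1: "1 \<le> N" using True m \<nu>1 by simp
    let ?I = "{\<nu> - 1..m}"
    have sub: "?I \<subseteq> {\<nu> - 1..N}" using m by auto
    have card: "real (card ?I) * \<tau> \<le> T" "real (card {Suc (\<nu> - 1)..m}) * \<tau> \<le> T"
    proof -
      have "card ?I \<le> N" using \<nu>1 m by simp
      then have "real (card ?I) * \<tau> \<le> real N * \<tau>" using \<tau> by (intro mult_right_mono) auto
      then show "real (card ?I) * \<tau> \<le> T" using N\<tau> by linarith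
      have "card {Suc (\<nu> - 1)..m} \<le> N" using \<nu>1 m by simp
      then have "real (card {Suc (\<nu> - 1)..m}) * \<tau> \<le> real N * \<tau>" using \<tau> by (intro mult_right_mono) auto
      then show "real (card {Suc (\<nu> - 1)..m}) * \<tau> \<le> T" using N\<tau> by linarith
    qed
    have "(\<Sum>n\<le>m. ?t n) = (\<Sum>n\<in>?I. ?t n)"
      by (rule sum.mono_neutral_right) (auto simp: fh_def)
    also have "\<dots> = (\<Sum>n\<in>?I. \<tau> * (eps n \<bullet> am \<nu> err n) - \<tau> * (am \<nu> en n \<bullet> sch.Ae n) + \<tau> * \<delta> * (fh n \<bullet> sch.Ae n)
      + \<delta>\<^sup>2 * (fh n \<bullet> dif (\<lambda>n. G (err n)) n))"
      by (rule sum.cong[OF refl], rule rhs_term) (use m in auto)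
    also have "\<dots> = (\<Sum>n\<in>?I. \<tau> * (eps n \<bullet> am \<nu> err n)) + (\<Sum>n\<in>?I. - (\<tau> * (am \<nu> en n \<bullet> sch.Ae n)))
      + (\<Sum>n\<in>?I. \<tau> * \<delta> * (fh n \<bullet> sch.Ae n)) + \<delta>\<^sup>2 * (\<Sum>n\<in>?I. fh n \<bullet> dif (\<lambda>n. G (err n)) n)"
      by (simp add: sum.distrib sum_subtractf sum_negf sum_distrib_left)
    also have "\<dots> \<le> \<beta> * (5 * sqrt T * ae) + (5 * ah / sqrt \<delta>) * sqrt (sch.D m) + (sqrt \<delta> * af) * sqrt (sch.D m)
      + \<beta> * (\<delta> * asup + \<delta> * sqrt T * aDf)"
    proof (intro add_mono)
      have M: "norm (am \<nu> err n) \<le> 5 * \<beta>" if "n \<in> ?I" for n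
      proof -
        have "norm (am \<nu> err n) \<le> (\<Sum>j<\<nu>. norm (err (n - j)))" by (rule norm_am_le[OF \<nu>])
        also have "\<dots> \<le> (\<Sum>j<\<nu>. \<beta>)" using \<beta> that by (intro sum_mono) auto
        also have "\<dots> = real \<nu> * \<beta>" by simp
        also have "\<dots> \<le> 5 * \<beta>" using \<nu> \<beta>0 by (intro mult_right_mono) auto
        finally show ?thesis .
      qed
      have "(\<Sum>n\<in>?I. \<tau> * (eps n \<bullet> am \<nu> err n)) \<le> (\<Sum>n\<in>?I. \<tau> * (norm (eps n) * (5 * \<beta>)))"
        using M \<tau> by (intro sum_mono mult_left_mono order.trans[OF norm_cauchy_schwarz mult_left_mono]) auto
      also have "\<dots> = 5 * \<beta> * (\<tau> * (\<Sum>n\<in>?I. norm (eps n)))" by (simp add: sum_distrib_left mult_ac)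
      also have "\<dots> \<le> 5 * \<beta> * (sqrt T * l2n \<tau> ?I eps)"
        using \<beta>0 by (intro mult_left_mono sum_norm_le_l2n[OF \<tau> _ card(1)]) auto
      also have "\<dots> \<le> 5 * \<beta> * (sqrt T * ae)"
        using \<beta>0 pos by (intro mult_left_mono order.trans[OF l2n_mono_set[OF \<tau> _ sub] l2n_eps]) auto
      finally show "(\<Sum>n\<in>?I. \<tau> * (eps n \<bullet> am \<nu> err n)) \<le> \<beta> * (5 * sqrt T * ae)" by (simp add: mult_ac)
      have A: "l2n \<tau> ?I sch.Ae \<le> sqrt (sch.D m) / sqrt \<delta>"
      proof (rule l2n_leI[OF \<tau>])
        have "\<tau> * (\<Sum>n\<in>?I. (norm (sch.Ae n))\<^sup>2) \<le> \<tau> * (\<Sum>n\<le>m. (norm (sch.Ae n))\<^sup>2)"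
          using \<tau> by (intro mult_left_mono sum_mono2) auto
        also have "\<dots> = sch.D m / \<delta>" using pos by (simp add: sch.D_def sum_distrib_left sum_divide_distrib)
        also have "\<dots> = (sqrt (sch.D m) / sqrt \<delta>)\<^sup>2" using pos sch.D_nonneg[of m] by (simp add: power_divide)
        finally show "\<tau> * (\<Sum>n\<in>?I. (norm (sch.Ae n))\<^sup>2) \<le> (sqrt (sch.D m) / sqrt \<delta>)\<^sup>2" .
      qed (use pos sch.D_nonneg[of m] in simp)
      have inn: "(\<Sum>n\<in>?I. \<tau> * \<bar>X n \<bullet> sch.Ae n\<bar>) \<le> l2n \<tau> ?I X * (sqrt (sch.D m) / sqrt \<delta>)" for X
      proof -
        have "(\<Sum>n\<in>?I. \<tau> * \<bar>X n \<bullet> sch.Ae n\<bar>) \<le> \<tau> * (\<Sum>n\<in>?I. norm (X n) * norm (sch.Ae n))"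
          unfolding sum_distrib_left[symmetric] using \<tau> by (intro mult_left_mono sum_mono Cauchy_Schwarz_ineq2)
        also have "\<dots> \<le> l2n \<tau> ?I X * l2n \<tau> ?I sch.Ae" by (rule l2n_cauchy_schwarz[OF \<tau>])
        also have "\<dots> \<le> l2n \<tau> ?I X * (sqrt (sch.D m) / sqrt \<delta>)" by (intro mult_left_mono A l2n_nonneg \<tau>)
        finally show ?thesis .
      qed
      have D0: "0 \<le> sqrt (sch.D m) / sqrt \<delta>"
        by (intro divide_nonneg_nonneg real_sqrt_ge_zero sch.D_nonneg) (use pos in simp)
      have "(\<Sum>n\<in>?I. - (\<tau> * (am \<nu> en n \<bullet> sch.Ae n))) \<le> (\<Sum>n\<in>?I. \<tau> * \<bar>am \<nu> en n \<bullet> sch.Ae n\<bar>)"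
        unfolding mult_minus_right[symmetric] by (intro sum_mono mult_left_mono abs_ge_minus_self \<tau>)
      also have "\<dots> \<le> l2n \<tau> ?I (am \<nu> en) * (sqrt (sch.D m) / sqrt \<delta>)" by (rule inn)
      also have "\<dots> \<le> (5 * ah) * (sqrt (sch.D m) / sqrt \<delta>)"
        using l2n_am_en(1)[OF N1] by (intro mult_right_mono D0 order.trans[OF l2n_mono_set[OF \<tau> _ sub]]) auto
      finally show "(\<Sum>n\<in>?I. - (\<tau> * (am \<nu> en n \<bullet> sch.Ae n))) \<le> (5 * ah / sqrt \<delta>) * sqrt (sch.D m)" by simp
      have "(\<Sum>n\<in>?I. \<tau> * \<delta> * (fh n \<bullet> sch.Ae n)) \<le> \<delta> * (\<Sum>n\<in>?I. \<tau> * \<bar>fh n \<bullet> sch.Ae n\<bar>)"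
      proof -
        have "(\<Sum>n\<in>?I. \<tau> * \<delta> * (fh n \<bullet> sch.Ae n)) = \<delta> * (\<Sum>n\<in>?I. \<tau> * (fh n \<bullet> sch.Ae n))"
          by (simp add: sum_distrib_left mult_ac)
        also have "\<dots> \<le> \<delta> * (\<Sum>n\<in>?I. \<tau> * \<bar>fh n \<bullet> sch.Ae n\<bar>)"
          using pos by (intro mult_left_mono sum_mono abs_ge_self) auto
        finally show ?thesis .
      qed
      also have "\<dots> \<le> \<delta> * (af * (sqrt (sch.D m) / sqrt \<delta>))"
        using l2n_fh[OF N1] pos
        by (intro mult_left_mono order.trans[OF inn] mult_right_mono D0 order.trans[OF l2n_mono_set[OF \<tau> _ sub]]) auto
      also have "\<dots> = (sqrt \<delta> * af) * sqrt (sch.D m)"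
      proof -
        have "\<delta> / sqrt \<delta> = sqrt \<delta>" using pos by (simp add: real_div_sqrt)
        moreover have "\<delta> * (af * (sqrt (sch.D m) / sqrt \<delta>)) = (\<delta> / sqrt \<delta>) * af * sqrt (sch.D m)" by simp
        ultimately show ?thesis by simp
      qed
      finally show "(\<Sum>n\<in>?I. \<tau> * \<delta> * (fh n \<bullet> sch.Ae n)) \<le> (sqrt \<delta> * af) * sqrt (sch.D m)" .
      have x0: "G (err (\<nu> - 1 - 1)) = 0" using err_0[of "\<nu> - 1 - 1"] \<nu>1 linear_0[OF linG] by simp
      have "(\<Sum>n\<in>?I. fh n \<bullet> dif (\<lambda>n. G (err n)) n)
        = fh m \<bullet> G (err m) - (\<Sum>n\<in>{Suc (\<nu> - 1)..m}. dif fh n \<bullet> G (err (n - 1)))"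
        by (rule summation_by_parts[where x = "\<lambda>n. G (err n)", OF True x0 \<nu>1(1)])
      also have "\<dots> \<le> norm (fh m) * norm (G (err m)) + (\<Sum>n\<in>{Suc (\<nu> - 1)..m}. norm (dif fh n) * norm (G (err (n - 1))))"
      proof -
        have "- (\<Sum>n\<in>{Suc (\<nu> - 1)..m}. dif fh n \<bullet> G (err (n - 1))) \<le> (\<Sum>n\<in>{Suc (\<nu> - 1)..m}. norm (dif fh n) * norm (G (err (n - 1))))"
          unfolding sum_negf[symmetric] by (intro sum_mono) (metis abs_le_iff Cauchy_Schwarz_ineq2)
        then show ?thesis using norm_cauchy_schwarz[of "fh m" "G (err m)"] by linarith
      qed
      finally have "\<delta>\<^sup>2 * (\<Sum>n\<in>?I. fh n \<bullet> dif (\<lambda>n. G (err n)) n)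
        \<le> \<delta>\<^sup>2 * (norm (fh m) * norm (G (err m)) + (\<Sum>n\<in>{Suc (\<nu> - 1)..m}. norm (dif fh n) * norm (G (err (n - 1)))))"
        by (intro mult_left_mono) auto
      also have "\<dots> = \<delta> * norm (fh m) * (\<delta> * norm (G (err m)))
          + \<delta> * (\<Sum>n\<in>{Suc (\<nu> - 1)..m}. norm (dif fh n) * (\<delta> * norm (G (err (n - 1)))))"
        by (simp add: power2_eq_square distrib_left sum_distrib_left mult_ac)
      also have "\<dots> \<le> \<delta> * asup * \<beta> + \<delta> * (\<Sum>n\<in>{Suc (\<nu> - 1)..m}. norm (dif fh n) * \<beta>)"
        using pos \<beta> \<beta>0 fh_sup by (intro add_mono mult_mono mult_left_mono sum_mono) (auto intro: mult_nonneg_nonneg coeff_nonneg)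
      also have "(\<Sum>n\<in>{Suc (\<nu> - 1)..m}. norm (dif fh n) * \<beta>) = \<beta> * (\<tau> * (\<Sum>n\<in>{Suc (\<nu> - 1)..m}. norm (dif fh n /\<^sub>R \<tau>)))"
      proof -
        have nrm: "\<tau> * norm (x /\<^sub>R \<tau>) = norm x" for x :: 'a using pos by simp
        show ?thesis unfolding sum_distrib_left nrm by (simp add: mult.commute)
      qed
      also have "\<tau> * (\<Sum>n\<in>{Suc (\<nu> - 1)..m}. norm (dif fh n /\<^sub>R \<tau>)) \<le> sqrt T * l2n \<tau> {Suc (\<nu> - 1)..m} (\<lambda>n. dif fh n /\<^sub>R \<tau>)"
        by (rule sum_norm_le_l2n[OF \<tau> _ card(2)]) simp
      also have "l2n \<tau> {Suc (\<nu> - 1)..m} (\<lambda>n. dif fh n /\<^sub>R \<tau>) \<le> aDf"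
        using \<nu>1 m by (intro order.trans[OF l2n_mono_set[OF \<tau>] l2n_dif_fh]) auto
      finally have "\<delta>\<^sup>2 * (\<Sum>n\<in>?I. fh n \<bullet> dif (\<lambda>n. G (err n)) n) \<le> \<delta> * asup * \<beta> + \<delta> * (\<beta> * (sqrt T * aDf))"
        using \<beta>0 pos by (auto simp: mult_left_mono)
      then show "\<delta>\<^sup>2 * (\<Sum>n\<in>?I. fh n \<bullet> dif (\<lambda>n. G (err n)) n) \<le> \<beta> * (\<delta> * asup + \<delta> * sqrt T * aDf)"
        by (simp add: algebra_simps)
    qed
    also have "\<dots> = \<beta> * (5 * sqrt T * ae + \<delta> * asup + \<delta> * sqrt T * aDf) + (5 * ah / sqrt \<delta> + sqrt \<delta> * af) * sqrt (sch.D m)"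
      by (simp add: algebra_simps)
    also have "\<dots> \<le> \<beta> * stab + stab * sqrt (sch.D m)"
    proof (intro add_mono mult_left_mono mult_right_mono)
      show "5 * sqrt T * ae + \<delta> * asup + \<delta> * sqrt T * aDf \<le> stab" "5 * ah / sqrt \<delta> + sqrt \<delta> * af \<le> stab"
        using stab_parts unfolding stab_def by linarith+
    qed (use \<beta>0 sch.D_nonneg[of m] in simp_all)
    finally show ?thesis by (simp add: algebra_simps)
  qed
qed

lemma error_bound_abstract:
  assumes m: "\<nu> - 1 \<le> m" "m \<le> N"
    and lam: "\<tau> * CG / h \<le> 1" "(200 * (1 + Cd * CG)\<^sup>2) ^ 4 * (\<tau> * CG / h)\<^sup>2 \<le> 1 / 32"
    and mu: "0 \<le> mu" "mu \<le> (\<tau> * CG / h)\<^sup>2"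
    and cases: "\<nu> = 3 \<and> mu = (\<tau> * CG / h) ^ 4 \<or> \<nu> = 4 \<and> mu = (\<tau> * CG / h) ^ 6 \<or> \<nu> = 5 \<or>
      \<nu> \<noteq> 5 \<and> (\<forall>w\<in>Vh. \<forall>v\<in>Vh. norm (G w) \<le> Ca / h * norm (w + G v)) \<and> \<tau> \<le> Ct * \<delta>
        \<and> (200 * (1 + Cd * CG)\<^sup>2) ^ 4 * ((\<tau> * Ca / h)\<^sup>2 * Ct) \<le> 1 / 2"
  shows "norm ((U m - u (real m * \<tau>)) + \<delta> *\<^sub>R G (U m - u (real m * \<tau>)))
    \<le> 10 * (200 * (1 + Cd * CG)\<^sup>2)\<^sup>2 * stab * exp (2 * (200 * (1 + Cd * CG)\<^sup>2) ^ 4 * mu * real m)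
      + (A * L0 + \<delta> * (A / h * L0))"
proof -
  have \<tau>: "0 \<le> \<tau>" using pos by simp
  have N1: "1 \<le> N" using m \<nu>1 by simp
  have K: "sch.K = 200 * (1 + Cd * CG)\<^sup>2" by (simp add: sch.K_def sch.q_def)
  have lamd: "sch.lam = \<tau> * CG / h" by (simp add: sch.lam_def)
  have stab0: "0 \<le> stab" using stab_parts unfolding stab_def by linarith
  have Phi: "sch.Phi \<le> stab\<^sup>2"
  proof -
    have "sch.Phi = \<tau> * (\<tau> * (\<Sum>n\<in>{\<nu> - 1..N}. (norm (fh n))\<^sup>2))"
      unfolding sch.Phi_def power2_eq_square[of \<tau>] mult.assoc
      by (intro arg_cong[of _ _ "\<lambda>x. \<tau> * (\<tau> * x)"] sum.mono_neutral_right) (auto simp: fh_def)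
    also have "\<dots> = \<tau> * (l2n \<tau> {\<nu> - 1..N} fh)\<^sup>2" by (simp add: l2n_sq \<tau>)
    also have "\<dots> \<le> \<tau> * af\<^sup>2" by (intro mult_left_mono power_mono l2n_fh N1 l2n_nonneg \<tau>)
    also have "\<dots> = (sqrt \<tau> * af)\<^sup>2" using \<tau> by (simp add: power_mult_distrib)
    also have "\<dots> \<le> stab\<^sup>2"
      using stab_parts unfolding stab_def by (intro power_mono) linarith+
    finally show ?thesis .
  qed
  have "norm (err m + \<delta> *\<^sub>R G (err m)) \<le> 10 * sch.K\<^sup>2 * stab * exp (2 * sch.K ^ 4 * mu * real m)"
    by (rule sch.stability[OF m(2) _ _ mu(1) _ stab0 Phi rhs_bound, where Ca = Ca and Ct = Ct])
      (use lam mu cases in \<open>simp_all only: K lamd\<close>)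
  moreover have "norm (en m + \<delta> *\<^sub>R G (en m)) \<le> A * L0 + \<delta> * (A / h * L0)"
  proof -
    have "norm (en m + \<delta> *\<^sub>R G (en m)) \<le> norm (en m) + \<delta> * norm (G (en m))"
      using norm_triangle_ineq[of "en m" "\<delta> *\<^sub>R G (en m)"] pos by simp
    also have "\<dots> \<le> A * L0 + \<delta> * (A / h * L0)"
      unfolding en_def using pos by (intro add_mono mult_left_mono eta_sup node_in m) auto
    finally show ?thesis .
  qed
  moreover have "(U m - u (real m * \<tau>)) + \<delta> *\<^sub>R G (U m - u (real m * \<tau>)) = (err m + \<delta> *\<^sub>R G (err m)) - (en m + \<delta> *\<^sub>R G (en m))"
  proof -
    have "U m - u (real m * \<tau>) = err m - en m" using m by (simp add: err_def en_def eta_def)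
    then show ?thesis unfolding linear_diff[OF linG, of "U m", symmetric] by (simp add: linear_diff[OF linG] scaleR_diff_right)
  qed
  ultimately show ?thesis
    unfolding K using norm_triangle_ineq4[of "err m + \<delta> *\<^sub>R G (err m)" "en m + \<delta> *\<^sub>R G (en m)"] by simp
qed

end

section \<open>Finite element spaces\<close>

text \<open>
  Gram--Schmidt. Completeness of the surrounding space is replaced by finite dimension.
\<close>

lemma exists_orthogonal_projection:
  fixes S :: "'a::real_inner set"
  assumes S: "subspace S" "S \<subseteq> span F" and F: "finite F"
  shows "\<exists>P. linear P \<and> (\<forall>x. P x \<in> S) \<and> (\<forall>x. \<forall>w\<in>S. (x - P x) \<bullet> w = 0)"
proof -
  obtain B where B: "B \<subseteq> S" "independent B" "S \<subseteq> span B"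
    by (rule real_vector.maximal_independent_subset)
  have "finite B" using real_vector.independent_span_bound[OF F B(2)] B(1) S(2) by blast
  from basis_orthogonal[OF this] obtain C where C: "finite C" "span C = span B" "pairwise orthogonal C" by blast
  have SC: "span C = S" using C(2) B span_minimal[OF B(1) S(1)] by blast
  define P where "P x = (\<Sum>c\<in>C. (c \<bullet> x / (c \<bullet> c)) *\<^sub>R c)" for x
  have "linear P"
    unfolding P_def
    by (rule linearI) (simp_all add: inner_add_right add_divide_distrib scaleR_add_left sum.distrib scaleR_sum_right)
  moreover have "P x \<in> S" for x
    unfolding P_def SC[symmetric] by (intro span_sum span_scale span_base)
  moreover have "(x - P x) \<bullet> w = 0" if "w \<in> S" for x w
  proof -
    have c: "(x - P x) \<bullet> c = 0" if c: "c \<in> C" for c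
    proof -
      have "P x \<bullet> c = (\<Sum>d\<in>C. if d = c then x \<bullet> c else 0)"
        unfolding P_def inner_sum_left
      proof (rule sum.cong[OF refl])
        fix d assume d: "d \<in> C"
        show "((d \<bullet> x / (d \<bullet> d)) *\<^sub>R d) \<bullet> c = (if d = c then x \<bullet> c else 0)"
        proof (cases "d = c")
          case True
          then show ?thesis by (cases "c = 0") (simp_all add: inner_commute)
        next
          case False
          then have "d \<bullet> c = 0" using C(3) c d by (auto simp: pairwise_def orthogonal_def)
          then show ?thesis using False by simp
        qed
      qed
      also have "\<dots> = x \<bullet> c" using C(1) c by simp
      finally show ?thesis by (simp add: inner_diff_left)
    qed
    have "w \<in> span C" using that SC by simp
    then show ?thesis
    proof (induction rule: span_induct)
      show "subspace {w. (x - P x) \<bullet> w = 0}"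
        by (auto simp: subspace_def inner_add_right)
    qed (use c in simp)
  qed
  ultimately show ?thesis by blast
qed

lemma finite_mi_order: "finite {\<alpha> :: 'd::finite \<Rightarrow> nat. mi_order \<alpha> \<le> k}"
proof (rule finite_subset)
  show "{\<alpha> :: 'd \<Rightarrow> nat. mi_order \<alpha> \<le> k} \<subseteq> PiE UNIV (\<lambda>_. {..k})"
    by (auto simp: mi_order_def PiE_def extensional_def intro: order.trans[OF member_le_sum[of _ UNIV]])
  show "finite (PiE (UNIV :: 'd set) (\<lambda>_. {..k}))" by (intro finite_PiE) auto
qed

lemma mesh_bounded:
  assumes "is_mesh \<Omega> \<T>"
  shows "bounded \<Omega>"
proof -
  have "finite \<T>" "\<And>K. K \<in> \<T> \<Longrightarrow> bounded K" using assms compact_imp_bounded by (auto simp: is_mesh_def)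
  then have "bounded (\<Union>\<T>)" by (intro bounded_Union) auto
  then have "bounded (closure \<Omega>)" using assms by (simp add: is_mesh_def)
  then show ?thesis using bounded_subset closure_subset by blast
qed

lemma bounded_measurable_L2:
  assumes \<Omega>: "\<Omega> \<in> lmeasurable" and g: "g \<in> borel_measurable (lebesgue_on \<Omega>)" and C: "\<And>x. x \<in> \<Omega> \<Longrightarrow> norm (g x) \<le> C"
  shows "g \<in> L2 \<Omega>"
proof -
  interpret finite_measure "lebesgue_on \<Omega>" by (rule finite_measure_lebesgue_on[OF \<Omega>])
  have "integrable (lebesgue_on \<Omega>) (\<lambda>x. (norm (g x))\<^sup>2)"
  proof (rule Bochner_Integration.integrable_bound[of _ "\<lambda>x. C\<^sup>2"])
    have "(norm (g x))\<^sup>2 \<le> C\<^sup>2" if "x \<in> \<Omega>" for x using C[OF that] by (intro power_mono) auto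
    then show "AE x in lebesgue_on \<Omega>. norm ((norm (g x))\<^sup>2) \<le> norm (C\<^sup>2)"
      by (intro AE_I2) (simp add: space_restrict_space)
    show "(\<lambda>x. (norm (g x))\<^sup>2) \<in> borel_measurable (lebesgue_on \<Omega>)" using g by simp
  qed simp
  then show ?thesis using g by (simp add: L2_def)
qed

lemma mesh_AE_interior:
  assumes m: "is_mesh \<Omega> \<T>" and \<Omega>: "\<Omega> \<in> sets lebesgue"
  shows "AE x in lebesgue_on \<Omega>. \<exists>K\<in>\<T>. x \<in> interior K"
proof -
  have "negligible (\<Union>K\<in>\<T>. frontier K)"
    using m by (intro negligible_Union) (auto simp: is_mesh_def)
  then have "AE x in lebesgue. x \<notin> (\<Union>K\<in>\<T>. frontier K)"
    by (intro AE_not_in) (simp only: negligible_iff_null_sets)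
  then have "AE x in lebesgue. x \<in> \<Omega> \<longrightarrow> (\<exists>K\<in>\<T>. x \<in> interior K)"
  proof eventually_elim
    case (elim x)
    show ?case
    proof
      assume "x \<in> \<Omega>"
      then have "x \<in> \<Union>\<T>" using m closure_subset by (auto simp: is_mesh_def)
      then obtain K where "K \<in> \<T>" "x \<in> K" by blast
      then show "\<exists>K\<in>\<T>. x \<in> interior K" using elim closure_subset by (auto simp: frontier_def)
    qed
  qed
  then show ?thesis using \<Omega> by (subst AE_restrict_space_iff) auto
qed

text \<open>
  The monomials times indicators of elements span, up to null sets, because the boundaries of the
  elements are negligible.
\<close>

lemma fe_space_finite_dimensional:
  fixes \<Omega> :: "(real^'d::finite) set" and Vh :: "('d, 'm::finite) field set"
  assumes m: "is_mesh \<Omega> \<T>" and \<Omega>: "open \<Omega>" and Vh: "Vh \<subseteq> L2 \<Omega>"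
    and poly: "\<And>W K. W \<in> Vh \<Longrightarrow> K \<in> \<T> \<Longrightarrow> poly_on k (interior K) W"
  shows "\<exists>F. finite F \<and> cls \<Omega> ` Vh \<subseteq> span F"
proof -
  have \<Omega>m: "\<Omega> \<in> lmeasurable" using mesh_bounded[OF m] \<Omega> by (simp add: lmeasurable_open)
  have \<Omega>s: "\<Omega> \<in> sets lebesgue" using \<Omega>m by auto
  let ?I = "{\<alpha> :: 'd \<Rightarrow> nat. mi_order \<alpha> \<le> k}"
  define mon where "mon \<alpha> x = (\<Prod>i\<in>UNIV. (x $ i) ^ \<alpha> i)" for \<alpha> :: "'d \<Rightarrow> nat" and x :: "real^'d"
  define g where "g = (\<lambda>(K, \<alpha>, i) x. (indicator (interior K) x * mon \<alpha> x) *\<^sub>R axis i (1::real) :: real^'m)"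
  let ?J = "\<T> \<times> ?I \<times> (UNIV :: 'm set)"
  have fin: "finite \<T>" using m by (simp add: is_mesh_def)
  have finJ: "finite ?J" by (intro finite_cartesian_product fin finite_mi_order) simp
  have gL2: "g p \<in> L2 \<Omega>" for p
  proof -
    obtain K \<alpha> i where p: "p = (K, \<alpha>, i)" by (cases p) auto
    have c: "continuous_on S (mon \<alpha>)" for S unfolding mon_def by (intro continuous_intros)
    have "bounded (mon \<alpha> ` closure \<Omega>)"
      using mesh_bounded[OF m] by (intro compact_imp_bounded compact_continuous_image c) (simp add: compact_closure)
    then obtain C where C: "\<forall>y\<in>mon \<alpha> ` closure \<Omega>. norm y \<le> C" by (auto simp: bounded_iff)
    show ?thesis
    proof (rule bounded_measurable_L2[OF \<Omega>m])
      show "norm (g p x) \<le> C" if "x \<in> \<Omega>" for x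
      proof -
        have "norm (mon \<alpha> x) \<le> C" using C subsetD[OF closure_subset that] by blast
        then show ?thesis using norm_ge_zero[of "mon \<alpha> x"] by (auto simp: g_def p indicator_def norm_axis_1)
      qed
      have "mon \<alpha> \<in> borel_measurable borel" by (rule borel_measurable_continuous_onI[OF c])
      then have "(\<lambda>x. (indicator (interior K) x * mon \<alpha> x) *\<^sub>R axis i (1::real) :: real^'m) \<in> borel_measurable borel"
        by (intro borel_measurable_scaleR borel_measurable_times borel_measurable_indicator) auto
      then show "g p \<in> borel_measurable (lebesgue_on \<Omega>)"
        unfolding g_def p by (simp add: measurable_completion measurable_restrict_space1)
    qed
  qed
  show ?thesis
  proof (intro exI[of _ "(\<lambda>p. cls \<Omega> (g p)) ` ?J"] conjI subsetI)
    show "finite ((\<lambda>p. cls \<Omega> (g p)) ` ?J)" using finJ by (rule finite_imageI)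
    fix z assume "z \<in> cls \<Omega> ` Vh"
    then obtain W where W: "W \<in> Vh" and z: "z = cls \<Omega> W" by blast
    have "\<forall>K\<in>\<T>. \<exists>c. \<forall>x\<in>interior K. W x = (\<Sum>\<alpha>\<in>?I. mon \<alpha> x *\<^sub>R c \<alpha>)"
      using poly[OF W] by (simp add: poly_on_def mon_def)
    then obtain c where c: "\<And>K x. K \<in> \<T> \<Longrightarrow> x \<in> interior K \<Longrightarrow> W x = (\<Sum>\<alpha>\<in>?I. mon \<alpha> x *\<^sub>R c K \<alpha>)"
      by metis
    define a where "a = (\<lambda>(K, \<alpha>, i). c K \<alpha> $ i)"
    have ae: "AE x in lebesgue_on \<Omega>. W x = (\<Sum>p\<in>?J. a p *\<^sub>R g p x)"
      using mesh_AE_interior[OF m \<Omega>s]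
    proof eventually_elim
      case (elim x)
      then obtain K where K: "K \<in> \<T>" "x \<in> interior K" by blast
      have other: "x \<notin> interior K'" if "K' \<in> \<T>" "K' \<noteq> K" for K'
      proof -
        have "interior K \<inter> interior K' = {}" using m K(1) that unfolding is_mesh_def by metis
        then show ?thesis using K(2) by blast
      qed
      have "(\<Sum>p\<in>?J. a p *\<^sub>R g p x) = (\<Sum>K'\<in>\<T>. \<Sum>\<alpha>\<in>?I. \<Sum>i\<in>UNIV. a (K', \<alpha>, i) *\<^sub>R g (K', \<alpha>, i) x)"
        by (simp add: sum.cartesian_product)
      also have "\<dots> = (\<Sum>K'\<in>\<T>. if K' = K then (\<Sum>\<alpha>\<in>?I. \<Sum>i\<in>UNIV. a (K, \<alpha>, i) *\<^sub>R g (K, \<alpha>, i) x) else 0)"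
        by (intro sum.cong refl) (auto simp: g_def other)
      also have "\<dots> = (\<Sum>\<alpha>\<in>?I. \<Sum>i\<in>UNIV. a (K, \<alpha>, i) *\<^sub>R g (K, \<alpha>, i) x)"
        using fin K by simp
      also have "\<dots> = (\<Sum>\<alpha>\<in>?I. mon \<alpha> x *\<^sub>R c K \<alpha>)"
      proof (intro sum.cong refl)
        fix \<alpha>
        have "(\<Sum>i\<in>UNIV. a (K, \<alpha>, i) *\<^sub>R g (K, \<alpha>, i) x) = mon \<alpha> x *\<^sub>R (\<Sum>i\<in>UNIV. (c K \<alpha> $ i) *\<^sub>R axis i 1)"
          using K by (simp add: a_def g_def scaleR_sum_right mult.commute)
        also have "(\<Sum>i\<in>UNIV. (c K \<alpha> $ i) *\<^sub>R axis i 1) = c K \<alpha>"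
          using basis_expansion[of "c K \<alpha>"] by (simp add: scalar_mult_eq_scaleR)
        finally show "(\<Sum>i\<in>UNIV. a (K, \<alpha>, i) *\<^sub>R g (K, \<alpha>, i) x) = mon \<alpha> x *\<^sub>R c K \<alpha>" .
      qed
      finally show ?case using c[OF K] by simp
    qed
    have L: "(\<lambda>x. \<Sum>p\<in>?J. a p *\<^sub>R g p x) \<in> L2 \<Omega>" by (intro L2_sum finJ L2_scaleR gL2)
    have "z = cls \<Omega> (\<lambda>x. \<Sum>p\<in>?J. a p *\<^sub>R g p x)"
      unfolding z using W Vh by (subst cls_eq_iff[OF \<Omega>s _ L]) (auto intro: ae)
    also have "\<dots> = (\<Sum>p\<in>?J. a p *\<^sub>R cls \<Omega> (g p))"
      by (subst cls_sum[OF \<Omega>s finJ]) (simp_all add: L2_scaleR gL2 cls_scaleR \<Omega>s)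
    also have "\<dots> \<in> span ((\<lambda>p. cls \<Omega> (g p)) ` ?J)"
      by (intro span_sum span_scale span_base imageI)
    finally show "z \<in> span ((\<lambda>p. cls \<Omega> (g p)) ` ?J)" .
  qed
qed

text \<open>
  Below the graph that locally describes the boundary there are points outside the closure. For a
  domain with a slit this would fail.
\<close>

lemma interior_closure_lipschitz:
  assumes "lipschitz_domain \<Omega>"
  shows "interior (closure \<Omega>) \<subseteq> \<Omega>"
proof
  fix p assume p: "p \<in> interior (closure \<Omega>)"
  have \<Omega>: "open \<Omega>" using assms by (simp add: lipschitz_domain_def)
  show "p \<in> \<Omega>"
  proof (rule ccontr)
    assume np: "p \<notin> \<Omega>"
    then have "p \<in> frontier \<Omega>" using p interior_subset[of "closure \<Omega>"] \<Omega> by (auto simp: frontier_def interior_open)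
    then obtain e \<gamma> L \<epsilon> where e: "norm e = 1" and \<gamma>: "L-lipschitz_on {y. y \<bullet> e = 0} \<gamma>" and \<epsilon>: "\<epsilon> > 0"
      and loc: "\<And>x. x \<in> ball p \<epsilon> \<Longrightarrow> x \<in> \<Omega> \<longleftrightarrow> x \<bullet> e > \<gamma> (x - (x \<bullet> e) *\<^sub>R e)"
      using assms unfolding lipschitz_domain_def by metis
    have ee: "e \<bullet> e = 1" using e by (simp add: norm_eq_1)
    let ?pr = "\<lambda>x. x - (x \<bullet> e) *\<^sub>R e"
    have pr0: "?pr x \<bullet> e = 0" for x by (simp add: inner_diff_left ee)
    have cg: "continuous_on UNIV (\<lambda>x. \<gamma> (?pr x))"
    proof (rule continuous_on_compose2[OF lipschitz_on_continuous_on[OF \<gamma>]])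
      show "continuous_on UNIV ?pr" by (intro continuous_intros)
    qed (use pr0 in auto)
    define Lo where "Lo = ball p \<epsilon> \<inter> {x. x \<bullet> e < \<gamma> (?pr x)}"
    have "open {x. x \<bullet> e < \<gamma> (?pr x)}" by (intro open_Collect_less cg continuous_intros)
    then have Lo: "open Lo" unfolding Lo_def by auto
    have disj: "Lo \<inter> \<Omega> = {}" using loc by (force simp: Lo_def)
    then have disj': "Lo \<inter> closure \<Omega> = {}" using open_Int_closure_eq_empty[OF Lo] by blast
    obtain \<eta> where \<eta>: "\<eta> > 0" "ball p \<eta> \<subseteq> closure \<Omega>"
      using p by (meson mem_interior)
    define s where "s = min \<epsilon> \<eta> / 2"
    have s: "0 < s" "s < \<epsilon>" "s < \<eta>" using \<epsilon> \<eta> by (auto simp: s_def)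
    define y where "y = p - s *\<^sub>R e"
    have d: "dist p y = s" using s e by (simp add: y_def dist_norm)
    have "p \<bullet> e \<le> \<gamma> (?pr p)" using loc[of p] np \<epsilon> by auto
    moreover have "?pr y = ?pr p" by (simp add: y_def inner_diff_left ee algebra_simps)
    moreover have "y \<bullet> e = p \<bullet> e - s" by (simp add: y_def inner_diff_left ee)
    ultimately have "y \<in> Lo" using s d by (simp add: Lo_def)
    moreover have "y \<in> closure \<Omega>" using \<eta> s d by (auto simp: subset_iff)
    ultimately show False using disj' by blast
  qed
qed

lemma mesh_interior_subset:
  assumes "lipschitz_domain \<Omega>" "is_mesh \<Omega> \<T>" "K \<in> \<T>"
  shows "interior K \<subseteq> \<Omega>"
proof -
  have "K \<subseteq> closure \<Omega>" using assms(2,3) by (auto simp: is_mesh_def)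
  then show ?thesis using interior_mono interior_closure_lipschitz[OF assms(1)] by blast
qed

section \<open>Inverse estimate for piecewise affine functions\<close>

lemma mi_order_le_1:
  "{\<alpha> :: 'd::finite \<Rightarrow> nat. mi_order \<alpha> \<le> 1} = insert (\<lambda>_. 0) (range (\<lambda>j. (\<lambda>_. 0)(j := 1)))"
proof (intro equalityI subsetI)
  fix \<alpha> :: "'d \<Rightarrow> nat" assume "\<alpha> \<in> {\<alpha>. mi_order \<alpha> \<le> 1}"
  then have s: "sum \<alpha> UNIV \<le> 1" by (simp add: mi_order_def)
  show "\<alpha> \<in> insert (\<lambda>_. 0) (range (\<lambda>j. (\<lambda>_. 0)(j := 1)))"
  proof (cases "\<alpha> = (\<lambda>_. 0)")
    case False
    then obtain j where j: "\<alpha> j \<noteq> 0" by auto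
    have "sum \<alpha> UNIV = \<alpha> j + sum \<alpha> (UNIV - {j})" by (rule sum.remove) auto
    then have 1: "\<alpha> j = 1" and 0: "sum \<alpha> (UNIV - {j}) = 0" using s j by linarith+
    have "\<alpha> i = 0" if "i \<noteq> j" for i
      using 0 that by (subst (asm) sum_eq_0_iff) auto
    then have "\<alpha> = (\<lambda>_. 0)(j := 1)" using 1 by (intro ext) simp
    then show ?thesis by blast
  qed simp
qed (auto simp: mi_order_def)

lemma poly_on_1_affine:
  assumes "poly_on 1 S W"
  obtains c0 c where "\<And>x. x \<in> S \<Longrightarrow> W x = c0 + (\<Sum>i\<in>UNIV. (x $ i) *\<^sub>R c i)"
proof -
  obtain c where c: "\<And>x. x \<in> S \<Longrightarrow> W x = (\<Sum>\<alpha> | mi_order \<alpha> \<le> 1. (\<Prod>i\<in>UNIV. (x $ i) ^ \<alpha> i) *\<^sub>R c \<alpha>)"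
    using assms by (auto simp: poly_on_def)
  let ?e = "\<lambda>j::'a. (\<lambda>_. 0::nat)(j := 1)"
  have nz: "(\<lambda>_. 0) \<notin> range ?e"
  proof
    assume "(\<lambda>_. 0) \<in> range ?e"
    then obtain j where "(\<lambda>_. 0) = ?e j" by blast
    from fun_cong[OF this, of j] show False by simp
  qed
  have inj: "inj ?e" by (auto simp: inj_on_def fun_eq_iff split: if_splits)
  have pe: "(\<Prod>i\<in>UNIV. (x $ i) ^ ?e j i) = x $ j" for x :: "real^'a" and j
  proof -
    have "(\<Prod>i\<in>UNIV. (x $ i) ^ ?e j i) = (\<Prod>i\<in>UNIV. if i = j then x $ j else 1)" by (intro prod.cong) auto
    then show ?thesis by simp
  qed
  have "W x = c (\<lambda>_. 0) + (\<Sum>j\<in>UNIV. (x $ j) *\<^sub>R c (?e j))" if "x \<in> S" for x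
    unfolding c[OF that] mi_order_le_1 using nz
    by (subst sum.insert) (simp_all only: finite_imageI finite sum.reindex[OF inj] o_def pe, simp_all)
  then show ?thesis by (rule that)
qed

lemma deriv_funpow_zero:
  assumes "\<And>t. t \<notin> {a..b} \<Longrightarrow> f t = 0" and t: "t \<notin> {a..b}"
  shows "(deriv ^^ n) f (t::real) = (0::real)"
  using t
proof (induction n arbitrary: t)
  case (Suc n)
  have "((\<lambda>_. 0) has_real_derivative 0) (at t)" by simp
  then have "((deriv ^^ n) f has_real_derivative 0) (at t)"
  proof (rule has_field_derivative_transform_within_open[where S = "- {a..b}"])
    show "open (- {a..b})" by (simp add: open_Compl)
    show "0 = (deriv ^^ n) f s" if "s \<in> - {a..b}" for s using Suc.IH that by simp
  qed (use Suc.prems in simp)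
  then show ?case by (simp add: DERIV_imp_deriv)
qed (use assms in simp)

text \<open>
  The multi-index is the order of the partial derivative, so that \<open>pbump a b n\<close> is a jet.
\<close>

definition pbump :: "real^'d::finite \<Rightarrow> real^'d \<Rightarrow> nat \<Rightarrow> ('d \<Rightarrow> nat) \<Rightarrow> real^'d \<Rightarrow> real" where
  "pbump a b n \<alpha> x = (\<Prod>i\<in>UNIV. (deriv ^^ \<alpha> i) (bump (a $ i) (b $ i) n) (x $ i))"

lemma continuous_pbump: "continuous_on S (pbump a b n \<alpha>)"
  unfolding pbump_def
  by (intro continuous_intros continuous_on_compose2[OF smooth_continuous[OF smooth_bump, of UNIV]]) auto

lemma pbump_has_deriv:
  "((\<lambda>t. pbump a b n \<alpha> (x + t *\<^sub>R axis i 1)) has_real_derivative pbump a b n (\<alpha>(i := Suc (\<alpha> i))) x) (at 0)"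
proof -
  let ?g = "\<lambda>k m. (deriv ^^ m) (bump (a $ k) (b $ k) n)"
  let ?C = "\<Prod>k\<in>UNIV - {i}. ?g k (\<alpha> k) (x $ k)"
  have eq: "pbump a b n \<alpha> (x + t *\<^sub>R axis i 1) = ?g i (\<alpha> i) (x $ i + t) * ?C" for t
    unfolding pbump_def by (subst prod.remove[of _ i]) (auto simp: axis_def intro!: prod.cong)
  have eq': "pbump a b n (\<alpha>(i := Suc (\<alpha> i))) x = ?g i (Suc (\<alpha> i)) (x $ i) * ?C"
    unfolding pbump_def by (subst prod.remove[of _ i]) (auto intro!: prod.cong)
  have "((\<lambda>t. ?g i (\<alpha> i) (x $ i + t)) has_real_derivative ?g i (Suc (\<alpha> i)) (x $ i)) (at 0)"
    using smooth_has_deriv[OF smooth_bump, of "\<alpha> i" "a $ i" "b $ i" n "x $ i"] DERIV_at_within_shift[of _ _ "x $ i" 0 UNIV]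
    by (simp add: add.commute DERIV_shift)
  from DERIV_cmult_right[OF this, of ?C] show ?thesis unfolding eq eq' .
qed

lemma pbump_outside: "x \<notin> cbox a b \<Longrightarrow> pbump a b n \<alpha> x = 0"
proof -
  assume "x \<notin> cbox a b"
  then obtain i where i: "x $ i \<notin> {a $ i..b $ i}" by (auto simp: mem_box_cart)
  have "(deriv ^^ \<alpha> i) (bump (a $ i) (b $ i) n) (x $ i) = 0"
    by (rule deriv_funpow_zero[OF _ i]) (auto intro: bump_0)
  then show ?thesis unfolding pbump_def by (intro prod_zero) auto
qed

lemma test_jet_pbump: "cbox a b \<subseteq> \<Omega> \<Longrightarrow> test_jet \<Omega> (pbump a b n)"
  unfolding test_jet_def smooth_jet_def
  using continuous_pbump pbump_has_deriv pbump_outside by (intro conjI allI exI[of _ "cbox a b"]) auto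

lemma pbump_0_bounds: "0 \<le> pbump a b n (\<lambda>_. 0) x" "pbump a b n (\<lambda>_. 0) x \<le> 1"
  by (simp_all add: pbump_def prod_nonneg bump_nonneg bump_le_1 prod_le_1)

lemma pbump_0_tendsto: "(\<lambda>n. pbump a b n (\<lambda>_. 0) x) \<longlonglongrightarrow> indicator (box a b) x"
proof -
  have "(\<lambda>n. pbump a b n (\<lambda>_. 0) x) \<longlonglongrightarrow> (\<Prod>i\<in>UNIV. indicator {a $ i<..<b $ i} (x $ i))"
    unfolding pbump_def by (intro tendsto_prod) (simp add: bump_tendsto)
  also have "(\<Prod>i\<in>UNIV. indicator {a $ i<..<b $ i} (x $ i)) = (indicator (box a b) x :: real)"
  proof (cases "x \<in> box a b")
    case False
    then obtain i where i: "x $ i \<notin> {a $ i<..<b $ i}" by (auto simp: mem_box_cart)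
    have "(\<Prod>i\<in>UNIV. indicator {a $ i<..<b $ i} (x $ i)) = (0::real)"
      by (intro prod_zero bexI[of _ i]) (use i in \<open>auto simp: indicator_def\<close>)
    then show ?thesis using False by simp
  qed (auto simp: mem_box_cart)
  finally show ?thesis .
qed

lemma integrable_lborel_continuous_support:
  fixes f :: "'a::euclidean_space \<Rightarrow> real"
  assumes "continuous_on UNIV f" "\<And>x. x \<notin> cbox a b \<Longrightarrow> f x = 0"
  shows "integrable lborel f" "integral\<^sup>L lborel f = integral (cbox a b) f"
proof -
  have c: "continuous_on (cbox a b) f" using assms(1) continuous_on_subset by blast
  have "integrable lborel (\<lambda>x. indicator (cbox a b) x *\<^sub>R f x)"
    using borel_integrable_compact[OF compact_cbox c] by (simp add: indicator_def if_distrib cong: if_cong)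
  moreover have "(\<lambda>x. indicator (cbox a b) x *\<^sub>R f x) = f" using assms(2) by (auto simp: indicator_def fun_eq_iff)
  ultimately show i: "integrable lborel f" by simp
  have "(f has_integral integral (cbox a b) f) UNIV"
    by (rule has_integral_on_superset[of _ _ "cbox a b"])
      (use assms(2) integrable_integral[OF integrable_continuous[OF c]] in auto)
  then show "integral\<^sup>L lborel f = integral (cbox a b) f"
    using integral_lborel[OF i] integral_unique by metis
qed

lemma lborel_integral_translate:
  fixes g :: "'a::euclidean_space \<Rightarrow> real"
  assumes "g \<in> borel_measurable borel"
  shows "(LINT x|lborel. g (c + x)) = (LINT x|lborel. g x)"
proof -
  have "(LINT x|lborel. g x) = (LINT x|distr lborel borel ((+) c). g x)" by (simp add: lborel_distr_plus)
  also have "\<dots> = (LINT x|lborel. g (c + x))" using assms by (subst integral_distr) auto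
  finally show ?thesis ..
qed

text \<open>
  Integration by parts against an affine function: the integral of \<open>\<Phi>(x + t e) w(x)\<close> is, after a
  translation, affine in \<open>t\<close>; compare derivatives at \<open>t = 0\<close>.
\<close>

lemma affine_integration_by_parts:
  fixes \<Phi> \<Phi>' w :: "real^'d::finite \<Rightarrow> real"
  assumes c: "continuous_on UNIV \<Phi>" "continuous_on UNIV \<Phi>'" "continuous_on UNIV w"
    and supp: "\<And>x. x \<notin> cbox a b \<Longrightarrow> \<Phi> x = 0" "\<And>x. x \<notin> cbox a b \<Longrightarrow> \<Phi>' x = 0"
    and d: "\<And>x. ((\<lambda>t. \<Phi> (x + t *\<^sub>R axis j 1)) has_real_derivative \<Phi>' x) (at 0)"
    and w: "\<And>x t. w (x + t *\<^sub>R axis j 1) = w x + t * s"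
  shows "(LINT x|lborel. \<Phi>' x * w x) = - s * (LINT x|lborel. \<Phi> x)"
proof -
  let ?e = "axis j 1 :: real^'d"
  let ?a = "a - (\<chi> i. 1)" and ?b = "b + (\<chi> i. 1)"
  have sub: "cbox a b \<subseteq> cbox ?a ?b"
  proof
    fix x assume x: "x \<in> cbox a b"
    have "?a $ i \<le> x $ i \<and> x $ i \<le> ?b $ i" for i
    proof -
      have "a $ i \<le> x $ i" "x $ i \<le> b $ i" using x by (simp_all add: mem_box_cart)
      then show ?thesis by simp
    qed
    then show "x \<in> cbox ?a ?b" by (simp add: mem_box_cart)
  qed
  have out: "\<Phi> (x + t *\<^sub>R ?e) = 0" if "x \<notin> cbox ?a ?b" "t \<in> {-1..1}" for x t
  proof (rule supp(1))
    have "\<exists>i. \<not> (?a $ i \<le> x $ i \<and> x $ i \<le> ?b $ i)" using that(1) by (simp add: mem_box_cart)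
    then obtain i where "\<not> (?a $ i \<le> x $ i \<and> x $ i \<le> ?b $ i)" by blast
    then have i: "x $ i < a $ i - 1 \<or> b $ i + 1 < x $ i" by auto
    have "\<bar>(t *\<^sub>R ?e) $ i\<bar> \<le> 1" using that(2) by (auto simp: axis_def)
    then have "(x + t *\<^sub>R ?e) $ i < a $ i \<or> b $ i < (x + t *\<^sub>R ?e) $ i" using i by (auto simp: vector_add_component abs_le_iff)
    then show "x + t *\<^sub>R ?e \<notin> cbox a b" by (auto simp: mem_box_cart not_le)
  qed
  have cc: "continuous_on S (\<lambda>x. \<Phi> (x + t *\<^sub>R ?e) * w x)" for S t
    by (intro continuous_intros continuous_on_compose2[OF c(1)] continuous_on_subset[OF c(3)]) auto
  have \<Psi>: "integral (cbox ?a ?b) (\<lambda>x. \<Phi> (x + t *\<^sub>R ?e) * w x)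
    = (LINT x|lborel. \<Phi> x * w x) - t * s * (LINT x|lborel. \<Phi> x)" if t: "t \<in> {-1..1}" for t
  proof -
    have "integral (cbox ?a ?b) (\<lambda>x. \<Phi> (x + t *\<^sub>R ?e) * w x) = (LINT x|lborel. \<Phi> (x + t *\<^sub>R ?e) * w x)"
      by (rule integrable_lborel_continuous_support(2)[OF cc, symmetric]) (subst out[OF _ t], assumption, rule mult_zero_left)
    also have "\<dots> = (LINT x|lborel. \<Phi> (t *\<^sub>R ?e + x) * w ((t *\<^sub>R ?e + x) + (- t) *\<^sub>R ?e))"
      by (simp add: add.commute)
    also have "\<dots> = (LINT y|lborel. \<Phi> y * w (y + (- t) *\<^sub>R ?e))"
      by (rule lborel_integral_translate[where g = "\<lambda>y. \<Phi> y * w (y + (- t) *\<^sub>R ?e)"])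
        (intro borel_measurable_continuous_onI continuous_intros c continuous_on_compose2[OF c(3)], auto)
    also have "\<dots> = (LINT y|lborel. \<Phi> y * w y - t * s * \<Phi> y)"
      unfolding w by (simp add: algebra_simps)
    also have "\<dots> = (LINT x|lborel. \<Phi> x * w x) - t * s * (LINT x|lborel. \<Phi> x)"
    proof -
      have "integrable lborel (\<lambda>y. \<Phi> y * w y)" "integrable lborel \<Phi>"
        using supp by (intro integrable_lborel_continuous_support(1)[of _ a b] continuous_intros c; simp)+
      then show ?thesis by simp
    qed
    finally show ?thesis .
  qed
  have "((\<lambda>t. integral (cbox ?a ?b) (\<lambda>x. \<Phi> (x + t *\<^sub>R ?e) * w x)) has_field_derivative
      integral (cbox ?a ?b) (\<lambda>x. \<Phi>' (x + 0 *\<^sub>R ?e) * w x)) (at 0 within {-1..1})"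
  proof (rule leibniz_rule_field_derivative)
    fix t x
    have "((\<lambda>h. \<Phi> ((x + t *\<^sub>R ?e) + h *\<^sub>R ?e)) has_real_derivative \<Phi>' (x + t *\<^sub>R ?e)) (at 0)" by (rule d)
    then have "((\<lambda>h. \<Phi> (x + (h + t) *\<^sub>R ?e)) has_real_derivative \<Phi>' (x + t *\<^sub>R ?e)) (at 0)"
      by (simp add: scaleR_add_left add_ac)
    then have "((\<lambda>t. \<Phi> (x + t *\<^sub>R ?e)) has_real_derivative \<Phi>' (x + t *\<^sub>R ?e)) (at t)"
      using DERIV_shift[of "\<lambda>t. \<Phi> (x + t *\<^sub>R ?e)" "\<Phi>' (x + t *\<^sub>R ?e)" 0 t] by simp
    from DERIV_cmult_right[OF this, of "w x"]
    show "((\<lambda>t. \<Phi> (x + t *\<^sub>R ?e) * w x) has_field_derivative \<Phi>' (x + t *\<^sub>R ?e) * w x) (at t within {-1..1})"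
      by (rule has_field_derivative_at_within)
  next
    show "(\<lambda>x. \<Phi> (x + t *\<^sub>R ?e) * w x) integrable_on cbox ?a ?b" for t
      by (rule integrable_continuous[OF cc])
    show "continuous_on ({-1..1} \<times> cbox ?a ?b) (\<lambda>(t, x). \<Phi>' (x + t *\<^sub>R ?e) * w x)"
      unfolding case_prod_beta
      by (intro continuous_intros continuous_on_compose2[OF c(2)] continuous_on_compose2[OF c(3)]) auto
  qed auto
  moreover have "((\<lambda>t. integral (cbox ?a ?b) (\<lambda>x. \<Phi> (x + t *\<^sub>R ?e) * w x)) has_field_derivative
      - s * (LINT x|lborel. \<Phi> x)) (at 0 within {-1..1})"
  proof -
    have "((\<lambda>t. (LINT x|lborel. \<Phi> x * w x) - t * s * (LINT x|lborel. \<Phi> x)) has_field_derivative - s * (LINT x|lborel. \<Phi> x)) (at 0 within {-1..1})"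
      by (auto intro!: derivative_eq_intros)
    then show ?thesis
      by (rule has_field_derivative_transform_within[where d = 1]) (simp_all only: \<Psi>, simp_all)
  qed
  ultimately have "integral (cbox ?a ?b) (\<lambda>x. \<Phi>' (x + 0 *\<^sub>R ?e) * w x) = - s * (LINT x|lborel. \<Phi> x)"
  proof (rule has_field_derivative_unique)
    show "at 0 within {-1..1::real} \<noteq> bot" by (simp add: at_within_Icc_at)
  qed
  moreover have "(LINT x|lborel. \<Phi>' x * w x) = integral (cbox ?a ?b) (\<lambda>x. \<Phi>' x * w x)"
  proof (rule integrable_lborel_continuous_support(2))
    show "continuous_on UNIV (\<lambda>x. \<Phi>' x * w x)" by (intro continuous_intros c)
    show "\<Phi>' x * w x = 0" if "x \<notin> cbox ?a ?b" for x using supp(2)[of x] sub that by auto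
  qed
  ultimately show ?thesis by simp
qed


lemma integral_lebesgue_on_subset:
  fixes f :: "'a::euclidean_space \<Rightarrow> 'b::{banach, second_countable_topology}"
  assumes "A \<in> sets lebesgue" "B \<in> sets lebesgue" "A \<subseteq> B" "\<And>x. x \<in> B \<Longrightarrow> x \<notin> A \<Longrightarrow> f x = 0"
  shows "integral\<^sup>L (lebesgue_on B) f = integral\<^sup>L (lebesgue_on A) f"
proof -
  have "(\<lambda>x. indicator B x *\<^sub>R f x) = (\<lambda>x. indicator A x *\<^sub>R f x)"
    using assms(3,4) by (auto simp: fun_eq_iff indicator_def)
  then show ?thesis using assms(1,2) by (simp add: integral_restrict_space)
qed

lemma integral_lebesgue_on_lborel:
  fixes f :: "'a::euclidean_space \<Rightarrow> real"
  assumes "A \<in> sets lebesgue" "f \<in> borel_measurable borel" "\<And>x. x \<notin> A \<Longrightarrow> f x = 0"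
  shows "integral\<^sup>L (lebesgue_on A) f = integral\<^sup>L lborel f"
proof -
  have "(\<lambda>x. indicator A x *\<^sub>R f x) = f" using assms(3) by (auto simp: fun_eq_iff indicator_def)
  then show ?thesis using assms(1,2) by (simp add: integral_restrict_space integral_completion)
qed

lemma L2_imp_integrable:
  assumes \<Omega>: "\<Omega> \<in> lmeasurable" and v: "v \<in> L2 \<Omega>"
  shows "integrable (lebesgue_on \<Omega>) v"
proof -
  interpret finite_measure "lebesgue_on \<Omega>" by (rule finite_measure_lebesgue_on[OF \<Omega>])
  have "integrable (lebesgue_on \<Omega>) (\<lambda>x. 1 + (norm (v x))\<^sup>2)"
    using L2_norm_integrable[OF v] by simp
  then show ?thesis
  proof (rule Bochner_Integration.integrable_bound)
    show "v \<in> borel_measurable (lebesgue_on \<Omega>)" by (rule L2_measurable[OF v])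
    have "r \<le> 1 + r\<^sup>2" if "0 \<le> r" for r :: real using zero_le_power2[of "r - 1/2"] by (simp add: power2_eq_square algebra_simps)
    then have "norm (v x) \<le> norm (1 + (norm (v x))\<^sup>2)" for x by simp
    then show "AE x in lebesgue_on \<Omega>. norm (v x) \<le> norm (1 + (norm (v x))\<^sup>2)" by simp
  qed
qed

lemma L2_subset:
  assumes "S \<subseteq> \<Omega>" "S \<in> sets lebesgue" "\<Omega> \<in> sets lebesgue" "v \<in> L2 \<Omega>"
  shows "v \<in> L2 S"
proof -
  have 1: "v \<in> borel_measurable (lebesgue_on \<Omega>)" "integrable (lebesgue_on \<Omega>) (\<lambda>x. (norm (v x))\<^sup>2)"
    using assms(4) by (auto simp: L2_def)
  have "v \<in> borel_measurable (lebesgue_on S)" by (rule measurable_restrict_mono[OF 1(1) assms(1)])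
  moreover have "integrable (lebesgue_on S) (\<lambda>x. (norm (v x))\<^sup>2)"
  proof -
    have "set_integrable lebesgue \<Omega> (\<lambda>x. (norm (v x))\<^sup>2)"
      using 1(2) assms(3) by (simp add: set_integrable_def integrable_restrict_space)
    then have "set_integrable lebesgue S (\<lambda>x. (norm (v x))\<^sup>2)"
      by (rule set_integrable_subset) (use assms in auto)
    then show ?thesis using assms(2) by (simp add: set_integrable_def integrable_restrict_space)
  qed
  ultimately show ?thesis by (simp add: L2_def)
qed

text \<open>
  Weak derivatives are local: test with bump functions on boxes inside \<open>S\<close> and let them increase to
  the indicators of the boxes.
\<close>

lemma affine_weak_deriv:
  fixes \<Omega> :: "(real^'d::finite) set" and W v :: "('d, 'm::finite) field"
  assumes \<Omega>: "open \<Omega>" "bounded \<Omega>" and S: "open S" "S \<subseteq> \<Omega>"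
    and D: "is_weak_deriv \<Omega> ((\<lambda>_. 0)(j := 1)) W v" and W: "W \<in> L2 \<Omega>"
    and aff: "\<And>x. x \<in> S \<Longrightarrow> W x = c0 + (\<Sum>i\<in>UNIV. (x $ i) *\<^sub>R c i)"
  shows "AE x in lebesgue_on S. v x = c j"
proof -
  let ?e = "(\<lambda>_. 0)(j := 1) :: 'd \<Rightarrow> nat"
  have \<Omega>m: "\<Omega> \<in> lmeasurable" using \<Omega> by (simp add: lmeasurable_open)
  have Sm: "S \<in> lmeasurable" using \<Omega> S bounded_subset by (intro lmeasurable_open) blast+
  have Ss: "S \<in> sets lebesgue" "\<Omega> \<in> sets lebesgue" using Sm \<Omega>m by auto
  interpret finite_measure "lebesgue_on S" by (rule finite_measure_lebesgue_on[OF Sm])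
  have v: "v \<in> L2 \<Omega>" using D by (simp add: is_weak_deriv_def)
  have iv: "integrable (lebesgue_on S) v" by (rule L2_imp_integrable[OF Sm L2_subset[OF S(2) Ss v]])
  have "AE x in lebesgue_on S. v x $ k - c j $ k = 0" for k
  proof (rule integral_box_zero_imp_AE_zero[OF S(1)])
    let ?f = "\<lambda>x. v x $ k - c j $ k"
    have ivk: "integrable (lebesgue_on S) (\<lambda>x. v x $ k)"
      using integrable_inner_left[of "axis k 1" "lebesgue_on S" v] iv by (simp add: inner_axis)
    show iff: "integrable (lebesgue_on S) ?f" using ivk by simp
    fix a b :: "real^'d" assume ab: "cbox a b \<subseteq> S"
    define p where "p n = pbump a b n (\<lambda>_. 0)" for n
    define p' where "p' n = pbump a b n ?e" for n
    define w where "w x = c0 $ k + (\<Sum>i\<in>UNIV. x $ i * c i $ k)" for x :: "real^'d"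
    have pout: "p n x = 0" "p' n x = 0" if "x \<notin> cbox a b" for n x
      using pbump_outside[OF that] by (simp_all add: p_def p'_def)
    have pS: "p n x = 0" "p' n x = 0" if "x \<notin> S" for n x
      using pout[of x n] ab that by blast+
    have pm: "p n \<in> borel_measurable borel" "p' n \<in> borel_measurable borel" for n
      unfolding p_def p'_def by (intro borel_measurable_continuous_onI continuous_pbump)+
    have pb: "\<bar>p n x\<bar> \<le> 1" for n x using pbump_0_bounds[of a b n x] by (simp add: p_def)
    have cw: "continuous_on UNIV w" unfolding w_def by (intro continuous_intros)
    have z: "(LINT x|lebesgue_on S. p n x * ?f x) = 0" for n
    proof -
      have "test_jet \<Omega> (pbump a b n)" using ab S(2) by (intro test_jet_pbump) blast
      then have id: "(LINT x|lebesgue_on \<Omega>. p' n x *\<^sub>R W x) = - (LINT x|lebesgue_on \<Omega>. p n x *\<^sub>R v x)"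
        using D unfolding is_weak_deriv_def p_def p'_def by (auto simp: mi_order_def)
      have comp: "(LINT x|lebesgue_on \<Omega>. q x *\<^sub>R V x) $ k = (LINT x|lebesgue_on S. q x * V x $ k)"
        if q: "continuous_on UNIV q" "\<And>x. x \<notin> cbox a b \<Longrightarrow> q x = 0" and V: "V \<in> L2 \<Omega>" for q V
      proof -
        have "bounded (q ` cbox a b)"
          by (intro compact_imp_bounded compact_continuous_image compact_cbox continuous_on_subset[OF q(1)]) auto
        then obtain C where C: "\<And>x. x \<in> cbox a b \<Longrightarrow> \<bar>q x\<bar> \<le> C" by (auto simp: bounded_iff)
        have C': "\<bar>q x\<bar> \<le> \<bar>C\<bar>" for x using C[of x] q(2)[of x] by (cases "x \<in> cbox a b") auto
        have qm: "q \<in> borel_measurable (lebesgue_on \<Omega>)"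
          using borel_measurable_continuous_onI[OF q(1)] by (simp add: measurable_completion measurable_restrict_space1)
        have "integrable (lebesgue_on \<Omega>) (\<lambda>x. q x *\<^sub>R V x)"
        proof (rule Bochner_Integration.integrable_bound)
          show "integrable (lebesgue_on \<Omega>) (\<lambda>x. C *\<^sub>R V x)" by (intro integrable_scaleR_right L2_imp_integrable[OF \<Omega>m V])
          show "(\<lambda>x. q x *\<^sub>R V x) \<in> borel_measurable (lebesgue_on \<Omega>)"
            by (intro borel_measurable_scaleR qm L2_measurable[OF V])
          show "AE x in lebesgue_on \<Omega>. norm (q x *\<^sub>R V x) \<le> norm (C *\<^sub>R V x)"
            by (rule AE_I2) (simp add: C' mult_right_mono)
        qed
        then have "(LINT x|lebesgue_on \<Omega>. q x *\<^sub>R V x) \<bullet> axis k 1 = (LINT x|lebesgue_on \<Omega>. (q x *\<^sub>R V x) \<bullet> axis k 1)"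
          by (intro integral_inner_left[symmetric])
        also have "\<dots> = (LINT x|lebesgue_on S. (q x *\<^sub>R V x) \<bullet> axis k 1)"
          by (rule integral_lebesgue_on_subset[OF Ss S(2)]) (use q(2) ab in auto)
        finally show ?thesis by (simp add: inner_axis)
      qed
      have "(LINT x|lebesgue_on S. p' n x * W x $ k) = - (LINT x|lebesgue_on S. p n x * v x $ k)"
      proof -
        have c: "continuous_on UNIV (p n)" "continuous_on UNIV (p' n)" unfolding p_def p'_def by (rule continuous_pbump)+
        have "(LINT x|lebesgue_on \<Omega>. p' n x *\<^sub>R W x) $ k = - ((LINT x|lebesgue_on \<Omega>. p n x *\<^sub>R v x) $ k)"
          unfolding id by simp
        moreover have "(LINT x|lebesgue_on \<Omega>. p' n x *\<^sub>R W x) $ k = (LINT x|lebesgue_on S. p' n x * W x $ k)"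
          by (rule comp[OF c(2) _ W]) (rule pout)
        moreover have "(LINT x|lebesgue_on \<Omega>. p n x *\<^sub>R v x) $ k = (LINT x|lebesgue_on S. p n x * v x $ k)"
          by (rule comp[OF c(1) _ v]) (rule pout)
        ultimately show ?thesis by simp
      qed
      moreover have "(LINT x|lebesgue_on S. p' n x * W x $ k) = - c j $ k * (LINT x|lebesgue_on S. p n x)"
      proof -
        have "(LINT x|lebesgue_on S. p' n x * W x $ k) = (LINT x|lebesgue_on S. p' n x * w x)"
          by (intro Bochner_Integration.integral_cong) (auto simp: space_restrict_space aff w_def)
        also have "\<dots> = (LINT x|lborel. p' n x * w x)"
          by (rule integral_lebesgue_on_lborel[OF Ss(1)])
            (use pm borel_measurable_continuous_onI[OF cw] in \<open>simp_all add: pS\<close>)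
        also have "\<dots> = - c j $ k * (LINT x|lborel. p n x)"
        proof (rule affine_integration_by_parts[where a = a and b = b and j = j])
          show "continuous_on UNIV (p n)" "continuous_on UNIV (p' n)" unfolding p_def p'_def by (rule continuous_pbump)+
          show "continuous_on UNIV w" by (rule cw)
          show "p n x = 0" "p' n x = 0" if "x \<notin> cbox a b" for x using pout that by auto
          show "((\<lambda>t. p n (x + t *\<^sub>R axis j 1)) has_real_derivative p' n x) (at 0)" for x
            using pbump_has_deriv[of a b n "\<lambda>_. 0" x j] by (simp add: p_def p'_def)
          show "w (x + t *\<^sub>R axis j 1) = w x + t * c j $ k" for x t
          proof -
            have "(\<Sum>i\<in>UNIV. (x + t *\<^sub>R axis j 1) $ i * c i $ k)
              = (\<Sum>i\<in>UNIV. x $ i * c i $ k + (if i = j then t * c j $ k else 0))"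
              by (intro sum.cong) (auto simp: axis_def algebra_simps)
            then show ?thesis by (simp add: w_def sum.distrib)
          qed
        qed
        also have "(LINT x|lborel. p n x) = (LINT x|lebesgue_on S. p n x)"
          by (rule integral_lebesgue_on_lborel[OF Ss(1), symmetric]) (use pm in \<open>simp_all add: pS\<close>)
        finally show ?thesis .
      qed
      moreover have "(LINT x|lebesgue_on S. p n x * ?f x)
        = (LINT x|lebesgue_on S. p n x * v x $ k) - c j $ k * (LINT x|lebesgue_on S. p n x)"
      proof -
        have pmS: "p n \<in> borel_measurable (lebesgue_on S)" using pm by (simp add: measurable_completion measurable_restrict_space1)
        have "integrable (lebesgue_on S) (p n)"
          by (rule Bochner_Integration.integrable_bound[of _ "\<lambda>_. 1::real"]) (use pmS pb in auto)
        moreover have "integrable (lebesgue_on S) (\<lambda>x. p n x * v x $ k)"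
        proof (rule Bochner_Integration.integrable_bound[OF ivk])
          show "(\<lambda>x. p n x * v x $ k) \<in> borel_measurable (lebesgue_on S)"
            by (intro borel_measurable_times pmS borel_measurable_integrable[OF ivk])
          show "AE x in lebesgue_on S. norm (p n x * v x $ k) \<le> norm (v x $ k)"
            using pb by (intro AE_I2) (simp add: abs_mult mult_left_le_one_le)
        qed
        ultimately show ?thesis by (simp add: right_diff_distrib mult.commute)
      qed
      ultimately show ?thesis by simp
    qed
    have "(\<lambda>n. LINT x|lebesgue_on S. p n x * ?f x) \<longlonglongrightarrow> (LINT x|lebesgue_on S. indicator (box a b) x * ?f x)"
    proof (rule integral_dominated_convergence[where w = "\<lambda>x. \<bar>?f x\<bar>"])
      have b: "indicator (box a b) \<in> borel_measurable borel" by simp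
      show "(\<lambda>x. indicator (box a b) x * ?f x) \<in> borel_measurable (lebesgue_on S)"
        using b by (intro borel_measurable_times borel_measurable_integrable[OF iff])
          (simp add: measurable_completion measurable_restrict_space1)
      show "(\<lambda>x. p n x * ?f x) \<in> borel_measurable (lebesgue_on S)" for n
        using pm by (intro borel_measurable_times borel_measurable_integrable[OF iff])
          (simp add: measurable_completion measurable_restrict_space1)
      show "integrable (lebesgue_on S) (\<lambda>x. \<bar>?f x\<bar>)" by (intro integrable_abs iff)
      show "AE x in lebesgue_on S. (\<lambda>n. p n x * ?f x) \<longlonglongrightarrow> indicator (box a b) x * ?f x"
        unfolding p_def by (intro AE_I2 tendsto_mult tendsto_const pbump_0_tendsto)
      show "AE x in lebesgue_on S. norm (p n x * ?f x) \<le> \<bar>?f x\<bar>" for n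
        using pb by (intro AE_I2) (simp add: abs_mult mult_left_le_one_le)
    qed
    then show "(LINT x|lebesgue_on S. indicator (box a b) x * ?f x) = 0"
      unfolding z by (simp add: LIMSEQ_const_iff)
  qed
  then have "AE x in lebesgue_on S. \<forall>k\<in>UNIV. v x $ k - c j $ k = 0"
    by (subst AE_finite_all) auto
  then show ?thesis by eventually_elim (simp add: vec_eq_iff)
qed


text \<open>
  On a ball an affine function controls its slopes: the difference of two values at distance \<open>\<rho>/2\<close> in
  direction \<open>j\<close> is \<open>\<rho>/2\<close> times the slope, wherever it is taken.
\<close>

lemma affine_slope_bound:
  fixes f :: "(real^'d::finite) \<Rightarrow> real^'m::finite"
  assumes S: "S \<in> sets lebesgue" "ball x0 \<rho> \<subseteq> S" and \<rho>: "\<rho> > 0"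
    and f: "integrable (lebesgue_on S) (\<lambda>x. (norm (f x))\<^sup>2)"
    and aff: "AE x in lebesgue_on S. f x = c0 + (\<Sum>i\<in>UNIV. (x $ i) *\<^sub>R c i)"
  shows "measure lborel (ball x0 (\<rho>/2)) * (\<rho>\<^sup>2 / 16 * (norm (c j))\<^sup>2) \<le> (LINT x|lebesgue_on S. (norm (f x))\<^sup>2)"
proof -
  define g where "g x = c0 + (\<Sum>i\<in>UNIV. (x $ i) *\<^sub>R c i)" for x :: "real^'d"
  define e where "e = (\<rho>/2) *\<^sub>R axis j (1::real)"
  have ne: "norm e = \<rho>/2" using \<rho> by (simp add: e_def norm_axis_1)
  have cg: "continuous_on X g" for X unfolding g_def by (intro continuous_intros)
  have gd: "g (e + z) = g z + (\<rho>/2) *\<^sub>R c j" for z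
  proof -
    have "(\<Sum>i\<in>UNIV. ((e + z) $ i) *\<^sub>R c i) = (\<Sum>i\<in>UNIV. (z $ i) *\<^sub>R c i + (if i = j then (\<rho>/2) *\<^sub>R c j else 0))"
      by (intro sum.cong) (auto simp: e_def axis_def scaleR_add_left)
    then show ?thesis by (simp add: g_def sum.distrib)
  qed
  have ib: "integrable lborel (\<lambda>x. indicator (ball y s) x * h x)" if "continuous_on UNIV h" for y :: "real^'d" and s and h :: "real^'d \<Rightarrow> real"
  proof -
    have "set_integrable lborel (cball y s) h"
      unfolding set_integrable_def
      using borel_integrable_compact[OF compact_cball continuous_on_subset[OF that subset_UNIV]]
      by (simp add: indicator_def if_distrib cong: if_cong)
    then have "set_integrable lborel (ball y s) h" by (rule set_integrable_subset) auto
    then show ?thesis by (simp add: set_integrable_def)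
  qed
  have cn: "continuous_on UNIV (\<lambda>x. (norm (g x))\<^sup>2)" "continuous_on UNIV (\<lambda>x. (norm (g (e + x)))\<^sup>2)"
    by (intro continuous_intros cg continuous_on_compose2[OF cg[of UNIV]]; simp)+
  have le: "(LINT x|lborel. indicator (ball y (\<rho>/2)) x * (norm (g x))\<^sup>2) \<le> (LINT x|lebesgue_on S. (norm (f x))\<^sup>2)"
    if "ball y (\<rho>/2) \<subseteq> S" for y
  proof -
    have m: "(\<lambda>x. indicator (ball y (\<rho>/2)) x * (norm (g x))\<^sup>2) \<in> borel_measurable borel"
      using borel_measurable_integrable[OF ib[OF cn(1)]] by simp
    have "(LINT x|lborel. indicator (ball y (\<rho>/2)) x * (norm (g x))\<^sup>2)
      = (LINT x|lebesgue_on S. indicator (ball y (\<rho>/2)) x * (norm (g x))\<^sup>2)"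
      by (rule integral_lebesgue_on_lborel[OF S(1) m, symmetric]) (use that in \<open>auto simp: indicator_def\<close>)
    also have "\<dots> \<le> (LINT x|lebesgue_on S. (norm (f x))\<^sup>2)"
    proof (rule integral_mono_AE')
      show "AE x in lebesgue_on S. indicator (ball y (\<rho>/2)) x * (norm (g x))\<^sup>2 \<le> (norm (f x))\<^sup>2"
        using aff by eventually_elim (auto simp: g_def indicator_def)
      show "AE x in lebesgue_on S. 0 \<le> (norm (f x))\<^sup>2" by simp
    qed (rule f)
    finally show ?thesis .
  qed
  let ?B = "ball x0 (\<rho>/2)"
  have 1: "(LINT x|lborel. indicator ?B x * (norm (g x))\<^sup>2) \<le> (LINT x|lebesgue_on S. (norm (f x))\<^sup>2)"
    by (rule le) (use S(2) \<rho> in \<open>auto simp: subset_iff\<close>)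
  have 2: "(LINT x|lborel. indicator ?B x * (norm (g (e + x)))\<^sup>2) \<le> (LINT x|lebesgue_on S. (norm (f x))\<^sup>2)"
  proof -
    have "indicator ?B x = (indicator (ball (x0 + e) (\<rho>/2)) (e + x) :: real)" for x
      by (auto simp: indicator_def dist_norm algebra_simps)
    then have "(LINT x|lborel. indicator ?B x * (norm (g (e + x)))\<^sup>2)
      = (LINT x|lborel. indicator (ball (x0 + e) (\<rho>/2)) (e + x) * (norm (g (e + x)))\<^sup>2)" by simp
    also have "\<dots> = (LINT x|lborel. indicator (ball (x0 + e) (\<rho>/2)) x * (norm (g x))\<^sup>2)"
      by (rule lborel_integral_translate[where g = "\<lambda>x. indicator (ball (x0 + e) (\<rho>/2)) x * (norm (g x))\<^sup>2"])
        (use borel_measurable_integrable[OF ib[OF cn(1)]] in simp)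
    also have "\<dots> \<le> (LINT x|lebesgue_on S. (norm (f x))\<^sup>2)"
    proof (rule le)
      have "ball (x0 + e) (\<rho>/2) \<subseteq> ball x0 \<rho>"
      proof
        fix z assume "z \<in> ball (x0 + e) (\<rho>/2)"
        moreover have "dist x0 z \<le> dist x0 (x0 + e) + dist (x0 + e) z" by (rule dist_triangle)
        moreover have "dist x0 (x0 + e) = \<rho>/2" using ne by (simp add: dist_norm)
        ultimately show "z \<in> ball x0 \<rho>" by simp
      qed
      then show "ball (x0 + e) (\<rho>/2) \<subseteq> S" using S(2) by blast
    qed
    finally show ?thesis .
  qed
  let ?q = "\<rho>\<^sup>2 / 4 * (norm (c j))\<^sup>2"
  have "?q \<le> 2 * (norm (g (e + x)))\<^sup>2 + 2 * (norm (g x))\<^sup>2" for x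
  proof -
    have "norm ((\<rho>/2) *\<^sub>R c j) \<le> norm (g (e + x)) + norm (g x)"
      using norm_triangle_ineq4[of "g (e + x)" "g x"] by (simp add: gd)
    then have "(norm ((\<rho>/2) *\<^sub>R c j))\<^sup>2 \<le> (norm (g (e + x)) + norm (g x))\<^sup>2" by (intro power_mono) auto
    also have "\<dots> \<le> 2 * (norm (g (e + x)))\<^sup>2 + 2 * (norm (g x))\<^sup>2"
      using zero_le_power2[of "norm (g (e + x)) - norm (g x)"] by (simp add: power2_eq_square algebra_simps)
    finally show ?thesis by (simp add: power_mult_distrib power_divide)
  qed
  then have "(LINT x|lborel. indicator ?B x * ?q)
    \<le> (LINT x|lborel. 2 * (indicator ?B x * (norm (g (e + x)))\<^sup>2) + 2 * (indicator ?B x * (norm (g x))\<^sup>2))"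
    by (intro integral_mono ib continuous_on_const Bochner_Integration.integrable_add integrable_mult_right cn)
      (auto simp: indicator_def)
  also have "\<dots> = 2 * (LINT x|lborel. indicator ?B x * (norm (g (e + x)))\<^sup>2) + 2 * (LINT x|lborel. indicator ?B x * (norm (g x))\<^sup>2)"
    using ib[OF cn(1), of x0 "\<rho>/2"] ib[OF cn(2), of x0 "\<rho>/2"] by simp
  also have "\<dots> \<le> 4 * (LINT x|lebesgue_on S. (norm (f x))\<^sup>2)" using 1 2 by linarith
  finally have "measure lborel ?B * ?q \<le> 4 * (LINT x|lebesgue_on S. (norm (f x))\<^sup>2)" by simp
  then show ?thesis by simp
qed

lemma integral_mesh:
  fixes g :: "real^'d::finite \<Rightarrow> real"
  assumes m: "is_mesh \<Omega> \<T>" and \<Omega>: "\<Omega> \<in> sets lebesgue" and sub: "\<And>K. K \<in> \<T> \<Longrightarrow> interior K \<subseteq> \<Omega>"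
    and g: "integrable (lebesgue_on \<Omega>) g"
  shows "(LINT x|lebesgue_on \<Omega>. g x) = (\<Sum>K\<in>\<T>. LINT x|lebesgue_on (interior K). g x)"
    "\<And>K. K \<in> \<T> \<Longrightarrow> integrable (lebesgue_on (interior K)) g"
proof -
  have gs: "set_integrable lebesgue \<Omega> g" using g \<Omega> by (simp add: set_integrable_def integrable_restrict_space)
  have K: "set_integrable lebesgue (interior K) g" if "K \<in> \<T>" for K
    by (rule set_integrable_subset[OF gs]) (use sub[OF that] in auto)
  then show "integrable (lebesgue_on (interior K)) g" if "K \<in> \<T>" for K
    using that by (simp add: set_integrable_def integrable_restrict_space)
  have fin: "finite \<T>" using m by (simp add: is_mesh_def)
  have "AE x in lebesgue. x \<in> \<Omega> \<longrightarrow> (\<exists>K\<in>\<T>. x \<in> interior K)"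
    using mesh_AE_interior[OF m \<Omega>] \<Omega> by (subst (asm) AE_restrict_space_iff) auto
  then have ae: "AE x in lebesgue. indicator \<Omega> x *\<^sub>R g x = (\<Sum>K\<in>\<T>. indicator (interior K) x *\<^sub>R g x)"
  proof eventually_elim
    case (elim x)
    show ?case
    proof (cases "x \<in> \<Omega>")
      case True
      then obtain K where K: "K \<in> \<T>" "x \<in> interior K" using elim by blast
      have other: "x \<notin> interior K'" if "K' \<in> \<T>" "K' \<noteq> K" for K'
      proof -
        have "interior K \<inter> interior K' = {}" using m K(1) that unfolding is_mesh_def by metis
        then show ?thesis using K(2) by blast
      qed
      have "(\<Sum>K'\<in>\<T>. indicator (interior K') x *\<^sub>R g x) = (\<Sum>K'\<in>\<T>. if K' = K then g x else 0)"
        by (intro sum.cong) (auto simp: K(2) other)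
      then show ?thesis using True K fin by simp
    next
      case False
      then have "x \<notin> interior K" if "K \<in> \<T>" for K using sub[OF that] by blast
      then show ?thesis using False by simp
    qed
  qed
  have "(LINT x|lebesgue_on \<Omega>. g x) = (LINT x|lebesgue. indicator \<Omega> x *\<^sub>R g x)"
    using \<Omega> by (simp add: integral_restrict_space)
  also have "\<dots> = (LINT x|lebesgue. (\<Sum>K\<in>\<T>. indicator (interior K) x *\<^sub>R g x))"
  proof (rule integral_cong_AE[OF _ _ ae])
    show "(\<lambda>x. indicator \<Omega> x *\<^sub>R g x) \<in> borel_measurable lebesgue"
      using gs by (simp only: set_integrable_def borel_measurable_integrable)
    show "(\<lambda>x. \<Sum>K\<in>\<T>. indicator (interior K) x *\<^sub>R g x) \<in> borel_measurable lebesgue"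
      using K by (intro borel_measurable_sum) (simp only: set_integrable_def borel_measurable_integrable)
  qed
  also have "\<dots> = (\<Sum>K\<in>\<T>. LINT x|lebesgue. indicator (interior K) x *\<^sub>R g x)"
    using K by (intro Bochner_Integration.integral_sum) (simp only: set_integrable_def)
  also have "\<dots> = (\<Sum>K\<in>\<T>. LINT x|lebesgue_on (interior K). g x)"
    by (simp add: integral_restrict_space)
  finally show "(LINT x|lebesgue_on \<Omega>. g x) = (\<Sum>K\<in>\<T>. LINT x|lebesgue_on (interior K). g x)" .
qed

lemma le_from_weighted_bound:
  fixes \<mu> r c X :: real
  assumes "\<mu> * (r\<^sup>2 / 16 * c) \<le> X" "0 < r" "0 < \<mu>"
  shows "c \<le> 16 * X / (r\<^sup>2 * \<mu>)"
proof -
  have "c * (r\<^sup>2 * \<mu>) \<le> 16 * X" using assms(1) by (simp add: mult.commute mult.left_commute)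
  then show ?thesis using assms(2,3) by (simp add: pos_le_divide_eq)
qed

lemma inverse_square_le:
  fixes h s r :: real
  assumes "h\<^sup>2 \<le> (s * r)\<^sup>2" "0 < h" "0 < r"
  shows "1 / r\<^sup>2 \<le> s\<^sup>2 / h\<^sup>2"
  using assms by (simp add: divide_le_eq pos_le_divide_eq power_mult_distrib)

lemma cancel_volume_factor:
  fixes m M b X r :: real
  assumes "m \<noteq> 0"
  shows "(M * m) * (b\<^sup>2 * (16 * X / (r\<^sup>2 * m))) = 16 * b\<^sup>2 * M * (X / r\<^sup>2)"
  using assms by (simp add: field_simps)

lemma mesh_size_facts:
  assumes "is_mesh \<Omega> \<T>"
  shows "K \<in> \<T> \<Longrightarrow> 0 < diameter K" "K \<in> \<T> \<Longrightarrow> diameter K \<le> mesh_size \<T>" "0 < mesh_size \<T>"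
proof -
  have pos: "0 < diameter K" if "K \<in> \<T>" for K
  proof -
    have K: "interior K \<noteq> {}" "bounded K" using assms that compact_imp_bounded by (auto simp: is_mesh_def)
    then obtain x where x: "x \<in> interior K" by blast
    have "interior K \<noteq> {x}" using open_interior not_open_singleton by metis
    then obtain y where y: "y \<in> interior K" "y \<noteq> x" using x by blast
    have "dist x y \<le> diameter K" using x y interior_subset by (intro diameter_bounded_bound[OF K(2)]) blast+
    moreover have "0 < dist x y" using y(2) by simp
    ultimately show ?thesis by linarith
  qed
  have fin: "finite \<T>" "\<T> \<noteq> {}" using assms by (auto simp: is_mesh_def)
  have le: "diameter K \<le> mesh_size \<T>" if "K \<in> \<T>" for K
    unfolding mesh_size_def using fin that by (intro Max_ge) auto
  show "0 < diameter K" if "K \<in> \<T>" using that by (rule pos)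
  show "diameter K \<le> mesh_size \<T>" if "K \<in> \<T>" using that by (rule le)
  show "0 < mesh_size \<T>" using fin pos le by (metis ex_in_conv order_less_le_trans)
qed

lemma L2_norm_sq: "(L2_norm \<Omega> u)\<^sup>2 = (LINT x|lebesgue_on \<Omega>. (norm (u x))\<^sup>2)"
  by (simp add: L2_norm_def L2_inner_def power2_norm_eq_inner)

lemma L2_norm_nonneg: "0 \<le> L2_norm \<Omega> u"
  by (simp add: L2_norm_def L2_inner_def)

text \<open>
  The weak derivatives of an affine function are its slopes, and the coefficients are constant.
\<close>

lemma piecewise_affine_first_order_op_constant:
  fixes \<Omega> :: "(real^'d::finite) set" and W :: "('d, 'm::finite) field"
  assumes \<Omega>: "open \<Omega>" "bounded \<Omega>" and S: "open S" "S \<subseteq> \<Omega>" and W: "W \<in> sobolev \<Omega> 1"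
    and aff: "\<And>x. x \<in> S \<Longrightarrow> W x = c0 + (\<Sum>i\<in>UNIV. (x $ i) *\<^sub>R c i)"
    and A: "\<And>j x. x \<in> \<Omega> \<Longrightarrow> A j x = a j" and B: "\<And>x. x \<in> \<Omega> \<Longrightarrow> B x = 0"
  shows "AE x in lebesgue_on S. first_order_op \<Omega> A B W x = (\<Sum>j\<in>UNIV. a j *v c j)"
proof -
  have "AE x in lebesgue_on S. weak_deriv \<Omega> ((\<lambda>_. 0)(j := 1)) W x = c j" for j
  proof (rule affine_weak_deriv[OF \<Omega> S])
    have "\<exists>v. is_weak_deriv \<Omega> ((\<lambda>_. 0)(j := 1)) W v" using W by (simp add: sobolev_def mi_order_def)
    then show "is_weak_deriv \<Omega> ((\<lambda>_. 0)(j := 1)) W (weak_deriv \<Omega> ((\<lambda>_. 0)(j := 1)) W)"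
      unfolding weak_deriv_def by (rule someI_ex)
    show "W \<in> L2 \<Omega>" using W by (simp add: sobolev_def)
  qed (rule aff)
  then have "AE x in lebesgue_on S. \<forall>j\<in>UNIV. weak_deriv \<Omega> ((\<lambda>_. 0)(j := 1)) W x = c j"
    by (subst AE_finite_all) auto
  moreover have "AE x in lebesgue_on S. x \<in> S" by (rule AE_I2) (simp add: space_restrict_space)
  ultimately show ?thesis
  proof eventually_elim
    case (elim x)
    then have x: "x \<in> \<Omega>" using S by blast
    show ?case unfolding first_order_op_def using elim by (simp add: A[OF x] B[OF x])
  qed
qed

text \<open>
  For a piecewise affine \<open>v\<close> and constant coefficients \<open>G v\<close> is constant on each element, so that
  \<open>W + G v\<close> is affine there with the slopes of \<open>W\<close>; hence it controls \<open>G W\<close>.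
\<close>

lemma piecewise_affine_inverse_estimate:
  fixes \<Omega> :: "(real^'d::finite) set"
    and A :: "'d \<Rightarrow> real^'d \<Rightarrow> real^'m::finite^'m" and B :: "real^'d \<Rightarrow> real^'m^'m"
  assumes lip: "lipschitz_domain \<Omega>" and Ac: "\<forall>j. A j constant_on \<Omega>" and B: "\<forall>x\<in>\<Omega>. B x = 0"
    and \<sigma>: "\<sigma> > 0" "\<sigma>' > 0"
  defines "G \<equiv> first_order_op \<Omega> A B"
  shows "\<exists>Ca>0. \<forall>\<T> W v. is_mesh \<Omega> \<T> \<longrightarrow> shape_regular \<sigma> \<T> \<longrightarrow> quasi_uniform \<sigma>' \<T> \<longrightarrow>
    W \<in> sobolev \<Omega> 1 \<longrightarrow> v \<in> sobolev \<Omega> 1 \<longrightarrow> G W \<in> L2 \<Omega> \<longrightarrow> G v \<in> L2 \<Omega> \<longrightarrow>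
    (\<forall>K\<in>\<T>. poly_on 1 (interior K) W \<and> poly_on 1 (interior K) v) \<longrightarrow>
    L2_norm \<Omega> (G W) \<le> Ca / mesh_size \<T> * L2_norm \<Omega> (\<lambda>x. W x + G v x)"
proof -
  have \<Omega>: "open \<Omega>" using lip by (simp add: lipschitz_domain_def)
  have \<Omega>s: "\<Omega> \<in> sets lebesgue" using \<Omega> by auto
  have "\<forall>j. \<exists>a. \<forall>x\<in>\<Omega>. A j x = a" using Ac by (simp add: constant_on_def)
  then obtain a where a: "\<And>j x. x \<in> \<Omega> \<Longrightarrow> A j x = a j" by metis
  have "\<forall>j. \<exists>\<beta>. \<forall>y. norm (a j *v y) \<le> norm y * \<beta>"
    using bounded_linear.bounded[OF matrix_vector_mul_bounded_linear] by blast
  then obtain \<beta> where \<beta>: "\<And>j y. norm (a j *v y) \<le> norm y * \<beta> j" by metis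
  define b where "b = (\<Sum>j\<in>UNIV. \<bar>\<beta> j\<bar>) + 1"
  have b: "b > 0" by (auto simp: b_def intro!: add_nonneg_pos sum_nonneg)
  define Q where "Q = 16 * b\<^sup>2 * (2 * \<sigma>) ^ CARD('d) * (\<sigma> * \<sigma>')\<^sup>2"
  have Q: "Q > 0" using b \<sigma> by (simp add: Q_def)
  show ?thesis
  proof (intro exI[of _ "sqrt Q"] conjI allI impI)
    fix \<T> :: "(real^'d) set set" and W v :: "('d, 'm) field"
    assume m: "is_mesh \<Omega> \<T>" and sr: "shape_regular \<sigma> \<T>" and qu: "quasi_uniform \<sigma>' \<T>"
      and W: "W \<in> sobolev \<Omega> 1" and v: "v \<in> sobolev \<Omega> 1" and GW: "G W \<in> L2 \<Omega>" and Gv: "G v \<in> L2 \<Omega>"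
      and poly: "\<forall>K\<in>\<T>. poly_on 1 (interior K) W \<and> poly_on 1 (interior K) v"
    let ?h = "mesh_size \<T>"
    have h: "?h > 0" by (rule mesh_size_facts(3)[OF m])
    have \<Omega>b: "bounded \<Omega>" by (rule mesh_bounded[OF m])
    have sub: "interior K \<subseteq> \<Omega>" if "K \<in> \<T>" for K by (rule mesh_interior_subset[OF lip m that])
    let ?f = "\<lambda>x. W x + G v x"
    have f: "?f \<in> L2 \<Omega>" using W by (intro L2_add Gv) (simp add: sobolev_def)
    have "(LINT x|lebesgue_on (interior K). (norm (G W x))\<^sup>2) \<le> Q / ?h\<^sup>2 * (LINT x|lebesgue_on (interior K). (norm (?f x))\<^sup>2)"
      if K: "K \<in> \<T>" for K
    proof -
      let ?S = "interior K" and ?D = "diameter K"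
      let ?X = "LINT x|lebesgue_on ?S. (norm (?f x))\<^sup>2"
      have D: "?D > 0" "?h \<le> \<sigma>' * ?D" using mesh_size_facts(1)[OF m K] qu K by (auto simp: quasi_uniform_def)
      define \<rho> where "\<rho> = ?D / \<sigma>"
      have \<rho>: "\<rho> > 0" using D \<sigma> by (simp add: \<rho>_def)
      obtain x0 where x0: "cball x0 \<rho> \<subseteq> K" using sr K by (auto simp: shape_regular_def \<rho>_def)
      have bS: "ball x0 \<rho> \<subseteq> ?S" using x0 ball_subset_cball by (intro interior_maximal) blast+
      have Kb: "bounded K" using m K compact_imp_bounded by (auto simp: is_mesh_def)
      obtain c0 c where Wa: "\<And>x. x \<in> ?S \<Longrightarrow> W x = c0 + (\<Sum>i\<in>UNIV. (x $ i) *\<^sub>R c i)"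
        by (rule poly_on_1_affine[OF conjunct1[OF bspec[OF poly K]]]) (rule that)
      obtain d0 d where va: "\<And>x. x \<in> ?S \<Longrightarrow> v x = d0 + (\<Sum>i\<in>UNIV. (x $ i) *\<^sub>R d i)"
        by (rule poly_on_1_affine[OF conjunct2[OF bspec[OF poly K]]]) (rule that)
      define p where "p = (\<Sum>j\<in>UNIV. a j *v c j)"
      define q where "q = (\<Sum>j\<in>UNIV. a j *v d j)"
      have GWc: "AE x in lebesgue_on ?S. G W x = p"
        unfolding G_def p_def
        by (rule piecewise_affine_first_order_op_constant[OF \<Omega> \<Omega>b open_interior sub[OF K] W Wa a])
          (use B in blast)+
      have Gvc: "AE x in lebesgue_on ?S. G v x = q"
        unfolding G_def q_def
        by (rule piecewise_affine_first_order_op_constant[OF \<Omega> \<Omega>b open_interior sub[OF K] v va a])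
          (use B in blast)+
      have "AE x in lebesgue_on ?S. x \<in> ?S" by (rule AE_I2) (simp add: space_restrict_space)
      with Gvc have fa: "AE x in lebesgue_on ?S. ?f x = (c0 + q) + (\<Sum>i\<in>UNIV. (x $ i) *\<^sub>R c i)"
        by eventually_elim (simp add: Wa)
      have fi: "integrable (lebesgue_on ?S) (\<lambda>x. (norm (?f x))\<^sup>2)"
        by (rule integral_mesh(2)[OF m \<Omega>s sub L2_norm_integrable[OF f] K])
      let ?\<mu> = "measure lborel (ball x0 (\<rho>/2))"
      have \<mu>: "?\<mu> = (\<rho>/2) ^ CARD('d) * measure lborel (ball (0::real^'d) 1)"
        using content_ball_conv_unit_ball[of "\<rho>/2" x0] \<rho> by simp
      have \<mu>1: "measure lborel (ball (0::real^'d) 1) > 0" by (rule content_ball_pos) simp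
      have \<mu>0: "?\<mu> > 0" using \<rho> by (intro content_ball_pos) simp
      have Sv: "measure lborel ?S \<le> (2 * \<sigma>) ^ CARD('d) * ?\<mu>"
      proof -
        have x0K: "x0 \<in> K" using x0 \<rho> by auto
        have "?S \<subseteq> cball x0 ?D"
        proof
          fix x assume "x \<in> ?S"
          then have "x \<in> K" using interior_subset by blast
          then show "x \<in> cball x0 ?D" using diameter_bounded_bound[OF Kb x0K] by simp
        qed
        then have "measure lborel ?S \<le> measure lborel (cball x0 ?D)"
          by (intro measure_mono_fmeasurable fmeasurable_compact) auto
        also have "\<dots> = ?D ^ CARD('d) * measure lborel (ball (0::real^'d) 1)"
          unfolding content_cball_conv_ball
          by (subst content_ball_conv_unit_ball) (use D in simp_all)
        also have "?D ^ CARD('d) = (2 * \<sigma>) ^ CARD('d) * (\<rho>/2) ^ CARD('d)"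
        proof -
          have "?D = (2 * \<sigma>) * (\<rho>/2)" using \<sigma> by (simp add: \<rho>_def)
          then show ?thesis by (simp only: power_mult_distrib)
        qed
        finally show ?thesis by (simp add: \<mu>)
      qed
      define Y where "Y = 16 * ?X / (\<rho>\<^sup>2 * ?\<mu>)"
      have X0: "?X \<ge> 0" by simp
      have cj: "norm (c j) \<le> sqrt Y" for j
      proof (rule real_le_rsqrt)
        have "?\<mu> * (\<rho>\<^sup>2 / 16 * (norm (c j))\<^sup>2) \<le> ?X"
          by (rule affine_slope_bound[OF _ bS \<rho> fi fa]) simp
        then show "(norm (c j))\<^sup>2 \<le> Y"
          unfolding Y_def by (rule le_from_weighted_bound) (use \<rho> \<mu>0 in auto)
      qed
      have Y0: "Y \<ge> 0" using X0 \<mu>0 by (simp add: Y_def)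
      have "norm p \<le> (\<Sum>j\<in>UNIV. \<bar>\<beta> j\<bar> * sqrt Y)"
        unfolding p_def
      proof (rule sum_norm_le)
        fix j
        have "norm (a j *v c j) \<le> norm (c j) * \<beta> j" by (rule \<beta>)
        also have "\<dots> \<le> norm (c j) * \<bar>\<beta> j\<bar>" by (intro mult_left_mono) auto
        also have "\<dots> \<le> sqrt Y * \<bar>\<beta> j\<bar>" by (intro mult_right_mono cj) auto
        finally show "norm (a j *v c j) \<le> \<bar>\<beta> j\<bar> * sqrt Y" by (simp add: mult.commute)
      qed
      also have "\<dots> \<le> b * sqrt Y" using Y0 by (simp add: b_def sum_distrib_right[symmetric] mult_right_mono)
      finally have "(norm p)\<^sup>2 \<le> (b * sqrt Y)\<^sup>2" by (intro power_mono) auto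
      then have pY: "(norm p)\<^sup>2 \<le> b\<^sup>2 * Y" using Y0 by (simp add: power_mult_distrib)
      have "(LINT x|lebesgue_on ?S. (norm (G W x))\<^sup>2) = (LINT x|lebesgue_on ?S. (norm p)\<^sup>2)"
      proof (rule integral_cong_AE)
        show "(\<lambda>x. (norm (G W x))\<^sup>2) \<in> borel_measurable (lebesgue_on ?S)"
          by (intro borel_measurable_integrable integral_mesh(2)[OF m \<Omega>s sub L2_norm_integrable[OF GW] K])
        show "AE x in lebesgue_on ?S. (norm (G W x))\<^sup>2 = (norm p)\<^sup>2" using GWc by eventually_elim simp
      qed simp
      also have "\<dots> = measure lborel ?S * (norm p)\<^sup>2"
        by (simp add: measure_restrict_space space_restrict_space)
      also have "\<dots> \<le> ((2 * \<sigma>) ^ CARD('d) * ?\<mu>) * (b\<^sup>2 * Y)"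
        using Sv pY \<mu>0 \<sigma> by (intro mult_mono) auto
      also have "\<dots> = 16 * b\<^sup>2 * (2 * \<sigma>) ^ CARD('d) * (?X / \<rho>\<^sup>2)"
        unfolding Y_def using \<mu>0 by (intro cancel_volume_factor) simp
      also have "\<dots> \<le> 16 * b\<^sup>2 * (2 * \<sigma>) ^ CARD('d) * ((\<sigma> * \<sigma>')\<^sup>2 / ?h\<^sup>2 * ?X)"
      proof (rule mult_left_mono)
        have "?h \<le> (\<sigma> * \<sigma>') * \<rho>" using D \<sigma> by (simp add: \<rho>_def)
        then have "?h\<^sup>2 \<le> ((\<sigma> * \<sigma>') * \<rho>)\<^sup>2" using h by (intro power_mono) auto
        then have "1 / \<rho>\<^sup>2 \<le> (\<sigma> * \<sigma>')\<^sup>2 / ?h\<^sup>2" by (rule inverse_square_le[OF _ h \<rho>])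
        from mult_right_mono[OF this X0] show "?X / \<rho>\<^sup>2 \<le> (\<sigma> * \<sigma>')\<^sup>2 / ?h\<^sup>2 * ?X" by simp
      qed (use \<sigma> in auto)
      also have "\<dots> = Q / ?h\<^sup>2 * ?X" unfolding Q_def by (simp only: times_divide_eq_left times_divide_eq_right mult.assoc)
      finally show ?thesis .
    qed
    then have le: "(\<Sum>K\<in>\<T>. LINT x|lebesgue_on (interior K). (norm (G W x))\<^sup>2)
      \<le> Q / ?h\<^sup>2 * (\<Sum>K\<in>\<T>. LINT x|lebesgue_on (interior K). (norm (?f x))\<^sup>2)"
      unfolding sum_distrib_left by (rule sum_mono)
    have "(L2_norm \<Omega> (G W))\<^sup>2 \<le> Q / ?h\<^sup>2 * (L2_norm \<Omega> ?f)\<^sup>2"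
    proof -
      have "(L2_norm \<Omega> (G W))\<^sup>2 = (\<Sum>K\<in>\<T>. LINT x|lebesgue_on (interior K). (norm (G W x))\<^sup>2)"
        unfolding L2_norm_sq by (rule integral_mesh(1)[OF m \<Omega>s sub L2_norm_integrable[OF GW]])
      moreover have "(L2_norm \<Omega> ?f)\<^sup>2 = (\<Sum>K\<in>\<T>. LINT x|lebesgue_on (interior K). (norm (?f x))\<^sup>2)"
        unfolding L2_norm_sq by (rule integral_mesh(1)[OF m \<Omega>s sub L2_norm_integrable[OF f]])
      ultimately show ?thesis using le by simp
    qed
    also have "\<dots> = (sqrt Q / ?h * L2_norm \<Omega> ?f)\<^sup>2" using Q by (simp add: power_mult_distrib power_divide)
    finally show "L2_norm \<Omega> (G W) \<le> sqrt Q / ?h * L2_norm \<Omega> ?f"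
      by (rule power2_le_imp_le) (intro mult_nonneg_nonneg divide_nonneg_nonneg L2_norm_nonneg, use Q h in auto)
  qed (use Q in simp)
qed

section \<open>Functions of time with values in classes\<close>

text \<open>
  Derivatives in time are fields in \<open>L\<^sup>2\<close> for almost every time only; the default value 0 keeps the norm
  bounds valid at every time.
\<close>

definition gcls :: "(real^'d) set \<Rightarrow> ('d::finite, 'm::finite) field \<Rightarrow> ('d, 'm) l2" where
  "gcls \<Omega> u = (if u \<in> L2 \<Omega> then cls \<Omega> u else 0)"

lemma gcls_L2: "u \<in> L2 \<Omega> \<Longrightarrow> gcls \<Omega> u = cls \<Omega> u"
  by (simp add: gcls_def)

lemma norm_gcls_le: "\<Omega> \<in> sets lebesgue \<Longrightarrow> norm (gcls \<Omega> u) \<le> L2_norm \<Omega> u"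
  by (simp add: gcls_def norm_cls L2_norm_nonneg)

lemma borel_measurable_lebesgue_on_AE:
  fixes f g :: "real \<Rightarrow> real"
  assumes S: "S \<in> sets lebesgue" and f: "f \<in> borel_measurable (lebesgue_on S)" and ae: "AE x in lebesgue_on S. f x = g x"
  shows "g \<in> borel_measurable (lebesgue_on S)"
proof -
  have "(\<lambda>x. indicator S x *\<^sub>R f x) \<in> borel_measurable lebesgue"
    using f S by (subst (asm) borel_measurable_restrict_space_iff) auto
  moreover have "AE x in lebesgue. x \<in> S \<longrightarrow> f x = g x"
    using ae S by (subst (asm) AE_restrict_space_iff) auto
  then have "AE x in lebesgue. indicator S x *\<^sub>R f x = indicator S x *\<^sub>R g x"
    by eventually_elim (auto simp: indicator_def)
  ultimately have "(\<lambda>x. indicator S x *\<^sub>R g x) \<in> borel_measurable lebesgue"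
    by (rule borel_measurable_AE)
  then show ?thesis using S by (subst borel_measurable_restrict_space_iff) auto
qed

text \<open>
  Simple functions have measurable pairings, limits of measurable functions are measurable, and
  Lebesgue measure is complete.
\<close>

lemma bochner_measurable_inner:
  assumes \<Omega>: "\<Omega> \<in> sets lebesgue" and X: "bochner_measurable T (L2 \<Omega>) (L2_norm \<Omega>) X"
  shows "(\<lambda>t. gcls \<Omega> (X t) \<bullet> w) \<in> borel_measurable (lebesgue_on {0<..<T})"
proof -
  let ?M = "lebesgue_on {0<..<T}"
  obtain Z where fin: "\<And>i. finite (Z i ` {0<..<T})" and ZL: "\<And>i. Z i ` {0<..<T} \<subseteq> L2 \<Omega>"
    and Zs: "\<And>i v. {t \<in> {0<..<T}. Z i t = v} \<in> sets lebesgue"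
    and lim: "AE t in ?M. X t \<in> L2 \<Omega> \<and> (\<lambda>i. L2_norm \<Omega> (fsub (Z i t) (X t))) \<longlonglongrightarrow> 0"
    using X unfolding bochner_measurable_def by blast
  have m: "(\<lambda>t. gcls \<Omega> (Z i t) \<bullet> w) \<in> borel_measurable ?M" for i
  proof -
    have "simple_function ?M (Z i)"
      unfolding simple_function_def
    proof (intro conjI ballI)
      show "finite (Z i ` space ?M)" using fin by (simp add: space_restrict_space)
      show "Z i -` {v} \<inter> space ?M \<in> sets ?M" for v
      proof -
        have "Z i -` {v} \<inter> space ?M = {t \<in> {0<..<T}. Z i t = v}" by (auto simp: space_restrict_space)
        moreover have "{t \<in> {0<..<T}. Z i t = v} \<in> sets ?M"
          using Zs[of i v] by (subst sets_restrict_space_iff) auto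
        ultimately show ?thesis by simp
      qed
    qed
    from simple_function_compose[OF this, of "\<lambda>v. gcls \<Omega> v \<bullet> w"]
    show ?thesis by (intro borel_measurable_simple_function) (simp add: o_def)
  qed
  have "AE t in ?M. t \<in> {0<..<T}" by (rule AE_I2) (simp add: space_restrict_space)
  with lim have conv: "AE t in ?M. (\<lambda>i. gcls \<Omega> (Z i t) \<bullet> w) \<longlonglongrightarrow> gcls \<Omega> (X t) \<bullet> w"
  proof eventually_elim
    case (elim t)
    then have XL: "X t \<in> L2 \<Omega>" and l: "(\<lambda>i. L2_norm \<Omega> (fsub (Z i t) (X t))) \<longlonglongrightarrow> 0" by auto
    have ZL': "Z i t \<in> L2 \<Omega>" for i using ZL[of i] elim(2) by blast
    have "norm (gcls \<Omega> (Z i t) - gcls \<Omega> (X t)) = L2_norm \<Omega> (fsub (Z i t) (X t))" for i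
      using XL ZL'[of i] by (simp add: gcls_L2 fsub_def norm_cls L2_diff \<Omega> flip: cls_diff)
    then have "(\<lambda>i. norm (gcls \<Omega> (Z i t) - gcls \<Omega> (X t))) \<longlonglongrightarrow> 0" using l by simp
    then have "(\<lambda>i. gcls \<Omega> (Z i t)) \<longlonglongrightarrow> gcls \<Omega> (X t)"
      by (simp add: tendsto_norm_zero_iff LIM_zero_iff)
    then show ?case by (intro tendsto_intros)
  qed
  have "(\<lambda>t. lim (\<lambda>i. gcls \<Omega> (Z i t) \<bullet> w)) \<in> borel_measurable ?M"
    by (rule borel_measurable_lim_metric) (rule m)
  moreover have "AE t in ?M. lim (\<lambda>i. gcls \<Omega> (Z i t) \<bullet> w) = gcls \<Omega> (X t) \<bullet> w"
    using conv by eventually_elim (rule limI)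
  ultimately show ?thesis by (rule borel_measurable_lebesgue_on_AE[rotated]) simp
qed

lemma bochner_measurable_AE_mem:
  "bochner_measurable T S \<eta> X \<Longrightarrow> AE t in lebesgue_on {0<..<T}. X t \<in> S"
  unfolding bochner_measurable_def by (auto elim: eventually_mono)

lemma L2T_inner_integrable:
  assumes \<Omega>: "\<Omega> \<in> sets lebesgue" and X: "X \<in> L2T T (L2 \<Omega>) (L2_norm \<Omega>)"
  shows "integrable (lebesgue_on {0<..<T}) (\<lambda>t. gcls \<Omega> (X t) \<bullet> w)"
proof -
  let ?M = "lebesgue_on {0<..<T}"
  interpret finite_measure ?M by (rule finite_measure_lebesgue_on) auto
  have X: "bochner_measurable T (L2 \<Omega>) (L2_norm \<Omega>) X" "integrable ?M (\<lambda>t. (L2_norm \<Omega> (X t))\<^sup>2)"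
    using X by (auto simp: L2T_def)
  have "integrable ?M (\<lambda>t. norm w * (1 + (L2_norm \<Omega> (X t))\<^sup>2))" using X(2) by simp
  then show ?thesis
  proof (rule Bochner_Integration.integrable_bound)
    show "(\<lambda>t. gcls \<Omega> (X t) \<bullet> w) \<in> borel_measurable ?M" by (rule bochner_measurable_inner[OF \<Omega> X(1)])
    have "norm (gcls \<Omega> (X t) \<bullet> w) \<le> norm (norm w * (1 + (L2_norm \<Omega> (X t))\<^sup>2))" for t
    proof -
      define n where "n = L2_norm \<Omega> (X t)"
      have n: "norm (gcls \<Omega> (X t)) \<le> n" unfolding n_def by (rule norm_gcls_le[OF \<Omega>])
      have "n \<le> 1 + n\<^sup>2" using zero_le_power2[of "n - 1/2"] by (simp add: power2_eq_square algebra_simps)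
      then have "norm (gcls \<Omega> (X t)) * norm w \<le> (1 + n\<^sup>2) * norm w"
        using n by (intro mult_right_mono) auto
      then have "\<bar>gcls \<Omega> (X t) \<bullet> w\<bar> \<le> norm w * (1 + n\<^sup>2)"
        using Cauchy_Schwarz_ineq2[of "gcls \<Omega> (X t)" w] by (simp add: mult.commute)
      also have "\<dots> \<le> norm (norm w * (1 + n\<^sup>2))" by simp
      finally show ?thesis by (simp add: n_def)
    qed
    then show "AE t in ?M. norm (gcls \<Omega> (X t) \<bullet> w) \<le> norm (norm w * (1 + (L2_norm \<Omega> (X t))\<^sup>2))" by simp
  qed
qed

text \<open>
  Weak differentiability in time is defined by pairing with fixed fields; it thus reduces to the
  scalar lemma of Du Bois-Reymond.
\<close>

lemma is_time_deriv_imp_wd: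
  fixes X Y :: "real \<Rightarrow> ('d::finite, 'm::finite) field"
  assumes \<Omega>: "\<Omega> \<in> sets lebesgue" and T: "0 < T" and d: "is_time_deriv \<Omega> T X Y" and w: "w \<in> cls \<Omega> ` L2 \<Omega>"
  shows "wd T (\<lambda>t. gcls \<Omega> (X t) \<bullet> w) (\<lambda>t. gcls \<Omega> (Y t) \<bullet> w)"
proof -
  let ?M = "lebesgue_on {0<..<T}"
  obtain W where W: "W \<in> L2 \<Omega>" "w = cls \<Omega> W" using w by blast
  have X: "X \<in> L2T T (L2 \<Omega>) (L2_norm \<Omega>)" and Y: "Y \<in> L2T T (L2 \<Omega>) (L2_norm \<Omega>)"
    using d by (auto simp: is_time_deriv_def)
  have eq: "(LINT t|?M. q t * L2_inner \<Omega> (Z t) W) = (LINT t|?M. q t * (gcls \<Omega> (Z t) \<bullet> w))"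
    if Z: "Z \<in> L2T T (L2 \<Omega>) (L2_norm \<Omega>)" and q: "continuous_on UNIV q" for Z :: "real \<Rightarrow> ('d, 'm) field" and q
  proof -
    have b: "bochner_measurable T (L2 \<Omega>) (L2_norm \<Omega>) Z" using Z by (simp add: L2T_def)
    have qm: "q \<in> borel_measurable ?M"
      using borel_measurable_continuous_onI[OF q] by (simp add: measurable_completion measurable_restrict_space1)
    have m: "(\<lambda>t. q t * (gcls \<Omega> (Z t) \<bullet> w)) \<in> borel_measurable ?M"
      by (intro borel_measurable_times qm bochner_measurable_inner[OF \<Omega> b])
    have ae: "AE t in ?M. q t * (gcls \<Omega> (Z t) \<bullet> w) = q t * L2_inner \<Omega> (Z t) W"
      using bochner_measurable_AE_mem[OF b]
      by eventually_elim (simp add: gcls_L2 W inner_cls[OF \<Omega>])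
    show ?thesis
    proof (rule integral_cong_AE[OF borel_measurable_lebesgue_on_AE[OF _ m ae] m])
      show "{0<..<T} \<in> sets lebesgue" by simp
      show "AE t in ?M. q t * L2_inner \<Omega> (Z t) W = q t * (gcls \<Omega> (Z t) \<bullet> w)" using ae by eventually_elim (rule sym)
    qed
  qed
  have i: "integrable ?M (\<lambda>t. gcls \<Omega> (X t) \<bullet> w)" "integrable ?M (\<lambda>t. gcls \<Omega> (Y t) \<bullet> w)"
    using L2T_inner_integrable[OF \<Omega>] X Y by blast+
  moreover have "\<exists>c. AE t in ?M. gcls \<Omega> (X t) \<bullet> w = c + integral {0..t} (\<lambda>t. gcls \<Omega> (Y t) \<bullet> w)"
  proof (rule weak_deriv_imp_primitive[OF T i])
    fix \<phi> assume \<phi>: "time_test_fun T \<phi>"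
    then have s: "smooth \<phi>" by (simp add: time_test_fun_iff_smooth)
    have c: "continuous_on UNIV \<phi>" "continuous_on UNIV (deriv \<phi>)"
      using smooth_continuous[OF s, of UNIV 0] smooth_continuous[OF s, of UNIV 1] by simp_all
    show "(LINT t|?M. deriv \<phi> t * (gcls \<Omega> (X t) \<bullet> w)) = - (LINT t|?M. \<phi> t * (gcls \<Omega> (Y t) \<bullet> w))"
      using d \<phi> W(1) unfolding eq[OF X c(2), symmetric] eq[OF Y c(1), symmetric] is_time_deriv_def by blast
  qed
  ultimately show ?thesis by (simp add: wd_def)
qed

text \<open>
  The infimum of the essential bounds is attained, being the limit of countably many bounds. Nonnegativity
  uses that \<open>(0, T)\<close> has positive measure.
\<close>

lemma LinfT_norm_bound:
  assumes T: "0 < T" and X: "X \<in> LinfT T S \<eta>" and pos: "\<And>t. 0 \<le> \<eta> (X t)"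
  shows "AE t in lebesgue_on {0<..<T}. \<eta> (X t) \<le> LinfT_norm T \<eta> X" "0 \<le> LinfT_norm T \<eta> X"
proof -
  let ?M = "lebesgue_on {0<..<T}"
  let ?C = "{C. AE t in ?M. \<eta> (X t) \<le> C}"
  have ne: "?C \<noteq> {}" using X by (auto simp: LinfT_def)
  have nn: "0 \<le> C" if "C \<in> ?C" for C
  proof (rule ccontr)
    assume "\<not> 0 \<le> C"
    have "AE t in ?M. \<eta> (X t) \<le> C" using that by simp
    then have "AE t in ?M. False" by eventually_elim (use \<open>\<not> 0 \<le> C\<close> pos order.trans in blast)
    then have "(LINT t|?M. 1) = (LINT t|?M. 0 :: real)" by (intro integral_cong_AE) (auto elim: eventually_mono)
    then show False using T by (simp add: space_restrict_space measure_restrict_space)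
  qed
  then show "0 \<le> LinfT_norm T \<eta> X" unfolding LinfT_norm_def by (intro cInf_greatest ne)
  have "AE t in ?M. \<eta> (X t) \<le> LinfT_norm T \<eta> X + inverse (real (Suc n))" for n
  proof -
    have "Inf ?C < LinfT_norm T \<eta> X + inverse (real (Suc n))" by (simp add: LinfT_norm_def)
    then obtain C where C: "C \<in> ?C" "C < LinfT_norm T \<eta> X + inverse (real (Suc n))"
      using cInf_lessD[OF ne] by blast
    have "AE t in ?M. \<eta> (X t) \<le> C" using C(1) by simp
    then show ?thesis by eventually_elim (use C(2) in linarith)
  qed
  then have "AE t in ?M. \<forall>n. \<eta> (X t) \<le> LinfT_norm T \<eta> X + inverse (real (Suc n))"
    unfolding AE_all_countable by blast
  then show "AE t in ?M. \<eta> (X t) \<le> LinfT_norm T \<eta> X"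
  proof eventually_elim
    case (elim t)
    show ?case
    proof (rule field_le_epsilon)
      fix e :: real assume "0 < e"
      then obtain n where "inverse (real (Suc n)) < e" using reals_Archimedean by blast
      then show "\<eta> (X t) \<le> LinfT_norm T \<eta> X + e" using elim[rule_format, of n] by linarith
    qed
  qed
qed

lemma L2_continuous_on_inner:
  assumes \<Omega>: "\<Omega> \<in> sets lebesgue" and c: "L2_continuous_on \<Omega> I X"
  shows "continuous_on I (\<lambda>t. gcls \<Omega> (X t) \<bullet> w)"
  unfolding continuous_on
proof
  fix t assume t: "t \<in> I"
  have L: "X s \<in> L2 \<Omega>" if "s \<in> I" for s using c that by (simp add: L2_continuous_on_def)
  have "((\<lambda>s. L2_norm \<Omega> (fsub (X s) (X t))) \<longlongrightarrow> 0) (at t within I)" using c t by (simp add: L2_continuous_on_def)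
  moreover have "\<forall>\<^sub>F s in at t within I. L2_norm \<Omega> (fsub (X s) (X t)) = norm (gcls \<Omega> (X s) - gcls \<Omega> (X t))"
    unfolding eventually_at_filter
    by (rule eventuallyI) (simp add: L t gcls_L2 fsub_def norm_cls L2_diff \<Omega> flip: cls_diff)
  ultimately have "((\<lambda>s. norm (gcls \<Omega> (X s) - gcls \<Omega> (X t))) \<longlongrightarrow> 0) (at t within I)"
    by (rule Lim_transform_eventually)
  then have "((\<lambda>s. gcls \<Omega> (X s)) \<longlongrightarrow> gcls \<Omega> (X t)) (at t within I)"
    by (simp add: tendsto_norm_zero_iff LIM_zero_iff)
  then show "((\<lambda>s. gcls \<Omega> (X s) \<bullet> w) \<longlongrightarrow> gcls \<Omega> (X t) \<bullet> w) (at t within I)" by (intro tendsto_intros)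
qed

lemma sobolev_norm_nonneg: "0 \<le> sobolev_norm \<Omega> r u"
  unfolding sobolev_norm_def by (auto intro!: add_nonneg_nonneg sum_nonneg)

lemma L2T_sqint:
  assumes "X \<in> L2T T S \<eta>" "\<And>u. 0 \<le> \<eta> u"
  shows "sqint T (\<lambda>t. \<eta> (X t))" "sqnorm T (\<lambda>t. \<eta> (X t)) = L2T_norm T \<eta> X"
  using assms by (auto simp: L2T_def sqint_def sqnorm_def L2T_norm_def)

lemma linear_extension_from_subspace:
  fixes f :: "'a::real_vector \<Rightarrow> 'b::real_vector"
  assumes S: "subspace S" and add: "\<And>x y. x \<in> S \<Longrightarrow> y \<in> S \<Longrightarrow> f (x + y) = f x + f y"
    and scale: "\<And>c x. x \<in> S \<Longrightarrow> f (c *\<^sub>R x) = c *\<^sub>R f x"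
  obtains g where "linear g" "\<And>x. x \<in> S \<Longrightarrow> g x = f x"
proof -
  obtain B where B: "B \<subseteq> S" "independent B" "S \<subseteq> span B"
    by (rule real_vector.maximal_independent_subset)
  obtain g where "linear g \<and> (\<forall>x\<in>B. g x = f x)"
    using linear_independent_extend[OF B(2), of f] by (rule exE)
  then have g: "linear g" "\<And>x. x \<in> B \<Longrightarrow> g x = f x" by auto
  have f0: "f 0 = 0" using scale[OF subspace_0[OF S], of 0] by simp
  have "span B \<subseteq> {x \<in> S. g x = f x}"
  proof (rule span_minimal)
    show "B \<subseteq> {x \<in> S. g x = f x}" using B(1) g(2) by blast
    show "subspace {x \<in> S. g x = f x}"
    proof (rule subspaceI)
      show "0 \<in> {x \<in> S. g x = f x}" using subspace_0[OF S] f0 linear_0[OF g(1)] by simp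
      show "x + y \<in> {x \<in> S. g x = f x}" if "x \<in> {x \<in> S. g x = f x}" "y \<in> {x \<in> S. g x = f x}" for x y
      proof -
        have xy: "x \<in> S" "y \<in> S" "g x = f x" "g y = f y" using that by auto
        have "g (x + y) = f (x + y)" unfolding linear_add[OF g(1)] add[OF xy(1,2)] xy(3,4) ..
        then show ?thesis using subspace_add[OF S xy(1,2)] by simp
      qed
      show "c *\<^sub>R x \<in> {x \<in> S. g x = f x}" if "x \<in> {x \<in> S. g x = f x}" for c x
      proof -
        have x: "x \<in> S" "g x = f x" using that by auto
        have "g (c *\<^sub>R x) = f (c *\<^sub>R x)" unfolding linear_scale[OF g(1)] scale[OF x(1)] x(2) ..
        then show ?thesis using subspace_scale[OF S x(1)] by simp
      qed
    qed
  qed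
  then have "g x = f x" if "x \<in> S" for x using B(3) that by blast
  then show ?thesis using that[OF g(1)] by blast
qed

section \<open>Operators and projections on classes\<close>

lemma subspace_classes:
  assumes \<Omega>: "\<Omega> \<in> sets lebesgue" and S: "linear_subspace S" "S \<subseteq> L2 \<Omega>"
  shows "subspace (cls \<Omega> ` S)"
proof (rule subspaceI)
  show "0 \<in> cls \<Omega> ` S" using S(1) cls_zero[of \<Omega>] by (auto simp: linear_subspace_def image_iff intro!: bexI[of _ "\<lambda>x. 0"])
  show "x + y \<in> cls \<Omega> ` S" if xy: "x \<in> cls \<Omega> ` S" "y \<in> cls \<Omega> ` S" for x y
  proof -
    obtain u v where uv: "u \<in> S" "v \<in> S" "x = cls \<Omega> u" "y = cls \<Omega> v" using xy by blast
    have "x + y = cls \<Omega> (\<lambda>z. u z + v z)" unfolding uv(3,4) using uv(1,2) S(2) by (intro cls_add[symmetric] \<Omega>) blast+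
    moreover have "(\<lambda>z. u z + v z) \<in> S" using S(1) uv(1,2) by (simp add: linear_subspace_def)
    ultimately show ?thesis by (rule image_eqI)
  qed
  show "c *\<^sub>R x \<in> cls \<Omega> ` S" if x: "x \<in> cls \<Omega> ` S" for c x
  proof -
    obtain u where u: "u \<in> S" "x = cls \<Omega> u" using x by blast
    have "c *\<^sub>R x = cls \<Omega> (\<lambda>z. c *\<^sub>R u z)" unfolding u(2) using u(1) S(2) by (intro cls_scaleR[symmetric] \<Omega>) blast
    moreover have "(\<lambda>z. c *\<^sub>R u z) \<in> S" using S(1) u(1) by (simp add: linear_subspace_def)
    ultimately show ?thesis by (rule image_eqI)
  qed
qed

lemma linear_subspace_L2: "linear_subspace (L2 \<Omega>)"
  by (auto simp: linear_subspace_def L2_zero L2_add L2_scaleR)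

lemma norm_le_by_density:
  assumes \<Omega>: "\<Omega> \<in> sets lebesgue" and V: "L2_dense \<Omega> V" and x: "x \<in> cls \<Omega> ` L2 \<Omega>" and B: "0 \<le> B"
    and le: "\<And>z. z \<in> cls \<Omega> ` V \<Longrightarrow> \<bar>x \<bullet> z\<bar> \<le> B * norm z"
  shows "norm x \<le> B"
proof -
  obtain u where u: "u \<in> L2 \<Omega>" "x = cls \<Omega> u" using x by blast
  have *: "norm x * norm x \<le> B * norm x + e" if "0 < e" for e
  proof -
    define d where "d = e / (norm x + B + 1)"
    have nB: "0 < norm x + B + 1" using B by (simp add: add_nonneg_pos)
    have d: "0 < d" "(norm x + B) * d \<le> e"
    proof -
      show "0 < d" using that nB by (simp add: d_def)
      have "(norm x + B) * d \<le> (norm x + B + 1) * d" using \<open>0 < d\<close> by (intro mult_right_mono) auto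
      also have "\<dots> = e" using nB by (simp add: d_def)
      finally show "(norm x + B) * d \<le> e" .
    qed
    obtain v where v: "v \<in> V" "L2_norm \<Omega> (fsub u v) < d" using V u(1) d(1) unfolding L2_dense_def by blast
    have vL: "v \<in> L2 \<Omega>" using V v(1) by (auto simp: L2_dense_def)
    define z where "z = cls \<Omega> v"
    have "norm (x - z) = L2_norm \<Omega> (fsub u v)"
      unfolding u(2) z_def fsub_def using u(1) vL by (simp add: norm_cls L2_diff \<Omega> flip: cls_diff)
    then have xz: "norm (x - z) \<le> d" using v(2) by simp
    have "norm x * norm x = x \<bullet> (x - z) + x \<bullet> z"
      by (simp add: inner_diff_right flip: power2_eq_square power2_norm_eq_inner)
    also have "\<dots> \<le> norm x * norm (x - z) + B * norm z"
      using norm_cauchy_schwarz[of x "x - z"] le[of z] v(1) by (simp add: z_def)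
    also have "\<dots> \<le> norm x * d + B * (norm x + d)"
    proof (intro add_mono mult_left_mono xz B norm_ge_zero)
      show "norm z \<le> norm x + d" using xz norm_triangle_ineq4[of x "x - z"] by simp
    qed
    also have "\<dots> \<le> B * norm x + e" using d(2) by (simp add: algebra_simps)
    finally show ?thesis .
  qed
  have "norm x * norm x \<le> B * norm x" by (rule field_le_epsilon) (rule *)
  then show ?thesis by (cases "x = 0") (use B in auto)
qed

text \<open>
  A skew-symmetric operator on a dense subspace is automatically linear modulo null sets: pairing
  with a test function moves it to the other, linear, slot.
\<close>

lemma skew_operator_on_classes:
  fixes V :: "('d::finite, 'm::finite) field set"
  assumes \<Omega>: "\<Omega> \<in> sets lebesgue" and V: "linear_subspace V" and dense: "L2_dense \<Omega> V"
    and G: "\<And>W. W \<in> V \<Longrightarrow> G W \<in> L2 \<Omega>"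
    and skew: "\<And>W Z. W \<in> V \<Longrightarrow> Z \<in> V \<Longrightarrow> L2_inner \<Omega> (G W) Z = - L2_inner \<Omega> W (G Z)"
  obtains g where "linear g" "\<And>W. W \<in> V \<Longrightarrow> g (cls \<Omega> W) = cls \<Omega> (G W)"
proof -
  have VL: "V \<subseteq> L2 \<Omega>" using dense by (simp add: L2_dense_def)
  have sk: "cls \<Omega> (G W) \<bullet> cls \<Omega> Z = - (cls \<Omega> W \<bullet> cls \<Omega> (G Z))" if "W \<in> V" "Z \<in> V" for W Z
    using skew[OF that] that G VL by (simp add: inner_cls[OF \<Omega>] subset_iff)
  have S: "subspace (cls \<Omega> ` L2 \<Omega>)" by (rule subspace_classes[OF \<Omega> linear_subspace_L2]) simp
  define f where "f x = cls \<Omega> (G (SOME W. W \<in> V \<and> cls \<Omega> W = x))" for x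
  have pick: "\<exists>W\<in>V. cls \<Omega> W = x \<and> f x = cls \<Omega> (G W)" if "x \<in> cls \<Omega> ` V" for x
  proof -
    have "\<exists>W. W \<in> V \<and> cls \<Omega> W = x" using that by blast
    from someI_ex[OF this] show ?thesis unfolding f_def by blast
  qed
  have fV: "f x \<in> cls \<Omega> ` L2 \<Omega>" if "x \<in> cls \<Omega> ` V" for x using pick[OF that] G by blast
  have adj: "f x \<bullet> cls \<Omega> Z = - (x \<bullet> cls \<Omega> (G Z))" if "x \<in> cls \<Omega> ` V" "Z \<in> V" for x Z
    using pick[OF that(1)] sk that(2) by metis
  have eq: "a = b" if ab: "a \<in> cls \<Omega> ` L2 \<Omega>" "b \<in> cls \<Omega> ` L2 \<Omega>" and
    le: "\<And>Z. Z \<in> V \<Longrightarrow> a \<bullet> cls \<Omega> Z = b \<bullet> cls \<Omega> Z" for a b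
  proof -
    have "norm (a - b) \<le> 0"
      by (rule norm_le_by_density[OF \<Omega> dense subspace_diff[OF S ab]]) (auto simp: inner_diff_left le)
    then show ?thesis by simp
  qed
  have SV: "subspace (cls \<Omega> ` V)" by (rule subspace_classes[OF \<Omega> V VL])
  have add: "f (x + y) = f x + f y" if xy: "x \<in> cls \<Omega> ` V" "y \<in> cls \<Omega> ` V" for x y
    by (rule eq[OF fV[OF subspace_add[OF SV xy]] subspace_add[OF S fV[OF xy(1)] fV[OF xy(2)]]])
      (simp add: adj subspace_add[OF SV] xy inner_add_left)
  have scale: "f (c *\<^sub>R x) = c *\<^sub>R f x" if x: "x \<in> cls \<Omega> ` V" for c x
    by (rule eq[OF fV[OF subspace_scale[OF SV x]] subspace_scale[OF S fV[OF x]]])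
      (simp add: adj subspace_scale[OF SV] x)
  obtain g where g: "linear g" "\<And>x. x \<in> cls \<Omega> ` V \<Longrightarrow> g x = f x"
    using linear_extension_from_subspace[OF SV add scale] by blast
  have "g (cls \<Omega> W) = cls \<Omega> (G W)" if W: "W \<in> V" for W
  proof -
    have "f (cls \<Omega> W) = cls \<Omega> (G W)"
    proof (rule eq)
      show "f (cls \<Omega> W) \<in> cls \<Omega> ` L2 \<Omega>" "cls \<Omega> (G W) \<in> cls \<Omega> ` L2 \<Omega>" using fV W G by blast+
      show "f (cls \<Omega> W) \<bullet> cls \<Omega> Z = cls \<Omega> (G W) \<bullet> cls \<Omega> Z" if "Z \<in> V" for Z
        using adj[of "cls \<Omega> W" Z] sk[OF W that] W that by simp
    qed
    then show ?thesis using g(2) W by simp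
  qed
  with g(1) show ?thesis by (rule that)
qed

text \<open>
  The orthogonal projection is unique in the space of classes, which identifies the chosen field.
\<close>

lemma L2_proj_class:
  assumes \<Omega>: "\<Omega> \<in> sets lebesgue" and Vh: "linear_subspace Vh" "Vh \<subseteq> L2 \<Omega>"
    and P: "\<And>x. P x \<in> cls \<Omega> ` Vh" "\<And>x w. w \<in> cls \<Omega> ` Vh \<Longrightarrow> (x - P x) \<bullet> w = 0" and Y: "Y \<in> L2 \<Omega>"
  shows "L2_proj \<Omega> Vh Y \<in> Vh" "cls \<Omega> (L2_proj \<Omega> Vh Y) = P (cls \<Omega> Y)"
proof -
  have ip: "L2_inner \<Omega> (fsub Y Z) W = (cls \<Omega> Y - cls \<Omega> Z) \<bullet> cls \<Omega> W" if "Z \<in> Vh" "W \<in> Vh" for Z W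
    using that Vh(2) Y by (simp add: fsub_def inner_cls[OF \<Omega>] L2_diff subset_iff flip: cls_diff[OF \<Omega>])
  obtain Z where Z: "Z \<in> Vh" "cls \<Omega> Z = P (cls \<Omega> Y)" using P(1)[of "cls \<Omega> Y"] by (metis imageE)
  have "\<exists>Z. Z \<in> Vh \<and> (\<forall>W\<in>Vh. L2_inner \<Omega> (fsub Y Z) W = 0)"
    using Z P(2) by (intro exI[of _ Z]) (simp add: ip)
  from someI_ex[OF this]
  have p: "L2_proj \<Omega> Vh Y \<in> Vh" "\<And>W. W \<in> Vh \<Longrightarrow> L2_inner \<Omega> (fsub Y (L2_proj \<Omega> Vh Y)) W = 0"
    unfolding L2_proj_def by blast+
  show "L2_proj \<Omega> Vh Y \<in> Vh" by (rule p(1))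
  let ?d = "cls \<Omega> (L2_proj \<Omega> Vh Y) - P (cls \<Omega> Y)"
  have dV: "?d \<in> cls \<Omega> ` Vh" by (rule subspace_diff[OF subspace_classes[OF \<Omega> Vh]]) (use p(1) P(1) in auto)
  then obtain W where W: "W \<in> Vh" "?d = cls \<Omega> W" by (rule imageE) (rule that)
  have "(cls \<Omega> Y - cls \<Omega> (L2_proj \<Omega> Vh Y)) \<bullet> ?d = 0" unfolding W(2) using p(2)[OF W(1)] by (simp add: ip[OF p(1) W(1)])
  moreover have "(cls \<Omega> Y - P (cls \<Omega> Y)) \<bullet> ?d = 0" by (rule P(2)[OF dV])
  ultimately have "?d \<bullet> ?d = 0" by (simp add: inner_diff_left)
  then show "cls \<Omega> (L2_proj \<Omega> Vh Y) = P (cls \<Omega> Y)" by simp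
qed

lemma am_mean_L2:
  assumes "\<And>j. j < \<nu> \<Longrightarrow> X (n - j) \<in> L2 \<Omega>"
  shows "am_mean \<nu> X n \<in> L2 \<Omega>"
  unfolding am_mean_def by (intro L2_sum L2_scaleR) (use assms in auto)

lemma cls_am_mean:
  assumes "\<Omega> \<in> sets lebesgue" "\<And>j. j < \<nu> \<Longrightarrow> X (n - j) \<in> L2 \<Omega>"
  shows "cls \<Omega> (am_mean \<nu> X n) = am \<nu> (\<lambda>i. cls \<Omega> (X i)) n"
proof -
  have "cls \<Omega> (am_mean \<nu> X n) = (\<Sum>j<\<nu>. cls \<Omega> (\<lambda>x. (am_coeffs \<nu> ! j) *\<^sub>R X (n - j) x))"
    unfolding am_mean_def by (rule cls_sum[OF assms(1)]) (use assms(2) in \<open>auto intro: L2_scaleR\<close>)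
  also have "\<dots> = am \<nu> (\<lambda>i. cls \<Omega> (X i)) n"
    unfolding am_def by (intro sum.cong refl cls_scaleR assms) simp
  finally show ?thesis .
qed

lemma linear_subspace_sum:
  assumes "linear_subspace S" "finite I" "\<And>i. i \<in> I \<Longrightarrow> u i \<in> S"
  shows "(\<lambda>x. \<Sum>i\<in>I. u i x) \<in> S"
  using assms(2,3,1) by (induction I rule: finite_induct) (simp_all add: linear_subspace_def)

lemma linear_subspace_diff:
  assumes "linear_subspace S" "u \<in> S" "v \<in> S"
  shows "fsub u v \<in> S"
proof -
  have add: "\<And>u v. u \<in> S \<Longrightarrow> v \<in> S \<Longrightarrow> (\<lambda>x. u x + v x) \<in> S" and scale: "\<And>c u. u \<in> S \<Longrightarrow> (\<lambda>x. c *\<^sub>R u x) \<in> S"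
    using assms(1) by (simp_all add: linear_subspace_def)
  from add[OF assms(2) scale[OF assms(3), of "-1"]] show ?thesis by (simp add: fsub_def)
qed

text \<open>
  Passage to classes turns the fully discrete scheme for fields into the abstract error equation.
\<close>

lemma am_error_of_fields:
  fixes \<Omega> :: "(real^'d::finite) set" and V Vh :: "('d, 'm::finite) field set"
    and U F :: "real \<Rightarrow> ('d, 'm) field" and Uh :: "nat \<Rightarrow> ('d, 'm) field"
  assumes \<Omega>: "\<Omega> \<in> sets lebesgue" and V: "linear_subspace V" and dense: "L2_dense \<Omega> V"
    and G: "\<And>W. W \<in> V \<Longrightarrow> G W \<in> L2 \<Omega>"
    and skew: "\<And>W Z. W \<in> V \<Longrightarrow> Z \<in> V \<Longrightarrow> L2_inner \<Omega> (G W) Z = - L2_inner \<Omega> W (G Z)"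
    and Vh: "linear_subspace Vh" "Vh \<subseteq> V" and fin: "finite B" "cls \<Omega> ` Vh \<subseteq> span B"
    and inv: "\<forall>W\<in>Vh. L2_norm \<Omega> (G W) \<le> C_G / h * L2_norm \<Omega> W"
    and pos: "0 < T" "0 < \<tau>" "0 < \<delta>" "0 < h" "0 < C_G" "0 < Cd" "0 \<le> C" and \<delta>: "\<delta> \<le> Cd * h"
    and \<nu>: "\<nu> \<in> {3, 4, 5}" and N\<tau>: "real N * \<tau> \<le> T" and N: "\<nu> - 1 \<le> N"
    and ex: "exact_solution \<Omega> V G T F U0 U" and reg: "regular_solution \<Omega> G T r \<nu> U F"
    and app: "\<forall>j\<le>2. AE t in lebesgue_on {0<..<T}. approx_estimate \<Omega> V G Vh C h r (time_deriv \<Omega> T j U t)"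
    and sch: "am_solution \<Omega> G Vh \<nu> \<tau> \<delta> N U F Uh"
  defines "\<rho> \<equiv> \<lambda>i t. L2_norm \<Omega> (time_deriv \<Omega> T i (residual G U F) t)"
    and "S \<equiv> \<lambda>j t. sobolev_norm \<Omega> r (time_deriv \<Omega> T j U t)"
  obtains g P where "linear g" "\<And>W. W \<in> V \<Longrightarrow> g (cls \<Omega> W) = cls \<Omega> (G W)"
    "am_error g P (cls \<Omega> ` L2 \<Omega>) (cls \<Omega> ` V) (cls \<Omega> ` Vh) \<nu> N T \<tau> \<delta> h C_G Cd (C * h powr r)
      (\<lambda>t. gcls \<Omega> (U t)) (\<lambda>t. gcls \<Omega> (time_deriv \<Omega> T 1 U t)) (\<lambda>t. gcls \<Omega> (time_deriv \<Omega> T 2 U t))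
      (\<lambda>i t. gcls \<Omega> (time_deriv \<Omega> T i (residual G U F) t)) (S 0) (S 1) (S 2) (\<rho> \<nu>) (\<rho> (Suc \<nu>))
      (LinfT_norm T (sobolev_norm \<Omega> r) U) (LinfT_norm T (sobolev_norm \<Omega> r) (time_deriv \<Omega> T 1 U))
      (LinfT_norm T (L2_norm \<Omega>) (time_deriv \<Omega> T \<nu> (residual G U F))) (\<lambda>n. cls \<Omega> (Uh n))"
proof -
  let ?M = "lebesgue_on {0<..<T}"
  let ?R = "residual G U F"
  have VL: "V \<subseteq> L2 \<Omega>" using dense by (simp add: L2_dense_def)
  have VhL: "Vh \<subseteq> L2 \<Omega>" using Vh(2) VL by blast
  have td0: "time_deriv \<Omega> T 0 X = X" for X :: "real \<Rightarrow> ('d, 'm) field" by (simp add: time_deriv_def)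
  obtain g where lg: "linear g" and g: "\<And>W. W \<in> V \<Longrightarrow> g (cls \<Omega> W) = cls \<Omega> (G W)"
    using skew_operator_on_classes[OF \<Omega> V dense G skew] by blast
  have SVh: "subspace (cls \<Omega> ` Vh)" by (rule subspace_classes[OF \<Omega> Vh(1) VhL])
  obtain P where lP: "linear P" and P: "\<And>x. P x \<in> cls \<Omega> ` Vh" "\<And>x w. w \<in> cls \<Omega> ` Vh \<Longrightarrow> (x - P x) \<bullet> w = 0"
    using exists_orthogonal_projection[OF SVh fin(2,1)] by blast
  have pr: "L2_proj \<Omega> Vh Y \<in> Vh" "cls \<Omega> (L2_proj \<Omega> Vh Y) = P (cls \<Omega> Y)" if "Y \<in> L2 \<Omega>" for Y
    using L2_proj_class[OF \<Omega> Vh(1) VhL P that] by blast+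
  have UV: "U t \<in> V" and FL: "F t \<in> L2 \<Omega>" if "t \<in> {0..T}" for t
    using ex that by (auto simp: exact_solution_def)
  have RL: "?R t \<in> L2 \<Omega>" if "t \<in> {0..T}" for t
    unfolding residual_def fsub_def by (intro L2_diff FL G UV that)
  have dU: "is_time_deriv \<Omega> T U (time_deriv \<Omega> T 1 U)" "is_time_deriv \<Omega> T (time_deriv \<Omega> T 1 U) (time_deriv \<Omega> T 2 U)"
  proof -
    have "is_time_deriv \<Omega> T (time_deriv \<Omega> T j U) (time_deriv \<Omega> T (Suc j) U)" if "j < 2" for j
      using reg that unfolding regular_solution_def time_differentiable_def by blast
    from this[of 0] this[of 1] show "is_time_deriv \<Omega> T U (time_deriv \<Omega> T 1 U)"
      "is_time_deriv \<Omega> T (time_deriv \<Omega> T 1 U) (time_deriv \<Omega> T 2 U)"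
      by (simp_all add: td0 numeral_2_eq_2)
  qed
  have dR: "is_time_deriv \<Omega> T (time_deriv \<Omega> T i ?R) (time_deriv \<Omega> T (Suc i) ?R)" if "i \<le> \<nu>" for i
    using reg that by (simp add: regular_solution_def time_differentiable_def)
  have app': "norm (gcls \<Omega> Y - P (gcls \<Omega> Y)) + h * norm (g (gcls \<Omega> Y - P (gcls \<Omega> Y))) \<le> C * h powr r * sobolev_norm \<Omega> r Y \<and> gcls \<Omega> Y \<in> cls \<Omega> ` V"
    if "approx_estimate \<Omega> V G Vh C h r Y" for Y
  proof -
    have Y: "Y \<in> V" "L2_norm \<Omega> (fsub Y (L2_proj \<Omega> Vh Y)) + h * L2_norm \<Omega> (G (fsub Y (L2_proj \<Omega> Vh Y))) \<le> C * h powr r * sobolev_norm \<Omega> r Y"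
      using that by (auto simp: approx_estimate_def)
    have YL: "Y \<in> L2 \<Omega>" using Y(1) VL by blast
    have dV: "fsub Y (L2_proj \<Omega> Vh Y) \<in> V" using pr(1)[OF YL] Vh(2) by (intro linear_subspace_diff[OF V Y(1)]) blast
    have pL: "L2_proj \<Omega> Vh Y \<in> L2 \<Omega>" using pr(1)[OF YL] VhL by blast
    have c: "gcls \<Omega> Y - P (gcls \<Omega> Y) = cls \<Omega> (fsub Y (L2_proj \<Omega> Vh Y))"
      unfolding gcls_L2[OF YL] pr(2)[OF YL, symmetric] fsub_def by (rule cls_diff[OF \<Omega> YL pL, symmetric])
    have "norm (gcls \<Omega> Y - P (gcls \<Omega> Y)) = L2_norm \<Omega> (fsub Y (L2_proj \<Omega> Vh Y))"
      unfolding c using dV VL by (intro norm_cls[OF \<Omega>]) blast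
    moreover have "norm (g (gcls \<Omega> Y - P (gcls \<Omega> Y))) = L2_norm \<Omega> (G (fsub Y (L2_proj \<Omega> Vh Y)))"
      unfolding c g[OF dV] by (rule norm_cls[OF \<Omega> G[OF dV]])
    moreover have "gcls \<Omega> Y \<in> cls \<Omega> ` V" unfolding gcls_L2[OF YL] using Y(1) by (rule imageI)
    ultimately show ?thesis using Y(2) by simp
  qed
  have ap: "AE t in ?M. approx_estimate \<Omega> V G Vh C h r (time_deriv \<Omega> T j U t)" if "j \<le> 2" for j
    using app that by blast
  have node: "real (n - j) * \<tau> \<in> {0..T}" if "n \<le> N" for n j
  proof -
    have "real (n - j) * \<tau> \<le> real N * \<tau>" using that pos by (intro mult_right_mono) auto
    moreover have "0 \<le> real (n - j) * \<tau>" using pos by simp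
    ultimately show ?thesis using N\<tau> unfolding atLeastAtMost_iff by linarith
  qed
  have node': "real n * \<tau> \<in> {0..T}" if "n \<le> N" for n using node[OF that, of 0] by simp
  have Sreg: "(\<lambda>t. time_deriv \<Omega> T j U t) \<in> L2T T (sobolev \<Omega> r) (sobolev_norm \<Omega> r)" if "j \<le> 2" for j
    using reg that by (simp add: regular_solution_def)
  have Sinf: "time_deriv \<Omega> T j U \<in> LinfT T (sobolev \<Omega> r) (sobolev_norm \<Omega> r)" if "j \<le> 1" for j
    using reg that by (simp add: regular_solution_def)
  have Rinf: "time_deriv \<Omega> T \<nu> ?R \<in> LinfT T (L2 \<Omega>) (L2_norm \<Omega>)" using reg by (simp add: regular_solution_def)
  have RT: "time_deriv \<Omega> T i ?R \<in> L2T T (L2 \<Omega>) (L2_norm \<Omega>)" if "i \<le> Suc \<nu>" for i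
    using dR[of i] dR[of "i - 1"] that by (cases "i \<le> \<nu>") (auto simp: is_time_deriv_def le_Suc_eq)
  have UhV: "Uh n \<in> Vh" if "n \<le> N" for n using sch that by (simp add: am_solution_def)
  have E: "am_error g P (cls \<Omega> ` L2 \<Omega>) (cls \<Omega> ` V) (cls \<Omega> ` Vh) \<nu> N T \<tau> \<delta> h C_G Cd (C * h powr r)
      (\<lambda>t. gcls \<Omega> (U t)) (\<lambda>t. gcls \<Omega> (time_deriv \<Omega> T 1 U t)) (\<lambda>t. gcls \<Omega> (time_deriv \<Omega> T 2 U t))
      (\<lambda>i t. gcls \<Omega> (time_deriv \<Omega> T i (residual G U F) t)) (S 0) (S 1) (S 2) (\<rho> \<nu>) (\<rho> (Suc \<nu>))
      (LinfT_norm T (sobolev_norm \<Omega> r) U) (LinfT_norm T (sobolev_norm \<Omega> r) (time_deriv \<Omega> T 1 U))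
      (LinfT_norm T (L2_norm \<Omega>) (time_deriv \<Omega> T \<nu> (residual G U F))) (\<lambda>n. cls \<Omega> (Uh n))"
  proof (rule am_error.intro)
    show "linear g" "linear P" by (rule lg, rule lP)
    show "subspace (cls \<Omega> ` L2 \<Omega>)" by (rule subspace_classes[OF \<Omega> linear_subspace_L2]) simp
    show "subspace (cls \<Omega> ` V)" by (rule subspace_classes[OF \<Omega> V VL])
    show "cls \<Omega> ` V \<subseteq> cls \<Omega> ` L2 \<Omega>" "cls \<Omega> ` Vh \<subseteq> cls \<Omega> ` V" using VL Vh(2) by (simp_all add: image_mono)
    show "subspace (cls \<Omega> ` Vh)" by (rule SVh)
    show "g w \<in> cls \<Omega> ` L2 \<Omega>" if "w \<in> cls \<Omega> ` V" for w using that g G by force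
    show "g w \<bullet> z = - (w \<bullet> g z)" if wz: "w \<in> cls \<Omega> ` V" "z \<in> cls \<Omega> ` V" for w z
    proof -
      obtain W Z where WZ: "W \<in> V" "Z \<in> V" "w = cls \<Omega> W" "z = cls \<Omega> Z" using wz by blast
      have L: "W \<in> L2 \<Omega>" "Z \<in> L2 \<Omega>" using WZ VL by blast+
      show ?thesis unfolding WZ(3,4) g[OF WZ(1)] g[OF WZ(2)]
        using skew[OF WZ(1,2)] by (simp only: inner_cls[OF \<Omega> G[OF WZ(1)] L(2)] inner_cls[OF \<Omega> L(1) G[OF WZ(2)]])
    qed
    show "norm x \<le> B" if "x \<in> cls \<Omega> ` L2 \<Omega>" "0 \<le> B" "\<And>z. z \<in> cls \<Omega> ` V \<Longrightarrow> \<bar>x \<bullet> z\<bar> \<le> B * norm z" for x B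
      by (rule norm_le_by_density[OF \<Omega> dense that])
    show "P x \<in> cls \<Omega> ` Vh" for x by (rule P(1))
    show "(x - P x) \<bullet> w = 0" if "w \<in> cls \<Omega> ` Vh" for x w by (rule P(2)[OF that])
    show "norm (g w) \<le> C_G / h * norm w" if w: "w \<in> cls \<Omega> ` Vh" for w
    proof -
      obtain W where W: "W \<in> Vh" "w = cls \<Omega> W" using w by blast
      have WV: "W \<in> V" "W \<in> L2 \<Omega>" using W(1) Vh(2) VL by blast+
      show ?thesis unfolding W(2) g[OF WV(1)] norm_cls[OF \<Omega> WV(2)] norm_cls[OF \<Omega> G[OF WV(1)]]
        using inv W(1) by blast
    qed
    show "0 < T" "0 < \<tau>" "0 < \<delta>" "0 < h" "0 < C_G" "0 < Cd" "\<delta> \<le> Cd * h" "\<nu> \<in> {3, 4, 5}" "real N * \<tau> \<le> T"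
      by (fact pos \<delta> \<nu> N\<tau>)+
    show "0 \<le> C * h powr r" using pos by simp
    show "gcls \<Omega> (U t) \<in> cls \<Omega> ` V" if "t \<in> {0..T}" for t
      using UV[OF that] VL by (simp add: gcls_L2 subset_iff)
    show "gcls \<Omega> (time_deriv \<Omega> T 0 ?R t) \<in> cls \<Omega> ` L2 \<Omega>" if "t \<in> {0..T}" for t
      using RL[OF that] by (simp add: td0 gcls_L2)
    show "wd T (\<lambda>t. gcls \<Omega> (U t) \<bullet> w) (\<lambda>t. gcls \<Omega> (time_deriv \<Omega> T 1 U t) \<bullet> w)"
      "wd T (\<lambda>t. gcls \<Omega> (time_deriv \<Omega> T 1 U t) \<bullet> w) (\<lambda>t. gcls \<Omega> (time_deriv \<Omega> T 2 U t) \<bullet> w)"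
      if "w \<in> cls \<Omega> ` L2 \<Omega>" for w
      by (rule is_time_deriv_imp_wd[OF \<Omega> pos(1) _ that], rule dU)+
    show "wd T (\<lambda>t. gcls \<Omega> (time_deriv \<Omega> T i ?R t) \<bullet> w) (\<lambda>t. gcls \<Omega> (time_deriv \<Omega> T (Suc i) ?R t) \<bullet> w)"
      if "w \<in> cls \<Omega> ` L2 \<Omega>" "i \<le> \<nu>" for w i
      by (rule is_time_deriv_imp_wd[OF \<Omega> pos(1) dR[OF that(2)] that(1)])
    show "continuous_on {0..T} (\<lambda>t. gcls \<Omega> (U t) \<bullet> w)" for w
      by (rule L2_continuous_on_inner[OF \<Omega>]) (use ex in \<open>simp add: exact_solution_def\<close>)
    show "continuous_on {0..T} (\<lambda>t. gcls \<Omega> (time_deriv \<Omega> T 0 ?R t) \<bullet> w)" for w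
      unfolding td0 by (rule L2_continuous_on_inner[OF \<Omega>]) (use ex in \<open>simp add: exact_solution_def\<close>)
    have int: "AE t in ?M. t \<in> {0..T}" by (rule AE_I2) (simp add: space_restrict_space)
    show "AE t in ?M. gcls \<Omega> (time_deriv \<Omega> T 1 U t) = gcls \<Omega> (time_deriv \<Omega> T 0 ?R t)"
    proof -
      have "AE t in ?M. AE x in lebesgue_on \<Omega>. time_deriv \<Omega> T 1 U t x + G (U t) x = F t x"
        using ex by (simp add: exact_solution_def)
      with ap[of 1, OF one_le_numeral] int show ?thesis
      proof eventually_elim
        case (elim t)
        have 1: "time_deriv \<Omega> T 1 U t \<in> L2 \<Omega>" using elim(1) VL by (auto simp: approx_estimate_def)
        have "AE x in lebesgue_on \<Omega>. time_deriv \<Omega> T 1 U t x = ?R t x"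
          using elim(3) by eventually_elim (simp add: residual_def fsub_def eq_diff_eq)
        then have "cls \<Omega> (time_deriv \<Omega> T 1 U t) = cls \<Omega> (?R t)"
          using cls_eq_iff[OF \<Omega> 1 RL[OF elim(2)]] by blast
        then show ?case unfolding td0 gcls_L2[OF 1] gcls_L2[OF RL[OF elim(2)]] .
      qed
    qed
    show "AE t in ?M. gcls \<Omega> (time_deriv \<Omega> T 1 U t) \<in> cls \<Omega> ` V"
      using ap[of 1, OF one_le_numeral] by eventually_elim (use app' in blast)
    show "AE t in ?M. norm (gcls \<Omega> (U t) - P (gcls \<Omega> (U t))) + h * norm (g (gcls \<Omega> (U t) - P (gcls \<Omega> (U t)))) \<le> C * h powr r * S 0 t"
      using ap[of 0, OF zero_le] unfolding S_def td0 by eventually_elim (use app' in blast)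
    show "AE t in ?M. norm (gcls \<Omega> (time_deriv \<Omega> T 1 U t) - P (gcls \<Omega> (time_deriv \<Omega> T 1 U t)))
        + h * norm (g (gcls \<Omega> (time_deriv \<Omega> T 1 U t) - P (gcls \<Omega> (time_deriv \<Omega> T 1 U t)))) \<le> C * h powr r * S 1 t"
      using ap[of 1, OF one_le_numeral] unfolding S_def by eventually_elim (use app' in blast)
    show "AE t in ?M. norm (gcls \<Omega> (time_deriv \<Omega> T 2 U t) - P (gcls \<Omega> (time_deriv \<Omega> T 2 U t))) \<le> C * h powr r * S 2 t"
      using ap[of 2, OF order_refl] unfolding S_def
    proof eventually_elim
      case (elim t)
      have "0 \<le> h * norm (g (gcls \<Omega> (time_deriv \<Omega> T 2 U t) - P (gcls \<Omega> (time_deriv \<Omega> T 2 U t))))" using pos by simp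
      then show ?case using app'[OF elim] by linarith
    qed
    show "sqint T (S 0)" "sqint T (S 1)" "sqint T (S 2)"
      unfolding S_def by (intro L2T_sqint(1)[OF Sreg sobolev_norm_nonneg]; simp)+
    show "sqint T (\<rho> \<nu>)" "sqint T (\<rho> (Suc \<nu>))"
      unfolding \<rho>_def by (intro L2T_sqint(1)[OF RT L2_norm_nonneg]; simp)+
    show "AE t in ?M. S 0 t \<le> LinfT_norm T (sobolev_norm \<Omega> r) U" "0 \<le> LinfT_norm T (sobolev_norm \<Omega> r) U"
      using LinfT_norm_bound[OF pos(1) Sinf[of 0, OF zero_le] sobolev_norm_nonneg] unfolding S_def td0 by blast+
    show "AE t in ?M. S 1 t \<le> LinfT_norm T (sobolev_norm \<Omega> r) (time_deriv \<Omega> T 1 U)"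
      "0 \<le> LinfT_norm T (sobolev_norm \<Omega> r) (time_deriv \<Omega> T 1 U)"
      using LinfT_norm_bound[OF pos(1) Sinf[of 1, OF order_refl] sobolev_norm_nonneg] unfolding S_def by blast+
    show "AE t in ?M. \<rho> \<nu> t \<le> LinfT_norm T (L2_norm \<Omega>) (time_deriv \<Omega> T \<nu> ?R)"
      "0 \<le> LinfT_norm T (L2_norm \<Omega>) (time_deriv \<Omega> T \<nu> ?R)"
      using LinfT_norm_bound[OF pos(1) Rinf L2_norm_nonneg] unfolding \<rho>_def by blast+
    show "norm (gcls \<Omega> (time_deriv \<Omega> T \<nu> ?R t)) \<le> \<rho> \<nu> t" "norm (gcls \<Omega> (time_deriv \<Omega> T (Suc \<nu>) ?R t)) \<le> \<rho> (Suc \<nu>) t" for t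
      unfolding \<rho>_def by (rule norm_gcls_le[OF \<Omega>])+
    show "cls \<Omega> (Uh n) \<in> cls \<Omega> ` Vh" if "n \<le> N" for n using UhV[OF that] by (rule imageI)
    show "cls \<Omega> (Uh j) = P (gcls \<Omega> (U (real j * \<tau>)))" if "j < \<nu> - 1" for j
    proof -
      have jN: "j \<le> N" using that N by simp
      have UL: "U (real j * \<tau>) \<in> L2 \<Omega>" using UV[OF node'[OF jN]] VL by blast
      have "AE x in lebesgue_on \<Omega>. Uh j x = L2_proj \<Omega> Vh (U (real j * \<tau>)) x"
        using sch that by (simp add: am_solution_def first_index_def)
      then have "cls \<Omega> (Uh j) = cls \<Omega> (L2_proj \<Omega> Vh (U (real j * \<tau>)))"
        using cls_eq_iff[OF \<Omega>] UhV[OF jN] pr(1)[OF UL] VhL by blast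
      then show ?thesis unfolding pr(2)[OF UL] gcls_L2[OF UL] .
    qed
    show "(dif (\<lambda>n. cls \<Omega> (Uh n)) n /\<^sub>R \<tau> + g (am \<nu> (\<lambda>n. cls \<Omega> (Uh n)) n)) \<bullet> (w + \<delta> *\<^sub>R g w)
      = am \<nu> (\<lambda>n. gcls \<Omega> (time_deriv \<Omega> T 0 ?R (real n * \<tau>)) + g (gcls \<Omega> (U (real n * \<tau>)))) n \<bullet> (w + \<delta> *\<^sub>R g w)"
      if n: "\<nu> - 1 \<le> n" "n \<le> N" and w: "w \<in> cls \<Omega> ` Vh" for n w
    proof -
      obtain W where W: "W \<in> Vh" "w = cls \<Omega> W" using w by blast
      have WV: "W \<in> V" "W \<in> L2 \<Omega>" using W(1) Vh(2) VL by blast+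
      have TL: "T_op G \<delta> W \<in> L2 \<Omega>" unfolding T_op_def by (intro L2_add L2_scaleR WV G)
      have Tw: "w + \<delta> *\<^sub>R g w = cls \<Omega> (T_op G \<delta> W)"
        unfolding T_op_def W(2) g[OF WV(1)]
        by (simp only: cls_add[OF \<Omega> WV(2) L2_scaleR[OF G[OF WV(1)]]] cls_scaleR[OF \<Omega> G[OF WV(1)]])
      have UhL: "Uh (n - j) \<in> V" "Uh (n - j) \<in> L2 \<Omega>" for j using UhV[of "n - j"] n(2) Vh(2) VL by (simp_all add: subset_iff)
      have mV: "am_mean \<nu> Uh n \<in> V"
        unfolding am_mean_def
        by (rule linear_subspace_sum[OF V]) (use UhL(1) V in \<open>auto simp: linear_subspace_def\<close>)
      have bL: "backward_diff \<tau> Uh n \<in> L2 \<Omega>"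
        unfolding backward_diff_def using UhL(2)[of 0] UhL(2)[of 1] by (intro L2_scaleR L2_diff) simp_all
      have cb: "cls \<Omega> (backward_diff \<tau> Uh n) = dif (\<lambda>n. cls \<Omega> (Uh n)) n /\<^sub>R \<tau>"
        unfolding backward_diff_def dif_def using UhL(2)[of 0] UhL(2)[of 1]
        by (simp add: cls_scaleR[OF \<Omega> L2_diff] cls_diff[OF \<Omega>] inverse_eq_divide)
      have AL: "A_op G \<nu> \<tau> Uh n \<in> L2 \<Omega>" unfolding A_op_def by (intro L2_add bL G mV)
      have cA: "cls \<Omega> (A_op G \<nu> \<tau> Uh n) = dif (\<lambda>n. cls \<Omega> (Uh n)) n /\<^sub>R \<tau> + g (am \<nu> (\<lambda>n. cls \<Omega> (Uh n)) n)"
        unfolding A_op_def cls_add[OF \<Omega> bL G[OF mV]] cb g[OF mV, symmetric]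
        by (subst cls_am_mean[OF \<Omega>]) (simp_all add: UhL(2))
      have nd: "real (n - j) * \<tau> \<in> {0..T}" for j by (rule node[OF n(2)])
      have FmL: "am_mean \<nu> (\<lambda>i. F (real i * \<tau>)) n \<in> L2 \<Omega>" by (rule am_mean_L2) (rule FL[OF nd])
      have cF: "cls \<Omega> (am_mean \<nu> (\<lambda>i. F (real i * \<tau>)) n)
        = am \<nu> (\<lambda>n. gcls \<Omega> (time_deriv \<Omega> T 0 ?R (real n * \<tau>)) + g (gcls \<Omega> (U (real n * \<tau>)))) n"
      proof -
        have "cls \<Omega> (F t) = gcls \<Omega> (time_deriv \<Omega> T 0 ?R t) + g (gcls \<Omega> (U t))" if t: "t \<in> {0..T}" for t
        proof -
          have "g (gcls \<Omega> (U t)) = cls \<Omega> (G (U t))" using UV[OF t] VL by (simp add: gcls_L2 g subset_iff)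
          moreover have "gcls \<Omega> (time_deriv \<Omega> T 0 ?R t) = cls \<Omega> (F t) - cls \<Omega> (G (U t))"
            unfolding td0 gcls_L2[OF RL[OF t]] unfolding residual_def fsub_def by (rule cls_diff[OF \<Omega> FL[OF t] G[OF UV[OF t]]])
          ultimately show ?thesis by simp
        qed
        note eq = this[OF nd]
        have "cls \<Omega> (am_mean \<nu> (\<lambda>i. F (real i * \<tau>)) n) = am \<nu> (\<lambda>i. cls \<Omega> (F (real i * \<tau>))) n"
          by (rule cls_am_mean[OF \<Omega>]) (rule FL[OF nd])
        then show ?thesis by (simp only: am_def eq)
      qed
      have "L2_inner \<Omega> (A_op G \<nu> \<tau> Uh n) (T_op G \<delta> W) = L2_inner \<Omega> (am_mean \<nu> (\<lambda>i. F (real i * \<tau>)) n) (T_op G \<delta> W)"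
        using sch n W(1) by (simp add: am_solution_def first_index_def)
      then show ?thesis unfolding Tw cA[symmetric] cF[symmetric] inner_cls[OF \<Omega> AL TL] inner_cls[OF \<Omega> FmL TL] .
    qed
  qed
  show ?thesis by (rule that[OF lg g E])
qed

section \<open>The error estimate\<close>

text \<open>
  Here \<open>b\<close>, \<open>st\<close>, \<open>sT\<close> are the square roots of \<delta>, \<tau>, \<open>T\<close>, and \<open>p\<close>, \<open>q\<close>, \<open>w\<close> are \<open>h ^ r\<close>, \<open>h ^ (r - 1)\<close>,
  \<open>\<tau> ^ \<nu>\<close>. The bound \<open>H\<close> for the mesh size turns surplus powers of \<open>h\<close> into constants; \<delta> \<le> 1 and
  \<tau> \<le> c h do the same for surplus powers of \<delta> and \<tau>.
\<close>

lemma stability_bound_le: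
  fixes C h H c b \<delta> \<tau> T w st sT p q S0 S1 S2 L0 L1 L\<rho> R0 R1 :: real
  assumes nn: "0 \<le> C" "0 < h" "0 < b" "0 \<le> \<tau>" "0 \<le> w" "0 \<le> st" "0 \<le> sT" "0 \<le> q"
      "0 \<le> S0" "0 \<le> S1" "0 \<le> S2" "0 \<le> L0" "0 \<le> L1" "0 \<le> L\<rho>" "0 \<le> R0" "0 \<le> R1" "0 \<le> c"
    and h: "h \<le> H" "1 \<le> H" and b: "b \<le> 1" "\<delta> = b\<^sup>2" and p: "p = q * h" and \<tau>: "\<tau> \<le> c * h"
  defines "ae \<equiv> 80000 * w * R0" and "ah \<equiv> 4 * (C * p) * (S0 + 2 * \<tau> * S1)"
  defines "af \<equiv> ae + 2 * (C * p) * S1 + 5 * (ah / h)"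
    and "aDf \<equiv> 200000 * w * R1 + 16 * (C * p) * S2 + 10 * (C * p / h) * S1"
    and "asup \<equiv> 80000 * w * L\<rho> + 2 * (C * p) * L1 + 5 * (C * p / h * L0)"
    and "NN \<equiv> S0 + S1 + S2 + L0 + L1" and "CS \<equiv> R0 + L\<rho> + R1"
  shows "5 * sT * ae + \<delta> * asup + \<delta> * sT * aDf + 5 * ah / b + b * af + st * af
    \<le> (1000000 + 160 * (C * H * (1 + c))) *
      (((1 + sT) * b * q + p / b) * NN + (1 + sT) * w * CS + st * (p + \<tau> * q) * S1 + st * q * S0 + w * st * CS)"
proof -
  define Q where "Q = C * H * (1 + c)"
  define t2 where "t2 = ((1 + sT) * b * q + p / b) * NN"
  define t3 where "t3 = (1 + sT) * w * CS"
  define t4 where "t4 = st * (p + \<tau> * q) * S1"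
  define t5 where "t5 = st * q * S0"
  define t6 where "t6 = w * st * CS"
  have p0: "0 \<le> p" unfolding p using nn by simp
  have b0: "0 \<le> b" "b \<noteq> 0" and h0: "0 \<le> h" "h \<noteq> 0" using nn by auto
  have CH: "0 \<le> C * H" using nn h by simp
  have cQ: "C * H \<le> Q" "C * (c * H) \<le> Q"
  proof -
    have "0 \<le> C * H * c" using CH nn by simp
    moreover have "Q = C * H + C * H * c" by (simp add: Q_def distrib_left)
    ultimately show "C * H \<le> Q" "C * (c * H) \<le> Q" using CH by (simp_all add: mult.commute mult.left_commute)
  qed
  have CHh: "C * h \<le> C * H" "C * 1 \<le> C * H" using h nn by (intro mult_left_mono; simp)+
  have Q: "C \<le> Q" "C * h \<le> Q" "C * h * b \<le> Q" "C * b \<le> Q" "C * \<tau> \<le> Q"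
  proof -
    show 1: "C \<le> Q" "C * h \<le> Q" using CHh cQ by linarith+
    have "C * h * b \<le> C * h * 1" "C * b \<le> C * 1" using b nn by (intro mult_left_mono; simp)+
    then show "C * h * b \<le> Q" "C * b \<le> Q" using 1 by linarith+
    have "c * h \<le> c * H" using h nn by (intro mult_left_mono) auto
    then have "C * \<tau> \<le> C * (c * H)" using \<tau> nn by (intro mult_left_mono) auto
    then show "C * \<tau> \<le> Q" using cQ by linarith
  qed
  have Q0: "0 \<le> Q" using Q(1) nn by linarith
  have NN: "S0 \<le> NN" "S1 \<le> NN" "S2 \<le> NN" "L0 \<le> NN" "L1 \<le> NN" "0 \<le> NN" using nn unfolding NN_def by linarith+
  have CS: "R0 \<le> CS" "R1 \<le> CS" "L\<rho> \<le> CS" "0 \<le> CS" using nn unfolding CS_def by linarith+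
  have wC: "0 \<le> w * CS" using CS nn by simp
  have bq: "0 \<le> b * q" "0 \<le> sT * (b * q)" "0 \<le> p / b" using nn p0 by simp_all
  have t2e: "t2 = (b * q + sT * (b * q) + p / b) * NN" by (simp add: t2_def algebra_simps)
  have t3e: "t3 = w * CS + sT * (w * CS)" by (simp add: t3_def algebra_simps)
  have swC: "0 \<le> sT * (w * CS)" using wC nn by simp
  have g: "b * q * X \<le> t2" "sT * (b * q) * X \<le> t2" "p / b * X \<le> t2" if "0 \<le> X" "X \<le> NN" for X
    unfolding t2e by (rule mult_mono; use bq NN that in linarith)+
  have f: "w * X \<le> t3" "sT * (w * X) \<le> t3" if "0 \<le> X" "X \<le> CS" for X
  proof -
    have 1: "w * X \<le> w * CS" by (rule mult_left_mono[OF that(2) nn(5)])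
    have 2: "sT * (w * X) \<le> sT * (w * CS)" by (rule mult_left_mono[OF 1 nn(7)])
    show "w * X \<le> t3" "sT * (w * X) \<le> t3" using 1 2 wC swC unfolding t3e by linarith+
  qed
  have d: "0 \<le> \<delta>" "\<delta> \<le> 1" using b nn by (simp_all add: power_le_one)
  have dX: "\<delta> * X \<le> X" if "0 \<le> X" for X using mult_right_mono[OF d(2) that] by simp
  have bX: "b * X \<le> X" if "0 \<le> X" for X using mult_right_mono[OF b(1) that] by simp
  have t4: "0 \<le> st * (p * S1)" "0 \<le> st * (\<tau> * q * S1)" "t4 = st * (p * S1) + st * (\<tau> * q * S1)"
    using nn p0 by (simp_all add: t4_def algebra_simps)
  have t5: "0 \<le> t5" using nn by (simp add: t5_def)
  have t: "0 \<le> t2" "0 \<le> t3" "0 \<le> t4" "0 \<le> t6"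
    using bq NN nn wC swC t4 CS unfolding t2e t3e t6_def by simp_all
  have mm: "x * y \<le> X * Y" if "x \<le> X" "y \<le> Y" "0 \<le> X" "0 \<le> y" for x y X Y :: real
    using that by (intro mult_mono) auto
  have wnn: "0 \<le> w * L\<rho>" "0 \<le> sT * (w * R1)" "0 \<le> w * R0" using nn by simp_all
  have ahh: "ah / h = 4 * (C * q * S0) + 8 * (C * \<tau> * (q * S1))"
    unfolding ah_def p using h0(2) by (simp add: field_simps)
  have qq: "C * p / h = C * q" unfolding p using h0(2) by simp
  have e1: "5 * sT * ae \<le> 400000 * t3" using f(2)[OF nn(15) CS(1)] by (simp add: ae_def)
  have e2: "\<delta> * asup \<le> 80000 * t3 + 7 * (Q * t2)"
  proof -
    have "\<delta> * asup = 80000 * (\<delta> * (w * L\<rho>)) + 2 * ((C * h * b) * (b * q * L1)) + 5 * ((C * b) * (b * q * L0))"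
      unfolding asup_def qq unfolding b(2) p by (simp add: power2_eq_square algebra_simps)
    moreover have "\<delta> * (w * L\<rho>) \<le> t3" using dX[OF wnn(1)] f(1)[OF nn(14) CS(3)] by linarith
    moreover have "(C * h * b) * (b * q * L1) \<le> Q * t2"
      by (rule mm[OF Q(3) g(1)[OF nn(13) NN(5)] Q0]) (use bq nn in simp)
    moreover have "(C * b) * (b * q * L0) \<le> Q * t2"
      by (rule mm[OF Q(4) g(1)[OF nn(12) NN(4)] Q0]) (use bq nn in simp)
    ultimately show ?thesis by linarith
  qed
  have e3: "\<delta> * sT * aDf \<le> 200000 * t3 + 26 * (Q * t2)"
  proof -
    have "\<delta> * sT * aDf = 200000 * (\<delta> * (sT * (w * R1))) + 16 * ((C * h * b) * (sT * (b * q) * S2)) + 10 * ((C * b) * (sT * (b * q) * S1))"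
      unfolding aDf_def qq unfolding b(2) p by (simp add: power2_eq_square algebra_simps)
    moreover have "\<delta> * (sT * (w * R1)) \<le> t3" using dX[OF wnn(2)] f(2)[OF nn(16) CS(2)] by linarith
    moreover have "(C * h * b) * (sT * (b * q) * S2) \<le> Q * t2"
      by (rule mm[OF Q(3) g(2)[OF nn(11) NN(3)] Q0]) (intro mult_nonneg_nonneg bq nn)
    moreover have "(C * b) * (sT * (b * q) * S1) \<le> Q * t2"
      by (rule mm[OF Q(4) g(2)[OF nn(10) NN(2)] Q0]) (intro mult_nonneg_nonneg bq nn)
    ultimately show ?thesis by linarith
  qed
  have e4: "5 * ah / b \<le> 60 * (Q * t2)"
  proof -
    have "5 * ah / b = 20 * (C * (p / b * S0)) + 40 * ((C * \<tau>) * (p / b * S1))"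
      unfolding ah_def using b0(2) by (simp add: field_simps)
    moreover have "C * (p / b * S0) \<le> Q * t2"
      by (rule mm[OF Q(1) g(3)[OF nn(9) NN(1)] Q0]) (intro mult_nonneg_nonneg bq nn)
    moreover have "(C * \<tau>) * (p / b * S1) \<le> Q * t2"
      by (rule mm[OF Q(5) g(3)[OF nn(10) NN(2)] Q0]) (intro mult_nonneg_nonneg bq nn)
    ultimately show ?thesis by linarith
  qed
  have e5: "b * af \<le> 80000 * t3 + 62 * (Q * t2)"
  proof -
    have "b * af = 80000 * (b * (w * R0)) + 2 * ((C * h) * (b * q * S1)) + 20 * (C * (b * q * S0)) + 40 * ((C * \<tau>) * (b * q * S1))"
      unfolding af_def ahh ae_def p by (simp add: algebra_simps)
    moreover have "b * (w * R0) \<le> t3" using bX[OF wnn(3)] f(1)[OF nn(15) CS(1)] by linarith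
    moreover have "(C * h) * (b * q * S1) \<le> Q * t2"
      by (rule mm[OF Q(2) g(1)[OF nn(10) NN(2)] Q0]) (intro mult_nonneg_nonneg bq nn)
    moreover have "C * (b * q * S0) \<le> Q * t2"
      by (rule mm[OF Q(1) g(1)[OF nn(9) NN(1)] Q0]) (intro mult_nonneg_nonneg bq nn)
    moreover have "(C * \<tau>) * (b * q * S1) \<le> Q * t2"
      by (rule mm[OF Q(5) g(1)[OF nn(10) NN(2)] Q0]) (intro mult_nonneg_nonneg bq nn)
    ultimately show ?thesis by linarith
  qed
  have e6: "st * af \<le> 80000 * t6 + 42 * (Q * t4) + 20 * (Q * t5)"
  proof -
    have "st * af = 80000 * (w * st * R0) + 2 * (C * (st * (p * S1))) + 20 * (C * t5) + 40 * (C * (st * (\<tau> * q * S1)))"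
      unfolding af_def ahh ae_def t5_def by (simp add: algebra_simps)
    moreover have "w * st * R0 \<le> t6" unfolding t6_def using CS nn by (intro mult_left_mono) auto
    moreover have "C * (st * (p * S1)) \<le> Q * t4" by (rule mm[OF Q(1) _ Q0 t4(1)]) (use t4 in linarith)
    moreover have "C * (st * (\<tau> * q * S1)) \<le> Q * t4" by (rule mm[OF Q(1) _ Q0 t4(2)]) (use t4 in linarith)
    moreover have "C * t5 \<le> Q * t5" by (rule mult_right_mono[OF Q(1) t5])
    ultimately show ?thesis by linarith
  qed
  have Qt: "0 \<le> Q * t2" "0 \<le> Q * t3" "0 \<le> Q * t4" "0 \<le> Q * t5" "0 \<le> Q * t6" using Q0 t t5 by simp_all
  have "5 * sT * ae + \<delta> * asup + \<delta> * sT * aDf + 5 * ah / b + b * af + st * af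
    \<le> 1000000 * (t2 + t3 + t4 + t5 + t6) + 160 * (Q * t2 + Q * t3 + Q * t4 + Q * t5 + Q * t6)"
  proof -
    have add_up: "a1 + a2 + a3 + a4 + a5 + a6
      \<le> 1000000 * (s2 + s3 + s4 + s5 + s6) + 160 * (q2 + q3 + q4 + q5 + q6)"
      if "a1 \<le> 400000 * s3" "a2 \<le> 80000 * s3 + 7 * q2" "a3 \<le> 200000 * s3 + 26 * q2" "a4 \<le> 60 * q2"
        "a5 \<le> 80000 * s3 + 62 * q2" "a6 \<le> 80000 * s6 + 42 * q4 + 20 * q5" "0 \<le> s2" "0 \<le> s3" "0 \<le> s4" "0 \<le> s6"
        "0 \<le> s5" "0 \<le> q2" "0 \<le> q3" "0 \<le> q4" "0 \<le> q5" "0 \<le> q6"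
      for a1 a2 a3 a4 a5 a6 s2 s3 s4 s5 s6 q2 q3 q4 q5 q6 :: real
    proof -
      have "a1 + a2 + a3 + a4 + a5 + a6 \<le> 760000 * s3 + 155 * q2 + 80000 * s6 + 42 * q4 + 20 * q5"
        using that(1-6) by linarith
      moreover have "760000 * s3 \<le> 1000000 * s3" "80000 * s6 \<le> 1000000 * s6" "155 * q2 \<le> 160 * q2"
        "42 * q4 \<le> 160 * q4" "20 * q5 \<le> 160 * q5" using that(8,10,12,14,15) by simp_all
      moreover have "0 \<le> 1000000 * s2" "0 \<le> 1000000 * s4" "0 \<le> 1000000 * s5" "0 \<le> 160 * q3" "0 \<le> 160 * q6"
        using that(7,9,11,13,16) by simp_all
      ultimately show ?thesis unfolding distrib_left by linarith
    qed
    show ?thesis by (rule add_up[OF e1 e2 e3 e4 e5 e6 t t5 Qt])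
  qed
  also have "\<dots> = (1000000 + 160 * Q) * (t2 + t3 + t4 + t5 + t6)" by (simp add: algebra_simps)
  finally show ?thesis unfolding Q_def t2_def t3_def t4_def t5_def t6_def .
qed

lemma mesh_size_le_diameter:
  assumes m: "is_mesh \<Omega> \<T>"
  shows "mesh_size \<T> \<le> diameter \<Omega>"
  unfolding mesh_size_def
proof (rule Max.boundedI)
  show "finite (diameter ` \<T>)" "diameter ` \<T> \<noteq> {}" using m by (auto simp: is_mesh_def)
  fix d assume "d \<in> diameter ` \<T>"
  then obtain K where K: "K \<in> \<T>" "d = diameter K" by blast
  have "K \<subseteq> closure \<Omega>" using m K(1) by (auto simp: is_mesh_def)
  then have "diameter K \<le> diameter (closure \<Omega>)"
    by (rule diameter_subset) (simp add: bounded_closure[OF mesh_bounded[OF m]])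
  then show "d \<le> diameter \<Omega>" using K(2) diameter_closure[OF mesh_bounded[OF m]] by simp
qed

text \<open>
  The step size restriction is exactly what makes \<open>N (\<tau> C\<^sub>G / h) ^ (k + 1)\<close> bounded, with \<open>k = 3\<close> for \<nu> = 3 and
  \<open>k = 5\<close> for \<nu> = 4.
\<close>

lemma step_power_bound:
  fixes \<tau> h C CG T :: real
  assumes "0 < \<tau>" "0 < h" "0 < CG" "real m * \<tau> \<le> T" "\<tau> \<le> C * h powr (real (Suc k) / real k)" "0 < k"
  shows "(\<tau> * CG / h) ^ Suc k * real m \<le> CG ^ Suc k * (T * C ^ k)" "0 \<le> T * C ^ k"
proof -
  have "0 < C * h powr (real (Suc k) / real k)" using assms(1,5) by linarith
  then have C: "0 < C" using assms(2) by (simp add: zero_less_mult_iff)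
  have T0: "0 \<le> T" using order.trans[OF _ assms(4), of 0] assms(1) by simp
  have "(h powr (real (Suc k) / real k)) ^ k = h powr (real (Suc k) / real k * real k)"
    using assms(2) by (simp add: powr_powr flip: powr_realpow)
  also have "real (Suc k) / real k * real k = real (Suc k)" using assms(6) by simp
  also have "h powr real (Suc k) = h ^ Suc k" by (rule powr_realpow[OF assms(2)])
  finally have "(h powr (real (Suc k) / real k)) ^ k = h ^ Suc k" .
  moreover have "\<tau> ^ k \<le> (C * h powr (real (Suc k) / real k)) ^ k" using assms(1,5) by (intro power_mono) auto
  ultimately have t: "\<tau> ^ k \<le> C ^ k * h ^ Suc k" by (simp only: power_mult_distrib)
  have "(\<tau> * CG / h) ^ Suc k * real m = CG ^ Suc k * ((\<tau> ^ k * (real m * \<tau>)) / h ^ Suc k)"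
    by (simp add: power_mult_distrib power_divide)
  also have "\<dots> \<le> CG ^ Suc k * ((C ^ k * h ^ Suc k * T) / h ^ Suc k)"
    by (intro mult_left_mono divide_right_mono mult_mono t assms(4)) (use assms C in auto)
  also have "\<dots> = CG ^ Suc k * (T * C ^ k)" using assms(2) by simp
  finally show "(\<tau> * CG / h) ^ Suc k * real m \<le> CG ^ Suc k * (T * C ^ k)" .
  show "0 \<le> T * C ^ k" using T0 C by simp
qed


theorem corollary5p2:
  fixes \<Omega> :: "(real^'d::finite) set"
    and V :: "('d, 'm::finite) field set"
    and A :: "'d \<Rightarrow> real^'d \<Rightarrow> real^'m^'m" and B :: "real^'d \<Rightarrow> real^'m^'m"
    and G :: "('d, 'm) field \<Rightarrow> ('d, 'm) field"
    and k \<nu> :: nat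
    and s r C_G C_delta C_tau_delta C_app \<sigma> \<sigma>' :: real
  assumes "lipschitz_domain \<Omega>"
    and "linear_subspace V" and "ae_saturated \<Omega> V" and "V \<subseteq> sobolev \<Omega> 1" and "L2_dense \<Omega> V"
    and "G = first_order_op \<Omega> A B"
    and "\<forall>W\<in>V. G W \<in> L2 \<Omega>"
    and "\<forall>W\<in>V. \<forall>Z\<in>V. L2_inner \<Omega> (G W) Z = - L2_inner \<Omega> W (G Z)"
    and "\<nu> \<in> {3, 4, 5}" and "s \<ge> 1" and "r = min s (real k + 1)"
    and "C_G > 0" and "C_delta > 0" and "C_tau_delta > 0" and "C_app > 0" and "\<sigma> > 0" and "\<sigma>' > 0"
  shows "\<exists>c0 > 0. \<exists>C > 0. \<exists>\<kappa> > 0.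
    \<forall>(T::real) (\<T> :: (real^'d) set set) (Vh :: ('d, 'm) field set) (h::real) (\<delta>::real) (\<tau>::real) (N::nat)
      (C43::real) (C65::real) (M::real)
      (U0 :: ('d, 'm) field) (U :: real \<Rightarrow> ('d, 'm) field) (F :: real \<Rightarrow> ('d, 'm) field)
      (Uh :: nat \<Rightarrow> ('d, 'm) field).
      T > 0 \<longrightarrow>
      is_mesh \<Omega> \<T> \<longrightarrow> shape_regular \<sigma> \<T> \<longrightarrow> h = mesh_size \<T> \<longrightarrow>
      conforming_fe_space V \<T> k Vh \<longrightarrow>
      (\<forall>W\<in>Vh. L2_norm \<Omega> (G W) \<le> C_G / h * L2_norm \<Omega> W) \<longrightarrow>
      \<tau> > 0 \<longrightarrow> real N * \<tau> \<le> T \<longrightarrow>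
      0 < \<delta> \<longrightarrow> \<delta> \<le> 1 \<longrightarrow>
      (\<delta> \<le> C_delta * h \<and> \<tau> \<le> c0 / C_G * h \<and>
       (\<nu> = 3 \<longrightarrow> \<tau> \<le> C43 * h powr (4/3)) \<and>
       (\<nu> = 4 \<longrightarrow> \<tau> \<le> C65 * h powr (6/5)) \<and>
       M = (if \<nu> = 3 then exp (\<kappa> * (T * C43 ^ 3)) else if \<nu> = 4 then exp (\<kappa> * (T * C65 ^ 5)) else 1))
      \<or>
      (\<nu> \<in> {3, 4} \<and>
       (\<forall>W\<in>Vh. continuous_on \<Omega> W \<and> (\<forall>K\<in>\<T>. poly_on 1 (interior K) W)) \<and>
       quasi_uniform \<sigma>' \<T> \<and>
       (\<forall>j. A j constant_on \<Omega>) \<and> (\<forall>x\<in>\<Omega>. B x = 0) \<and>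
       \<tau> \<le> C_tau_delta * \<delta> \<and> \<delta> \<le> C_delta * h \<and> \<tau> \<le> c0 / C_G * h \<and>
       M = 1) \<longrightarrow>
      exact_solution \<Omega> V G T F U0 U \<longrightarrow>
      regular_solution \<Omega> G T r \<nu> U F \<longrightarrow>
      (\<forall>j\<le>2. AE t in lebesgue_on {0<..<T}.
          approx_estimate \<Omega> V G Vh C_app h r (time_deriv \<Omega> T j U t)) \<longrightarrow>
      am_solution \<Omega> G Vh \<nu> \<tau> \<delta> N U F Uh \<longrightarrow>
      (\<forall>n\<in>{first_index \<nu>..N}.
          L2_norm \<Omega> (T_op G \<delta> (fsub (Uh n) (U (real n * \<tau>))))
            \<le> C * M * error_bound \<Omega> G T \<nu> r h \<tau> \<delta> U F)"
proof -
  note \<Omega>_lip = assms(1) and V_lin = assms(2) and V_sob = assms(4) and V_dense = assms(5) and G_def = assms(6)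
    and \<nu> = assms(9) and pos = assms(12-17)
  have G_L2: "G W \<in> L2 \<Omega>" if "W \<in> V" for W using assms(7) that by blast
  have skew: "L2_inner \<Omega> (G W) Z = - L2_inner \<Omega> W (G Z)" if "W \<in> V" "Z \<in> V" for W Z
    using assms(8) that by blast
  have \<Omega>_open: "open \<Omega>" using \<Omega>_lip by (simp add: lipschitz_domain_def)
  have \<Omega>: "\<Omega> \<in> sets lebesgue" using \<Omega>_open by auto
  have VL: "V \<subseteq> L2 \<Omega>" using V_dense by (simp add: L2_dense_def)
  have "\<exists>Ca>0. (\<forall>j. A j constant_on \<Omega>) \<longrightarrow> (\<forall>x\<in>\<Omega>. B x = 0) \<longrightarrow> (\<forall>\<T> W v. is_mesh \<Omega> \<T> \<longrightarrow> shape_regular \<sigma> \<T> \<longrightarrow>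
    quasi_uniform \<sigma>' \<T> \<longrightarrow> W \<in> sobolev \<Omega> 1 \<longrightarrow> v \<in> sobolev \<Omega> 1 \<longrightarrow> G W \<in> L2 \<Omega> \<longrightarrow> G v \<in> L2 \<Omega> \<longrightarrow>
    (\<forall>K\<in>\<T>. poly_on 1 (interior K) W \<and> poly_on 1 (interior K) v) \<longrightarrow>
    L2_norm \<Omega> (G W) \<le> Ca / mesh_size \<T> * L2_norm \<Omega> (\<lambda>x. W x + G v x))"
  proof (cases "(\<forall>j. A j constant_on \<Omega>) \<and> (\<forall>x\<in>\<Omega>. B x = 0)")
    case True
    then show ?thesis
      using piecewise_affine_inverse_estimate[OF \<Omega>_lip, of A B \<sigma> \<sigma>'] pos(5,6) unfolding G_def by blast
  next
    case False
    then show ?thesis by (intro exI[of _ 1]) auto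
  qed
  then obtain Ca where Ca: "0 < Ca" and affine: "(\<forall>j. A j constant_on \<Omega>) \<longrightarrow> (\<forall>x\<in>\<Omega>. B x = 0) \<longrightarrow> (\<forall>\<T> W v. is_mesh \<Omega> \<T> \<longrightarrow> shape_regular \<sigma> \<T> \<longrightarrow>
    quasi_uniform \<sigma>' \<T> \<longrightarrow> W \<in> sobolev \<Omega> 1 \<longrightarrow> v \<in> sobolev \<Omega> 1 \<longrightarrow> G W \<in> L2 \<Omega> \<longrightarrow> G v \<in> L2 \<Omega> \<longrightarrow>
    (\<forall>K\<in>\<T>. poly_on 1 (interior K) W \<and> poly_on 1 (interior K) v) \<longrightarrow>
    L2_norm \<Omega> (G W) \<le> Ca / mesh_size \<T> * L2_norm \<Omega> (\<lambda>x. W x + G v x))" by blast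
  define K where "K = 200 * (1 + C_delta * C_G)\<^sup>2"
  define x where "x = Ca / C_G * (1 + C_tau_delta)"
  \<comment> \<open>The factor with \<open>K\<close> makes \<open>lam\<close> small enough for the stability estimate; the factor \<open>1 + x\<close> does the same for \<open>\<tau> Ca / h\<close> in the piecewise affine case.\<close>
  define c0 where "c0 = 1 / (8 * K\<^sup>2 * (1 + x))"
  define H where "H = 1 + \<bar>diameter \<Omega>\<bar>"
  define \<kappa> where "\<kappa> = 2 * K ^ 4 * (C_G ^ 4 + C_G ^ 6)"
  define Q where "Q = 1000000 + 160 * (C_app * H * (1 + c0 / C_G))"
  define C where "C = 10 * K\<^sup>2 * Q + C_app"
  have K1: "1 \<le> K"
  proof -
    have "1 \<le> (1 + C_delta * C_G)\<^sup>2" using pos by (intro one_le_power) simp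
    then show ?thesis unfolding K_def by linarith
  qed
  have x0: "0 \<le> x" using Ca pos by (simp add: x_def)
  have K2: "1 \<le> K\<^sup>2" using K1 by (rule one_le_power)
  have c0: "0 < c0" using K1 x0 by (simp add: c0_def add_pos_nonneg)
  have c0x: "c0 * (8 * K\<^sup>2) * (1 + x) = 1" using K1 x0 by (simp add: c0_def)
  have c0K: "c0 * (8 * K\<^sup>2) \<le> 1"
  proof -
    have "c0 * (8 * K\<^sup>2) * 1 \<le> c0 * (8 * K\<^sup>2) * (1 + x)" using c0 x0 by (intro mult_left_mono) auto
    then show ?thesis using c0x by simp
  qed
  have c01: "c0 \<le> 1"
  proof -
    have "c0 * 1 \<le> c0 * (8 * K\<^sup>2)" using c0 K2 by (intro mult_left_mono) auto
    then show ?thesis using c0K by simp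
  qed
  have c0xK: "c0 * x * (8 * K\<^sup>2) \<le> 1"
  proof -
    have "c0 * (8 * K\<^sup>2) * x \<le> c0 * (8 * K\<^sup>2) * (1 + x)" using c0 by (intro mult_left_mono) auto
    then show ?thesis using c0x by (simp add: mult.commute mult.left_commute)
  qed
  have H: "1 \<le> H" by (simp add: H_def)
  have Q0: "0 < Q"
  proof -
    have "0 \<le> C_app * H * (1 + c0 / C_G)" using pos c0 H by simp
    then show ?thesis unfolding Q_def by linarith
  qed
  have C0: "0 < C" using Q0 K2 pos by (simp add: C_def add_nonneg_pos)
  have \<kappa>0: "0 < \<kappa>" using K1 pos by (simp add: \<kappa>_def add_pos_pos)
  show ?thesis
  proof (rule exI[of _ c0], rule conjI[OF c0], rule exI[of _ C], rule conjI[OF C0], rule exI[of _ \<kappa>],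
      rule conjI[OF \<kappa>0], intro allI impI ballI)
    fix T :: real and \<T> :: "(real^'d) set set" and Vh :: "('d, 'm) field set" and h \<delta> \<tau> :: real and N :: nat
      and C43 C65 M :: real and U0 :: "('d, 'm) field" and U F :: "real \<Rightarrow> ('d, 'm) field" and Uh :: "nat \<Rightarrow> ('d, 'm) field" and n :: nat
    assume T: "0 < T" and mesh: "is_mesh \<Omega> \<T>" and shape: "shape_regular \<sigma> \<T>" and h_def: "h = mesh_size \<T>"
      and fe: "conforming_fe_space V \<T> k Vh" and inv: "\<forall>W\<in>Vh. L2_norm \<Omega> (G W) \<le> C_G / h * L2_norm \<Omega> W"
      and \<tau>: "0 < \<tau>" and N\<tau>: "real N * \<tau> \<le> T" and \<delta>: "0 < \<delta>" "\<delta> \<le> 1"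
      and cases: "(\<delta> \<le> C_delta * h \<and> \<tau> \<le> c0 / C_G * h \<and>
       (\<nu> = 3 \<longrightarrow> \<tau> \<le> C43 * h powr (4/3)) \<and>
       (\<nu> = 4 \<longrightarrow> \<tau> \<le> C65 * h powr (6/5)) \<and>
       M = (if \<nu> = 3 then exp (\<kappa> * (T * C43 ^ 3)) else if \<nu> = 4 then exp (\<kappa> * (T * C65 ^ 5)) else 1))
      \<or>
      (\<nu> \<in> {3, 4} \<and>
       (\<forall>W\<in>Vh. continuous_on \<Omega> W \<and> (\<forall>K\<in>\<T>. poly_on 1 (interior K) W)) \<and>
       quasi_uniform \<sigma>' \<T> \<and>
       (\<forall>j. A j constant_on \<Omega>) \<and> (\<forall>x\<in>\<Omega>. B x = 0) \<and>
       \<tau> \<le> C_tau_delta * \<delta> \<and> \<delta> \<le> C_delta * h \<and> \<tau> \<le> c0 / C_G * h \<and>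
       M = 1)"
      and ex: "exact_solution \<Omega> V G T F U0 U" and reg: "regular_solution \<Omega> G T r \<nu> U F"
      and app: "\<forall>j\<le>2. AE t in lebesgue_on {0<..<T}. approx_estimate \<Omega> V G Vh C_app h r (time_deriv \<Omega> T j U t)"
      and sch: "am_solution \<Omega> G Vh \<nu> \<tau> \<delta> N U F Uh"
      and n: "n \<in> {first_index \<nu>..N}"
    have n: "\<nu> - 1 \<le> n" "n \<le> N" using n by (simp_all add: first_index_def)
    have h: "0 < h" unfolding h_def by (rule mesh_size_facts(3)[OF mesh])
    have hH: "h \<le> H" using mesh_size_le_diameter[OF mesh] unfolding h_def H_def by linarith
    have \<delta>h: "\<delta> \<le> C_delta * h" and \<tau>h: "\<tau> \<le> c0 / C_G * h" using cases by blast+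
    have Vh: "linear_subspace Vh" "Vh \<subseteq> V" and poly: "\<And>W K. W \<in> Vh \<Longrightarrow> K \<in> \<T> \<Longrightarrow> poly_on k (interior K) W"
      using fe by (auto simp: conforming_fe_space_def)
    have VhL: "Vh \<subseteq> L2 \<Omega>" using Vh(2) VL by blast
    obtain D where D: "finite D" "cls \<Omega> ` Vh \<subseteq> span D"
      using fe_space_finite_dimensional[OF mesh \<Omega>_open VhL poly] by blast
    have nN: "\<nu> - 1 \<le> N" using n by linarith
    obtain g P where lg: "linear g" and g: "\<And>W. W \<in> V \<Longrightarrow> g (cls \<Omega> W) = cls \<Omega> (G W)"
      and E: "am_error g P (cls \<Omega> ` L2 \<Omega>) (cls \<Omega> ` V) (cls \<Omega> ` Vh) \<nu> N T \<tau> \<delta> h C_G C_delta (C_app * h powr r)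
      (\<lambda>t. gcls \<Omega> (U t)) (\<lambda>t. gcls \<Omega> (time_deriv \<Omega> T 1 U t)) (\<lambda>t. gcls \<Omega> (time_deriv \<Omega> T 2 U t))
      (\<lambda>i t. gcls \<Omega> (time_deriv \<Omega> T i (residual G U F) t))
      (\<lambda>t. sobolev_norm \<Omega> r (time_deriv \<Omega> T 0 U t)) (\<lambda>t. sobolev_norm \<Omega> r (time_deriv \<Omega> T 1 U t))
      (\<lambda>t. sobolev_norm \<Omega> r (time_deriv \<Omega> T 2 U t)) (\<lambda>t. L2_norm \<Omega> (time_deriv \<Omega> T \<nu> (residual G U F) t))
      (\<lambda>t. L2_norm \<Omega> (time_deriv \<Omega> T (Suc \<nu>) (residual G U F) t))
      (LinfT_norm T (sobolev_norm \<Omega> r) U) (LinfT_norm T (sobolev_norm \<Omega> r) (time_deriv \<Omega> T 1 U))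
      (LinfT_norm T (L2_norm \<Omega>) (time_deriv \<Omega> T \<nu> (residual G U F))) (\<lambda>n. cls \<Omega> (Uh n))"
      by (rule am_error_of_fields[OF \<Omega> V_lin V_dense G_L2 skew Vh D inv T \<tau> \<delta>(1) h pos(1,2) less_imp_le[OF pos(4)] \<delta>h \<nu> N\<tau> nN ex reg app sch]; (assumption | (rule that; assumption)))
    interpret E: am_error g P "cls \<Omega> ` L2 \<Omega>" "cls \<Omega> ` V" "cls \<Omega> ` Vh" \<nu> N T \<tau> \<delta> h C_G C_delta "C_app * h powr r"
      "\<lambda>t. gcls \<Omega> (U t)" "\<lambda>t. gcls \<Omega> (time_deriv \<Omega> T 1 U t)" "\<lambda>t. gcls \<Omega> (time_deriv \<Omega> T 2 U t)"
      "\<lambda>i t. gcls \<Omega> (time_deriv \<Omega> T i (residual G U F) t)"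
      "\<lambda>t. sobolev_norm \<Omega> r (time_deriv \<Omega> T 0 U t)" "\<lambda>t. sobolev_norm \<Omega> r (time_deriv \<Omega> T 1 U t)"
      "\<lambda>t. sobolev_norm \<Omega> r (time_deriv \<Omega> T 2 U t)" "\<lambda>t. L2_norm \<Omega> (time_deriv \<Omega> T \<nu> (residual G U F) t)"
      "\<lambda>t. L2_norm \<Omega> (time_deriv \<Omega> T (Suc \<nu>) (residual G U F) t)"
      "LinfT_norm T (sobolev_norm \<Omega> r) U" "LinfT_norm T (sobolev_norm \<Omega> r) (time_deriv \<Omega> T 1 U)"
      "LinfT_norm T (L2_norm \<Omega>) (time_deriv \<Omega> T \<nu> (residual G U F))" "\<lambda>n. cls \<Omega> (Uh n)"
      by (rule E)
    define lam where "lam = \<tau> * C_G / h"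
    have lam: "0 < lam" "lam \<le> c0"
    proof -
      show "0 < lam" using \<tau> pos h by (simp add: lam_def)
      have "\<tau> * C_G \<le> (c0 / C_G * h) * C_G" using \<tau>h pos by (intro mult_right_mono) auto
      also have "\<dots> = c0 * h" using pos by simp
      finally show "lam \<le> c0" using h by (simp add: lam_def pos_divide_le_eq)
    qed
    have lam1: "lam \<le> 1" using lam c01 by linarith
    have sq_le: "K ^ 4 * y\<^sup>2 \<le> 1 / 64" if y: "0 \<le> y" "y * (8 * K\<^sup>2) \<le> 1" for y
    proof -
      have "(y * (8 * K\<^sup>2))\<^sup>2 \<le> 1" using y K2 by (intro power_le_one) auto
      then show ?thesis by (simp add: power_mult_distrib mult.commute mult.left_commute flip: power_mult)
    qed
    have Klam: "K ^ 4 * lam\<^sup>2 \<le> 1 / 32"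
    proof -
      have "lam * (8 * K\<^sup>2) \<le> c0 * (8 * K\<^sup>2)" using lam K2 by (intro mult_right_mono) auto
      then have "K ^ 4 * lam\<^sup>2 \<le> 1 / 64" using lam c0K by (intro sq_le) linarith+
      then show ?thesis by linarith
    qed
    have \<tau>N: "real n * \<tau> \<le> T" and tn: "real n * \<tau> \<in> {0..T}"
    proof -
      have "real n * \<tau> \<le> real N * \<tau>" using n(2) \<tau> by (intro mult_right_mono) auto
      then show "real n * \<tau> \<le> T" using N\<tau> by linarith
      then show "real n * \<tau> \<in> {0..T}" using \<tau> by simp
    qed
    \<comment> \<open>\<open>mu\<close> is the growth rate per step; it is 0 where the growth is absorbed, and then the factor \<open>M\<close> is 1.\<close>
    have "\<exists>mu. 0 \<le> mu \<and> mu \<le> lam\<^sup>2 \<and> 2 * K ^ 4 * mu * real n \<le> ln M \<and> 1 \<le> M \<and>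
      (\<nu> = 3 \<and> mu = lam ^ 4 \<or> \<nu> = 4 \<and> mu = lam ^ 6 \<or> \<nu> = 5 \<or>
      \<nu> \<noteq> 5 \<and> (\<forall>w\<in>cls \<Omega> ` Vh. \<forall>v\<in>cls \<Omega> ` Vh. norm (g w) \<le> Ca / h * norm (w + g v)) \<and> \<tau> \<le> C_tau_delta * \<delta>
        \<and> K ^ 4 * ((\<tau> * Ca / h)\<^sup>2 * C_tau_delta) \<le> 1 / 2)"
      using cases
    proof (elim disjE conjE)
      assume c43: "\<nu> = 3 \<longrightarrow> \<tau> \<le> C43 * h powr (4/3)" and c65: "\<nu> = 4 \<longrightarrow> \<tau> \<le> C65 * h powr (6/5)"
        and M: "M = (if \<nu> = 3 then exp (\<kappa> * (T * C43 ^ 3)) else if \<nu> = 4 then exp (\<kappa> * (T * C65 ^ 5)) else 1)"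
      have exponent: "2 * K ^ 4 * (lam ^ Suc m * real n) \<le> \<kappa> * (T * c ^ m)" "0 \<le> \<kappa> * (T * c ^ m)"
        if m: "m = 3 \<or> m = 5" and c: "\<tau> \<le> c * h powr (real (Suc m) / real m)" for m c
      proof -
        have b: "lam ^ Suc m * real n \<le> C_G ^ Suc m * (T * c ^ m)" "0 \<le> T * c ^ m"
          unfolding lam_def using step_power_bound[OF \<tau> h pos(1) \<tau>N c] m by auto
        have "C_G ^ Suc m \<le> C_G ^ 4 + C_G ^ 6" using m pos by (auto simp: numeral_eq_Suc)
        then have "C_G ^ Suc m * (T * c ^ m) \<le> (C_G ^ 4 + C_G ^ 6) * (T * c ^ m)" by (rule mult_right_mono[OF _ b(2)])
        then have "lam ^ Suc m * real n \<le> (C_G ^ 4 + C_G ^ 6) * (T * c ^ m)" using b(1) by linarith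
        then have "2 * K ^ 4 * (lam ^ Suc m * real n) \<le> 2 * K ^ 4 * ((C_G ^ 4 + C_G ^ 6) * (T * c ^ m))"
          using K1 by (intro mult_left_mono) auto
        then show "2 * K ^ 4 * (lam ^ Suc m * real n) \<le> \<kappa> * (T * c ^ m)" by (simp only: \<kappa>_def mult.assoc)
        show "0 \<le> \<kappa> * (T * c ^ m)" using \<kappa>0 b(2) by simp
      qed
      have nu: "\<nu> = 3 \<or> \<nu> = 4 \<or> \<nu> = 5" using \<nu> by blast
      then show ?thesis
      proof (elim disjE)
        assume 3: "\<nu> = 3"
        have c: "\<tau> \<le> C43 * h powr (real (Suc 3) / real 3)" using c43 3 by simp
        have e: "2 * K ^ 4 * (lam ^ 4 * real n) \<le> \<kappa> * (T * C43 ^ 3)" "0 \<le> \<kappa> * (T * C43 ^ 3)"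
          using exponent[of 3, OF _ c] by simp_all
        show ?thesis
          using 3 e M lam lam1 power_decreasing[of 2 4 lam] by (intro exI[of _ "lam ^ 4"]) (simp add: mult.assoc)
      next
        assume 4: "\<nu> = 4"
        have c: "\<tau> \<le> C65 * h powr (real (Suc 5) / real 5)" using c65 4 by simp
        have e: "2 * K ^ 4 * (lam ^ 6 * real n) \<le> \<kappa> * (T * C65 ^ 5)" "0 \<le> \<kappa> * (T * C65 ^ 5)"
          using exponent[of 5, OF _ c] by simp_all
        show ?thesis
          using 4 e M lam lam1 power_decreasing[of 2 6 lam] by (intro exI[of _ "lam ^ 6"]) (simp add: mult.assoc)
      next
        assume 5: "\<nu> = 5"
        then have "M = 1" using M by simp
        then show ?thesis using 5 by (intro exI[of _ 0]) simp
      qed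
    next
      assume \<nu>34: "\<nu> \<in> {3, 4}" and p1: "\<forall>W\<in>Vh. continuous_on \<Omega> W \<and> (\<forall>K\<in>\<T>. poly_on 1 (interior K) W)"
        and qu: "quasi_uniform \<sigma>' \<T>" and Ac: "\<forall>j. A j constant_on \<Omega>" and B0: "\<forall>x\<in>\<Omega>. B x = 0"
        and \<tau>\<delta>: "\<tau> \<le> C_tau_delta * \<delta>" and M: "M = 1"
      have est: "norm (g w) \<le> Ca / h * norm (w + g v)" if w: "w \<in> cls \<Omega> ` Vh" and v: "v \<in> cls \<Omega> ` Vh" for w v
      proof -
        obtain W where W: "W \<in> Vh" "w = cls \<Omega> W" using w by blast
        obtain Z where Z: "Z \<in> Vh" "v = cls \<Omega> Z" using v by blast
        have WZ: "W \<in> V" "Z \<in> V" "W \<in> L2 \<Omega>" "W \<in> sobolev \<Omega> 1" "Z \<in> sobolev \<Omega> 1"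
          using W(1) Z(1) Vh(2) VL V_sob by blast+
        have "L2_norm \<Omega> (G W) \<le> Ca / mesh_size \<T> * L2_norm \<Omega> (\<lambda>x. W x + G Z x)"
          using affine[rule_format, OF _ _ mesh shape qu WZ(4,5) G_L2[OF WZ(1)] G_L2[OF WZ(2)]] Ac B0 p1 W(1) Z(1) by blast
        moreover have "norm (g w) = L2_norm \<Omega> (G W)"
          unfolding W(2) g[OF WZ(1)] by (rule norm_cls[OF \<Omega> G_L2[OF WZ(1)]])
        moreover have "norm (w + g v) = L2_norm \<Omega> (\<lambda>x. W x + G Z x)"
          unfolding W(2) Z(2) g[OF WZ(2)] cls_add[OF \<Omega> WZ(3) G_L2[OF WZ(2)], symmetric]
          by (rule norm_cls[OF \<Omega> L2_add[OF WZ(3) G_L2[OF WZ(2)]]])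
        ultimately show ?thesis unfolding h_def by simp
      qed
      have small: "K ^ 4 * ((\<tau> * Ca / h)\<^sup>2 * C_tau_delta) \<le> 1 / 2"
      proof -
        have a: "0 \<le> \<tau> * Ca / h" "\<tau> * Ca / h \<le> c0 * (Ca / C_G)"
        proof -
          show "0 \<le> \<tau> * Ca / h" using \<tau> Ca h by simp
          have "\<tau> * Ca \<le> (c0 / C_G * h) * Ca" using \<tau>h Ca by (intro mult_right_mono) auto
          then show "\<tau> * Ca / h \<le> c0 * (Ca / C_G)" using h by (simp add: pos_divide_le_eq mult.commute mult.left_commute)
        qed
        have "(\<tau> * Ca / h)\<^sup>2 \<le> (c0 * (Ca / C_G))\<^sup>2" by (rule power_mono[OF a(2,1)])
        moreover have "C_tau_delta \<le> (1 + C_tau_delta)\<^sup>2" using pos by (simp add: power2_eq_square algebra_simps)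
        ultimately have "(\<tau> * Ca / h)\<^sup>2 * C_tau_delta \<le> (c0 * (Ca / C_G))\<^sup>2 * (1 + C_tau_delta)\<^sup>2"
          using pos by (intro mult_mono) auto
        also have "\<dots> = (c0 * x)\<^sup>2" unfolding x_def power_mult_distrib[symmetric] by (simp only: mult.assoc)
        finally have "K ^ 4 * ((\<tau> * Ca / h)\<^sup>2 * C_tau_delta) \<le> K ^ 4 * (c0 * x)\<^sup>2"
          using K1 by (intro mult_left_mono) auto
        also have "\<dots> \<le> 1 / 64" using c0 x0 c0xK by (intro sq_le) auto
        finally show ?thesis by linarith
      qed
      show ?thesis
        using est \<tau>\<delta> small \<nu>34 M by (intro exI[of _ 0]) auto
    qed
    then obtain mu where mu: "0 \<le> mu" "mu \<le> lam\<^sup>2" and growth: "2 * K ^ 4 * mu * real n \<le> ln M" "1 \<le> M"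
      and alternatives: "\<nu> = 3 \<and> mu = lam ^ 4 \<or> \<nu> = 4 \<and> mu = lam ^ 6 \<or> \<nu> = 5 \<or>
      \<nu> \<noteq> 5 \<and> (\<forall>w\<in>cls \<Omega> ` Vh. \<forall>v\<in>cls \<Omega> ` Vh. norm (g w) \<le> Ca / h * norm (w + g v)) \<and> \<tau> \<le> C_tau_delta * \<delta>
        \<and> K ^ 4 * ((\<tau> * Ca / h)\<^sup>2 * C_tau_delta) \<le> 1 / 2" by blast
    define p q where "p = h powr r" and "q = h powr (r - 1)"
    define L0 where "L0 = LinfT_norm T (sobolev_norm \<Omega> r) U"
    define L1 where "L1 = LinfT_norm T (sobolev_norm \<Omega> r) (time_deriv \<Omega> T 1 U)"
    define L\<rho> where "L\<rho> = LinfT_norm T (L2_norm \<Omega>) (time_deriv \<Omega> T \<nu> (residual G U F))"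
    define S where "S j = L2T_norm T (sobolev_norm \<Omega> r) (time_deriv \<Omega> T j U)" for j
    define R where "R i = L2T_norm T (L2_norm \<Omega>) (time_deriv \<Omega> T i (residual G U F))" for i
    define X where "X = ((1 + sqrt T) * sqrt \<delta> * q + p / sqrt \<delta>) * (S 0 + S 1 + S 2 + L0 + L1)
      + (1 + sqrt T) * \<tau> ^ \<nu> * (R \<nu> + L\<rho> + R (Suc \<nu>)) + sqrt \<tau> * (p + \<tau> * q) * S 1 + sqrt \<tau> * q * S 0
      + \<tau> ^ \<nu> * sqrt \<tau> * (R \<nu> + L\<rho> + R (Suc \<nu>))"
    have pq: "p = q * h" "0 \<le> p" "0 \<le> q"
      using h by (simp_all add: p_def q_def powr_diff)
    have Snn: "0 \<le> S j" "0 \<le> R j" for j by (simp_all add: S_def R_def L2T_norm_def)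
    have Lnn: "0 \<le> L0" "0 \<le> L1" "0 \<le> L\<rho>" unfolding L0_def L1_def L\<rho>_def by (rule E.L)+
    have bound: "error_bound \<Omega> G T \<nu> r h \<tau> \<delta> U F = (p + \<delta> * q) * L0 + X"
    proof -
      have td0: "time_deriv \<Omega> T 0 U = U" by (simp add: time_deriv_def)
      have N: "N_norm \<Omega> T r U = S 0 + S 1 + S 2 + L0 + L1"
        by (simp add: N_norm_def S_def L0_def L1_def numeral_2_eq_2 td0)
      have Cs: "C_sharp \<Omega> G T \<nu> U F = R \<nu> + L\<rho> + R (Suc \<nu>)"
        by (simp add: C_sharp_def R_def L\<rho>_def)
      have roots: "T powr (1/2) = sqrt T" "\<delta> powr (1/2) = sqrt \<delta>" "\<tau> powr (1/2) = sqrt \<tau>"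
        using T \<delta> \<tau> by (simp_all add: powr_half_sqrt)
      have "\<delta> powr (-1/2) = inverse (sqrt \<delta>)"
        using \<delta> powr_minus[of \<delta> "1/2"] by (simp add: powr_half_sqrt)
      then have root: "\<delta> powr (-1/2) * p = p / sqrt \<delta>" by (simp only: divide_inverse mult.commute)
      have \<tau>\<nu>: "\<tau> powr (real \<nu> + 1/2) = \<tau> ^ \<nu> * sqrt \<tau>"
        using \<tau> by (simp add: powr_add powr_realpow powr_half_sqrt)
      have S0: "L2T_norm T (sobolev_norm \<Omega> r) U = S 0" unfolding S_def td0 ..
      show ?thesis
        unfolding error_bound_def N Cs roots \<tau>\<nu> S0 p_def[symmetric] q_def[symmetric] root L0_def[symmetric]
          S_def[of 1, symmetric] X_def add.assoc ..
    qed
    have stab: "E.stab \<le> Q * X"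
    proof -
      have "5 * sqrt T * (80000 * \<tau> ^ \<nu> * R \<nu>)
          + \<delta> * (80000 * \<tau> ^ \<nu> * L\<rho> + 2 * (C_app * p) * L1 + 5 * (C_app * p / h * L0))
          + \<delta> * sqrt T * (200000 * \<tau> ^ \<nu> * R (Suc \<nu>) + 16 * (C_app * p) * S 2 + 10 * (C_app * p / h) * S 1)
          + 5 * (4 * (C_app * p) * (S 0 + 2 * \<tau> * S 1)) / sqrt \<delta>
          + sqrt \<delta> * (80000 * \<tau> ^ \<nu> * R \<nu> + 2 * (C_app * p) * S 1 + 5 * (4 * (C_app * p) * (S 0 + 2 * \<tau> * S 1) / h))
          + sqrt \<tau> * (80000 * \<tau> ^ \<nu> * R \<nu> + 2 * (C_app * p) * S 1 + 5 * (4 * (C_app * p) * (S 0 + 2 * \<tau> * S 1) / h))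
        \<le> Q * X"
        unfolding Q_def X_def
      proof (rule stability_bound_le)
        show "0 \<le> C_app" "0 \<le> \<tau>" "0 \<le> c0 / C_G" using pos \<tau> c0 by simp_all
        show "0 < h" "0 < sqrt \<delta>" "0 \<le> \<tau> ^ \<nu>" "0 \<le> sqrt \<tau>" "0 \<le> sqrt T" "sqrt \<delta> \<le> 1" "\<delta> = (sqrt \<delta>)\<^sup>2"
          using h \<delta> \<tau> T by simp_all
        show "\<tau> \<le> c0 / C_G * h" "h \<le> H" "1 \<le> H" by (fact \<tau>h hH H)+
      qed (fact pq Snn Lnn)+
      then show ?thesis
        unfolding E.stab_def E.asup_def E.aDf_def E.af_def E.ah_def E.ae_def sqnorm_def
          S_def R_def L2T_norm_def L0_def L1_def L\<rho>_def p_def by simp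
    qed
    have X0: "0 \<le> X"
      unfolding X_def using pq Snn Lnn \<tau> T \<delta> by (intro add_nonneg_nonneg mult_nonneg_nonneg divide_nonneg_nonneg; simp)
    have UV: "U (real n * \<tau>) \<in> V" using ex tn by (simp add: exact_solution_def)
    have Uhn: "Uh n \<in> V" using sch n(2) Vh(2) by (auto simp: am_solution_def)
    have f: "fsub (Uh n) (U (real n * \<tau>)) \<in> V" by (rule linear_subspace_diff[OF V_lin Uhn UV])
    have L: "U (real n * \<tau>) \<in> L2 \<Omega>" "Uh n \<in> L2 \<Omega>" "fsub (Uh n) (U (real n * \<tau>)) \<in> L2 \<Omega>" using UV Uhn f VL by blast+
    have "cls \<Omega> (T_op G \<delta> (fsub (Uh n) (U (real n * \<tau>))))
      = (cls \<Omega> (Uh n) - gcls \<Omega> (U (real n * \<tau>))) + \<delta> *\<^sub>R g (cls \<Omega> (Uh n) - gcls \<Omega> (U (real n * \<tau>)))"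
    proof -
      have c: "cls \<Omega> (Uh n) - gcls \<Omega> (U (real n * \<tau>)) = cls \<Omega> (fsub (Uh n) (U (real n * \<tau>)))"
        unfolding gcls_L2[OF L(1)] fsub_def by (rule cls_diff[OF \<Omega> L(2,1), symmetric])
      show ?thesis
        unfolding c g[OF f] T_op_def cls_scaleR[OF \<Omega> G_L2[OF f], symmetric]
        by (rule cls_add[OF \<Omega> L(3) L2_scaleR[OF G_L2[OF f]]])
    qed
    moreover have "T_op G \<delta> (fsub (Uh n) (U (real n * \<tau>))) \<in> L2 \<Omega>"
      unfolding T_op_def by (intro L2_add L2_scaleR L(3) G_L2[OF f])
    ultimately have "L2_norm \<Omega> (T_op G \<delta> (fsub (Uh n) (U (real n * \<tau>))))
      = norm ((cls \<Omega> (Uh n) - gcls \<Omega> (U (real n * \<tau>))) + \<delta> *\<^sub>R g (cls \<Omega> (Uh n) - gcls \<Omega> (U (real n * \<tau>))))"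
      using norm_cls[OF \<Omega>] by metis
    also have "\<dots> \<le> 10 * K\<^sup>2 * E.stab * exp (2 * K ^ 4 * mu * real n)
        + (C_app * h powr r * L0 + \<delta> * (C_app * h powr r / h * L0))"
      unfolding L0_def K_def
      by (rule E.error_bound_abstract[OF n, where mu = mu and Ca = Ca and Ct = C_tau_delta])
        (use lam1 Klam mu alternatives in \<open>simp_all only: K_def lam_def\<close>)
    also have "\<dots> \<le> 10 * K\<^sup>2 * (Q * X) * M + C_app * ((p + \<delta> * q) * L0)"
    proof (rule add_mono)
      have "exp (2 * K ^ 4 * mu * real n) \<le> exp (ln M)" using growth(1) by simp
      then have eM: "exp (2 * K ^ 4 * mu * real n) \<le> M" using growth(2) by simp
      have "10 * K\<^sup>2 * E.stab \<le> 10 * K\<^sup>2 * (Q * X)" using stab K2 by (intro mult_left_mono) auto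
      then show "10 * K\<^sup>2 * E.stab * exp (2 * K ^ 4 * mu * real n) \<le> 10 * K\<^sup>2 * (Q * X) * M"
        by (rule mult_mono[OF _ eM]) (use K2 Q0 X0 in simp_all)
      show "C_app * h powr r * L0 + \<delta> * (C_app * h powr r / h * L0) \<le> C_app * ((p + \<delta> * q) * L0)"
        unfolding p_def[symmetric] pq(1) using h by (simp add: algebra_simps)
    qed
    also have "\<dots> \<le> C * M * ((p + \<delta> * q) * L0 + X)"
    proof -
      define Y where "Y = (p + \<delta> * q) * L0"
      have Y: "0 \<le> Y" using pq Lnn \<delta> by (simp add: Y_def)
      have KQ: "0 \<le> 10 * K\<^sup>2 * Q" using K2 Q0 by simp
      have M0: "0 \<le> M" using growth(2) by linarith
      have "C_app * Y * 1 \<le> C_app * Y * M" using pos Y growth(2) by (intro mult_left_mono) auto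
      moreover have "0 \<le> C_app * X * M" "0 \<le> 10 * K\<^sup>2 * Q * Y * M" using pos X0 Y KQ M0 by simp_all
      moreover have "C * M * (Y + X) = 10 * K\<^sup>2 * (Q * X) * M + C_app * Y * M + C_app * X * M + 10 * K\<^sup>2 * Q * Y * M"
        unfolding C_def by (simp only: distrib_left distrib_right mult.assoc mult.left_commute mult.commute add_ac)
      ultimately show ?thesis unfolding Y_def[symmetric] by linarith
    qed
    finally show "L2_norm \<Omega> (T_op G \<delta> (fsub (Uh n) (U (real n * \<tau>)))) \<le> C * M * error_bound \<Omega> G T \<nu> r h \<tau> \<delta> U F"
      unfolding bound .
  qed
qed

end
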